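(* Let $\Omega\in\mathcal A_\omega$ be an open set and let $J:\mathcal A_\omega\to\mathbf R$ be twice differentiable at $\Omega$. (i) There are mappings $\tilde{\mathfrak g}:\operatorname{im}(\mathfrak J^1_{\partial\Omega})\to\mathbf R$ and $\tilde{\mathfrak l}:\operatorname{im}(\mathfrak J^1_{\partial\Omega})\times\operatorname{im}(\mathfrak J^1_{\partial\Omega})\to\mathbf R$ such that $$\mathfrak D^2J(\Omega)(X)(Y)=\tilde{\mathfrak l}(X|_{\partial\Omega},Y|_{\partial\Omega})\quad\text{and}\quad DJ(\Omega)(\partial X\,Y)=\tilde{\mathfrak g}((\partial X\,Y)|_{\partial\Omega}),$$ and hence $$D^2J(\Omega)(X)(Y)=\tilde{\mathfrak l}(X|_{\partial\Omega},Y|_{\partial\Omega})+\tilde{\mathfrak g}((\partial X\,Y)|_{\partial\Omega})$$ for all $X,Y\in\mathring C^2(\overline{\mathsf D},\mathbf R^d)$. (ii) If $\partial\Omega\in C^2$, then $\operatorname{im}(\mathfrak J^1_{\partial\Omega})=C^1(\partial\Omega,\mathbf R^d)$, and $\tilde{\mathfrak g}$ and $\tilde{\mathfrak l}$ are continuous on $C^1(\partial\Omega,\mathbf R^d)$ and $(C^1(\partial\Omega,\mathbf R^d))^2$, respectively. (iii) If $\partial\Omega\in C^3$, then $\mathfrak g(v):=\tilde{\mathfrak g}(v\nu)$ and $\mathfrak l(v,w):=\tilde{\mathfrak l}(v\nu,w\nu)$ are continuous on $C^1(\partial\Omega)$ and $(C^1(\partial\Omega))^2$, respectively, and satisfy $$\mathfrak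 D^2J(\Omega)(X)(Y)=\mathfrak l(X|_{\partial\Omega}\cdot\nu,\,Y|_{\partial\Omega}\cdot\nu)-\mathfrak g(\partial^\tau X_\tau\,Y_\tau\cdot\nu)-\mathfrak g(\nabla^\tau(Y\cdot\nu)\cdot X_\tau)-\mathfrak g(\nabla^\tau(X\cdot\nu)\cdot Y_\tau)$$ for all $X,Y\in\mathring C^2(\overline{\mathsf D},\mathbf R^d)$.
   Context: $\mathsf D\subset\mathbf R^d$ is open. $C^k(\overline{\mathsf D},\mathbf R^d)$ is the space of $C^k$ maps on $\mathsf D$ all of whose partial derivatives of order $\le k$ admit uniformly continuous bounded extensions to $\overline{\mathsf D}$; $\mathring C^k(\overline{\mathsf D},\mathbf R^d)$ is the subspace of those vanishing on $\partial\mathsf D$ (for $\mathsf D=\mathbf R^d$ write $C^k(\overline{\mathbf R}^d,\mathbf R^d)$). $\|f\|_{C^1}=\sup\|f\|+\sup\|\partial f\|$, $\partial f$ the Jacobian. $\mathcal F=\{\mathrm{Id}+f\text{ bijective on }\mathbf R^d: f\in C^1(\overline{\mathbf R}^d,\mathbf R^d),\ (\mathrm{Id}+f)^{-1}=\mathrm{Id}+g,\ g\in C^1(\overline{\mathbf R}^d,\mathbf R^d)\}$. $\omega\subset\mathsf D$ is a bounded $C^1$ domain (assumed more regular whenever elements of $\mathcal A_\omega$ are), and $\mathcal A_\omega=\{F(\omega):F\in\mathcal F,\ F(\omega)\subset\mathsf D\}$. For $X,Y$ vector fields on $\overline{\mathsf D}$: $DJ(\Omega)(X)=\lim_{t\to0}\frac1t\big(J((\mathrm{Id}+tX)(\Omega))-J(\Omega)\big)$;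 $\mathfrak D^2J(\Omega)(X)(Y)=\lim_{t\to0}\frac1t\big(DJ((\mathrm{Id}+tY)(\Omega))(X\circ(\mathrm{Id}+tY)^{-1})-DJ(\Omega)(X)\big)$; $D^2J(\Omega)(X)(Y)=\lim_{t\to0}\frac1t\big(DJ((\mathrm{Id}+tY)(\Omega))(X)-DJ(\Omega)(X)\big)$. $J$ is differentiable at $\Omega$ if for all $X\in\mathring C^1(\overline{\mathsf D},\mathbf R^d)$ the limit $D_HJ(\Omega)(X)=\lim_{t\to0,\,V\to X\text{ in }C^1}\frac1t(J((\mathrm{Id}+tV)(\Omega))-J(\Omega))$ exists and is linear and continuous in $X$. $J$ is twice differentiable at $\Omega$ if it is differentiable in a neighborhood of $\Omega$; the map $(X,Y)\mapsto D_HJ((\mathrm{Id}+Y)(\Omega))(X\circ(\mathrm{Id}+Y)^{-1})$ is continuous at all $(X_0,0)\in(\mathring C^1(\overline{\mathsf D},\mathbf R^d))^2$; and for all $X,Y\in\mathring C^1(\overline{\mathsf D},\mathbf R^d)$ the limit $\mathfrak D^2_HJ(\Omega)(X)(Y)=\lim_{t\to0,\,W\to Y\text{ in }C^1}\frac1t\big(D_HJ((\mathrm{Id}+tW)(\Omega))(X\circ(\mathrm{Id}+tW)^{-1})-D_HJ(\Omega)(X)\big)$ exists and is bilinear and continuous in $(X,Y)$ (so $D_HJ=DJ$, $\mathfrak D^2_HJ=\mathfrak D^2J$). $\mathfrak J^1_{\partial\Omega}:\mathring C^1(\overline{\mathsf D},\mathbf R^d)\to\{\text{maps }\partial\Omega\to\mathbf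 R^d\}$ is the restriction $X\mapsto X|_{\partial\Omega}$ and $\operatorname{im}$ denotes its image. $\nu$ is the outward unit normal along $\partial\Omega$; $(a\otimes b)c=(c\cdot b)a$. For a vector field $X$ set $X_\tau=X|_{\partial\Omega}-(X|_{\partial\Omega}\cdot\nu)\nu$; for a matrix field $A$ set $A_\tau=A|_{\partial\Omega}-(A|_{\partial\Omega}\nu)\otimes\nu$. For $f\in C^1(\partial\Omega)$ and $g\in C^1(\partial\Omega,\mathbf R^d)$, $\nabla^\tau f=(\nabla\tilde f)_\tau$ and $\partial^\tau g=(\partial\tilde g)_\tau$, where $\tilde f,\tilde g$ are $C^1$ extensions to a neighborhood of $\partial\Omega$. The expression $\partial^\tau X_\tau\,Y_\tau\cdot\nu$ means $((\partial^\tau X_\tau)Y_\tau)\cdot\nu$.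
   Formalization: Parts (ii) and (iii) are proved under the added assumption that the closure of Ω lies in D; if ∂Ω meets ∂D, fields vanishing on ∂D cannot have image all of C¹(∂Ω,R^d), so (ii) fails and g̃(vν) in (iii) is undefined for general v. *)

theory Defs
  imports "HOL-Analysis.Analysis"
begin

subsection \<open>Function spaces\<close>

text \<open>The list gives the indices of the successive partial derivatives, the last one applied
  being the head. All open sets below live in \<open>real ^ 'd\<close>, so differentiability on them is
  differentiability at each point.\<close>

primrec iterated_partial ::
    "'d::finite list \<Rightarrow> (real ^ 'd \<Rightarrow> 'b::real_normed_vector) \<Rightarrow> real ^ 'd \<Rightarrow> 'b" where
  "iterated_partial [] f = f"
| "iterated_partial (i # \<alpha>) f = (\<lambda>x. frechet_derivative (iterated_partial \<alpha> f) (at x) (axis i 1))"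

definition Ck_on :: "nat \<Rightarrow> (real ^ 'd::finite) set \<Rightarrow> (real ^ 'd \<Rightarrow> 'b::real_normed_vector) \<Rightarrow> bool" where
  "Ck_on k U f \<longleftrightarrow>
     (\<forall>\<alpha>. length \<alpha> < k \<longrightarrow> iterated_partial \<alpha> f differentiable_on U) \<and>
     (\<forall>\<alpha>. length \<alpha> \<le> k \<longrightarrow> continuous_on U (iterated_partial \<alpha> f))"

definition Ck_bar :: "nat \<Rightarrow> (real ^ 'd::finite) set \<Rightarrow> (real ^ 'd \<Rightarrow> real ^ 'd) set" where
  "Ck_bar k D = {f. Ck_on k D f \<and>
     (\<forall>\<alpha>. length \<alpha> \<le> k \<longrightarrow>
        (\<exists>g. uniformly_continuous_on (closure D) g \<and> bounded (g ` closure D) \<and>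
             (\<forall>x\<in>D. g x = iterated_partial \<alpha> f x)))}"

text \<open>A field on the closure of \<open>D\<close> that vanishes on the boundary is represented by its
  extension by zero to the whole space. Continuity on \<open>closure D\<close> then says that the continuous
  extension of \<open>f\<close> from \<open>D\<close> to \<open>closure D\<close> is zero on the boundary.\<close>

definition Ck_ring :: "nat \<Rightarrow> (real ^ 'd::finite) set \<Rightarrow> (real ^ 'd \<Rightarrow> real ^ 'd) set" where
  "Ck_ring k D = {f \<in> Ck_bar k D. continuous_on (closure D) f \<and> (\<forall>x. x \<notin> D \<longrightarrow> f x = 0)}"

definition C1_norm :: "(real ^ 'd::finite) set \<Rightarrow> (real ^ 'd \<Rightarrow> real ^ 'd) \<Rightarrow> real" where
  "C1_norm D f = (SUP x\<in>D. norm (f x)) + (SUP x\<in>D. norm (jacobian f (at x)))"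

text \<open>Neighbourhood filter of \<open>f\<close> in a set \<open>A\<close> of functions with norm \<open>N\<close>; it is not punctured.\<close>

definition norm_nhds ::
    "('a \<Rightarrow> 'b::ab_group_add) set \<Rightarrow> (('a \<Rightarrow> 'b) \<Rightarrow> real) \<Rightarrow> ('a \<Rightarrow> 'b) \<Rightarrow> ('a \<Rightarrow> 'b) filter" where
  "norm_nhds A N f = (INF e\<in>{0<..}. principal {g \<in> A. N (\<lambda>x. g x - f x) < e})"

definition norm_continuous ::
    "('a \<Rightarrow> 'b::ab_group_add) set \<Rightarrow> (('a \<Rightarrow> 'b) \<Rightarrow> real) \<Rightarrow> (('a \<Rightarrow> 'b) \<Rightarrow> real) \<Rightarrow> bool" where
  "norm_continuous A N L \<longleftrightarrow> (\<forall>f\<in>A. (L \<longlongrightarrow> L f) (norm_nhds A N f))"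

definition norm_continuous2 ::
    "('a \<Rightarrow> 'b::ab_group_add) set \<Rightarrow> (('a \<Rightarrow> 'b) \<Rightarrow> real) \<Rightarrow>
     (('a \<Rightarrow> 'b) \<Rightarrow> ('a \<Rightarrow> 'b) \<Rightarrow> real) \<Rightarrow> bool" where
  "norm_continuous2 A N B \<longleftrightarrow>
     (\<forall>f\<in>A. \<forall>h\<in>A. ((\<lambda>(u, v). B u v) \<longlongrightarrow> B f h) (norm_nhds A N f \<times>\<^sub>F norm_nhds A N h))"

definition fun_linear_on :: "('a \<Rightarrow> 'b::real_vector) set \<Rightarrow> (('a \<Rightarrow> 'b) \<Rightarrow> real) \<Rightarrow> bool" where
  "fun_linear_on A L \<longleftrightarrow>
     (\<forall>f\<in>A. \<forall>h\<in>A. L (\<lambda>x. f x + h x) = L f + L h) \<and>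
     (\<forall>c. \<forall>f\<in>A. L (\<lambda>x. c *\<^sub>R f x) = c * L f)"

abbreviation C1_ring_nhds ::
    "(real ^ 'd::finite) set \<Rightarrow> (real ^ 'd \<Rightarrow> real ^ 'd) \<Rightarrow> (real ^ 'd \<Rightarrow> real ^ 'd) filter" where
  "C1_ring_nhds D \<equiv> norm_nhds (Ck_ring 1 D) (C1_norm D)"

subsection \<open>Regular boundaries and the class of admissible sets\<close>

definition gradient :: "(real ^ 'd::finite \<Rightarrow> real) \<Rightarrow> real ^ 'd \<Rightarrow> real ^ 'd" where
  "gradient f x = (\<chi> i. frechet_derivative f (at x) (axis i 1))"

definition Ck_defining ::
    "nat \<Rightarrow> (real ^ 'd::finite) set \<Rightarrow> (real ^ 'd) set \<Rightarrow> (real ^ 'd \<Rightarrow> real) \<Rightarrow> bool" where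
  "Ck_defining k \<Omega> U \<phi> \<longleftrightarrow> open U \<and> Ck_on k U \<phi> \<and> (\<forall>y\<in>U. gradient \<phi> y \<noteq> 0) \<and>
     \<Omega> \<inter> U = {y\<in>U. \<phi> y < 0} \<and> frontier \<Omega> \<inter> U = {y\<in>U. \<phi> y = 0}"

definition Ck_boundary :: "nat \<Rightarrow> (real ^ 'd::finite) set \<Rightarrow> bool" where
  "Ck_boundary k \<Omega> \<longleftrightarrow> (\<forall>x\<in>frontier \<Omega>. \<exists>U \<phi>. x \<in> U \<and> Ck_defining k \<Omega> U \<phi>)"

text \<open>Connectedness is not required.\<close>

definition bounded_C1_domain :: "(real ^ 'd::finite) set \<Rightarrow> bool" where
  "bounded_C1_domain \<omega> \<longleftrightarrow> open \<omega> \<and> \<omega> \<noteq> {} \<and> bounded \<omega> \<and> Ck_boundary 1 \<omega>"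

definition diffeos :: "(real ^ 'd::finite \<Rightarrow> real ^ 'd) set" where
  "diffeos = {F. bij F \<and> (\<exists>f\<in>Ck_bar 1 UNIV. F = (\<lambda>x. x + f x)) \<and>
                         (\<exists>g\<in>Ck_bar 1 UNIV. inv F = (\<lambda>x. x + g x))}"

definition admissible :: "(real ^ 'd::finite) set \<Rightarrow> (real ^ 'd) set \<Rightarrow> (real ^ 'd) set set" where
  "admissible D \<omega> = {F ` \<omega> |F. F \<in> diffeos \<and> F ` \<omega> \<subseteq> D}"

subsection \<open>Shape derivatives\<close>

text \<open>\<open>J\<close> is a total function in HOL; only its values on admissible sets matter, because
  \<open>id_plus (t X) ` \<Omega>\<close> is admissible for small \<open>t\<close>. Likewise \<open>id_plus (t Y)\<close>, with \<open>Y\<close> extended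
  by zero, is a bijection of the whole space for small \<open>t\<close>, so that \<open>inv\<close> is its inverse.\<close>

definition id_plus :: "(real ^ 'd::finite \<Rightarrow> real ^ 'd) \<Rightarrow> real ^ 'd \<Rightarrow> real ^ 'd" where
  "id_plus X = (\<lambda>x. x + X x)"

definition scale_field :: "real \<Rightarrow> (real ^ 'd::finite \<Rightarrow> real ^ 'd) \<Rightarrow> real ^ 'd \<Rightarrow> real ^ 'd" where
  "scale_field t X = (\<lambda>x. t *\<^sub>R X x)"

context
  fixes J :: "(real ^ 'd::finite) set \<Rightarrow> real" and \<Omega> :: "(real ^ 'd) set"
begin

definition DJ_quotient :: "(real ^ 'd \<Rightarrow> real ^ 'd) \<Rightarrow> real \<Rightarrow> real" where
  "DJ_quotient X t = (J (id_plus (scale_field t X) ` \<Omega>) - J \<Omega>) / t"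

definition DJ :: "(real ^ 'd \<Rightarrow> real ^ 'd) \<Rightarrow> real" where
  "DJ X = Lim (at 0) (DJ_quotient X)"

definition DHJ :: "(real ^ 'd) set \<Rightarrow> (real ^ 'd \<Rightarrow> real ^ 'd) \<Rightarrow> real" where
  "DHJ D X = Lim (at 0 \<times>\<^sub>F C1_ring_nhds D X) (\<lambda>(t, V). DJ_quotient V t)"

definition shape_differentiable :: "(real ^ 'd) set \<Rightarrow> bool" where
  "shape_differentiable D \<longleftrightarrow>
     (\<forall>X\<in>Ck_ring 1 D. \<exists>L. ((\<lambda>(t, V). DJ_quotient V t) \<longlongrightarrow> L) (at 0 \<times>\<^sub>F C1_ring_nhds D X)) \<and>
     fun_linear_on (Ck_ring 1 D) (DHJ D) \<and>
     norm_continuous (Ck_ring 1 D) (C1_norm D) (DHJ D)"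

end

context
  fixes J :: "(real ^ 'd::finite) set \<Rightarrow> real" and \<Omega> :: "(real ^ 'd) set"
begin

text \<open>The prefix \<open>frak\<close> marks the second derivatives along transported fields, \<open>D2J\<close> is the
  one with a fixed field \<open>X\<close>.\<close>

definition frakD2J :: "(real ^ 'd \<Rightarrow> real ^ 'd) \<Rightarrow> (real ^ 'd \<Rightarrow> real ^ 'd) \<Rightarrow> real" where
  "frakD2J X Y = Lim (at 0) (\<lambda>t.
     (DJ J (id_plus (scale_field t Y) ` \<Omega>) (X \<circ> inv (id_plus (scale_field t Y))) - DJ J \<Omega> X) / t)"

definition D2J_quotient :: "(real ^ 'd \<Rightarrow> real ^ 'd) \<Rightarrow> (real ^ 'd \<Rightarrow> real ^ 'd) \<Rightarrow> real \<Rightarrow> real" where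
  "D2J_quotient X Y t = (DJ J (id_plus (scale_field t Y) ` \<Omega>) X - DJ J \<Omega> X) / t"

definition D2J :: "(real ^ 'd \<Rightarrow> real ^ 'd) \<Rightarrow> (real ^ 'd \<Rightarrow> real ^ 'd) \<Rightarrow> real" where
  "D2J X Y = Lim (at 0) (D2J_quotient X Y)"

definition transported_DHJ ::
    "(real ^ 'd) set \<Rightarrow> (real ^ 'd \<Rightarrow> real ^ 'd) \<Rightarrow> (real ^ 'd \<Rightarrow> real ^ 'd) \<Rightarrow> real" where
  "transported_DHJ D X Y = DHJ J (id_plus Y ` \<Omega>) D (X \<circ> inv (id_plus Y))"

definition frakD2HJ_quotient ::
    "(real ^ 'd) set \<Rightarrow> (real ^ 'd \<Rightarrow> real ^ 'd) \<Rightarrow> real \<Rightarrow> (real ^ 'd \<Rightarrow> real ^ 'd) \<Rightarrow> real" where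
  "frakD2HJ_quotient D X t W = (transported_DHJ D X (scale_field t W) - DHJ J \<Omega> D X) / t"

definition frakD2HJ ::
    "(real ^ 'd) set \<Rightarrow> (real ^ 'd \<Rightarrow> real ^ 'd) \<Rightarrow> (real ^ 'd \<Rightarrow> real ^ 'd) \<Rightarrow> real" where
  "frakD2HJ D X Y = Lim (at 0 \<times>\<^sub>F C1_ring_nhds D Y) (\<lambda>(t, W). frakD2HJ_quotient D X t W)"

text \<open>A neighbourhood of \<open>\<Omega>\<close> consists of the sets \<open>id_plus Y ` \<Omega>\<close> with \<open>Y\<close> small in the \<open>C1\<close> norm.\<close>

definition twice_shape_differentiable :: "(real ^ 'd) set \<Rightarrow> bool" where
  "twice_shape_differentiable D \<longleftrightarrow>
     (\<forall>\<^sub>F Y in C1_ring_nhds D (\<lambda>x. 0). shape_differentiable J (id_plus Y ` \<Omega>) D) \<and>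
     (\<forall>X0\<in>Ck_ring 1 D.
        ((\<lambda>(X, Y). transported_DHJ D X Y) \<longlongrightarrow> transported_DHJ D X0 (\<lambda>x. 0))
          (C1_ring_nhds D X0 \<times>\<^sub>F C1_ring_nhds D (\<lambda>x. 0))) \<and>
     (\<forall>X\<in>Ck_ring 1 D. \<forall>Y\<in>Ck_ring 1 D. \<exists>L.
        ((\<lambda>(t, W). frakD2HJ_quotient D X t W) \<longlongrightarrow> L) (at 0 \<times>\<^sub>F C1_ring_nhds D Y)) \<and>
     (\<forall>Y\<in>Ck_ring 1 D. fun_linear_on (Ck_ring 1 D) (\<lambda>X. frakD2HJ D X Y)) \<and>
     (\<forall>X\<in>Ck_ring 1 D. fun_linear_on (Ck_ring 1 D) (\<lambda>Y. frakD2HJ D X Y)) \<and>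
     norm_continuous2 (Ck_ring 1 D) (C1_norm D) (frakD2HJ D)"

end

subsection \<open>Tangential calculus on the boundary\<close>

text \<open>Maps on \<open>frontier \<Omega>\<close> are represented extensionally, in the sense of \<open>extensional\<close>
  and \<open>restrict\<close>.\<close>

definition boundary_image :: "(real ^ 'd::finite) set \<Rightarrow> (real ^ 'd) set \<Rightarrow> (real ^ 'd \<Rightarrow> real ^ 'd) set" where
  "boundary_image D \<Omega> = (\<lambda>X. restrict X (frontier \<Omega>)) ` Ck_ring 1 D"

definition field_deriv ::
    "(real ^ 'd::finite \<Rightarrow> real ^ 'd) \<Rightarrow> (real ^ 'd \<Rightarrow> real ^ 'd) \<Rightarrow> real ^ 'd \<Rightarrow> real ^ 'd" where
  "field_deriv X Y = (\<lambda>x. jacobian X (at x) *v Y x)"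

text \<open>Differentiability of a map on a subset of Euclidean space, by local extension.\<close>

definition C1_maps :: "(real ^ 'd::finite) set \<Rightarrow> (real ^ 'd \<Rightarrow> 'b::real_normed_vector) set" where
  "C1_maps S = {f \<in> extensional S.
     \<forall>p\<in>S. \<exists>U F. open U \<and> p \<in> U \<and> Ck_on 1 U F \<and> (\<forall>x\<in>S \<inter> U. F x = f x)}"

definition C1_extension ::
    "(real ^ 'd::finite) set \<Rightarrow> (real ^ 'd \<Rightarrow> 'b::real_normed_vector) \<Rightarrow> real ^ 'd \<Rightarrow> 'b" where
  "C1_extension S f = (SOME F. (\<exists>U. open U \<and> S \<subseteq> U \<and> Ck_on 1 U F) \<and> (\<forall>x\<in>S. F x = f x))"

context
  fixes \<Omega> :: "(real ^ 'd::finite) set"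
begin

definition outward_normal :: "real ^ 'd \<Rightarrow> real ^ 'd" where
  "outward_normal x = (THE n. \<exists>U \<phi>. x \<in> U \<and> Ck_defining 1 \<Omega> U \<phi> \<and>
                                 n = gradient \<phi> x /\<^sub>R norm (gradient \<phi> x))"

definition normal_part :: "(real ^ 'd \<Rightarrow> real ^ 'd) \<Rightarrow> real ^ 'd \<Rightarrow> real" where
  "normal_part X = (\<lambda>x\<in>frontier \<Omega>. X x \<bullet> outward_normal x)"

definition times_normal :: "(real ^ 'd \<Rightarrow> real) \<Rightarrow> real ^ 'd \<Rightarrow> real ^ 'd" where
  "times_normal v = (\<lambda>x\<in>frontier \<Omega>. v x *\<^sub>R outward_normal x)"

definition tangential :: "(real ^ 'd \<Rightarrow> real ^ 'd) \<Rightarrow> real ^ 'd \<Rightarrow> real ^ 'd" where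
  "tangential X = (\<lambda>x\<in>frontier \<Omega>. X x - (X x \<bullet> outward_normal x) *\<^sub>R outward_normal x)"

definition outer_product :: "real ^ 'd \<Rightarrow> real ^ 'd \<Rightarrow> real ^ 'd ^ 'd" where
  "outer_product a b = (\<chi> i j. a $ i * b $ j)"

definition tangential_matrix :: "(real ^ 'd \<Rightarrow> real ^ 'd ^ 'd) \<Rightarrow> real ^ 'd \<Rightarrow> real ^ 'd ^ 'd" where
  "tangential_matrix A = (\<lambda>x\<in>frontier \<Omega>. A x - outer_product (A x *v outward_normal x) (outward_normal x))"

definition tangential_gradient :: "(real ^ 'd \<Rightarrow> real) \<Rightarrow> real ^ 'd \<Rightarrow> real ^ 'd" where
  "tangential_gradient f = tangential (gradient (C1_extension (frontier \<Omega>) f))"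

definition tangential_jacobian :: "(real ^ 'd \<Rightarrow> real ^ 'd) \<Rightarrow> real ^ 'd \<Rightarrow> real ^ 'd ^ 'd" where
  "tangential_jacobian g = tangential_matrix (\<lambda>x. jacobian (C1_extension (frontier \<Omega>) g) (at x))"

definition boundary_C1_norm :: "(real ^ 'd \<Rightarrow> real) \<Rightarrow> real" where
  "boundary_C1_norm f = (SUP x\<in>frontier \<Omega>. \<bar>f x\<bar>) + (SUP x\<in>frontier \<Omega>. norm (tangential_gradient f x))"

definition boundary_C1_vnorm :: "(real ^ 'd \<Rightarrow> real ^ 'd) \<Rightarrow> real" where
  "boundary_C1_vnorm g =
     (SUP x\<in>frontier \<Omega>. norm (g x)) + (SUP x\<in>frontier \<Omega>. norm (tangential_jacobian g x))"

end

lemma outer_product_mult: "outer_product a b *v c = (c \<bullet> b) *\<^sub>R a"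
  by (vector outer_product_def matrix_vector_mult_def inner_vec_def sum_distrib_right
        sum_distrib_left mult_ac)

end

theory Submission
  imports Defs
begin

text \<open>
  Let \<open>\<Phi> V = J ((id + V) \<Omega>)\<close> for small fields \<open>V\<close>. Since
  \<open>(id + t X \<circ> T\<^sup>-\<^sup>1) (T \<Omega>) = (id + V + t X) \<Omega>\<close> for \<open>T = id + V\<close>, the derivative of \<open>J\<close> at \<open>T \<Omega>\<close> in the
  transported direction \<open>X \<circ> T\<^sup>-\<^sup>1\<close> is the derivative of \<open>\<Phi>\<close> at \<open>V\<close> in the direction \<open>X\<close>, and the second
  derivative along transported fields is the second derivative of \<open>\<Phi>\<close> at zero. Everything below
  follows from this picture and from the fact that \<open>\<Phi>\<close> is constant along perturbations that map \<open>\<Omega>\<close> onto itself.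

  Dependence on boundary values. If \<open>X\<close> vanishes on the boundary of \<open>\<Omega>\<close>, then \<open>id + t X\<close> fixes the boundary
  pointwise and is a homeomorphism, so it maps \<open>\<Omega>\<close> onto itself (\<open>id_plus_image_fixed_frontier\<close>). Hence
  both derivatives vanish when one argument vanishes on the boundary, and by linearity they only
  depend on boundary values (\<open>DHJ_cong_frontier\<close>, \<open>frakD2HJ_cong_frontier\<close>). For a fixed field \<open>X\<close> one
  writes \<open>X = (X \<circ> T) \<circ> T\<^sup>-\<^sup>1\<close> with \<open>T = id + t Y\<close>. As \<open>(X \<circ> T - X) / t\<close> converges to \<open>\<partial>X Y\<close> in \<open>C\<^sup>1\<close>
  (\<open>diff_quotient_approx\<close>), the derivative along fixed fields is the one along transported fields plus
  \<open>DJ(\<Omega>)(\<partial>X Y)\<close> (\<open>D2J_tendsto\<close>).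

  Continuity on boundary data. A \<open>C\<^sup>1\<close> map \<open>g\<close> on the boundary is extended by \<open>\<Sum>\<^sub>i l\<^sub>i (g \<circ> R\<^sub>i)\<close> with a partition of
  unity and local retractions \<open>R\<^sub>i\<close> onto the boundary. The derivative of \<open>R\<^sub>i\<close> takes tangential values, so
  only the tangential derivative of \<open>g\<close> enters and the extension is bounded in the norm of \<open>C\<^sup>1\<close> of the
  boundary (\<open>bounded_extension\<close>). Continuity then passes from fields to their boundary values.

  The formula. Let \<open>T\<close> be tangential to the boundary. In a chart in which the boundary is the graph of \<open>u\<close> over a
  hyperplane, correcting the displacement \<open>t T\<close> along the graph direction produces maps \<open>id + t W\<^sub>t\<close> that leave \<open>\<Omega>\<close>
  invariant, with \<open>W\<^sub>t\<close> converging in \<open>C\<^sup>1\<close> to a field equal to \<open>T\<close> on the boundary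
  (\<open>invariant_family_in_chart\<close>). Therefore \<open>DJ(\<Omega>)(T) = 0\<close>, and the limit along the fixed field \<open>X\<close> being zero,
  the second derivative at \<open>(X, T)\<close> equals \<open>- DJ(\<Omega>)(\<partial>X T)\<close> (\<open>tangential_fields\<close>). Splitting \<open>X\<close> and \<open>Y\<close> into
  normal and tangential parts, expanding bilinearly, and using that the second derivative is
  symmetric (\<open>frakD2HJ_symmetric\<close>), each term with a tangential entry reduces to a first derivative, which
  only sees the normal component of its argument (\<open>second_derivative_formula\<close>).
\<close>

section \<open>Maps with continuous derivatives\<close>

definition pd :: "'d::finite \<Rightarrow> (real ^ 'd \<Rightarrow> 'b::real_normed_vector) \<Rightarrow> real ^ 'd \<Rightarrow> 'b" where
  "pd i f x = frechet_derivative f (at x) (axis i 1)"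

lemma linear_sum_axis:
  fixes f :: "real ^ 'd::finite \<Rightarrow> 'b::real_vector"
  assumes "linear f"
  shows "f v = (\<Sum>i\<in>UNIV. v $ i *\<^sub>R f (axis i 1))"
proof -
  have "f v = f (\<Sum>i\<in>UNIV. v $ i *\<^sub>R axis i 1)"
    by (metis (no_types, lifting) basis_expansion scalar_mult_eq_scaleR sum.cong)
  then show ?thesis
    using assms by (simp add: linear_sum linear_scale)
qed

lemma has_derivative_eq_frechet:
  assumes "(f has_derivative f') (at x)"
  shows "frechet_derivative f (at x) = f'"
  using frechet_derivative_at[OF assms] by simp

lemma has_derivative_pd:
  fixes f :: "real ^ 'd::finite \<Rightarrow> 'b::real_normed_vector"
  assumes "f differentiable at x"
  shows "(f has_derivative (\<lambda>v. \<Sum>i\<in>UNIV. v $ i *\<^sub>R pd i f x)) (at x)"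
proof -
  have d: "(f has_derivative frechet_derivative f (at x)) (at x)"
    using assms frechet_derivative_works by blast
  have "frechet_derivative f (at x) = (\<lambda>v. \<Sum>i\<in>UNIV. v $ i *\<^sub>R pd i f x)"
    unfolding pd_def by (intro ext linear_sum_axis has_derivative_linear[OF d])
  with d show ?thesis by simp
qed

lemma pd_eq:
  assumes "(f has_derivative f') (at x)"
  shows "pd i f x = f' (axis i 1)"
  by (simp add: pd_def has_derivative_eq_frechet[OF assms])

lemma frechet_derivative_pd:
  fixes f :: "real ^ 'd::finite \<Rightarrow> 'b::real_normed_vector"
  assumes "f differentiable at x"
  shows "frechet_derivative f (at x) v = (\<Sum>i\<in>UNIV. v $ i *\<^sub>R pd i f x)"
  using has_derivative_eq_frechet[OF has_derivative_pd[OF assms]] by simp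

lemma frechet_derivative_cong_open:
  assumes "open U" "x \<in> U" "\<And>y. y \<in> U \<Longrightarrow> f y = g y"
  shows "frechet_derivative f (at x) = frechet_derivative g (at x)"
proof -
  have "(f has_derivative D) (at x) \<longleftrightarrow> (g has_derivative D) (at x)" for D
    using has_derivative_transform_within_open[OF _ assms(1,2)] assms(3) by metis
  then show ?thesis
    unfolding frechet_derivative_def by simp
qed

lemma iterated_partial_append:
  "iterated_partial (\<alpha> @ \<beta>) f = iterated_partial \<alpha> (iterated_partial \<beta> f)"
  by (induction \<alpha>) auto

lemma iterated_partial_snoc: "iterated_partial (\<alpha> @ [i]) f = iterated_partial \<alpha> (pd i f)"
  unfolding iterated_partial_append by (simp add: pd_def[abs_def])

lemma iterated_partial_cong:
  assumes "open U" "\<And>y. y \<in> U \<Longrightarrow> f y = g y" "x \<in> U"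
  shows "iterated_partial \<alpha> f x = iterated_partial \<alpha> g x"
  using assms(3)
proof (induction \<alpha> arbitrary: x)
  case (Cons i \<alpha>)
  then have "frechet_derivative (iterated_partial \<alpha> f) (at x) = frechet_derivative (iterated_partial \<alpha> g) (at x)"
    by (intro frechet_derivative_cong_open[OF assms(1)]) auto
  then show ?case by simp
qed (use assms in auto)

lemma Ck_on_0: "Ck_on 0 U f \<longleftrightarrow> continuous_on U f"
  by (auto simp: Ck_on_def)

lemma less_Suc_list_cases:
  "(\<forall>\<alpha>. length \<alpha> < Suc k \<longrightarrow> P \<alpha>) \<longleftrightarrow> (\<forall>\<alpha>. length \<alpha> < k \<longrightarrow> (\<forall>i. P (\<alpha> @ [i]))) \<and> P []"
  by (safe, simp, simp) (metis length_append_singleton not_less_eq rev_exhaust)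

text \<open>Peeling off the innermost partial derivative makes \<open>k\<close> accessible to induction.\<close>

lemma Ck_on_Suc:
  "Ck_on (Suc k) U f \<longleftrightarrow> f differentiable_on U \<and> continuous_on U f \<and> (\<forall>i. Ck_on k U (pd i f))"
  unfolding Ck_on_def less_Suc_eq_le[symmetric]
  by (subst (1 2) less_Suc_list_cases) (auto simp: iterated_partial_snoc)

lemma Ck_on_cong:
  assumes "open U" "\<And>y. y \<in> U \<Longrightarrow> f y = g y"
  shows "Ck_on k U f \<longleftrightarrow> Ck_on k U g"
proof -
  have e: "\<And>\<alpha> y. y \<in> U \<Longrightarrow> iterated_partial \<alpha> f y = iterated_partial \<alpha> g y"
    by (rule iterated_partial_cong[OF assms(1)]) (use assms(2) in auto)
  have "iterated_partial \<alpha> f differentiable_on U \<longleftrightarrow> iterated_partial \<alpha> g differentiable_on U" for \<alpha>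
    unfolding differentiable_on_eq_differentiable_at[OF assms(1)] differentiable_def
    using has_derivative_transform_within_open[OF _ assms(1), of "iterated_partial \<alpha> f" _ _ UNIV "iterated_partial \<alpha> g"]
      has_derivative_transform_within_open[OF _ assms(1), of "iterated_partial \<alpha> g" _ _ UNIV "iterated_partial \<alpha> f"] e
    by metis
  moreover have "continuous_on U (iterated_partial \<alpha> f) \<longleftrightarrow> continuous_on U (iterated_partial \<alpha> g)" for \<alpha>
    by (intro continuous_on_cong e) auto
  ultimately show ?thesis by (simp add: Ck_on_def)
qed

lemma Ck_on_SucI:
  assumes "open U" "\<And>x. x \<in> U \<Longrightarrow> (f has_derivative f' x) (at x)"
    "\<And>i. Ck_on k U (\<lambda>x. f' x (axis i 1))"
  shows "Ck_on (Suc k) U f"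
proof -
  have d: "f differentiable_on U"
    unfolding differentiable_on_eq_differentiable_at[OF assms(1)]
    using assms(2) differentiable_def by blast
  have "Ck_on k U (pd i f)" for i
    using assms(3)[of i] Ck_on_cong[OF assms(1), of "pd i f" "\<lambda>x. f' x (axis i 1)"]
      pd_eq[OF assms(2)] by auto
  with d show ?thesis
    by (simp add: Ck_on_Suc differentiable_imp_continuous_on)
qed

lemma Ck_on_mono: "Ck_on k U f \<Longrightarrow> j \<le> k \<Longrightarrow> V \<subseteq> U \<Longrightarrow> Ck_on j V f"
  unfolding Ck_on_def
  by (meson continuous_on_subset differentiable_on_subset le_trans less_le_trans)

lemma Ck_on_continuous: "Ck_on k U f \<Longrightarrow> continuous_on U f"
  by (metis Ck_on_0 Ck_on_mono order_refl zero_le)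

lemma Ck_on_differentiable:
  assumes "Ck_on k U f" "k \<ge> 1" "open U" "x \<in> U"
  shows "f differentiable at x"
  using assms differentiable_on_eq_differentiable_at[of U f]
  by (metis Ck_on_Suc One_nat_def Suc_le_D)

lemma Ck_on_has_derivative:
  assumes "Ck_on k U f" "k \<ge> 1" "open U" "x \<in> U"
  shows "(f has_derivative (\<lambda>v. \<Sum>i\<in>UNIV. v $ i *\<^sub>R pd i f x)) (at x)"
  using has_derivative_pd Ck_on_differentiable[OF assms] by blast

lemma Ck_on_pd: "Ck_on (Suc k) U f \<Longrightarrow> Ck_on k U (pd i f)"
  by (simp add: Ck_on_Suc)

lemma Ck_on_const: "open U \<Longrightarrow> Ck_on k U (\<lambda>x. c)"
proof (induction k arbitrary: c)
  case (Suc k)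
  then show ?case by (intro Ck_on_SucI[where f'="\<lambda>x v. 0"]) auto
qed (auto simp: Ck_on_0)

lemma Ck_on_add:
  assumes "open U" "Ck_on k U f" "Ck_on k U g"
  shows "Ck_on k U (\<lambda>x. f x + g x)"
  using assms(2,3)
proof (induction k arbitrary: f g)
  case (Suc k)
  note d = Ck_on_has_derivative[OF Suc.prems(1) _ assms(1)] Ck_on_has_derivative[OF Suc.prems(2) _ assms(1)]
  show ?case
  proof (rule Ck_on_SucI[OF assms(1)])
    show "Ck_on k U (\<lambda>x. frechet_derivative f (at x) (axis i 1) + frechet_derivative g (at x) (axis i 1))" for i
      using Suc.IH[OF Ck_on_pd[OF Suc.prems(1)] Ck_on_pd[OF Suc.prems(2)], of i i] by (simp add: pd_def[abs_def])
    show "((\<lambda>x. f x + g x) has_derivative (\<lambda>v. frechet_derivative f (at x) v + frechet_derivative g (at x) v)) (at x)"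
      if "x \<in> U" for x
      using d[OF _ that] by (intro derivative_intros) (auto simp: differentiable_def frechet_derivative_works[symmetric])
  qed
qed (auto simp: Ck_on_0 intro: continuous_intros)

lemma Ck_on_linear_compose:
  assumes "open U" "bounded_linear L" "Ck_on k U f"
  shows "Ck_on k U (\<lambda>x. L (f x))"
  using assms(3)
proof (induction k arbitrary: f)
  case 0 then show ?case
    using bounded_linear.continuous_on[OF assms(2)] by (auto simp: Ck_on_0)
next
  case (Suc k)
  show ?case
  proof (rule Ck_on_SucI[OF assms(1)])
    show "Ck_on k U (\<lambda>x. L (frechet_derivative f (at x) (axis i 1)))" for i
      using Suc.IH[OF Ck_on_pd[OF Suc.prems(1)], of i] by (simp add: pd_def[abs_def])
    show "((\<lambda>x. L (f x)) has_derivative (\<lambda>v. L (frechet_derivative f (at x) v))) (at x)"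
      if "x \<in> U" for x
      using Ck_on_differentiable[OF Suc.prems(1) _ assms(1) that]
      by (intro bounded_linear.has_derivative[OF assms(2)]) (simp add: frechet_derivative_works[symmetric])
  qed
qed

lemma Ck_on_bilinear:
  assumes "open U" "bounded_bilinear B" "Ck_on k U f" "Ck_on k U g"
  shows "Ck_on k U (\<lambda>x. B (f x) (g x))"
  using assms(3,4)
proof (induction k arbitrary: f g)
  case 0 then show ?case
    using bounded_bilinear.continuous_on[OF assms(2)] by (auto simp: Ck_on_0)
next
  case (Suc k)
  have m: "Ck_on k U f" "Ck_on k U g"
    using Suc.prems Ck_on_mono by (metis le_Suc_eq order_refl)+
  show ?case
  proof (rule Ck_on_SucI[OF assms(1)])
    show "Ck_on k U (\<lambda>x. B (f x) (frechet_derivative g (at x) (axis i 1)) + B (frechet_derivative f (at x) (axis i 1)) (g x))" for i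
      using Ck_on_add[OF assms(1) Suc.IH[OF m(1) Ck_on_pd[OF Suc.prems(2)], of i]
         Suc.IH[OF Ck_on_pd[OF Suc.prems(1)] m(2), of i]]  by (simp add: pd_def[abs_def])
    show "((\<lambda>x. B (f x) (g x)) has_derivative (\<lambda>v. B (f x) (frechet_derivative g (at x) v) + B (frechet_derivative f (at x) v) (g x))) (at x)"
      if "x \<in> U" for x
      using Ck_on_differentiable[OF Suc.prems(1) _ assms(1) that] Ck_on_differentiable[OF Suc.prems(2) _ assms(1) that]
      by (intro bounded_bilinear.FDERIV[OF assms(2)]) (simp_all add: frechet_derivative_works[symmetric])
  qed
qed

lemmas Ck_on_scaleR = Ck_on_bilinear[OF _ bounded_bilinear_scaleR]
lemmas Ck_on_inner = Ck_on_bilinear[OF _ bounded_bilinear_inner]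
lemmas Ck_on_mult = Ck_on_bilinear[OF _ bounded_bilinear_mult]
lemmas Ck_on_minus = Ck_on_linear_compose[OF _ bounded_linear_minus[OF bounded_linear_ident]]

lemma Ck_on_diff:
  assumes "open U" "Ck_on k U f" "Ck_on k U g"
  shows "Ck_on k U (\<lambda>x. f x - g x)"
  using Ck_on_add[OF assms(1,2) Ck_on_minus[OF assms(1,3)]] by simp

lemma Ck_on_sum:
  assumes "open U" "\<And>i. i \<in> I \<Longrightarrow> Ck_on k U (f i)"
  shows "Ck_on k U (\<lambda>x. \<Sum>i\<in>I. f i x)"
  using assms(2)
  by (induction I rule: infinite_finite_induct) (auto intro: Ck_on_const Ck_on_add assms)

lemma Ck_on_prod:
  fixes f :: "'i \<Rightarrow> real ^ 'd::finite \<Rightarrow> real"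
  assumes "open U" "\<And>i. i \<in> I \<Longrightarrow> Ck_on k U (f i)"
  shows "Ck_on k U (\<lambda>x. \<Prod>i\<in>I. f i x)"
  using assms(2)
  by (induction I rule: infinite_finite_induct) (auto intro: Ck_on_const Ck_on_mult assms)

lemma Ck_on_bounded_linear:
  assumes "open U" "bounded_linear L"
  shows "Ck_on k U L"
proof (cases k)
  case 0
  then show ?thesis
    using bounded_linear.continuous_on[OF assms(2) continuous_on_id] by (simp add: Ck_on_0)
next
  case (Suc j)
  have "Ck_on (Suc j) U L"
    by (rule Ck_on_SucI[OF assms(1), where f'="\<lambda>x. L"])
      (use assms bounded_linear_imp_has_derivative Ck_on_const in auto)
  with Suc show ?thesis by simp
qed

lemmas Ck_on_ident = Ck_on_bounded_linear[OF _ bounded_linear_ident]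

text \<open>By the chain rule a partial derivative of \<open>g \<circ> f\<close> is a sum of products of partial derivatives of \<open>f\<close>
  with compositions \<open>\<partial>\<^sub>j g \<circ> f\<close>, to which the induction hypothesis applies because \<open>g\<close> is arbitrary in it.\<close>

lemma Ck_on_compose:
  assumes "open U" "open V" "Ck_on k V g" "Ck_on k U f" "f ` U \<subseteq> V"
  shows "Ck_on k U (\<lambda>x. g (f x))"
  using assms(3,4)
proof (induction k arbitrary: g)
  case 0 then show ?case
    using continuous_on_compose2[of V g U f] assms by (auto simp: Ck_on_0)
next
  case (Suc k)
  have m: "Ck_on k U f"
    using Suc.prems Ck_on_mono by (metis le_Suc_eq order_refl)+
  have fi: "Ck_on k U (\<lambda>x. frechet_derivative f (at x) (axis i 1) $ j)" for i j
    using Ck_on_linear_compose[OF assms(1) bounded_linear_vec_nth Ck_on_pd[OF Suc.prems(2), of i], of j]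
    by (simp add: pd_def[abs_def])
  show ?case
  proof (rule Ck_on_SucI[OF assms(1)])
    show "Ck_on k U (\<lambda>x. \<Sum>j\<in>UNIV. frechet_derivative f (at x) (axis i 1) $ j *\<^sub>R pd j g (f x))" for i
      by (intro Ck_on_sum Ck_on_scaleR fi Suc.IH Ck_on_pd Suc.prems m assms(1))
    show "((\<lambda>x. g (f x)) has_derivative (\<lambda>v. \<Sum>j\<in>UNIV. frechet_derivative f (at x) v $ j *\<^sub>R pd j g (f x))) (at x)"
      if "x \<in> U" for x
      using Ck_on_differentiable[OF Suc.prems(2) _ assms(1) that] assms(5) that
        Ck_on_has_derivative[OF Suc.prems(1) _ assms(2), of "f x"]
      by (intro has_derivative_compose[where g=g and f=f]) (auto simp: frechet_derivative_works[symmetric])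
  qed
qed

text \<open>The family of all powers is closed under differentiation. It supplies reciprocals (exponent \<open>- 1\<close>)
  and the normalisation of gradients (exponent \<open>- 1 / 2\<close>).\<close>

lemma Ck_on_powr:
  fixes f :: "real ^ 'd::finite \<Rightarrow> real"
  assumes "open U" "Ck_on k U f" "\<And>x. x \<in> U \<Longrightarrow> f x > 0"
  shows "Ck_on k U (\<lambda>x. f x powr a)"
  using assms(2)
proof (induction k arbitrary: a)
  case 0 then show ?case
    using assms(3) by (force simp: Ck_on_0 intro!: continuous_intros)
next
  case (Suc k)
  have m: "Ck_on k U f"
    using Suc.prems Ck_on_mono by (metis le_Suc_eq order_refl)+
  show ?case
  proof (rule Ck_on_SucI[OF assms(1)])
    show "Ck_on k U (\<lambda>x. frechet_derivative f (at x) (axis i 1) * (a * f x powr (a - 1)))" for i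
      using Ck_on_mult[OF assms(1) Ck_on_pd[OF Suc.prems, of i] Ck_on_mult[OF assms(1) Ck_on_const[OF assms(1)] Suc.IH[OF m]]]
      by (simp add: pd_def[abs_def])
    show "((\<lambda>x. f x powr a) has_derivative (\<lambda>v. frechet_derivative f (at x) v * (a * f x powr (a - 1)))) (at x)"
      if "x \<in> U" for x
    proof -
      have "((\<lambda>s. s powr a) has_field_derivative (a * f x powr (a - 1))) (at (f x))"
        using assms(3)[OF that] has_real_derivative_powr by blast
      then have "((\<lambda>s. s powr a) has_derivative (\<lambda>v. v * (a * f x powr (a - 1)))) (at (f x))"
        by (simp add: has_field_derivative_def mult_commute_abs)
      then show ?thesis
        using Ck_on_differentiable[OF Suc.prems _ assms(1) that]
        by (intro has_derivative_compose[where f=f and g="\<lambda>s. s powr a"]) (auto simp: frechet_derivative_works[symmetric])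
    qed
  qed
qed

text \<open>Powers of the positive part are the building block of cut-off functions of any finite order of
  differentiability.\<close>

lemma has_derivative_max_power:
  fixes s :: real
  shows "((\<lambda>s. max 0 s ^ Suc (Suc n)) has_derivative (\<lambda>v. v * (real (Suc (Suc n)) * max 0 s ^ Suc n))) (at s)"
proof (cases "s = 0")
  case False
  then consider "s > 0" | "s < 0" by linarith
  then show ?thesis
  proof cases
    case 1
    have "((\<lambda>s. s ^ Suc (Suc n)) has_derivative (\<lambda>v. v * (real (Suc (Suc n)) * max 0 s ^ Suc n))) (at s)"
      using 1 by (auto intro!: derivative_eq_intros simp: fun_eq_iff max_def algebra_simps simp del: power_Suc)
    then show ?thesis
      by (rule has_derivative_transform_within_open[OF _ open_greaterThan[of 0]]) (use 1 in auto)
  next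
    case 2
    have "((\<lambda>s. 0) has_derivative (\<lambda>v. v * (real (Suc (Suc n)) * max 0 s ^ Suc n))) (at s)"
      using 2 by (simp add: max_def)
    then show ?thesis
      by (rule has_derivative_transform_within_open[OF _ open_lessThan[of 0]]) (use 2 in auto)
  qed
next
  case True
  have "((\<lambda>y. inverse (norm (y - 0)) *\<^sub>R (max 0 y ^ Suc (Suc n) - max 0 0 ^ Suc (Suc n) - (y - 0) * 0)) \<longlongrightarrow> 0) (at (0::real))"
  proof (rule tendsto_norm_zero_cancel, rule tendsto_sandwich[of "\<lambda>_. 0"])
    have "norm (inverse (norm (y - 0)) *\<^sub>R (max 0 y ^ Suc (Suc n) - max 0 0 ^ Suc (Suc n) - (y - 0) * 0)) \<le> \<bar>y\<bar> ^ Suc n" for y :: real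
      by (cases "y > 0") (auto simp: max_def field_simps mult_nonpos_nonneg)
    then show "\<forall>\<^sub>F y in at 0. norm (inverse (norm (y - 0)) *\<^sub>R (max 0 y ^ Suc (Suc n) - max 0 0 ^ Suc (Suc n) - (y - 0) * 0)) \<le> \<bar>y::real\<bar> ^ Suc n"
      by simp
    have "((\<lambda>y::real. \<bar>y\<bar> ^ Suc n) \<longlongrightarrow> \<bar>0\<bar> ^ Suc n) (at 0)"
      by (intro tendsto_intros)
    then show "((\<lambda>y::real. \<bar>y\<bar> ^ Suc n) \<longlongrightarrow> 0) (at 0)" by simp
  qed auto
  then show ?thesis
    unfolding True has_derivative_at by (simp add: divide_inverse mult.commute)
qed

lemma Ck_on_max_power:
  fixes f :: "real ^ 'd::finite \<Rightarrow> real"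
  assumes "open U" "Ck_on k U f" "k < n"
  shows "Ck_on k U (\<lambda>x. max 0 (f x) ^ n)"
  using assms(2,3)
proof (induction k arbitrary: n)
  case 0 then show ?case
    unfolding Ck_on_0 by (intro continuous_on_power continuous_on_max continuous_on_const)
next
  case (Suc k)
  have "n = Suc (Suc (n - 2))" using Suc.prems(2) by simp
  then obtain m where n: "n = Suc (Suc m)" by blast
  have m: "Ck_on k U f"
    using Suc.prems Ck_on_mono by (metis le_Suc_eq order_refl)+
  show ?case unfolding n
  proof (rule Ck_on_SucI[OF assms(1)])
    show "Ck_on k U (\<lambda>x. frechet_derivative f (at x) (axis i 1) * (real (Suc (Suc m)) * max 0 (f x) ^ Suc m))" for i
      using Ck_on_mult[OF assms(1) Ck_on_pd[OF Suc.prems(1), of i] Ck_on_mult[OF assms(1) Ck_on_const[OF assms(1)] Suc.IH[OF m]], of "Suc m"]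
        Suc.prems n by (simp add: pd_def[abs_def])
    show "((\<lambda>x. max 0 (f x) ^ Suc (Suc m)) has_derivative (\<lambda>v. frechet_derivative f (at x) v * (real (Suc (Suc m)) * max 0 (f x) ^ Suc m))) (at x)"
      if "x \<in> U" for x
      using Ck_on_differentiable[OF Suc.prems(1) _ assms(1) that]
      by (intro has_derivative_compose[OF _ has_derivative_max_power, where f=f]) (auto simp: frechet_derivative_works[symmetric])
  qed
qed

lemma Ck_on_Un:
  assumes "open U" "open V" "Ck_on k U f" "Ck_on k V f"
  shows "Ck_on k (U \<union> V) f"
  using assms(3,4)
proof (induction k arbitrary: f)
  case 0 then show ?case
    using assms continuous_on_open_Un by (auto simp: Ck_on_0)
next
  case (Suc k)
  then show ?case
    unfolding Ck_on_Suc using assms continuous_on_open_Un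
    by (auto simp: differentiable_on_eq_differentiable_at open_Un)
qed

section \<open>Bounded uniformly continuous maps and the spaces of vector fields\<close>

definition bounded_ucont :: "'a::metric_space set \<Rightarrow> ('a \<Rightarrow> 'b::real_normed_vector) \<Rightarrow> bool" where
  "bounded_ucont D f \<longleftrightarrow> uniformly_continuous_on D f \<and> bounded (f ` D)"

lemma uniformly_continuous_on_mono:
  fixes f :: "'a::metric_space \<Rightarrow> 'b::metric_space"
  assumes "uniformly_continuous_on S f" "T \<subseteq> S"
  shows "uniformly_continuous_on T f"
  unfolding uniformly_continuous_on_def
proof (intro allI impI)
  fix e :: real assume "e > 0"
  then obtain d where "d > 0" "\<forall>x\<in>S. \<forall>x'\<in>S. dist x' x < d \<longrightarrow> dist (f x') (f x) < e"
    using assms(1) unfolding uniformly_continuous_on_def by blast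
  then show "\<exists>d>0. \<forall>x\<in>T. \<forall>x'\<in>T. dist x' x < d \<longrightarrow> dist (f x') (f x) < e"
    using assms(2) by (intro exI[of _ d]) blast
qed

text \<open>The extension to the closure in the definition of the function spaces exists exactly for the bounded
  uniformly continuous maps, so that the closure no longer appears below.\<close>

lemma bounded_ucont_extension:
  fixes f :: "'a::metric_space \<Rightarrow> 'b::banach"
  shows "(\<exists>g. uniformly_continuous_on (closure D) g \<and> bounded (g ` closure D) \<and> (\<forall>x\<in>D. g x = f x))
    \<longleftrightarrow> bounded_ucont D f"
proof
  assume "\<exists>g. uniformly_continuous_on (closure D) g \<and> bounded (g ` closure D) \<and> (\<forall>x\<in>D. g x = f x)"
  then obtain g where g: "uniformly_continuous_on (closure D) g" "bounded (g ` closure D)" "\<forall>x\<in>D. g x = f x"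
    by blast
  have "uniformly_continuous_on D g"
    using g(1) closure_subset by (rule uniformly_continuous_on_mono)
  then have "uniformly_continuous_on D f"
    using g(3) unfolding uniformly_continuous_on_def by force
  moreover have "f ` D \<subseteq> g ` closure D"
    using g(3) closure_subset by force
  ultimately show "bounded_ucont D f"
    using g(2) bounded_subset by (auto simp: bounded_ucont_def)
next
  assume f: "bounded_ucont D f"
  then have u: "uniformly_continuous_on D f" by (simp add: bounded_ucont_def)
  obtain g where g: "uniformly_continuous_on (closure D) g" "\<And>x. x \<in> D \<Longrightarrow> f x = g x"
    by (rule uniformly_continuous_on_extension_on_closure[OF u]) (rule that)
  have "g ` closure D \<subseteq> closure (g ` D)"
    by (rule image_closure_subset[OF uniformly_continuous_imp_continuous[OF g(1)] closed_closure closure_subset])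
  moreover have "g ` D = f ` D" using g(2) by auto
  ultimately have "bounded (g ` closure D)"
    using f bounded_subset[OF bounded_closure[of "f ` D"]] by (simp add: bounded_ucont_def)
  then show "\<exists>g. uniformly_continuous_on (closure D) g \<and> bounded (g ` closure D) \<and> (\<forall>x\<in>D. g x = f x)"
    using g by (intro exI[of _ g]) simp
qed

lemma bounded_ucont_cong:
  "(\<And>x. x \<in> D \<Longrightarrow> f x = g x) \<Longrightarrow> bounded_ucont D f \<longleftrightarrow> bounded_ucont D g"
  unfolding bounded_ucont_def uniformly_continuous_on_def by (simp cong: image_cong)

lemma bounded_ucont_bound:
  assumes "bounded_ucont D f"
  obtains B where "B > 0" "\<And>x. x \<in> D \<Longrightarrow> norm (f x) \<le> B"
proof -
  obtain B where "B > 0" "\<forall>y\<in>f ` D. norm y \<le> B"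
    using assms unfolding bounded_ucont_def bounded_pos by blast
  then show ?thesis using that by blast
qed

lemma bounded_ucontD:
  assumes "bounded_ucont D f" "e > 0"
  obtains d where "d > 0" "\<And>x y. x \<in> D \<Longrightarrow> y \<in> D \<Longrightarrow> dist y x < d \<Longrightarrow> norm (f y - f x) < e"
  using assms unfolding bounded_ucont_def uniformly_continuous_on_def dist_norm by meson

lemma bounded_ucont_const: "bounded_ucont D (\<lambda>x. c)"
  by (auto simp: bounded_ucont_def uniformly_continuous_on_const bounded_iff)

lemma bounded_ucont_add:
  "bounded_ucont D f \<Longrightarrow> bounded_ucont D g \<Longrightarrow> bounded_ucont D (\<lambda>x. f x + g x)"
  unfolding bounded_ucont_def
  by (auto intro: uniformly_continuous_on_add bounded_plus_comp)

lemma bounded_ucont_bilinear: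
  assumes "bounded_bilinear b" "bounded_ucont D f" "bounded_ucont D g"
  shows "bounded_ucont D (\<lambda>x. b (f x) (g x))"
proof -
  interpret bounded_bilinear b by fact
  obtain K where K: "K > 0" "\<And>a c. norm (b a c) \<le> norm a * norm c * K"
    using pos_bounded by blast
  obtain F where F: "F > 0" "\<And>x. x \<in> D \<Longrightarrow> norm (f x) \<le> F"
    using bounded_ucont_bound[OF assms(2)] by blast
  obtain G where G: "G > 0" "\<And>x. x \<in> D \<Longrightarrow> norm (g x) \<le> G"
    using bounded_ucont_bound[OF assms(3)] by blast
  have "norm (b (f x) (g x)) \<le> F * G * K" if "x \<in> D" for x
    using K(2)[of "f x" "g x"] F(2)[OF that] G(2)[OF that] K(1) F(1) G(1)
    by (meson less_imp_le mult_mono mult_right_mono norm_ge_zero order_trans)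
  then have "bounded ((\<lambda>x. b (f x) (g x)) ` D)"
    unfolding bounded_iff by blast
  moreover have "uniformly_continuous_on D (\<lambda>x. b (f x) (g x))"
    unfolding uniformly_continuous_on_def
  proof safe
    fix e :: real assume e: "e > 0"
    define r where "r = e / (K * (F + G))"
    have r: "r > 0" using e K F G by (simp add: r_def)
    obtain d1 where d1: "d1 > 0" "\<And>x y. x \<in> D \<Longrightarrow> y \<in> D \<Longrightarrow> dist y x < d1 \<Longrightarrow> norm (f y - f x) < r"
      using bounded_ucontD[OF assms(2) r] by metis
    obtain d2 where d2: "d2 > 0" "\<And>x y. x \<in> D \<Longrightarrow> y \<in> D \<Longrightarrow> dist y x < d2 \<Longrightarrow> norm (g y - g x) < r"
      using bounded_ucontD[OF assms(3) r] by metis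
    have "dist (b (f y) (g y)) (b (f x) (g x)) < e" if "x \<in> D" "y \<in> D" "dist y x < min d1 d2" for x y
    proof -
      have 1: "norm (f y - f x) < r" "norm (g y - g x) < r"
        using d1(2)[OF that(1,2)] d2(2)[OF that(1,2)] that(3) by auto
      have eq: "b (f y) (g y) - b (f x) (g x) = b (f y - f x) (g y) + b (f x) (g y - g x)"
        by (simp add: diff_left diff_right)
      have "norm (b (f y) (g y) - b (f x) (g x)) \<le> norm (f y - f x) * norm (g y) * K + norm (f x) * norm (g y - g x) * K"
        unfolding eq using K(2)[of "f y - f x" "g y"] K(2)[of "f x" "g y - g x"] norm_triangle_ineq[of "b (f y - f x) (g y)" "b (f x) (g y - g x)"]
        by linarith
      also have "\<dots> \<le> norm (f y - f x) * G * K + F * norm (g y - g x) * K"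
        using F(2)[OF that(1)] G(2)[OF that(2)] K(1)
        by (intro add_mono mult_right_mono mult_left_mono) auto
      also have "\<dots> < r * G * K + F * r * K"
        using 1 F G K by (intro add_strict_mono mult_strict_right_mono mult_strict_left_mono) auto
      also have "\<dots> = e"
      proof -
        have "r * G * K + F * r * K = r * (K * (F + G))" by (simp add: algebra_simps)
        also have "\<dots> = e" using K F G by (simp add: r_def)
        finally show ?thesis .
      qed
      finally show ?thesis by (simp add: dist_norm)
    qed
    then show "\<exists>d>0. \<forall>x\<in>D. \<forall>x'\<in>D. dist x' x < d \<longrightarrow> dist (b (f x') (g x')) (b (f x) (g x)) < e"
      using d1(1) d2(1) by (intro exI[of _ "min d1 d2"]) auto
  qed
  ultimately show ?thesis by (simp add: bounded_ucont_def)
qed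

lemmas bounded_ucont_scaleR = bounded_ucont_bilinear[OF bounded_bilinear_scaleR]

lemma bounded_ucont_linear:
  assumes "bounded_linear L" "bounded_ucont D f"
  shows "bounded_ucont D (\<lambda>x. L (f x))"
proof -
  have "(\<lambda>x. L (f x)) ` D = L ` f ` D" by auto
  then show ?thesis
    using assms(2) bounded_linear.uniformly_continuous_on[OF assms(1), of D f]
      bounded_linear_image[OF _ assms(1), of "f ` D"] by (simp add: bounded_ucont_def)
qed

lemma bounded_ucont_cmul: "bounded_ucont D f \<Longrightarrow> bounded_ucont D (\<lambda>x. c *\<^sub>R f x)"
  by (rule bounded_ucont_linear[OF bounded_linear_scaleR_right])

lemma bounded_ucont_nth: "bounded_ucont D f \<Longrightarrow> bounded_ucont D (\<lambda>x. f x $ i)"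
  by (rule bounded_ucont_linear[OF bounded_linear_vec_nth])

lemma bounded_ucont_sum:
  "(\<And>i. i \<in> I \<Longrightarrow> bounded_ucont D (f i)) \<Longrightarrow> bounded_ucont D (\<lambda>x. \<Sum>i\<in>I. f i x)"
  by (induction I rule: infinite_finite_induct) (auto intro: bounded_ucont_const bounded_ucont_add)

lemma bounded_ucont_compose:
  assumes "bounded_ucont D f" "uniformly_continuous_on D T" "T ` D \<subseteq> D"
  shows "bounded_ucont D (\<lambda>x. f (T x))"
proof -
  have "uniformly_continuous_on D (f \<circ> T)"
    using assms uniformly_continuous_on_compose[of D T f] uniformly_continuous_on_mono[of D f "T ` D"]
    by (auto simp: bounded_ucont_def comp_def)
  moreover have "(\<lambda>x. f (T x)) ` D \<subseteq> f ` D" using assms(3) by auto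
  ultimately show ?thesis
    using assms(1) bounded_subset by (auto simp: bounded_ucont_def comp_def)
qed

text \<open>Two close points either both lie in a ball slightly larger than the support, which is compact, or
  both lie where the map is zero.\<close>

lemma bounded_ucont_compact_support:
  fixes f :: "real ^ 'd::finite \<Rightarrow> 'b::real_normed_vector"
  assumes "continuous_on UNIV f" "compact C" "\<And>x. x \<notin> C \<Longrightarrow> f x = 0"
  shows "bounded_ucont D f"
proof -
  have "bounded (f ` C)"
    by (intro compact_imp_bounded compact_continuous_image continuous_on_subset[OF assms(1)] assms(2)) simp
  moreover have "f ` D \<subseteq> insert 0 (f ` C)" using assms(3) by auto
  ultimately have b: "bounded (f ` D)" by (metis bounded_insert bounded_subset)
  obtain R where R: "\<forall>x\<in>C. norm x \<le> R" "R > 0"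
    using compact_imp_bounded[OF assms(2)] unfolding bounded_pos by blast
  have u: "uniformly_continuous_on (cball 0 (R + 1)) f"
    using assms(1) by (meson compact_cball compact_uniformly_continuous continuous_on_subset subset_UNIV)
  have "uniformly_continuous_on D f"
    unfolding uniformly_continuous_on_def
  proof safe
    fix e :: real assume e: "e > 0"
    obtain d where d: "d > 0" "\<And>x y. x \<in> cball 0 (R + 1) \<Longrightarrow> y \<in> cball 0 (R + 1) \<Longrightarrow> dist y x < d \<Longrightarrow> dist (f y) (f x) < e"
      using u e unfolding uniformly_continuous_on_def by meson
    have "dist (f y) (f x) < e" if "dist y x < min d 1" for x y
    proof (cases "norm x \<le> R \<or> norm y \<le> R")
      case True
      have "norm x \<le> norm y + dist y x" "norm y \<le> norm x + dist y x"
        using norm_triangle_ineq2[of x y] norm_triangle_ineq2[of y x]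
        by (auto simp: dist_norm norm_minus_commute)
      then show ?thesis using True that by (intro d(2)) auto
    next
      case False
      then have "x \<notin> C" "y \<notin> C" using R by auto
      then show ?thesis using assms(3) e by simp
    qed
    then show "\<exists>d>0. \<forall>x\<in>D. \<forall>x'\<in>D. dist x' x < d \<longrightarrow> dist (f x') (f x) < e"
      using d(1) by (intro exI[of _ "min d 1"]) auto
  qed
  with b show ?thesis by (simp add: bounded_ucont_def)
qed

lemma Ck_bar_iff: "f \<in> Ck_bar k D \<longleftrightarrow> Ck_on k D f \<and> (\<forall>\<alpha>. length \<alpha> \<le> k \<longrightarrow> bounded_ucont D (iterated_partial \<alpha> f))"
  unfolding Ck_bar_def bounded_ucont_extension by simp

lemma Ck_bar_Suc:
  "f \<in> Ck_bar (Suc k) D \<longleftrightarrow> f differentiable_on D \<and> continuous_on D f \<and> bounded_ucont D f \<and> (\<forall>i. pd i f \<in> Ck_bar k D)"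
  unfolding Ck_bar_iff Ck_on_Suc less_Suc_eq_le[symmetric]
  by (subst less_Suc_list_cases) (auto simp: iterated_partial_snoc)

lemma Ck_bar_0: "f \<in> Ck_bar 0 D \<longleftrightarrow> bounded_ucont D f"
  by (auto simp: Ck_bar_iff Ck_on_0 bounded_ucont_def uniformly_continuous_imp_continuous)

text \<open>The derivative may be given by any formula valid on \<open>D\<close>; iterated partial derivatives only see the
  values on the open set \<open>D\<close>.\<close>

lemma Ck_bar_SucI:
  assumes "open D" "\<And>x. x \<in> D \<Longrightarrow> (f has_derivative f' x) (at x)" "bounded_ucont D f"
    "\<And>i. (\<lambda>x. f' x (axis i 1)) \<in> Ck_bar k D"
  shows "f \<in> Ck_bar (Suc k) D"
proof -
  have e: "pd i f x = f' x (axis i 1)" if "x \<in> D" for i x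
    using pd_eq[OF assms(2)] that by blast
  have "f differentiable_on D"
    using assms(2) unfolding differentiable_on_eq_differentiable_at[OF assms(1)] differentiable_def by blast
  moreover have "pd i f \<in> Ck_bar k D" for i
    using assms(4)[of i] Ck_on_cong[OF assms(1), of "pd i f" "\<lambda>x. f' x (axis i 1)" k, OF e]
      bounded_ucont_cong[of D "iterated_partial _ (pd i f)" "iterated_partial _ (\<lambda>x. f' x (axis i 1))"]
      iterated_partial_cong[OF assms(1), of "pd i f" "\<lambda>x. f' x (axis i 1)", OF e]
    unfolding Ck_bar_iff by blast
  ultimately show ?thesis
    using assms(3) by (simp add: Ck_bar_Suc differentiable_imp_continuous_on)
qed

lemma Ck_bar_1I:
  assumes "open D" "\<And>x. x \<in> D \<Longrightarrow> (f has_derivative f' x) (at x)" "bounded_ucont D f"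
    "\<And>i. bounded_ucont D (\<lambda>x. f' x (axis i 1))"
  shows "f \<in> Ck_bar 1 D"
  using Ck_bar_SucI[OF assms(1-3), where k=0] assms(4) by (simp add: Ck_bar_0)

lemma Ck_bar_1D:
  assumes "f \<in> Ck_bar 1 D" "open D"
  shows "x \<in> D \<Longrightarrow> f differentiable at x" "bounded_ucont D f" "bounded_ucont D (pd i f)"
    "x \<in> D \<Longrightarrow> (f has_derivative (\<lambda>v. \<Sum>i\<in>UNIV. v $ i *\<^sub>R pd i f x)) (at x)"
proof -
  show 1: "x \<in> D \<Longrightarrow> f differentiable at x"
    using assms Ck_bar_Suc[of f 0 D] differentiable_on_eq_differentiable_at by auto
  show "bounded_ucont D f" "bounded_ucont D (pd i f)"
    using assms Ck_bar_Suc[of f 0 D] Ck_bar_0 by auto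
  show "x \<in> D \<Longrightarrow> (f has_derivative (\<lambda>v. \<Sum>i\<in>UNIV. v $ i *\<^sub>R pd i f x)) (at x)"
    using has_derivative_pd 1 by blast
qed

lemma Ck_bar_2D: "f \<in> Ck_bar 2 D \<Longrightarrow> f \<in> Ck_bar 1 D" "f \<in> Ck_bar 2 D \<Longrightarrow> pd i f \<in> Ck_bar 1 D"
  using Ck_bar_Suc[of f 1 D] Ck_bar_Suc[of f 0 D] Ck_bar_Suc[of "pd _ f" 0 D] Ck_bar_0
  by (auto simp: numeral_2_eq_2 Ck_bar_0)

lemma Ck_ringD:
  assumes "X \<in> Ck_ring k D"
  shows "X \<in> Ck_bar k D" "continuous_on (closure D) X" "x \<notin> D \<Longrightarrow> X x = 0" "Ck_on k D X"
  using assms by (auto simp: Ck_ring_def Ck_bar_iff)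

lemma Ck_ring_2_1: "X \<in> Ck_ring 2 D \<Longrightarrow> X \<in> Ck_ring 1 D"
  using Ck_bar_2D(1) by (auto simp: Ck_ring_def)

lemma Ck_ring_add:
  assumes "open D" "X \<in> Ck_ring k D" "Y \<in> Ck_ring k D"
  shows "(\<lambda>x. X x + Y x) \<in> Ck_ring k D"
proof -
  have "X \<in> Ck_bar k D \<Longrightarrow> Y \<in> Ck_bar k D \<Longrightarrow> (\<lambda>x. X x + Y x) \<in> Ck_bar k D" for X Y
  proof (induction k arbitrary: X Y)
    case (Suc k)
    have d: "(X has_derivative frechet_derivative X (at x)) (at x)" "(Y has_derivative frechet_derivative Y (at x)) (at x)"
      if "x \<in> D" for x
      using Suc.prems that unfolding Ck_bar_Suc differentiable_on_eq_differentiable_at[OF assms(1)]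
      by (auto simp: frechet_derivative_works[symmetric])
    show ?case
    proof (rule Ck_bar_SucI[OF assms(1)])
      show "((\<lambda>x. X x + Y x) has_derivative (\<lambda>v. frechet_derivative X (at x) v + frechet_derivative Y (at x) v)) (at x)"
        if "x \<in> D" for x
        using d[OF that] by (rule has_derivative_add)
      show "bounded_ucont D (\<lambda>x. X x + Y x)"
        using Suc.prems bounded_ucont_add by (auto simp: Ck_bar_Suc)
      show "(\<lambda>x. frechet_derivative X (at x) (axis i 1) + frechet_derivative Y (at x) (axis i 1)) \<in> Ck_bar k D" for i
        using Suc.IH[of "pd i X" "pd i Y"] Suc.prems by (simp add: Ck_bar_Suc pd_def[abs_def])
    qed
  qed (simp add: Ck_bar_0 bounded_ucont_add)
  then show ?thesis
    using assms(2,3) by (auto simp: Ck_ring_def intro: continuous_on_add)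
qed

lemma Ck_ring_cmul:
  assumes "open D" "X \<in> Ck_ring k D"
  shows "(\<lambda>x. c *\<^sub>R X x) \<in> Ck_ring k D"
proof -
  have "X \<in> Ck_bar k D \<Longrightarrow> (\<lambda>x. c *\<^sub>R X x) \<in> Ck_bar k D" for X
  proof (induction k arbitrary: X)
    case (Suc k)
    have d: "(X has_derivative frechet_derivative X (at x)) (at x)" if "x \<in> D" for x
      using Suc.prems that unfolding Ck_bar_Suc differentiable_on_eq_differentiable_at[OF assms(1)]
      by (auto simp: frechet_derivative_works[symmetric])
    show ?case
    proof (rule Ck_bar_SucI[OF assms(1)])
      show "((\<lambda>x. c *\<^sub>R X x) has_derivative (\<lambda>v. c *\<^sub>R frechet_derivative X (at x) v)) (at x)"
        if "x \<in> D" for x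
        using d[OF that] by (rule has_derivative_scaleR_right)
      show "bounded_ucont D (\<lambda>x. c *\<^sub>R X x)"
        using Suc.prems bounded_ucont_cmul by (auto simp: Ck_bar_Suc)
      show "(\<lambda>x. c *\<^sub>R frechet_derivative X (at x) (axis i 1)) \<in> Ck_bar k D" for i
        using Suc.IH[of "pd i X"] Suc.prems by (simp add: Ck_bar_Suc pd_def[abs_def])
    qed
  qed (simp add: Ck_bar_0 bounded_ucont_cmul)
  then show ?thesis
    using assms(2) by (auto simp: Ck_ring_def intro: continuous_intros)
qed

lemma Ck_ring_diff:
  assumes "open D" "X \<in> Ck_ring k D" "Y \<in> Ck_ring k D"
  shows "(\<lambda>x. X x - Y x) \<in> Ck_ring k D"
  using Ck_ring_add[OF assms(1,2) Ck_ring_cmul[OF assms(1,3), of "-1"]] by simp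

lemma Ck_ring_zero:
  fixes D :: "(real ^ 'd::finite) set"
  assumes D: "open D"
  shows "(\<lambda>x. 0) \<in> Ck_ring k D"
proof -
  have "iterated_partial \<alpha> (\<lambda>x. 0 :: real ^ 'd) = (\<lambda>x. 0)" for \<alpha> :: "'d list"
    by (induction \<alpha>) (auto simp: has_derivative_eq_frechet[OF has_derivative_const])
  then show ?thesis
    unfolding Ck_ring_def Ck_bar_iff using D Ck_on_const bounded_ucont_const by auto
qed

lemma Ck_ring_compact_support:
  fixes f :: "real ^ 'd::finite \<Rightarrow> real ^ 'd"
  assumes "open D" "Ck_on k UNIV f" "compact C" "C \<subseteq> D" "\<And>x. x \<notin> C \<Longrightarrow> f x = 0"
  shows "f \<in> Ck_ring k D"
proof -
  have z: "iterated_partial \<alpha> f x = 0" if "x \<notin> C" for \<alpha> x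
  proof -
    have "iterated_partial \<alpha> f x = iterated_partial \<alpha> (\<lambda>x. 0) x"
      by (rule iterated_partial_cong[of "-C"]) (use that assms compact_imp_closed in auto)
    also have "iterated_partial \<alpha> (\<lambda>x. 0) = (\<lambda>x. 0)" for \<alpha> :: "'d::finite list"
      by (induction \<alpha>) (auto simp: has_derivative_eq_frechet[OF has_derivative_const])
    finally show ?thesis by simp
  qed
  have "bounded_ucont D (iterated_partial \<alpha> f)" if "length \<alpha> \<le> k" for \<alpha>
    by (rule bounded_ucont_compact_support[OF _ assms(3) z]) (use assms(2) that in \<open>auto simp: Ck_on_def\<close>)
  then show ?thesis
    unfolding Ck_ring_def Ck_bar_iff
    using assms Ck_on_mono[OF assms(2), of k D] Ck_on_continuous[OF assms(2)] continuous_on_subset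
    by blast
qed

subsection \<open>The norm on fields\<close>

text \<open>The columns of a Jacobian are the partial derivatives, so this reduces estimates of the \<open>C\<^sup>1\<close> norm to
  estimates of partial derivatives. The dimension factors that this costs below are harmless, because
  only convergence matters.\<close>

lemma norm_matrix_le_sum_columns:
  fixes A :: "real ^ 'n::finite ^ 'm::finite"
  shows "norm A \<le> (\<Sum>j\<in>UNIV. norm (A *v axis j 1))"
proof -
  have "A = (\<Sum>j\<in>UNIV. \<chi> i k. if k = j then A $ i $ j else 0)"
    by (simp add: vec_eq_iff if_distrib cong: if_cong)
  then have "norm A = norm (\<Sum>j\<in>UNIV. \<chi> i k. if k = j then A $ i $ j else (0::real))"
    by (rule arg_cong)
  also have "\<dots> \<le> (\<Sum>j\<in>UNIV. norm (\<chi> i k. if k = j then A $ i $ j else (0::real)))"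
    by (rule norm_sum)
  finally have le: "norm A \<le> (\<Sum>j\<in>UNIV. norm (\<chi> i k. if k = j then A $ i $ j else (0::real)))" .
  have "norm (\<chi> i k. if k = j then A $ i $ j else (0::real)) = norm (A *v axis j 1)" for j
  proof -
    have "norm (\<chi> k. if k = j then a else (0::real)) = \<bar>a\<bar>" for a
    proof -
      have "(\<chi> k. if k = j then a else (0::real)) = a *\<^sub>R axis j 1" by (simp add: axis_def vec_eq_iff)
      then show ?thesis by simp
    qed
    then have "norm ((\<chi> i k. if k = j then A $ i $ j else (0::real)) $ i) = norm ((A *v axis j 1) $ i)" for i
      by (simp add: matrix_vector_mult_basis column_def)
    then show ?thesis by (simp add: norm_vec_def)
  qed
  with le show ?thesis by simp
qed

lemma norm_matrix_vector_le:
  fixes A :: "real ^ 'n::finite ^ 'm::finite"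
  shows "norm (A *v v) \<le> norm A * norm v"
proof -
  have "norm (A *v v) = L2_set (\<lambda>i. norm ((A *v v) $ i)) UNIV" by (simp add: norm_vec_def)
  also have "\<dots> \<le> L2_set (\<lambda>i. norm (A $ i) * norm v) UNIV"
  proof (rule L2_set_mono)
    show "norm ((A *v v) $ i) \<le> norm (A $ i) * norm v" for i
      using Cauchy_Schwarz_ineq2[of "A $ i" v]
      by (simp add: matrix_vector_mult_def inner_vec_def)
  qed auto
  also have "\<dots> = L2_set (\<lambda>i. norm (A $ i)) UNIV * norm v"
    by (simp add: L2_set_left_distrib)
  finally show ?thesis by (simp add: norm_vec_def)
qed

lemma jacobian_mult:
  fixes X :: "real ^ 'm::finite \<Rightarrow> real ^ 'n::finite"
  assumes "X differentiable at x"
  shows "jacobian X (at x) *v v = frechet_derivative X (at x) v"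
  using has_derivative_eq_frechet[of X "\<lambda>h. jacobian X (at x) *v h" x] assms jacobian_works[of X "at x"]
  by simp

lemma jacobian_axis:
  fixes X :: "real ^ 'm::finite \<Rightarrow> real ^ 'n::finite"
  shows "X differentiable at x \<Longrightarrow> jacobian X (at x) *v axis i 1 = pd i X x"
  by (simp add: jacobian_mult pd_def)

lemma norm_jacobian_le:
  fixes X :: "real ^ 'd::finite \<Rightarrow> real ^ 'd"
  assumes "X differentiable at x" "\<And>i. norm (pd i X x) \<le> b"
  shows "norm (jacobian X (at x)) \<le> real CARD('d) * b"
  proof -
  have "norm (jacobian X (at x)) \<le> (\<Sum>i\<in>UNIV. norm (pd i X x))"
    using norm_matrix_le_sum_columns[of "jacobian X (at x)"] by (simp add: jacobian_axis[OF assms(1)])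
  also have "\<dots> \<le> (\<Sum>i\<in>(UNIV :: 'd set). b)" by (rule sum_mono) (rule assms)
  finally show ?thesis by simp
qed

lemma C1_norm_ge:
  fixes X :: "real ^ 'd::finite \<Rightarrow> real ^ 'd"
  assumes "open D" "X \<in> Ck_bar 1 D" "x \<in> D"
  shows "norm (X x) \<le> C1_norm D X" "norm (jacobian X (at x)) \<le> C1_norm D X"
    "norm (frechet_derivative X (at x) v) \<le> C1_norm D X * norm v"
    "norm (pd i X x) \<le> C1_norm D X"
proof -
  obtain B where "\<And>x. x \<in> D \<Longrightarrow> norm (X x) \<le> B"
    using Ck_bar_1D(2)[OF assms(2,1)] by (metis bounded_ucont_bound)
  then have b1: "bdd_above ((\<lambda>x. norm (X x)) ` D)" by (rule bdd_aboveI2)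
  have "\<exists>B. \<forall>x\<in>D. norm (pd i X x) \<le> B" for i
    using Ck_bar_1D(3)[OF assms(2,1)] by (metis bounded_ucont_bound)
  then obtain Bf where Bf: "\<And>i x. x \<in> D \<Longrightarrow> norm (pd i X x) \<le> Bf i" by metis
  have "norm (jacobian X (at x)) \<le> (\<Sum>i\<in>UNIV. Bf i)" if "x \<in> D" for x
    using norm_matrix_le_sum_columns[of "jacobian X (at x)"] sum_mono[of UNIV "\<lambda>i. norm (pd i X x)" Bf] Bf[OF that]
    by (simp add: jacobian_axis[OF Ck_bar_1D(1)[OF assms(2,1) that]])
  then have b2: "bdd_above ((\<lambda>x. norm (jacobian X (at x))) ` D)" by (rule bdd_aboveI2)
  have 1: "norm (X x) \<le> (SUP x\<in>D. norm (X x))" "norm (jacobian X (at x)) \<le> (SUP x\<in>D. norm (jacobian X (at x)))"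
    using cSUP_upper[OF assms(3) b1] cSUP_upper[OF assms(3) b2] by auto
  then show "norm (X x) \<le> C1_norm D X" and 2: "norm (jacobian X (at x)) \<le> C1_norm D X"
    unfolding C1_norm_def using norm_ge_zero[of "X x"] norm_ge_zero[of "jacobian X (at x)"] by linarith+
  show 3: "norm (frechet_derivative X (at x) v) \<le> C1_norm D X * norm v" for v
    using norm_matrix_vector_le[of "jacobian X (at x)" v] mult_right_mono[OF 2 norm_ge_zero[of v]]
      jacobian_mult[OF Ck_bar_1D(1)[OF assms(2,1,3)], of v] by simp
  show "norm (pd i X x) \<le> C1_norm D X"
    using 3[of "axis i 1"] by (simp add: pd_def)
qed

lemma C1_norm_le:
  fixes X :: "real ^ 'd::finite \<Rightarrow> real ^ 'd"
  assumes "D \<noteq> {}" "\<And>x. x \<in> D \<Longrightarrow> X differentiable at x" "\<And>x. x \<in> D \<Longrightarrow> norm (X x) \<le> a"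
    "\<And>x i. x \<in> D \<Longrightarrow> norm (pd i X x) \<le> b"
  shows "C1_norm D X \<le> a + real CARD('d) * b"
  unfolding C1_norm_def using assms norm_jacobian_le[of X _ b]
  by (intro add_mono cSUP_least) auto

lemma C1_norm_nonneg: "open D \<Longrightarrow> D \<noteq> {} \<Longrightarrow> X \<in> Ck_bar 1 D \<Longrightarrow> 0 \<le> C1_norm D X"
  using C1_norm_ge(1)[of D X] order_trans[OF norm_ge_zero] by blast

lemma C1_norm_zero:
  fixes D :: "(real ^ 'd::finite) set"
  shows "D \<noteq> {} \<Longrightarrow> C1_norm D (\<lambda>x. 0) = 0"
proof -
  have "jacobian (\<lambda>x. 0 :: real ^ 'd) (at x) = 0" for x :: "real ^ 'd"
    by (simp add: jacobian_def has_derivative_eq_frechet[OF has_derivative_const] matrix_def vec_eq_iff)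
  then show "D \<noteq> {} \<Longrightarrow> C1_norm D (\<lambda>x. 0) = 0" by (simp add: C1_norm_def)
qed

lemma pd_add:
  assumes "f differentiable at x" "g differentiable at x"
  shows "pd i (\<lambda>x. f x + g x) x = pd i f x + pd i g x"
  using pd_eq[OF has_derivative_add[OF assms[unfolded frechet_derivative_works]]] by (simp add: pd_def)

lemma pd_cmul:
  assumes "f differentiable at x"
  shows "pd i (\<lambda>x. c *\<^sub>R f x) x = c *\<^sub>R pd i f x"
  using pd_eq[OF has_derivative_scaleR_right[OF assms[unfolded frechet_derivative_works]]] by (simp add: pd_def)

lemma differentiable_cmul: "f differentiable at x \<Longrightarrow> (\<lambda>x. c *\<^sub>R f x) differentiable at x"
  by (auto simp: differentiable_def intro: has_derivative_scaleR_right)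

lemma pd_diff:
  assumes "f differentiable at x" "g differentiable at x"
  shows "pd i (\<lambda>x. f x - g x) x = pd i f x - pd i g x"
  using pd_eq[OF has_derivative_diff[OF assms[unfolded frechet_derivative_works]]] by (simp add: pd_def)

lemma C1_norm_cmul_le:
  fixes X :: "real ^ 'd::finite \<Rightarrow> real ^ 'd"
  assumes "open D" "D \<noteq> {}" "X \<in> Ck_bar 1 D"
  shows "C1_norm D (\<lambda>x. c *\<^sub>R X x) \<le> \<bar>c\<bar> * C1_norm D X * (1 + real CARD('d))"
  proof -
  have "C1_norm D (\<lambda>x. c *\<^sub>R X x) \<le> \<bar>c\<bar> * C1_norm D X + real CARD('d) * (\<bar>c\<bar> * C1_norm D X)"
    using assms C1_norm_ge[OF assms(1,3)] Ck_bar_1D(1)[OF assms(3,1)]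
    by (intro C1_norm_le) (auto simp: pd_cmul differentiable_cmul intro!: mult_left_mono)
  then show ?thesis by (simp add: algebra_simps)
qed

lemma C1_norm_add_le:
  fixes X :: "real ^ 'd::finite \<Rightarrow> real ^ 'd"
  assumes "open D" "D \<noteq> {}" "X \<in> Ck_bar 1 D" "Y \<in> Ck_bar 1 D"
  shows "C1_norm D (\<lambda>x. X x + Y x) \<le> (C1_norm D X + C1_norm D Y) * (1 + real CARD('d))"
  proof -
  have "C1_norm D (\<lambda>x. X x + Y x) \<le> (C1_norm D X + C1_norm D Y) + real CARD('d) * (C1_norm D X + C1_norm D Y)"
    using assms C1_norm_ge[OF assms(1,3)] C1_norm_ge[OF assms(1,4)] Ck_bar_1D(1)[OF assms(3,1)] Ck_bar_1D(1)[OF assms(4,1)]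
    by (intro C1_norm_le) (auto simp: pd_add intro!: norm_triangle_mono)
  then show ?thesis by (simp add: algebra_simps)
qed

section \<open>Small perturbations of the identity\<close>

text \<open>A mean value inequality that compares an increment with an arbitrary candidate \<open>w\<close> for its linear
  part.\<close>

lemma segment_estimate:
  fixes f :: "'a::real_normed_vector \<Rightarrow> 'b::real_normed_vector"
  assumes "\<And>s. s \<in> {0..1} \<Longrightarrow> (f has_derivative f' s) (at (x + s *\<^sub>R v))"
    and "\<And>s. s \<in> {0..1} \<Longrightarrow> norm (f' s v - w) \<le> e"
  shows "norm (f (x + v) - f x - w) \<le> e"
proof -
  define g where "g = (\<lambda>s::real. f (x + s *\<^sub>R v) - s *\<^sub>R w)"
  have d: "(g has_derivative (\<lambda>h. h *\<^sub>R (f' s v - w))) (at s within {0..1})" if "s \<in> {0..1}" for s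
  proof -
    have 1: "((\<lambda>s. x + s *\<^sub>R v) has_derivative (\<lambda>h. h *\<^sub>R v)) (at s)"
      by (auto intro!: derivative_eq_intros)
    have "((\<lambda>s. f (x + s *\<^sub>R v)) has_derivative (\<lambda>h. f' s (h *\<^sub>R v))) (at s)"
      by (rule has_derivative_compose[OF 1 assms(1)[OF that]])
    moreover have "f' s (h *\<^sub>R v) = h *\<^sub>R f' s v" for h
      using has_derivative_linear[OF assms(1)[OF that]] by (simp add: linear_scale)
    ultimately have "((\<lambda>s. f (x + s *\<^sub>R v)) has_derivative (\<lambda>h. h *\<^sub>R f' s v)) (at s)" by simp
    then have "(g has_derivative (\<lambda>h. h *\<^sub>R f' s v - h *\<^sub>R w)) (at s)"
      unfolding g_def by (intro has_derivative_diff has_derivative_scaleR_left has_derivative_ident)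
    then show ?thesis
      unfolding scaleR_diff_right by (rule has_derivative_at_withinI)
  qed
  have o: "onorm (\<lambda>h. h *\<^sub>R (f' s v - w)) \<le> e" if "s \<in> {0..1}" for s
    using assms(2)[OF that] by (intro onorm_le) (simp add: mult.commute[of e] mult_left_mono)
  have "norm (g 1 - g 0) \<le> e * norm (1 - 0 :: real)"
    by (rule differentiable_bound[OF _ d o]) auto
  then show ?thesis by (simp add: g_def algebra_simps)
qed

text \<open>With the constant one half, \<open>id + Y\<close> shrinks distances at most by this factor. It is then a bijection
  whose inverse has Lipschitz constant 2. The fields need not be differentiable on the boundary of \<open>D\<close>, so
  the derivative is only estimated on \<open>D\<close>.\<close>

definition small_field :: "(real ^ 'd::finite) set \<Rightarrow> (real ^ 'd \<Rightarrow> real ^ 'd) \<Rightarrow> bool" where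
  "small_field D Y \<longleftrightarrow> Y \<in> Ck_ring 1 D \<and> (\<forall>x y. norm (Y x - Y y) \<le> norm (x - y) / 2) \<and>
     (\<forall>x\<in>D. \<forall>v. norm (frechet_derivative Y (at x) v) \<le> norm v / 2)"

context
  fixes D :: "(real ^ 'd::finite) set"
  assumes D: "open D" "D \<noteq> {}"
begin

lemma Ck_ring_1D:
  assumes "X \<in> Ck_ring 1 D"
  shows "X \<in> Ck_bar 1 D" "x \<in> D \<Longrightarrow> (X has_derivative frechet_derivative X (at x)) (at x)"
    "x \<notin> D \<Longrightarrow> X x = 0" "bounded_ucont D X" "bounded_ucont D (pd i X)" "x \<in> D \<Longrightarrow> X differentiable at x"
    "0 \<le> C1_norm D X" "norm (X x) \<le> C1_norm D X"
proof -
  show 1: "X \<in> Ck_bar 1 D" and 3: "x \<notin> D \<Longrightarrow> X x = 0" for x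
    using assms Ck_ringD by blast+
  show "x \<in> D \<Longrightarrow> (X has_derivative frechet_derivative X (at x)) (at x)"
    using Ck_bar_1D(1)[OF 1 D(1)] frechet_derivative_works by blast
  show "bounded_ucont D X" "bounded_ucont D (pd i X)" "x \<in> D \<Longrightarrow> X differentiable at x"
    using Ck_bar_1D[OF 1 D(1)] by auto
  show 2: "0 \<le> C1_norm D X" using C1_norm_nonneg[OF D 1] .
  show "norm (X x) \<le> C1_norm D X"
    using C1_norm_ge(1)[OF D(1) 1, of x] 2 3[of x] by (cases "x \<in> D") auto
qed

text \<open>The open ball around \<open>x\<close> that reaches to the nearest point of the complement lies in \<open>D\<close>, and the
  field is continuous up to that point, where it is zero.\<close>

lemma Ck_ring_lipschitz_to_complement:
  assumes "X \<in> Ck_ring 1 D" "x \<in> D" "z \<notin> D"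
  shows "norm (X x) \<le> C1_norm D X * norm (x - z)"
proof -
  note X = Ck_ring_1D[OF assms(1)]
  have "closed (- D)" "- D \<noteq> {}" using D(1) assms(3) by auto
  then obtain w where w: "w \<in> - D" "\<And>y. y \<in> - D \<Longrightarrow> dist x w \<le> dist x y"
    using distance_attains_inf[of "- D" x] by metis
  define \<rho> where "\<rho> = dist x w"
  have b: "ball x \<rho> \<subseteq> D" using w(2) by (force simp: \<rho>_def)
  have \<rho>: "\<rho> > 0" using w(1) assms(2) by (auto simp: \<rho>_def)
  have le: "norm (X x) \<le> norm (X y) + C1_norm D X * \<rho>" if "y \<in> ball x \<rho>" for y
  proof -
    have "norm (X x - X y) \<le> C1_norm D X * norm (x - y)"
    proof (rule differentiable_bound[OF convex_ball])
      show "(X has_derivative frechet_derivative X (at u)) (at u within ball x \<rho>)" if "u \<in> ball x \<rho>" for u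
        using X(2) b that by (blast intro: has_derivative_at_withinI)
      show "onorm (frechet_derivative X (at u)) \<le> C1_norm D X" if "u \<in> ball x \<rho>" for u
        using C1_norm_ge(3)[OF D(1) X(1), of u] b that by (intro onorm_le) auto
    qed (use that \<rho> in auto)
    also have "\<dots> \<le> C1_norm D X * \<rho>"
      using that X(7) by (intro mult_left_mono) (auto simp: dist_norm)
    finally show ?thesis using norm_triangle_ineq2[of "X x" "X y"] by linarith
  qed
  have w_cl: "w \<in> closure (ball x \<rho>)"
    using \<rho> by (simp add: \<rho>_def dist_commute)
  have cont: "continuous_on (closure (ball x \<rho>)) (\<lambda>y. norm (X y) + C1_norm D X * \<rho>)"
    using Ck_ringD(2)[OF assms(1)] closure_mono[OF b]
    by (intro continuous_intros) (metis continuous_on_subset)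
  have "norm (X x) \<le> norm (X w) + C1_norm D X * \<rho>"
    by (rule continuous_ge_on_closure[OF cont w_cl]) (use le in auto)
  also have "\<dots> = C1_norm D X * \<rho>" using w(1) X(3) by simp
  also have "\<dots> \<le> C1_norm D X * norm (x - z)"
    using w(2)[of z] assms(3) X(7) by (intro mult_left_mono) (auto simp: \<rho>_def dist_norm)
  finally show ?thesis .
qed

text \<open>The extension by zero need not be differentiable on the boundary of \<open>D\<close>, but it keeps the
  Lipschitz constant, whatever the shape of \<open>D\<close>: a segment that leaves \<open>D\<close> meets the complement,
  where the field vanishes.\<close>

lemma Ck_ring_lipschitz:
  assumes "X \<in> Ck_ring 1 D"
  shows "norm (X x - X y) \<le> C1_norm D X * norm (x - y)"
proof -
  note X = Ck_ring_1D[OF assms]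
  consider "closed_segment x y \<subseteq> D" | z where "z \<in> closed_segment x y" "z \<notin> D" "x \<in> D" "y \<in> D"
    | "x \<notin> D" | "y \<notin> D" by blast
  then show ?thesis
  proof cases
    case 1
    show ?thesis
    proof (rule differentiable_bound[OF convex_closed_segment])
      show "(X has_derivative frechet_derivative X (at u)) (at u within closed_segment x y)" if "u \<in> closed_segment x y" for u
        using X(2) 1 that by (blast intro: has_derivative_at_withinI)
      show "onorm (frechet_derivative X (at u)) \<le> C1_norm D X" if "u \<in> closed_segment x y" for u
        using C1_norm_ge(3)[OF D(1) X(1), of u] 1 that by (intro onorm_le) auto
    qed auto
  next
    case 2
    have "norm (X x - X y) \<le> norm (X x) + norm (X y)" by (rule norm_triangle_ineq4)
    also have "\<dots> \<le> C1_norm D X * norm (x - z) + C1_norm D X * norm (y - z)"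
      by (intro add_mono Ck_ring_lipschitz_to_complement assms 2)
    also have "\<dots> = C1_norm D X * norm (x - y)"
      using 2(1) by (simp add: distrib_left[symmetric] between_mem_segment[symmetric] between dist_norm norm_minus_commute)
    finally show ?thesis .
  next
    case 3
    then show ?thesis
      using Ck_ring_lipschitz_to_complement[OF assms, of y x] X(3) X(7) by (cases "y \<in> D") (auto simp: norm_minus_commute)
  next
    case 4
    then show ?thesis
      using Ck_ring_lipschitz_to_complement[OF assms, of x y] X(3) X(7) by (cases "x \<in> D") auto
  qed
qed

lemma Ck_ring_continuous: "X \<in> Ck_ring 1 D \<Longrightarrow> continuous_on UNIV X"
proof -
  assume "X \<in> Ck_ring 1 D"
  then have "(C1_norm D X)-lipschitz_on UNIV X"
    using Ck_ring_lipschitz Ck_ring_1D(7) by (auto simp: lipschitz_on_def dist_norm)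
  then show ?thesis by (rule lipschitz_on_continuous_on)
qed

lemma small_field_scale:
  assumes "W \<in> Ck_ring 1 D" "\<bar>t\<bar> * C1_norm D W \<le> 1 / 2"
  shows "small_field D (\<lambda>x. t *\<^sub>R W x)"
  unfolding small_field_def
proof (intro conjI allI ballI)
  note W = Ck_ring_1D[OF assms(1)]
  have r: "\<bar>t\<bar> * (C1_norm D W * a) \<le> a / 2" if "a \<ge> 0" for a
    using mult_right_mono[OF assms(2) that] by (simp add: mult.assoc)
  show "(\<lambda>x. t *\<^sub>R W x) \<in> Ck_ring 1 D" using Ck_ring_cmul[OF D(1) assms(1)] .
  show "norm (t *\<^sub>R W x - t *\<^sub>R W y) \<le> norm (x - y) / 2" for x y
    using mult_left_mono[OF Ck_ring_lipschitz[OF assms(1), of x y], of "\<bar>t\<bar>"] r[of "norm (x - y)"]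
    by (simp add: scaleR_diff_right[symmetric])
  show "norm (frechet_derivative (\<lambda>x. t *\<^sub>R W x) (at x) v) \<le> norm v / 2" if "x \<in> D" for x v
    using has_derivative_eq_frechet[OF has_derivative_scaleR_right[OF W(2)[OF that]], of t]
      mult_left_mono[OF C1_norm_ge(3)[OF D(1) W(1) that, of v], of "\<bar>t\<bar>"] r[of "norm v"] by simp
qed

lemma small_fieldI: "W \<in> Ck_ring 1 D \<Longrightarrow> C1_norm D W \<le> 1 / 2 \<Longrightarrow> small_field D W"
  using small_field_scale[of W 1] by simp

lemma small_field_shrink:
  assumes "small_field D Y" "\<bar>s\<bar> \<le> 1"
  shows "small_field D (\<lambda>x. s *\<^sub>R Y x)"
  unfolding small_field_def
proof (intro conjI allI ballI)
  have Y: "Y \<in> Ck_ring 1 D" "\<And>x y. norm (Y x - Y y) \<le> norm (x - y) / 2"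
    "\<And>x v. x \<in> D \<Longrightarrow> norm (frechet_derivative Y (at x) v) \<le> norm v / 2"
    using assms(1) by (auto simp: small_field_def)
  have r: "\<bar>s\<bar> * a \<le> a" if "a \<ge> 0" for a
    using mult_right_mono[OF assms(2) that] by simp
  show "(\<lambda>x. s *\<^sub>R Y x) \<in> Ck_ring 1 D" using Ck_ring_cmul[OF D(1) Y(1)] .
  show "norm (s *\<^sub>R Y x - s *\<^sub>R Y y) \<le> norm (x - y) / 2" for x y
    using Y(2)[of x y] r[of "norm (Y x - Y y)"]
    by (simp add: scaleR_diff_right[symmetric])
  show "norm (frechet_derivative (\<lambda>x. s *\<^sub>R Y x) (at x) v) \<le> norm v / 2" if "x \<in> D" for x v
    using has_derivative_eq_frechet[OF has_derivative_scaleR_right[OF Ck_ring_1D(2)[OF Y(1) that]], of s]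
      Y(3)[OF that, of v] r[of "norm (frechet_derivative Y (at x) v)"] by simp
qed

context
  fixes Y
  assumes Y: "small_field D Y"
begin

lemma small_field_Ck: "Y \<in> Ck_ring 1 D"
  using Y by (simp add: small_field_def)

lemma id_plus_expand: "norm (x - y) \<le> 2 * norm (id_plus Y x - id_plus Y y)"
proof -
  have "norm (Y x - Y y) \<le> norm (x - y) / 2"
    using Y by (simp add: small_field_def)
  moreover have "x - y = (id_plus Y x - id_plus Y y) - (Y x - Y y)" by (simp add: id_plus_def)
  then have "norm (x - y) \<le> norm (id_plus Y x - id_plus Y y) + norm (Y x - Y y)"
    by (metis norm_triangle_ineq4)
  ultimately show ?thesis by linarith
qed

text \<open>Solving \<open>x + Y x = y\<close> means finding a fixed point of the contraction \<open>x \<mapsto> y - Y x\<close>.\<close>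

lemma bij_id_plus: "bij (id_plus Y)"
proof (rule bijI)
  show "inj (id_plus Y)"
  proof (rule injI)
    fix x y assume "id_plus Y x = id_plus Y y"
    then show "x = y" using id_plus_expand[of x y] by simp
  qed
  show "surj (id_plus Y)"
    unfolding surj_def
  proof
    fix y
    have "\<exists>!x. y - Y x = x"
      by (rule banach_fix_type[of "1/2"])
        (use Y in \<open>auto simp: small_field_def dist_norm norm_minus_commute\<close>)
    then obtain x where "y - Y x = x" by blast
    then have "y = id_plus Y x" by (metis add_diff_cancel_left' diff_add_cancel id_plus_def)
    then show "\<exists>x. y = id_plus Y x" ..
  qed
qed

lemma id_plus_off: "x \<notin> D \<Longrightarrow> id_plus Y x = x"
  using Ck_ring_1D(3)[OF small_field_Ck] by (simp add: id_plus_def)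

lemma id_plus_inv: "id_plus Y (inv (id_plus Y) y) = y" "inv (id_plus Y) (id_plus Y x) = x"
  using bij_id_plus by (auto simp: bij_def surj_f_inv_f)

lemma id_plus_mem_iff: "id_plus Y x \<in> D \<longleftrightarrow> x \<in> D" "inv (id_plus Y) x \<in> D \<longleftrightarrow> x \<in> D"
proof -
  have "id_plus Y x \<in> D \<longleftrightarrow> x \<in> D" for x
    by (metis id_plus_inv(2) id_plus_off)
  then show "id_plus Y x \<in> D \<longleftrightarrow> x \<in> D" "inv (id_plus Y) x \<in> D \<longleftrightarrow> x \<in> D"
    by (metis id_plus_inv(1))+
qed

lemma inv_id_plus_lipschitz: "norm (inv (id_plus Y) x - inv (id_plus Y) y) \<le> 2 * norm (x - y)"
  using id_plus_expand[of "inv (id_plus Y) x" "inv (id_plus Y) y"] by (simp add: id_plus_inv)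

lemma continuous_id_plus: "continuous_on UNIV (id_plus Y)" "continuous_on UNIV (inv (id_plus Y))"
proof -
  show "continuous_on UNIV (id_plus Y)"
    unfolding id_plus_def using Ck_ring_continuous[OF small_field_Ck] by (intro continuous_intros)
  have "2-lipschitz_on UNIV (inv (id_plus Y))"
    using inv_id_plus_lipschitz by (auto simp: lipschitz_on_def dist_norm)
  then show "continuous_on UNIV (inv (id_plus Y))" by (rule lipschitz_on_continuous_on)
qed

lemma frontier_id_plus: "frontier (id_plus Y ` S) = id_plus Y ` frontier S"
proof -
  have cl: "closure (id_plus Y ` S) = id_plus Y ` closure S" for S
  proof
    show "id_plus Y ` closure S \<subseteq> closure (id_plus Y ` S)"
      by (rule image_closure_subset[OF continuous_on_subset[OF continuous_id_plus(1) subset_UNIV] closed_closure closure_subset])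
    have inv_im: "inv (id_plus Y) ` id_plus Y ` S = S"
      by (simp add: image_image id_plus_inv)
    have "inv (id_plus Y) ` closure (id_plus Y ` S) \<subseteq> closure S"
      by (rule image_closure_subset[OF continuous_on_subset[OF continuous_id_plus(2) subset_UNIV] closed_closure])
        (simp only: inv_im closure_subset)
    then show "closure (id_plus Y ` S) \<subseteq> id_plus Y ` closure S"
      by (metis (no_types, lifting) id_plus_inv(1) image_subset_iff rev_image_eqI subsetI)
  qed
  have "- (id_plus Y ` S) = id_plus Y ` (- S)"
    using bij_image_Compl_eq[OF bij_id_plus] by simp
  then show ?thesis
    using bij_id_plus unfolding frontier_closures
    by (simp add: cl image_Int bij_is_inj)
qed

lemma id_plus_has_derivative:
  "x \<in> D \<Longrightarrow> (id_plus Y has_derivative (\<lambda>v. v + frechet_derivative Y (at x) v)) (at x)"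
  unfolding id_plus_def
  by (intro has_derivative_add has_derivative_ident Ck_ring_1D(2)[OF small_field_Ck])

end

lemma Ck_ring_compose:
  assumes "X \<in> Ck_ring 1 D" "continuous_on UNIV S" "uniformly_continuous_on D S" "\<And>x. S x \<in> D \<longleftrightarrow> x \<in> D"
    "\<And>x. x \<in> D \<Longrightarrow> (S has_derivative S' x) (at x)" "\<And>i. bounded_ucont D (\<lambda>x. S' x (axis i 1))"
  shows "(\<lambda>x. X (S x)) \<in> Ck_ring 1 D"
proof -
  note X = Ck_ring_1D[OF assms(1)]
  have im: "S ` D \<subseteq> D" using assms(4) by blast
  have "(\<lambda>x. X (S x)) \<in> Ck_bar 1 D"
  proof (rule Ck_bar_1I[OF D(1)])
    show "((\<lambda>x. X (S x)) has_derivative (\<lambda>v. \<Sum>j\<in>UNIV. S' x v $ j *\<^sub>R pd j X (S x))) (at x)" if "x \<in> D" for x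
      using that assms(4)[of x] Ck_bar_1D(4)[OF X(1) D(1)]
      by (intro has_derivative_compose[OF assms(5)]) auto
    show "bounded_ucont D (\<lambda>x. X (S x))"
      by (rule bounded_ucont_compose[OF X(4) assms(3) im])
    show "bounded_ucont D (\<lambda>x. \<Sum>j\<in>UNIV. S' x (axis i 1) $ j *\<^sub>R pd j X (S x))" for i
      by (intro bounded_ucont_sum bounded_ucont_scaleR bounded_ucont_nth assms(6)
          bounded_ucont_compose[OF X(5) assms(3) im])
  qed
  moreover have "continuous_on (closure D) (\<lambda>x. X (S x))"
    using continuous_on_compose2[OF Ck_ring_continuous[OF assms(1)] assms(2)] continuous_on_subset by blast
  ultimately show ?thesis
    using assms(4) X(3) by (simp add: Ck_ring_def)
qed

lemma Ck_ring_compose_id_plus: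
  assumes "X \<in> Ck_ring 1 D" "small_field D Y"
  shows "(\<lambda>x. X (x + Y x)) \<in> Ck_ring 1 D"
proof -
  note Y = Ck_ring_1D[OF small_field_Ck[OF assms(2)]]
  have u: "uniformly_continuous_on D (id_plus Y)"
    using Y(4) unfolding id_plus_def bounded_ucont_def
    by (intro uniformly_continuous_on_add uniformly_continuous_on_id) auto
  have "(\<lambda>x. X (id_plus Y x)) \<in> Ck_ring 1 D"
  proof (rule Ck_ring_compose[OF assms(1) continuous_id_plus(1)[OF assms(2)] u
      id_plus_mem_iff(1)[OF assms(2)] id_plus_has_derivative[OF assms(2)]])
    show "bounded_ucont D (\<lambda>x. axis i 1 + frechet_derivative Y (at x) (axis i 1))" for i
      using bounded_ucont_add[OF bounded_ucont_const Y(5)] by (simp add: pd_def[abs_def])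
  qed
  then show ?thesis by (simp add: id_plus_def)
qed

text \<open>The derivative depends linearly on finitely many partial derivatives, which have a common modulus of
  continuity.\<close>

lemma Ck_bar_derivative_ucont:
  assumes "g \<in> Ck_bar 1 D" "e > 0"
  obtains d where "d > 0" "\<And>x y v. x \<in> D \<Longrightarrow> y \<in> D \<Longrightarrow> dist y x < d \<Longrightarrow>
     norm (frechet_derivative g (at y) v - frechet_derivative g (at x) v) \<le> e * norm v"
proof -
  define r where "r = e / real CARD('d)"
  have r: "r > 0" using assms(2) by (simp add: r_def)
  have "\<exists>d>0. \<forall>x\<in>D. \<forall>y\<in>D. dist y x < d \<longrightarrow> norm (pd i g y - pd i g x) < r" for i
    using bounded_ucontD[OF Ck_bar_1D(3)[OF assms(1) D(1), of i] r] by metis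
  then obtain df where df: "\<And>i. df i > 0"
    "\<And>i x y. x \<in> D \<Longrightarrow> y \<in> D \<Longrightarrow> dist y x < df i \<Longrightarrow> norm (pd i g y - pd i g x) < r"
    by metis
  define d where "d = Min (range df)"
  have d: "d > 0" "\<And>i. d \<le> df i" using df(1) by (auto simp: d_def)
  have "norm (frechet_derivative g (at y) v - frechet_derivative g (at x) v) \<le> e * norm v"
    if xy: "x \<in> D" "y \<in> D" "dist y x < d" for x y v
  proof -
    have "frechet_derivative g (at y) v - frechet_derivative g (at x) v = (\<Sum>i\<in>UNIV. v $ i *\<^sub>R (pd i g y - pd i g x))"
      using Ck_bar_1D(1)[OF assms(1) D(1)] xy
      by (simp add: frechet_derivative_pd sum_subtractf scaleR_diff_right)
    also have "norm \<dots> \<le> (\<Sum>i\<in>(UNIV :: 'd set). norm v * r)"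
    proof (rule sum_norm_le)
      fix i
      have "norm (pd i g y - pd i g x) \<le> r"
        using df(2)[OF xy(1,2), of i] xy(3) d(2)[of i] by linarith
      then show "norm (v $ i *\<^sub>R (pd i g y - pd i g x)) \<le> norm v * r"
        using component_le_norm_cart[of v i] by (simp add: mult_mono)
    qed
    also have "\<dots> = e * norm v" by (simp add: r_def)
    finally show ?thesis .
  qed
  with d(1) show ?thesis using that by blast
qed

text \<open>The derivative of the inverse is the inverse of the derivative; it is uniformly continuous
  since inversion is Lipschitz on the maps that expand every vector at least by the factor one half.\<close>

lemma Ck_ring_transport:
  assumes "X \<in> Ck_ring 1 D" "small_field D Y"
  shows "X \<circ> inv (id_plus Y) \<in> Ck_ring 1 D"
proof -
  define S where "S = inv (id_plus Y)"
  define B where "B x v = v + frechet_derivative Y (at x) v" for x v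
  define A where "A x = inv (B x)" for x
  note Y = Ck_ring_1D[OF small_field_Ck[OF assms(2)]]
  have lin: "linear (B x)" if "x \<in> D" for x
    using has_derivative_linear[OF id_plus_has_derivative[OF assms(2) that]] by (simp add: B_def[abs_def])
  have ge: "norm v \<le> 2 * norm (B x v)" if "x \<in> D" for x v
  proof -
    have "norm (frechet_derivative Y (at x) v) \<le> norm v / 2"
      using assms(2) that by (simp add: small_field_def)
    moreover have "norm v \<le> norm (B x v) + norm (frechet_derivative Y (at x) v)"
      unfolding B_def by (metis add_diff_cancel_right' norm_triangle_ineq4)
    ultimately show ?thesis by linarith
  qed
  have inj: "inj (B x)" if "x \<in> D" for x
  proof (rule injI)
    fix u v assume "B x u = B x v"
    then have "B x (u - v) = 0" using lin[OF that] by (simp add: linear_diff)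
    then show "u = v" using ge[OF that, of "u - v"] by simp
  qed
  have BA: "B x (A x v) = v" and AB: "A x (B x v) = v" if "x \<in> D" for x v
    using linear_injective_imp_surjective[OF lin[OF that] inj[OF that]] inj[OF that]
    by (simp_all add: A_def surj_f_inv_f)
  have linA: "linear (A x)" if "x \<in> D" for x
  proof (rule linearI)
    show "A x (u + v) = A x u + A x v" for u v
      using linear_add[OF lin[OF that], of "A x u" "A x v"] AB[OF that, of "A x u + A x v"] BA[OF that] by simp
    show "A x (c *\<^sub>R v) = c *\<^sub>R A x v" for c v
      using linear_scale[OF lin[OF that], of c "A x v"] AB[OF that, of "c *\<^sub>R A x v"] BA[OF that] by simp
  qed
  have leA: "norm (A x v) \<le> 2 * norm v" if "x \<in> D" for x v
    using ge[OF that, of "A x v"] BA[OF that] by simp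
  have uS: "uniformly_continuous_on D S"
    unfolding uniformly_continuous_on_def
  proof safe
    fix e :: real assume "e > 0"
    then show "\<exists>d>0. \<forall>x\<in>D. \<forall>x'\<in>D. dist x' x < d \<longrightarrow> dist (S x') (S x) < e"
      using inv_id_plus_lipschitz[OF assms(2)]
      by (intro exI[of _ "e / 2"]) (fastforce simp: S_def dist_norm intro: le_less_trans)
  qed
  have mem: "S x \<in> D \<longleftrightarrow> x \<in> D" for x
    unfolding S_def by (rule id_plus_mem_iff(2)[OF assms(2)])
  have der: "(S has_derivative A (S x)) (at x)" if "x \<in> D" for x
  proof (rule has_derivative_inverse_basic[where T=UNIV])
    have Sx: "S x \<in> D" using that mem by simp
    show "(id_plus Y has_derivative B (S x)) (at (S x))"
      using id_plus_has_derivative[OF assms(2) Sx] by (simp add: B_def[abs_def])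
    show "bounded_linear (A (S x))" using linA[OF Sx] linear_conv_bounded_linear by blast
    show "A (S x) \<circ> B (S x) = id" using AB[OF Sx] by auto
    show "continuous (at x) S"
      using continuous_id_plus(2)[OF assms(2)] by (simp add: S_def continuous_on_eq_continuous_at)
    show "id_plus Y (S z) = z" for z by (simp add: S_def id_plus_inv[OF assms(2)])
  qed auto
  have bA: "bounded_ucont D (\<lambda>x. A x (axis i 1))" for i
  proof -
    have "bounded ((\<lambda>x. A x (axis i 1)) ` D)"
      unfolding bounded_iff using leA[of _ "axis i 1"] by fastforce
    moreover have "uniformly_continuous_on D (\<lambda>x. A x (axis i 1))"
      unfolding uniformly_continuous_on_def
    proof safe
      fix e :: real assume "e > 0"
      then obtain d where d: "d > 0" "\<And>x y v. x \<in> D \<Longrightarrow> y \<in> D \<Longrightarrow> dist y x < d \<Longrightarrow>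
          norm (frechet_derivative Y (at y) v - frechet_derivative Y (at x) v) \<le> e / 8 * norm v"
        using Ck_bar_derivative_ucont[OF Y(1), of "e / 8"] by (metis divide_pos_pos zero_less_numeral)
      have "dist (A y (axis i 1)) (A x (axis i 1)) < e" if xy: "x \<in> D" "y \<in> D" "dist y x < d" for x y
      proof -
        define a where "a = A x (axis i 1)"
        have "B y (A y (axis i 1) - a) = B x a - B y a"
          by (simp add: linear_diff[OF lin[OF xy(2)]] BA xy a_def)
        also have "\<dots> = - (frechet_derivative Y (at y) a - frechet_derivative Y (at x) a)"
          by (simp add: B_def)
        finally have "norm (B y (A y (axis i 1) - a)) \<le> e / 8 * norm a"
          using d(2)[OF xy, of a] by (simp add: norm_minus_commute)
        also have "\<dots> \<le> e / 8 * 2"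
          using leA[OF xy(1), of "axis i 1"] \<open>e > 0\<close> by (intro mult_left_mono) (auto simp: a_def)
        finally have "norm (A y (axis i 1) - a) \<le> e / 2"
          using ge[OF xy(2), of "A y (axis i 1) - a"] by linarith
        then show ?thesis using \<open>e > 0\<close> by (simp add: dist_norm a_def)
      qed
      then show "\<exists>d>0. \<forall>x\<in>D. \<forall>x'\<in>D. dist x' x < d \<longrightarrow> dist (A x' (axis i 1)) (A x (axis i 1)) < e"
        using d(1) by blast
    qed
    ultimately show ?thesis by (simp add: bounded_ucont_def)
  qed
  have "(\<lambda>x. X (S x)) \<in> Ck_ring 1 D"
  proof (rule Ck_ring_compose[OF assms(1) _ uS mem der])
    show "continuous_on UNIV S" unfolding S_def by (rule continuous_id_plus(2)[OF assms(2)])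
    show "bounded_ucont D (\<lambda>x. A (S x) (axis i 1))" for i
      using bounded_ucont_compose[OF bA uS] mem by blast
  qed
  then show ?thesis by (simp add: S_def comp_def)
qed

end

section \<open>Difference quotients of fields along fields\<close>

text \<open>The difference quotients \<open>n * (f (x + e\<^sub>j / n) - f x)\<close> converge to the \<open>j\<close>-th partial
  derivative, and their derivatives converge locally uniformly by the mean value theorem, so the
  limit may be differentiated term by term.\<close>

lemma pd_commute:
  fixes f :: "real ^ 'd::finite \<Rightarrow> 'b::banach"
  assumes "open U" "Ck_on 2 U f" "x \<in> U"
  shows "pd i (pd j f) x = pd j (pd i f) x"
proof -
  have f: "Ck_on 1 U f" "\<And>i. Ck_on 1 U (pd i f)" "\<And>i j. continuous_on U (pd i (pd j f))"
  proof -
    have 2: "Ck_on (Suc (Suc 0)) U f" using assms(2) by (simp add: numeral_2_eq_2)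
    then show 1: "Ck_on 1 U f" "Ck_on 1 U (pd i f)" for i
      using Ck_on_mono[OF 2, of 1 U] Ck_on_pd[OF 2] by auto
    show "continuous_on U (pd i (pd j f))" for i j
      using Ck_on_pd[of 0 U "pd j f"] 1(2)[of j] by (simp add: Ck_on_0)
  qed
  obtain r where r: "r > 0" "cball x (2 * r) \<subseteq> U"
  proof -
    obtain e where "e > 0" "cball x e \<subseteq> U"
      using assms(1,3) open_contains_cball by blast
    then show ?thesis using that[of "e / 2"] by simp
  qed
  define F where "F = (\<lambda>(n::nat) y. real (Suc n) *\<^sub>R (f (y + inverse (real (Suc n)) *\<^sub>R axis j 1) - f y))"
  \<comment> \<open>From the index \<open>N\<close> on, the shifted points stay in the ball of radius \<open>2 * r\<close>.\<close>
  define N where "N = nat \<lceil>1 / r\<rceil>"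
  have N: "inverse (real (Suc n)) \<le> r" if "n \<ge> N" for n
  proof -
    have "1 / r \<le> real (Suc n)" using that unfolding N_def by linarith
    then show ?thesis using r(1) by (simp add: field_simps)
  qed
  define G where "G = (\<lambda>n y v. \<Sum>k\<in>UNIV. v $ k *\<^sub>R
      (real (Suc n) *\<^sub>R (pd k f (y + inverse (real (Suc n)) *\<^sub>R axis j 1) - pd k f y)))"
  define H where "H = (\<lambda>y v. \<Sum>k\<in>UNIV. v $ k *\<^sub>R pd j (pd k f) y)"
  have seg: "y + s *\<^sub>R axis j 1 \<in> cball x (2 * r)" if "y \<in> ball x r" "\<bar>s\<bar> \<le> r" for y s
    using that norm_triangle_ineq4[of "x - y" "s *\<^sub>R axis j 1"] by (simp add: dist_norm algebra_simps)
  have derF: "(F n has_derivative G n y) (at y within ball x r)" if "n \<ge> N" "y \<in> ball x r" for n y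
  proof -
    have "y + inverse (real (Suc n)) *\<^sub>R axis j 1 \<in> U"
      using seg[OF that(2), of "inverse (real (Suc n))"] N[OF that(1)] r(2) by auto
    then have 1: "(f has_derivative (\<lambda>v. \<Sum>k\<in>UNIV. v $ k *\<^sub>R pd k f (y + inverse (real (Suc n)) *\<^sub>R axis j 1)))
        (at (y + inverse (real (Suc n)) *\<^sub>R axis j 1))"
      by (intro Ck_on_has_derivative[OF f(1) _ assms(1)]) auto
    have "((\<lambda>y. y + inverse (real (Suc n)) *\<^sub>R axis j 1) has_derivative (\<lambda>v. v)) (at y)"
      by (auto intro!: derivative_eq_intros)
    from has_derivative_compose[OF this 1]
    have 2: "((\<lambda>y. f (y + inverse (real (Suc n)) *\<^sub>R axis j 1)) has_derivative
      (\<lambda>v. \<Sum>k\<in>UNIV. v $ k *\<^sub>R pd k f (y + inverse (real (Suc n)) *\<^sub>R axis j 1))) (at y)" .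
    have "y \<in> U" using seg[OF that(2), of 0] r by auto
    then have 3: "(f has_derivative (\<lambda>v. \<Sum>k\<in>UNIV. v $ k *\<^sub>R pd k f y)) (at y)"
      by (intro Ck_on_has_derivative[OF f(1) _ assms(1)]) auto
    have "(F n has_derivative (\<lambda>v. real (Suc n) *\<^sub>R ((\<Sum>k\<in>UNIV. v $ k *\<^sub>R pd k f (y + inverse (real (Suc n)) *\<^sub>R axis j 1))
        - (\<Sum>k\<in>UNIV. v $ k *\<^sub>R pd k f y)))) (at y)"
      unfolding F_def by (intro has_derivative_scaleR_right has_derivative_diff 2 3)
    moreover have "real (Suc n) *\<^sub>R ((\<Sum>k\<in>UNIV. v $ k *\<^sub>R pd k f (y + inverse (real (Suc n)) *\<^sub>R axis j 1))
        - (\<Sum>k\<in>UNIV. v $ k *\<^sub>R pd k f y)) = G n y v" for v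
      unfolding G_def sum_subtractf[symmetric] scaleR_sum_right
      by (intro sum.cong) (simp_all add: scaleR_diff_right mult.commute)
    ultimately show ?thesis by (simp add: has_derivative_at_withinI)
  qed
  have GH: "\<forall>\<^sub>F n in sequentially. \<forall>y\<in>ball x r. \<forall>h. norm (G (n + N) y h - H y h) \<le> e * norm h" if "e > 0" for e
  proof -
    define \<epsilon> where "\<epsilon> = e / real CARD('d)"
    have \<epsilon>: "\<epsilon> > 0" using that by (simp add: \<epsilon>_def)
    have "\<exists>d>0. \<forall>y\<in>cball x (2 * r). \<forall>z\<in>cball x (2 * r). dist z y < d \<longrightarrow>
        dist (pd j (pd k f) z) (pd j (pd k f) y) < \<epsilon>" for k
      using compact_uniformly_continuous[OF continuous_on_subset[OF f(3) r(2)] compact_cball] \<epsilon>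
      unfolding uniformly_continuous_on_def by blast
    then obtain df where df: "\<And>k. df k > 0"
      "\<And>k y z. y \<in> cball x (2 * r) \<Longrightarrow> z \<in> cball x (2 * r) \<Longrightarrow> dist z y < df k \<Longrightarrow>
        dist (pd j (pd k f) z) (pd j (pd k f) y) < \<epsilon>" by metis
    define d where "d = Min (range df)"
    have d: "d > 0" "\<And>i. d \<le> df i" using df(1) by (auto simp: d_def)
    have key: "norm (G n y h - H y h) \<le> e * norm h"
      if n: "n \<ge> N" "inverse (real (Suc n)) < d" and y: "y \<in> ball x r" for n y h
    proof -
      define \<eta> where "\<eta> = inverse (real (Suc n))"
      have \<eta>: "\<eta> > 0" "\<eta> \<le> r" "\<eta> < d" using n N by (auto simp: \<eta>_def)
      have q: "norm (real (Suc n) *\<^sub>R (pd k f (y + \<eta> *\<^sub>R axis j 1) - pd k f y) - pd j (pd k f) y) \<le> \<epsilon>" for k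
      proof -
        have "norm (pd k f (y + \<eta> *\<^sub>R axis j 1) - pd k f y - \<eta> *\<^sub>R pd j (pd k f) y) \<le> \<eta> * \<epsilon>"
        proof (rule segment_estimate)
          fix s :: real assume s: "s \<in> {0..1}"
          have s': "\<bar>s * \<eta>\<bar> \<le> \<eta>" using s \<eta> by (simp add: abs_mult mult_left_le_one_le)
          have m: "y + (s * \<eta>) *\<^sub>R axis j 1 \<in> cball x (2 * r)"
            using seg[OF y, of "s * \<eta>"] s' \<eta> by linarith
          show "(pd k f has_derivative (\<lambda>v. \<Sum>l\<in>UNIV. v $ l *\<^sub>R pd l (pd k f) (y + s *\<^sub>R \<eta> *\<^sub>R axis j 1)))
              (at (y + s *\<^sub>R \<eta> *\<^sub>R axis j 1))"
            using m r(2) by (intro Ck_on_has_derivative[OF f(2) _ assms(1)]) auto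
          have "dist (pd j (pd k f) (y + (s * \<eta>) *\<^sub>R axis j 1)) (pd j (pd k f) y) < \<epsilon>"
            using m seg[OF y, of 0] r s' \<eta> d(2)[of k] by (intro df(2)) (auto simp: dist_norm)
          moreover have "(\<Sum>l\<in>UNIV. (\<eta> *\<^sub>R axis j 1 :: real ^ 'd) $ l *\<^sub>R pd l (pd k f) z) = \<eta> *\<^sub>R pd j (pd k f) z" for z
          proof -
            have "(\<Sum>l\<in>UNIV. (\<eta> *\<^sub>R axis j 1 :: real ^ 'd) $ l *\<^sub>R pd l (pd k f) z)
               = (\<Sum>l\<in>UNIV. if l = j then \<eta> *\<^sub>R pd l (pd k f) z else 0)"
              by (intro sum.cong) (auto simp: axis_def)
            then show ?thesis by simp
          qed
          ultimately show "norm ((\<Sum>l\<in>UNIV. (\<eta> *\<^sub>R axis j 1 :: real ^ 'd) $ l *\<^sub>R pd l (pd k f) (y + s *\<^sub>R \<eta> *\<^sub>R axis j 1))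
              - \<eta> *\<^sub>R pd j (pd k f) y) \<le> \<eta> * \<epsilon>"
            using \<eta>(1) by (simp add: scaleR_diff_right[symmetric] dist_norm)
        qed
        moreover have "real (Suc n) *\<^sub>R (pd k f (y + \<eta> *\<^sub>R axis j 1) - pd k f y) - pd j (pd k f) y
           = real (Suc n) *\<^sub>R (pd k f (y + \<eta> *\<^sub>R axis j 1) - pd k f y - \<eta> *\<^sub>R pd j (pd k f) y)"
          by (simp add: \<eta>_def scaleR_diff_right)
        moreover have "real (Suc n) * (\<eta> * \<epsilon>) = \<epsilon>" by (simp add: \<eta>_def)
        ultimately show ?thesis
          using mult_left_mono[of _ "\<eta> * \<epsilon>" "real (Suc n)"] by (metis abs_of_nat norm_scaleR of_nat_0_le_iff)
      qed
      have "G n y h - H y h = (\<Sum>k\<in>UNIV. h $ k *\<^sub>R (real (Suc n) *\<^sub>R (pd k f (y + \<eta> *\<^sub>R axis j 1) - pd k f y) - pd j (pd k f) y))"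
        unfolding G_def H_def \<eta>_def[symmetric] sum_subtractf[symmetric] by (simp add: scaleR_diff_right)
      also have "norm \<dots> \<le> (\<Sum>k\<in>(UNIV :: 'd set). norm h * \<epsilon>)"
      proof (rule sum_norm_le)
        fix k
        show "norm (h $ k *\<^sub>R (real (Suc n) *\<^sub>R (pd k f (y + \<eta> *\<^sub>R axis j 1) - pd k f y) - pd j (pd k f) y)) \<le> norm h * \<epsilon>"
          unfolding norm_scaleR by (intro mult_mono q) (use component_le_norm_cart[of h k] in auto)
      qed
      also have "\<dots> = e * norm h" by (simp add: \<epsilon>_def)
      finally show ?thesis .
    qed
    have "\<forall>\<^sub>F n in sequentially. inverse (real (Suc (n + N))) < d"
    proof -
      have "(\<lambda>n. inverse (real (Suc (n + N)))) \<longlonglongrightarrow> 0"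
        using LIMSEQ_ignore_initial_segment[OF LIMSEQ_inverse_real_of_nat] by simp
      then show ?thesis using d(1) order_tendstoD(2) by blast
    qed
    then show ?thesis
      by (rule eventually_mono) (intro ballI allI key, auto)
  qed
  have fx: "(pd j f has_derivative H x) (at x)"
  proof -
    have lim: "(\<lambda>n. F (n + N) y) \<longlonglongrightarrow> pd j f y" if "y \<in> ball x r" for y
    proof -
      have yU: "y \<in> U" using seg[OF that, of 0] r by auto
      have "(f has_derivative frechet_derivative f (at y)) (at y)"
        using Ck_on_differentiable[OF f(1) _ assms(1) yU] frechet_derivative_works by auto
      then have "((\<lambda>s. (f (y + s *\<^sub>R axis j 1) - f y) /\<^sub>R s) \<longlongrightarrow> pd j f y) (at 0)"
      proof -
        assume df: "(f has_derivative frechet_derivative f (at y)) (at y)"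
        have a: "((\<lambda>s::real. y + s *\<^sub>R axis j 1) has_derivative (\<lambda>s. s *\<^sub>R axis j 1)) (at 0)"
          by (auto intro!: derivative_eq_intros)
        have "((\<lambda>s::real. f (y + s *\<^sub>R axis j 1)) has_derivative (\<lambda>s. frechet_derivative f (at y) (s *\<^sub>R axis j 1))) (at 0)"
          by (rule has_derivative_compose[OF a]) (use df in simp)
        moreover have "frechet_derivative f (at y) (s *\<^sub>R axis j 1) = s *\<^sub>R pd j f y" for s
          using has_derivative_linear[OF df] by (simp add: linear_scale pd_def)
        ultimately have "((\<lambda>s::real. f (y + s *\<^sub>R axis j 1)) has_derivative (\<lambda>s. s *\<^sub>R pd j f y)) (at 0)" by simp
        then have "((\<lambda>s::real. norm (f (y + s *\<^sub>R axis j 1) - f y - s *\<^sub>R pd j f y) / norm s) \<longlongrightarrow> 0) (at 0)"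
          by (simp add: has_derivative_at)
        then have "((\<lambda>s. norm ((f (y + s *\<^sub>R axis j 1) - f y) /\<^sub>R s - pd j f y)) \<longlongrightarrow> 0) (at 0)"
        proof (rule Lim_transform_eventually)
          have "norm (f (y + s *\<^sub>R axis j 1) - f y - s *\<^sub>R pd j f y) / norm s
             = norm ((f (y + s *\<^sub>R axis j 1) - f y) /\<^sub>R s - pd j f y)" if "s \<noteq> 0" for s
          proof -
            have "(f (y + s *\<^sub>R axis j 1) - f y) /\<^sub>R s - pd j f y
              = inverse s *\<^sub>R (f (y + s *\<^sub>R axis j 1) - f y - s *\<^sub>R pd j f y)"
              using that by (simp add: scaleR_diff_right)
            then show ?thesis by (simp only: norm_scaleR) (simp add: divide_inverse)
          qed
          then show "\<forall>\<^sub>F s in at 0. norm (f (y + s *\<^sub>R axis j 1) - f y - s *\<^sub>R pd j f y) / norm s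
             = norm ((f (y + s *\<^sub>R axis j 1) - f y) /\<^sub>R s - pd j f y)"
            unfolding eventually_at by (auto intro: exI[of _ 1])
        qed
        then show ?thesis
          by (rule LIM_zero_cancel[OF tendsto_norm_zero_cancel])
      qed
      moreover have "filterlim (\<lambda>n. inverse (real (Suc (n + N)))) (at 0) sequentially"
        unfolding filterlim_at
        using LIMSEQ_ignore_initial_segment[OF LIMSEQ_inverse_real_of_nat, of N] by simp
      ultimately have "((\<lambda>n. (f (y + inverse (real (Suc (n + N))) *\<^sub>R axis j 1) - f y) /\<^sub>R inverse (real (Suc (n + N)))) \<longlongrightarrow> pd j f y) sequentially"
        by (rule filterlim_compose)
      then show ?thesis by (simp add: F_def)
    qed
    have x0: "x \<in> ball x r" using r(1) by simp
    obtain g where g: "\<And>y. y \<in> ball x r \<Longrightarrow> (\<lambda>n. F (n + N) y) \<longlonglongrightarrow> g y"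
       "\<And>y. y \<in> ball x r \<Longrightarrow> (g has_derivative H y) (at y within ball x r)"
      using has_derivative_sequence[of "ball x r" "\<lambda>n. F (n + N)" "\<lambda>n. G (n + N)" H, OF convex_ball _ GH x0 lim[OF x0]] derF
      by (metis le_add2)
    have "g y = pd j f y" if "y \<in> ball x r" for y
      using LIMSEQ_unique[OF g(1)[OF that] lim[OF that]] .
    moreover have "(g has_derivative H x) (at x)"
      using g(2)[OF x0] at_within_open[OF x0 open_ball] by simp
    ultimately show ?thesis
      using has_derivative_transform_within_open[OF _ open_ball x0] by metis
  qed
  have "pd i (pd j f) x = H x (axis i 1)" by (rule pd_eq[OF fx])
  also have "\<dots> = (\<Sum>k\<in>UNIV. if k = i then pd j (pd k f) x else 0)"
    unfolding H_def by (intro sum.cong) (auto simp: axis_def)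
  finally show ?thesis by simp
qed

definition diff_quotient :: "(real ^ 'd::finite \<Rightarrow> real ^ 'd) \<Rightarrow> real \<Rightarrow> (real ^ 'd \<Rightarrow> real ^ 'd) \<Rightarrow> real ^ 'd \<Rightarrow> real ^ 'd" where
  "diff_quotient X t W x = (X (x + t *\<^sub>R W x) - X x) /\<^sub>R t"

lemma field_deriv_eq:
  assumes "X differentiable at x"
  shows "field_deriv X Y x = frechet_derivative X (at x) (Y x)"
  using jacobian_mult[OF assms] by (simp add: field_deriv_def)

lemma field_deriv_diff: "field_deriv X (\<lambda>x. W x - Y x) x = field_deriv X W x - field_deriv X Y x"
  by (simp add: field_deriv_def matrix_vector_mult_diff_distrib)

lemma field_deriv_add: "field_deriv X (\<lambda>x. T x + T' x) = (\<lambda>x. field_deriv X T x + field_deriv X T' x)"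
  by (simp add: field_deriv_def matrix_vector_right_distrib)

context
  fixes D :: "(real ^ 'd::finite) set"
  assumes D: "open D" "D \<noteq> {}"
begin

lemma diff_quotient_Ck_ring:
  assumes "X \<in> Ck_ring 1 D" "small_field D (\<lambda>x. t *\<^sub>R W x)"
  shows "diff_quotient X t W \<in> Ck_ring 1 D"
  unfolding diff_quotient_def
  by (intro Ck_ring_cmul Ck_ring_diff D assms(1) Ck_ring_compose_id_plus[OF D assms])

lemma field_deriv_off: "Y \<in> Ck_ring 1 D \<Longrightarrow> x \<notin> D \<Longrightarrow> field_deriv X Y x = 0"
  using Ck_ring_1D(3)[OF D, of Y x] by (simp add: field_deriv_def)

lemma field_deriv_has_derivative:
  assumes "X \<in> Ck_ring 2 D" "Y \<in> Ck_ring 1 D" "x \<in> D"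
  shows "(field_deriv X Y has_derivative
     (\<lambda>v. \<Sum>j\<in>UNIV. Y x $ j *\<^sub>R frechet_derivative (pd j X) (at x) v + frechet_derivative Y (at x) v $ j *\<^sub>R pd j X x)) (at x)"
proof -
  note X = Ck_ringD[OF assms(1)] and Y = Ck_ring_1D[OF D assms(2)]
  have e: "field_deriv X Y y = (\<Sum>j\<in>UNIV. Y y $ j *\<^sub>R pd j X y)" if "y \<in> D" for y
    using field_deriv_eq[of X y Y] Ck_bar_1D(1)[OF Ck_bar_2D(1)[OF X(1)] D(1) that]
    by (simp add: frechet_derivative_pd)
  have "((\<lambda>y. \<Sum>j\<in>UNIV. Y y $ j *\<^sub>R pd j X y) has_derivative
     (\<lambda>v. \<Sum>j\<in>UNIV. Y x $ j *\<^sub>R frechet_derivative (pd j X) (at x) v + frechet_derivative Y (at x) v $ j *\<^sub>R pd j X x)) (at x)"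
  proof (intro has_derivative_sum has_derivative_scaleR)
    show "((\<lambda>y. Y y $ j) has_derivative (\<lambda>v. frechet_derivative Y (at x) v $ j)) (at x)" for j
      by (rule bounded_linear.has_derivative[OF bounded_linear_vec_nth Y(2)[OF assms(3)]])
    show "(pd j X has_derivative frechet_derivative (pd j X) (at x)) (at x)" for j
      using Ck_bar_1D(1)[OF Ck_bar_2D(2)[OF X(1)] D(1) assms(3)] frechet_derivative_works by blast
  qed
  then show ?thesis
    by (rule has_derivative_transform_within_open[OF _ D(1) assms(3)]) (simp add: e)
qed

text \<open>Exchanging the order of the second derivatives of \<open>X\<close> brings the derivative of \<open>\<partial>X Y\<close> into the form of
  the limit of the derivatives of the difference quotients.\<close>

lemma pd_field_deriv:
  assumes "X \<in> Ck_ring 2 D" "Y \<in> Ck_ring 1 D" "x \<in> D"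
  shows "pd i (field_deriv X Y) x = frechet_derivative (pd i X) (at x) (Y x) + frechet_derivative X (at x) (pd i Y x)"
proof -
  note X = Ck_ringD[OF assms(1)]
  have "frechet_derivative (pd j X) (at x) (axis i 1) = pd j (pd i X) x" for j
    using pd_commute[OF D(1) X(4) assms(3), of i j] by (simp add: pd_def)
  then have "pd i (field_deriv X Y) x = (\<Sum>j\<in>UNIV. Y x $ j *\<^sub>R pd j (pd i X) x) + (\<Sum>j\<in>UNIV. pd i Y x $ j *\<^sub>R pd j X x)"
    using pd_eq[OF field_deriv_has_derivative[OF assms], of i] by (simp add: sum.distrib pd_def)
  then show ?thesis
    using Ck_bar_1D(1)[OF Ck_bar_2D(2)[OF X(1)] D(1) assms(3)] Ck_bar_1D(1)[OF Ck_bar_2D(1)[OF X(1)] D(1) assms(3)]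
    by (simp add: frechet_derivative_pd)
qed

text \<open>The field \<open>\<partial>X Y\<close> tends to zero at the boundary of \<open>D\<close> because \<open>\<partial>X\<close> is bounded and \<open>Y\<close> does.\<close>

lemma field_deriv_Ck_ring:
  assumes "X \<in> Ck_ring 2 D" "Y \<in> Ck_ring 1 D"
  shows "field_deriv X Y \<in> Ck_ring 1 D"
proof -
  note X = Ck_ringD[OF assms(1)] and Y = Ck_ring_1D[OF D assms(2)]
  note X1 = Ck_bar_1D[OF Ck_bar_2D(1)[OF X(1)] D(1)] and X2 = Ck_bar_1D[OF Ck_bar_2D(2)[OF X(1)] D(1)]
  have e: "field_deriv X Y y = (\<Sum>j\<in>UNIV. Y y $ j *\<^sub>R pd j X y)" if "y \<in> D" for y
    using field_deriv_eq[OF X1(1)[OF that], of Y] X1(1)[OF that] by (simp add: frechet_derivative_pd)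
  have "field_deriv X Y \<in> Ck_bar 1 D"
  proof (rule Ck_bar_1I[OF D(1) field_deriv_has_derivative[OF assms]])
    have "bounded_ucont D (\<lambda>y. \<Sum>j\<in>UNIV. Y y $ j *\<^sub>R pd j X y)"
      by (intro bounded_ucont_sum bounded_ucont_scaleR bounded_ucont_nth X1 Y)
    then show "bounded_ucont D (field_deriv X Y)"
      using bounded_ucont_cong[of D "field_deriv X Y", OF e] by simp
    show "bounded_ucont D (\<lambda>x. \<Sum>j\<in>UNIV. Y x $ j *\<^sub>R frechet_derivative (pd j X) (at x) (axis i 1)
        + frechet_derivative Y (at x) (axis i 1) $ j *\<^sub>R pd j X x)" for i
      using Y(5)[of i] X2(3)[of i]
      by (intro bounded_ucont_sum bounded_ucont_add bounded_ucont_scaleR bounded_ucont_nth X1 Y)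
        (auto simp: pd_def[abs_def])
  qed
  moreover have "continuous_on (closure D) (field_deriv X Y)"
    unfolding continuous_on_eq_continuous_within
  proof
    fix x assume "x \<in> closure D"
    show "continuous (at x within closure D) (field_deriv X Y)"
    proof (cases "x \<in> D")
      case True
      then show ?thesis
        using has_derivative_continuous[OF field_deriv_has_derivative[OF assms]]
          continuous_at_imp_continuous_at_within by blast
    next
      case False
      have le: "norm (field_deriv X Y y) \<le> C1_norm D X * norm (Y y)" for y
        using C1_norm_ge(3)[OF D(1) Ck_bar_2D(1)[OF X(1)], of y] field_deriv_eq[OF X1(1), of y Y] field_deriv_off[OF assms(2), of y X]
          Ck_ring_1D(7)[OF D Ck_ring_2_1[OF assms(1)]] by (cases "y \<in> D") auto
      have "((\<lambda>y. C1_norm D X * norm (Y y)) \<longlongrightarrow> C1_norm D X * norm (Y x)) (at x within closure D)"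
        using Ck_ring_continuous[OF D assms(2)]
        by (intro tendsto_intros) (auto simp: continuous_on_def intro: tendsto_within_subset)
      then have "((\<lambda>y. C1_norm D X * norm (Y y)) \<longlongrightarrow> 0) (at x within closure D)"
        using Y(3)[OF False] by simp
      then have "(field_deriv X Y \<longlongrightarrow> 0) (at x within closure D)"
        by (rule Lim_null_comparison[rotated]) (simp add: le)
      then show ?thesis
        using field_deriv_off[OF assms(2) False] by (simp add: continuous_within)
    qed
  qed
  ultimately show ?thesis
    using field_deriv_off[OF assms(2)] by (simp add: Ck_ring_def)
qed

text \<open>The speed of convergence is uniform over directions bounded by \<open>M\<close>, since \<open>\<partial>g\<close> is uniformly
  continuous. The segment has to stay in \<open>D\<close>, which need not be convex.\<close>

lemma difference_quotient_uniform:
  assumes "g \<in> Ck_bar 1 D" "M \<ge> 0" "e > 0"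
  obtains \<delta> where "\<delta> > 0" "\<And>x w t. x \<in> D \<Longrightarrow> t \<noteq> 0 \<Longrightarrow> \<bar>t\<bar> < \<delta> \<Longrightarrow> norm w \<le> M \<Longrightarrow>
      \<forall>s\<in>{0..1}. x + (s * t) *\<^sub>R w \<in> D \<Longrightarrow>
      norm ((g (x + t *\<^sub>R w) - g x) /\<^sub>R t - frechet_derivative g (at x) w) \<le> e"
proof -
  define r where "r = e / (M + 1)"
  have r: "r > 0" "r * M \<le> e" using assms by (auto simp: r_def field_simps)
  obtain d where d: "d > 0" "\<And>x y v. x \<in> D \<Longrightarrow> y \<in> D \<Longrightarrow> dist y x < d \<Longrightarrow>
     norm (frechet_derivative g (at y) v - frechet_derivative g (at x) v) \<le> r * norm v"
    using Ck_bar_derivative_ucont[OF D assms(1) r(1)] by metis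
  define \<delta> where "\<delta> = d / (M + 1)"
  have \<delta>: "\<delta> > 0" using d(1) assms(2) by (simp add: \<delta>_def)
  have "norm ((g (x + t *\<^sub>R w) - g x) /\<^sub>R t - frechet_derivative g (at x) w) \<le> e"
    if x: "x \<in> D" and t: "t \<noteq> 0" "\<bar>t\<bar> < \<delta>" and w: "norm w \<le> M"
      and seg: "\<forall>s\<in>{0..1}. x + (s * t) *\<^sub>R w \<in> D" for x w t
  proof -
    have lin: "linear (frechet_derivative g (at y))" if "y \<in> D" for y
      using Ck_bar_1D(1)[OF assms(1) D(1) that] linear_frechet_derivative by blast
    have "norm (g (x + t *\<^sub>R w) - g x - t *\<^sub>R frechet_derivative g (at x) w) \<le> \<bar>t\<bar> * e"
    proof (rule segment_estimate)
      fix s :: real assume s: "s \<in> {0..1}"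
      have m: "x + s *\<^sub>R t *\<^sub>R w \<in> D" using seg s by simp
      show "(g has_derivative frechet_derivative g (at (x + s *\<^sub>R t *\<^sub>R w))) (at (x + s *\<^sub>R t *\<^sub>R w))"
        using Ck_bar_1D(1)[OF assms(1) D(1) m] frechet_derivative_works by blast
      have "dist (x + s *\<^sub>R t *\<^sub>R w) x = s * (\<bar>t\<bar> * norm w)"
        using s by (simp add: dist_norm abs_mult)
      also have "\<dots> \<le> \<bar>t\<bar> * norm w"
        using s by (simp add: mult_left_le_one_le)
      also have "\<dots> \<le> \<bar>t\<bar> * (M + 1)" using w by (intro mult_left_mono) auto
      also have "\<dots> < \<delta> * (M + 1)" using t assms(2) by (intro mult_strict_right_mono) auto
      also have "\<dots> = d" using assms(2) by (simp add: \<delta>_def)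
      finally have "norm (frechet_derivative g (at (x + s *\<^sub>R t *\<^sub>R w)) w - frechet_derivative g (at x) w) \<le> r * norm w"
        by (intro d(2) x m)
      also have "\<dots> \<le> r * M" using r(1) w by (intro mult_left_mono) auto
      also have "\<dots> \<le> e" by (rule r(2))
      finally have "\<bar>t\<bar> * norm (frechet_derivative g (at (x + s *\<^sub>R t *\<^sub>R w)) w - frechet_derivative g (at x) w) \<le> \<bar>t\<bar> * e"
        by (intro mult_left_mono) auto
      then show "norm (frechet_derivative g (at (x + s *\<^sub>R t *\<^sub>R w)) (t *\<^sub>R w) - t *\<^sub>R frechet_derivative g (at x) w) \<le> \<bar>t\<bar> * e"
        by (simp only: linear_scale[OF lin[OF m]] scaleR_diff_right[symmetric] norm_scaleR real_norm_def)
    qed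
    then have "inverse \<bar>t\<bar> * norm (g (x + t *\<^sub>R w) - g x - t *\<^sub>R frechet_derivative g (at x) w) \<le> inverse \<bar>t\<bar> * (\<bar>t\<bar> * e)"
      by (intro mult_left_mono) auto
    moreover have "(g (x + t *\<^sub>R w) - g x) /\<^sub>R t - frechet_derivative g (at x) w = inverse t *\<^sub>R (g (x + t *\<^sub>R w) - g x - t *\<^sub>R frechet_derivative g (at x) w)"
      using t(1) by (simp add: scaleR_diff_right)
    ultimately have "norm ((g (x + t *\<^sub>R w) - g x) /\<^sub>R t - frechet_derivative g (at x) w) \<le> inverse \<bar>t\<bar> * (\<bar>t\<bar> * e)"
      by (simp only: norm_scaleR real_norm_def abs_inverse)
    moreover have "inverse \<bar>t\<bar> * (\<bar>t\<bar> * e) = e" using t(1) by simp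
    ultimately show ?thesis by simp
  qed
  with \<delta> show ?thesis using that by blast
qed

lemma pd_diff_quotient:
  assumes "X \<in> Ck_ring 1 D" "small_field D (\<lambda>x. t *\<^sub>R W x)" "W \<in> Ck_ring 1 D" "x \<in> D" "t \<noteq> 0"
  shows "pd i (diff_quotient X t W) x = (pd i X (x + t *\<^sub>R W x) - pd i X x) /\<^sub>R t
     + frechet_derivative X (at (x + t *\<^sub>R W x)) (pd i W x)"
proof -
  note X = Ck_ring_1D[OF D assms(1)] and W = Ck_ring_1D[OF D assms(3)]
  have m: "x + t *\<^sub>R W x \<in> D"
    using id_plus_mem_iff(1)[OF D assms(2), of x] assms(4) by (simp add: id_plus_def)
  have 1: "((\<lambda>x. x + t *\<^sub>R W x) has_derivative (\<lambda>v. v + t *\<^sub>R frechet_derivative W (at x) v)) (at x)"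
    by (intro has_derivative_add has_derivative_ident has_derivative_scaleR_right W(2) assms)
  have "(diff_quotient X t W has_derivative (\<lambda>v. (frechet_derivative X (at (x + t *\<^sub>R W x)) (v + t *\<^sub>R frechet_derivative W (at x) v)
     - frechet_derivative X (at x) v) /\<^sub>R t)) (at x)"
    unfolding diff_quotient_def
    by (intro has_derivative_scaleR_right has_derivative_diff has_derivative_compose[OF 1 X(2)[OF m]] X(2) assms)
  note e = pd_eq[OF this, of i]
  have lin: "linear (frechet_derivative X (at (x + t *\<^sub>R W x)))"
    using X(6)[OF m] linear_frechet_derivative by blast
  show ?thesis
    unfolding e using assms(5)
    by (simp add: linear_add[OF lin] linear_scale[OF lin] pd_def scaleR_add_right scaleR_diff_right)
qed

lemma small_field_segment:
  assumes "small_field D (\<lambda>x. t *\<^sub>R W x)" "x \<in> D" "s \<in> {0..1}"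
  shows "x + (s * t) *\<^sub>R W x \<in> D"
  using id_plus_mem_iff(1)[OF D small_field_shrink[OF D assms(1), of s], of x] assms(2,3)
  by (simp add: id_plus_def)

text \<open>Two derivatives of \<open>X\<close> and one of \<open>W\<close> suffice for convergence in \<open>C\<^sup>1\<close>: the derivative of
  the quotient splits into the difference quotient of \<open>\<partial>\<^sub>i X\<close> and a term without division by \<open>t\<close>.\<close>

lemma diff_quotient_uniform:
  assumes "X \<in> Ck_ring 2 D" "M \<ge> 0" "e > 0"
  obtains \<delta> where "\<delta> > 0" "\<And>t W. t \<noteq> 0 \<Longrightarrow> \<bar>t\<bar> < \<delta> \<Longrightarrow> W \<in> Ck_ring 1 D \<Longrightarrow> C1_norm D W \<le> M \<Longrightarrow>
     small_field D (\<lambda>x. t *\<^sub>R W x) \<and> C1_norm D (\<lambda>x. diff_quotient X t W x - field_deriv X W x) \<le> e"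
proof -
  note X2 = Ck_ringD[OF assms(1)] and X1 = Ck_ring_2_1[OF assms(1)]
  note X = Ck_ring_1D[OF D X1]
  define r where "r = e / (1 + 2 * real CARD('d))"
  have r: "r > 0" using assms(3) by (simp add: r_def add_pos_nonneg)
  define r2 where "r2 = r / (M + 1)"
  have r2: "r2 > 0" "r2 * M \<le> r" using r assms(2) by (auto simp: r2_def field_simps)
  obtain d0 where d0: "d0 > 0" "\<And>x w t. x \<in> D \<Longrightarrow> t \<noteq> 0 \<Longrightarrow> \<bar>t\<bar> < d0 \<Longrightarrow> norm w \<le> M \<Longrightarrow>
      \<forall>s\<in>{0..1}. x + (s * t) *\<^sub>R w \<in> D \<Longrightarrow>
      norm ((X (x + t *\<^sub>R w) - X x) /\<^sub>R t - frechet_derivative X (at x) w) \<le> r"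
    by (rule difference_quotient_uniform[OF X(1) assms(2) r]) (rule that)
  have "\<exists>d>0. \<forall>x w t. x \<in> D \<longrightarrow> t \<noteq> 0 \<longrightarrow> \<bar>t\<bar> < d \<longrightarrow> norm w \<le> M \<longrightarrow>
      (\<forall>s\<in>{0..1}. x + (s * t) *\<^sub>R w \<in> D) \<longrightarrow>
      norm ((pd i X (x + t *\<^sub>R w) - pd i X x) /\<^sub>R t - frechet_derivative (pd i X) (at x) w) \<le> r" for i
    by (rule difference_quotient_uniform[OF Ck_bar_2D(2)[OF X2(1), of i] assms(2) r]) blast
  then obtain df where df: "\<And>i. df i > 0" "\<And>i x w t. x \<in> D \<Longrightarrow> t \<noteq> 0 \<Longrightarrow> \<bar>t\<bar> < df i \<Longrightarrow> norm w \<le> M \<Longrightarrow>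
      (\<forall>s\<in>{0..1}. x + (s * t) *\<^sub>R w \<in> D) \<Longrightarrow>
      norm ((pd i X (x + t *\<^sub>R w) - pd i X x) /\<^sub>R t - frechet_derivative (pd i X) (at x) w) \<le> r" by metis
  obtain d1 where d1: "d1 > 0" "\<And>x y v. x \<in> D \<Longrightarrow> y \<in> D \<Longrightarrow> dist y x < d1 \<Longrightarrow>
     norm (frechet_derivative X (at y) v - frechet_derivative X (at x) v) \<le> r2 * norm v"
    using Ck_bar_derivative_ucont[OF D X(1) r2(1)] by metis
  define \<delta> where "\<delta> = Min ({d0, d1 / (M + 1), 1 / (2 * (M + 1))} \<union> range df)"
  have \<delta>: "\<delta> > 0" "\<delta> \<le> d0" "\<delta> \<le> d1 / (M + 1)" "\<delta> \<le> 1 / (2 * (M + 1))" "\<And>i. \<delta> \<le> df i"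
  proof -
    show "\<delta> > 0" "\<delta> \<le> d0" "\<delta> \<le> d1 / (M + 1)" "\<delta> \<le> 1 / (2 * (M + 1))"
      using d0(1) d1(1) df(1) assms(2) by (auto simp: \<delta>_def)
    show "\<delta> \<le> df i" for i unfolding \<delta>_def by (rule Min_le) auto
  qed
  have "small_field D (\<lambda>x. t *\<^sub>R W x) \<and> C1_norm D (\<lambda>x. diff_quotient X t W x - field_deriv X W x) \<le> e"
    if t: "t \<noteq> 0" "\<bar>t\<bar> < \<delta>" and W: "W \<in> Ck_ring 1 D" and WM: "C1_norm D W \<le> M" for t W
  proof
    note W1 = Ck_ring_1D[OF D W]
    have "\<bar>t\<bar> * C1_norm D W \<le> 1 / (2 * (M + 1)) * M"
      using t \<delta>(4) WM W1(7) assms(2) by (intro mult_mono) auto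
    also have "\<dots> \<le> 1 / 2" using assms(2) by (simp add: field_simps)
    finally show small: "small_field D (\<lambda>x. t *\<^sub>R W x)"
      by (rule small_field_scale[OF D W])
    note seg = small_field_segment[OF small]
    have WxM: "norm (W x) \<le> M" for x using W1(8)[of x] WM by linarith
    have "C1_norm D (\<lambda>x. diff_quotient X t W x - field_deriv X W x) \<le> r + real CARD('d) * (2 * r)"
    proof (rule C1_norm_le[OF D(2)])
      fix x assume x: "x \<in> D"
      have dd: "diff_quotient X t W differentiable at x" "field_deriv X W differentiable at x"
        using Ck_ring_1D(6)[OF D diff_quotient_Ck_ring[OF X1 small] x]
          Ck_ring_1D(6)[OF D field_deriv_Ck_ring[OF assms(1) W] x] by auto
      then show "(\<lambda>x. diff_quotient X t W x - field_deriv X W x) differentiable at x"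
        by (rule differentiable_diff)
      show "norm (diff_quotient X t W x - field_deriv X W x) \<le> r"
        unfolding diff_quotient_def field_deriv_eq[OF X(6)[OF x]]
        using t \<delta>(2) x seg WxM by (intro d0(2)) auto
      fix i
      have m: "x + t *\<^sub>R W x \<in> D" using seg[OF x, of 1] by simp
      have 1: "norm ((pd i X (x + t *\<^sub>R W x) - pd i X x) /\<^sub>R t - frechet_derivative (pd i X) (at x) (W x)) \<le> r"
        using t \<delta>(5)[of i] x seg WxM by (intro df(2)) auto
      have "dist (x + t *\<^sub>R W x) x \<le> \<bar>t\<bar> * (M + 1)"
        using WxM[of x] by (simp add: dist_norm mult_left_mono)
      also have "\<dots> < d1 / (M + 1) * (M + 1)"
        using t(2) \<delta>(3) assms(2) by (intro mult_strict_right_mono) auto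
      also have "\<dots> = d1" using assms(2) by simp
      finally have "norm (frechet_derivative X (at (x + t *\<^sub>R W x)) (pd i W x) - frechet_derivative X (at x) (pd i W x)) \<le> r2 * norm (pd i W x)"
        by (intro d1(2) x m)
      also have "\<dots> \<le> r2 * M"
        using C1_norm_ge(4)[OF D(1) W1(1) x, of i] WM r2(1) by (intro mult_left_mono) auto
      finally have 2: "norm (frechet_derivative X (at (x + t *\<^sub>R W x)) (pd i W x) - frechet_derivative X (at x) (pd i W x)) \<le> r"
        using r2(2) by linarith
      have "pd i (\<lambda>x. diff_quotient X t W x - field_deriv X W x) x =
        ((pd i X (x + t *\<^sub>R W x) - pd i X x) /\<^sub>R t - frechet_derivative (pd i X) (at x) (W x))
        + (frechet_derivative X (at (x + t *\<^sub>R W x)) (pd i W x) - frechet_derivative X (at x) (pd i W x))"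
        unfolding pd_diff[OF dd] pd_diff_quotient[OF X1 small W x t(1)] pd_field_deriv[OF assms(1) W x] by simp
      also have "norm \<dots> \<le> r + r" by (rule norm_triangle_mono[OF 1 2])
      finally show "norm (pd i (\<lambda>x. diff_quotient X t W x - field_deriv X W x) x) \<le> 2 * r" by simp
    qed
    also have "\<dots> = r * (1 + 2 * real CARD('d))" by (simp add: algebra_simps)
    also have "\<dots> = e" unfolding r_def by (simp add: add_pos_nonneg[THEN less_imp_neq, symmetric])
    finally show "C1_norm D (\<lambda>x. diff_quotient X t W x - field_deriv X W x) \<le> e" .
  qed
  with \<delta>(1) show ?thesis using that by blast
qed

lemma field_deriv_bounded:
  assumes "X \<in> Ck_ring 2 D"
  obtains K where "K \<ge> 0" "\<And>V. V \<in> Ck_ring 1 D \<Longrightarrow> C1_norm D (field_deriv X V) \<le> K * C1_norm D V"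
proof -
  note X2 = Ck_ringD[OF assms] and X1 = Ck_ring_2_1[OF assms]
  note X = Ck_ring_1D[OF D X1]
  define S where "S = C1_norm D X + (\<Sum>i\<in>UNIV. C1_norm D (pd i X))"
  have nn: "0 \<le> C1_norm D (pd i X)" for i
    using C1_norm_nonneg[OF D Ck_bar_2D(2)[OF X2(1)]] .
  have S: "C1_norm D X \<le> S" "\<And>i. C1_norm D (pd i X) + C1_norm D X \<le> S" "S \<ge> 0"
    using nn X(7) member_le_sum[of _ UNIV "\<lambda>i. C1_norm D (pd i X)"]
    by (auto simp: S_def intro: sum_nonneg add_nonneg_nonneg)
  have "C1_norm D (field_deriv X V) \<le> (1 + real CARD('d)) * S * C1_norm D V" if V: "V \<in> Ck_ring 1 D" for V
  proof -
    note V1 = Ck_ring_1D[OF D V]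
    have "C1_norm D (field_deriv X V) \<le> S * C1_norm D V + real CARD('d) * (S * C1_norm D V)"
    proof (rule C1_norm_le[OF D(2)])
      fix x assume x: "x \<in> D"
      show "field_deriv X V differentiable at x"
        using Ck_ring_1D(6)[OF D field_deriv_Ck_ring[OF assms V] x] .
      have "norm (field_deriv X V x) \<le> C1_norm D X * norm (V x)"
        unfolding field_deriv_eq[OF X(6)[OF x]] by (rule C1_norm_ge(3)[OF D(1) X(1) x])
      also have "\<dots> \<le> S * C1_norm D V"
        using S V1(7,8) X(7) by (intro mult_mono) auto
      finally show "norm (field_deriv X V x) \<le> S * C1_norm D V" .
      fix i
      have "norm (frechet_derivative (pd i X) (at x) (V x)) \<le> C1_norm D (pd i X) * norm (V x)"
        by (rule C1_norm_ge(3)[OF D(1) Ck_bar_2D(2)[OF X2(1)] x])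
      also have "\<dots> \<le> C1_norm D (pd i X) * C1_norm D V" using V1(8) nn by (intro mult_left_mono) auto
      finally have 1: "norm (frechet_derivative (pd i X) (at x) (V x)) \<le> C1_norm D (pd i X) * C1_norm D V" .
      have "norm (frechet_derivative X (at x) (pd i V x)) \<le> C1_norm D X * norm (pd i V x)"
        by (rule C1_norm_ge(3)[OF D(1) X(1) x])
      also have "\<dots> \<le> C1_norm D X * C1_norm D V"
        using C1_norm_ge(4)[OF D(1) V1(1) x] X(7) by (intro mult_left_mono) auto
      finally have 2: "norm (frechet_derivative X (at x) (pd i V x)) \<le> C1_norm D X * C1_norm D V" .
      have "norm (pd i (field_deriv X V) x) \<le> (C1_norm D (pd i X) + C1_norm D X) * C1_norm D V"
        unfolding pd_field_deriv[OF assms V x] using norm_triangle_mono[OF 1 2] by (simp add: algebra_simps)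
      also have "\<dots> \<le> S * C1_norm D V" using S(2) V1(7) by (intro mult_right_mono) auto
      finally show "norm (pd i (field_deriv X V) x) \<le> S * C1_norm D V" .
    qed
    then show ?thesis by (simp add: algebra_simps)
  qed
  moreover have "(1 + real CARD('d)) * S \<ge> 0" using S(3) by simp
  ultimately show ?thesis using that by blast
qed

text \<open>Convergence along varying directions: the quotients converge uniformly on bounded sets of fields \<open>W\<close>, and
  \<open>\<partial>X W\<close> depends continuously on \<open>W\<close>.\<close>

lemma diff_quotient_approx:
  assumes "X \<in> Ck_ring 2 D" "Y \<in> Ck_ring 1 D" "e > 0"
  obtains \<delta> where "\<delta> > 0" "\<And>t W. t \<noteq> 0 \<Longrightarrow> \<bar>t\<bar> < \<delta> \<Longrightarrow> W \<in> Ck_ring 1 D \<Longrightarrow> C1_norm D (\<lambda>x. W x - Y x) < \<delta> \<Longrightarrow>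
     small_field D (\<lambda>x. t *\<^sub>R W x) \<and> C1_norm D (\<lambda>x. diff_quotient X t W x - field_deriv X Y x) < e"
proof -
  define d where "d = 1 + real CARD('d)"
  have d: "d \<ge> 1" by (simp add: d_def)
  note Y = Ck_ring_1D[OF D assms(2)]
  \<comment> \<open>Fields closer than 1 to \<open>Y\<close> have norm at most \<open>M\<close>.\<close>
  define M where "M = (1 + C1_norm D Y) * d"
  have M: "M \<ge> 0" using Y(7) d by (simp add: M_def)
  define r where "r = e / (4 * d)"
  have r: "r > 0" using assms(3) d by (simp add: r_def)
  obtain \<delta>1 where \<delta>1: "\<delta>1 > 0" "\<And>t W. t \<noteq> 0 \<Longrightarrow> \<bar>t\<bar> < \<delta>1 \<Longrightarrow> W \<in> Ck_ring 1 D \<Longrightarrow> C1_norm D W \<le> M \<Longrightarrow>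
     small_field D (\<lambda>x. t *\<^sub>R W x) \<and> C1_norm D (\<lambda>x. diff_quotient X t W x - field_deriv X W x) \<le> r"
    by (rule diff_quotient_uniform[OF assms(1) M r]) (rule that)
  obtain K where K: "K \<ge> 0" "\<And>V. V \<in> Ck_ring 1 D \<Longrightarrow> C1_norm D (field_deriv X V) \<le> K * C1_norm D V"
    by (rule field_deriv_bounded[OF assms(1)]) (rule that)
  define \<delta> where "\<delta> = Min {\<delta>1, 1, r / (K + 1)}"
  have \<delta>: "\<delta> > 0" "\<delta> \<le> \<delta>1" "\<delta> \<le> 1" "\<delta> \<le> r / (K + 1)" using \<delta>1(1) r K(1) by (auto simp: \<delta>_def)
  have "small_field D (\<lambda>x. t *\<^sub>R W x) \<and> C1_norm D (\<lambda>x. diff_quotient X t W x - field_deriv X Y x) < e"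
    if t: "t \<noteq> 0" "\<bar>t\<bar> < \<delta>" and W: "W \<in> Ck_ring 1 D" and WY: "C1_norm D (\<lambda>x. W x - Y x) < \<delta>" for t W
  proof -
    note WYr = Ck_ring_diff[OF D(1) W assms(2)]
    note WYb = Ck_ring_1D(1)[OF D WYr]
    have "C1_norm D W \<le> (C1_norm D (\<lambda>x. W x - Y x) + C1_norm D Y) * d"
      using C1_norm_add_le[OF D WYb Y(1)] by (simp add: d_def)
    also have "\<dots> \<le> M"
      unfolding M_def using WY \<delta>(3) d by (intro mult_right_mono) auto
    finally have WM: "C1_norm D W \<le> M" .
    have 1: "small_field D (\<lambda>x. t *\<^sub>R W x)" "C1_norm D (\<lambda>x. diff_quotient X t W x - field_deriv X W x) \<le> r"
      using \<delta>1(2)[OF t(1) _ W WM] t(2) \<delta>(2) by auto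
    have "C1_norm D (field_deriv X (\<lambda>x. W x - Y x)) \<le> K * C1_norm D (\<lambda>x. W x - Y x)"
      by (rule K(2)[OF WYr])
    also have "\<dots> \<le> (K + 1) * (r / (K + 1))"
      using K(1) WY \<delta>(4) Ck_ring_1D(7)[OF D WYr] by (intro mult_mono) auto
    also have "\<dots> = r" using K(1) by simp
    finally have 2: "C1_norm D (field_deriv X (\<lambda>x. W x - Y x)) \<le> r" .
    have "C1_norm D (\<lambda>x. (diff_quotient X t W x - field_deriv X W x) + field_deriv X (\<lambda>x. W x - Y x) x)
      \<le> (C1_norm D (\<lambda>x. diff_quotient X t W x - field_deriv X W x) + C1_norm D (field_deriv X (\<lambda>x. W x - Y x))) * d"
      unfolding d_def
      by (rule C1_norm_add_le[OF D Ck_ring_1D(1)[OF D] Ck_ring_1D(1)[OF D]])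
        (intro Ck_ring_diff D diff_quotient_Ck_ring 1 field_deriv_Ck_ring assms W Ck_ring_2_1)+
    also have "\<dots> \<le> (r + r) * d" using 1 2 d by (intro mult_right_mono) auto
    also have "\<dots> = e / 2" using d by (simp add: r_def)
    also have "\<dots> < e" using assms(3) by simp
    finally show ?thesis using 1(1) by (simp add: field_deriv_diff)
  qed
  with \<delta>(1) show ?thesis using that by blast
qed

end

section \<open>Limits in the space of fields\<close>

lemma eventually_norm_nhds:
  "eventually P (norm_nhds A N f) \<longleftrightarrow> (\<exists>e>0. \<forall>g\<in>A. N (\<lambda>x. g x - f x) < e \<longrightarrow> P g)"
proof -
  have "eventually P (norm_nhds A N f) \<longleftrightarrow> (\<exists>e\<in>{0<..}. eventually P (principal {g \<in> A. N (\<lambda>x. g x - f x) < e}))"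
    unfolding norm_nhds_def
  proof (rule eventually_INF_base)
    fix a b :: real assume "a \<in> {0<..}" "b \<in> {0<..}"
    then show "\<exists>x\<in>{0<..}. principal {g \<in> A. N (\<lambda>y. g y - f y) < x}
      \<le> inf (principal {g \<in> A. N (\<lambda>y. g y - f y) < a}) (principal {g \<in> A. N (\<lambda>y. g y - f y) < b})"
      by (intro bexI[of _ "min a b"]) auto
  qed auto
  then show ?thesis by (auto simp: eventually_principal)
qed

lemma filterlim_norm_nhds:
  assumes "\<And>e. e > 0 \<Longrightarrow> \<forall>\<^sub>F t in F. W t \<in> A \<and> N (\<lambda>x. W t x - f x) < e"
  shows "filterlim W (norm_nhds A N f) F"
  unfolding filterlim_iff eventually_norm_nhds
proof safe
  fix P and e :: real assume e: "e > 0" "\<forall>g\<in>A. N (\<lambda>x. g x - f x) < e \<longrightarrow> P g"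
  show "\<forall>\<^sub>F t in F. P (W t)"
    using assms[OF e(1)] by (rule eventually_mono) (use e(2) in blast)
qed

lemma filterlim_norm_nhdsD:
  assumes "filterlim W (norm_nhds A N f) F" "e > 0"
  shows "\<forall>\<^sub>F t in F. W t \<in> A \<and> N (\<lambda>x. W t x - f x) < e"
proof -
  have "\<forall>\<^sub>F g in norm_nhds A N f. g \<in> A \<and> N (\<lambda>x. g x - f x) < e"
    unfolding eventually_norm_nhds using assms(2) by blast
  then show ?thesis using assms(1) unfolding filterlim_iff by blast
qed

lemma norm_nhds_neq_bot:
  assumes "f \<in> A" "N (\<lambda>x. 0) = 0"
  shows "norm_nhds A N f \<noteq> bot"
proof
  assume "norm_nhds A N f = bot"
  then have "eventually (\<lambda>_. False) (norm_nhds A N f)" by simp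
  then obtain e where "e > 0" "\<forall>g\<in>A. \<not> N (\<lambda>x. g x - f x) < e"
    unfolding eventually_norm_nhds by blast
  then show False using assms by force
qed

context
  fixes D :: "(real ^ 'd::finite) set"
  assumes D: "open D" "D \<noteq> {}"
begin

lemma filterlim_C1_const: "X \<in> Ck_ring 1 D \<Longrightarrow> filterlim (\<lambda>t. X) (C1_ring_nhds D X) F"
  by (rule filterlim_norm_nhds) (simp add: C1_norm_zero[OF D(2)])

lemma C1_nhds_neq_bot: "X \<in> Ck_ring 1 D \<Longrightarrow> C1_ring_nhds D X \<noteq> bot"
  by (rule norm_nhds_neq_bot) (simp_all add: C1_norm_zero[OF D(2)])

lemma filterlim_C1_scale:
  assumes "filterlim W (C1_ring_nhds D Y) F" "Y \<in> Ck_ring 1 D" "(\<tau> \<longlongrightarrow> 0) F"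
  shows "filterlim (\<lambda>n. scale_field (\<tau> n) (W n)) (C1_ring_nhds D (\<lambda>x. 0)) F"
proof (rule filterlim_norm_nhds)
  fix e :: real assume e: "e > 0"
  define d where "d = 1 + real CARD('d)"
  have d: "d \<ge> 1" by (simp add: d_def)
  define M where "M = (1 + C1_norm D Y) * d * d"
  have M: "M > 0" using Ck_ring_1D(7)[OF D assms(2)] d by (simp add: M_def add_pos_nonneg)
  have "\<forall>\<^sub>F n in F. W n \<in> Ck_ring 1 D \<and> C1_norm D (\<lambda>x. W n x - Y x) < 1"
    by (rule filterlim_norm_nhdsD[OF assms(1)]) simp
  moreover have "\<forall>\<^sub>F n in F. dist (\<tau> n) 0 < e / M"
    using assms(3) e M by (intro tendstoD) auto
  ultimately show "\<forall>\<^sub>F n in F. scale_field (\<tau> n) (W n) \<in> Ck_ring 1 D \<and> C1_norm D (\<lambda>x. scale_field (\<tau> n) (W n) x - 0) < e"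
  proof eventually_elim
    case (elim n)
    then have W: "W n \<in> Ck_ring 1 D" by simp
    note WY = Ck_ring_diff[OF D(1) W assms(2)]
    have "C1_norm D (W n) \<le> (C1_norm D (\<lambda>x. W n x - Y x) + C1_norm D Y) * d"
      using C1_norm_add_le[OF D Ck_ring_1D(1)[OF D WY] Ck_ring_1D(1)[OF D assms(2)]] by (simp add: d_def)
    also have "\<dots> \<le> (1 + C1_norm D Y) * d" using elim d by (intro mult_right_mono) auto
    finally have "C1_norm D (W n) * d \<le> M" unfolding M_def using d by (intro mult_right_mono) auto
    then have "\<bar>\<tau> n\<bar> * (C1_norm D (W n) * d) \<le> \<bar>\<tau> n\<bar> * M" by (intro mult_left_mono) auto
    also have "\<dots> < e / M * M" using elim M by (intro mult_strict_right_mono) auto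
    finally have "\<bar>\<tau> n\<bar> * C1_norm D (W n) * d < e" using M by simp
    moreover have "C1_norm D (\<lambda>x. \<tau> n *\<^sub>R W n x) \<le> \<bar>\<tau> n\<bar> * C1_norm D (W n) * d"
      using C1_norm_cmul_le[OF D Ck_ring_1D(1)[OF D W]] by (simp add: d_def)
    ultimately show ?case
      using Ck_ring_cmul[OF D(1) W] by (simp add: scale_field_def)
  qed
qed

lemma diff_quotient_tendsto:
  assumes "X \<in> Ck_ring 2 D" "Y \<in> Ck_ring 1 D" "filterlim W (C1_ring_nhds D Y) (at 0)"
  shows "filterlim (\<lambda>t. diff_quotient X t (W t)) (C1_ring_nhds D (field_deriv X Y)) (at 0)"
    and "\<forall>\<^sub>F t in at 0. small_field D (\<lambda>x. t *\<^sub>R W t x)"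
proof -
  have key: "\<forall>\<^sub>F t in at 0. small_field D (\<lambda>x. t *\<^sub>R W t x) \<and>
    C1_norm D (\<lambda>x. diff_quotient X t (W t) x - field_deriv X Y x) < e" if e: "e > 0" for e
  proof -
    obtain \<delta> where \<delta>: "\<delta> > 0" "\<And>t W. t \<noteq> 0 \<Longrightarrow> \<bar>t\<bar> < \<delta> \<Longrightarrow> W \<in> Ck_ring 1 D \<Longrightarrow> C1_norm D (\<lambda>x. W x - Y x) < \<delta> \<Longrightarrow>
       small_field D (\<lambda>x. t *\<^sub>R W x) \<and> C1_norm D (\<lambda>x. diff_quotient X t W x - field_deriv X Y x) < e"
      by (rule diff_quotient_approx[OF D assms(1,2) e]) (rule that)
    have "\<forall>\<^sub>F t in at (0::real). t \<noteq> 0 \<and> \<bar>t\<bar> < \<delta>"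
      unfolding eventually_at using \<delta>(1) by (auto simp: dist_norm)
    then show ?thesis
      using filterlim_norm_nhdsD[OF assms(3) \<delta>(1)]
      by eventually_elim (use \<delta>(2) in blast)
  qed
  from key[of 1] show "\<forall>\<^sub>F t in at 0. small_field D (\<lambda>x. t *\<^sub>R W t x)"
    by (simp add: eventually_conj_iff)
  show "filterlim (\<lambda>t. diff_quotient X t (W t)) (C1_ring_nhds D (field_deriv X Y)) (at 0)"
  proof (rule filterlim_norm_nhds)
    fix e :: real assume "e > 0"
    from key[OF this] show "\<forall>\<^sub>F t in at 0. diff_quotient X t (W t) \<in> Ck_ring 1 D \<and>
       C1_norm D (\<lambda>x. diff_quotient X t (W t) x - field_deriv X Y x) < e"
      by (rule eventually_mono) (use diff_quotient_Ck_ring[OF D Ck_ring_2_1[OF assms(1)]] in blast)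
  qed
qed

section \<open>First and second shape derivatives\<close>

context
  fixes J :: "(real ^ 'd) set \<Rightarrow> real" and \<Omega> :: "(real ^ 'd) set"
  assumes sd: "shape_differentiable J \<Omega> D"
begin

lemma DHJ_tendsto:
  assumes "X \<in> Ck_ring 1 D"
  shows "((\<lambda>(t, V). DJ_quotient J \<Omega> V t) \<longlongrightarrow> DHJ J \<Omega> D X) (at 0 \<times>\<^sub>F C1_ring_nhds D X)"
proof -
  obtain L where L: "((\<lambda>(t, V). DJ_quotient J \<Omega> V t) \<longlongrightarrow> L) (at 0 \<times>\<^sub>F C1_ring_nhds D X)"
    using sd assms unfolding shape_differentiable_def by blast
  have "at (0::real) \<times>\<^sub>F C1_ring_nhds D X \<noteq> bot"
    using C1_nhds_neq_bot[OF assms] by (simp add: prod_filter_eq_bot)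
  from tendsto_Lim[OF this L] L show ?thesis by (simp add: DHJ_def)
qed

text \<open>This is the form in which Hadamard differentiability is used: the direction may vary with \<open>t\<close> as long
  as it converges in \<open>C\<^sup>1\<close>.\<close>

lemma DHJ_tendsto_along:
  assumes "X \<in> Ck_ring 1 D" "filterlim V (C1_ring_nhds D X) (at 0)"
  shows "((\<lambda>t. DJ_quotient J \<Omega> (V t) t) \<longlongrightarrow> DHJ J \<Omega> D X) (at 0)"
  using filterlim_compose[OF DHJ_tendsto[OF assms(1)] filterlim_Pair[OF filterlim_ident assms(2)]] by simp

lemma DJ_tendsto: "X \<in> Ck_ring 1 D \<Longrightarrow> (DJ_quotient J \<Omega> X \<longlongrightarrow> DHJ J \<Omega> D X) (at 0)"
  using DHJ_tendsto_along[OF _ filterlim_C1_const] by simp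

lemma DJ_eq_DHJ: "X \<in> Ck_ring 1 D \<Longrightarrow> DJ J \<Omega> X = DHJ J \<Omega> D X"
  unfolding DJ_def by (rule tendsto_Lim[OF _ DJ_tendsto]) auto

lemma DHJ_add: "X \<in> Ck_ring 1 D \<Longrightarrow> Y \<in> Ck_ring 1 D \<Longrightarrow>
    DHJ J \<Omega> D (\<lambda>x. X x + Y x) = DHJ J \<Omega> D X + DHJ J \<Omega> D Y"
  and DHJ_cmul: "X \<in> Ck_ring 1 D \<Longrightarrow> DHJ J \<Omega> D (\<lambda>x. c *\<^sub>R X x) = c * DHJ J \<Omega> D X"
  using sd unfolding shape_differentiable_def fun_linear_on_def by auto

lemma DHJ_diff: "X \<in> Ck_ring 1 D \<Longrightarrow> Y \<in> Ck_ring 1 D \<Longrightarrow>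
    DHJ J \<Omega> D (\<lambda>x. X x - Y x) = DHJ J \<Omega> D X - DHJ J \<Omega> D Y"
  using DHJ_add[of X "\<lambda>x. (-1) *\<^sub>R Y x"] DHJ_cmul[of Y "-1"] Ck_ring_cmul[OF D(1), of Y 1 "-1"] by simp

end

lemma id_plus_image_eqI:
  assumes "small_field D Y" "\<And>x. id_plus Y x \<in> \<Omega> \<longleftrightarrow> x \<in> \<Omega>"
  shows "id_plus Y ` \<Omega> = \<Omega>"
proof
  show "id_plus Y ` \<Omega> \<subseteq> \<Omega>" using assms(2) by blast
  show "\<Omega> \<subseteq> id_plus Y ` \<Omega>"
  proof
    fix y assume "y \<in> \<Omega>"
    then have "inv (id_plus Y) y \<in> \<Omega>"
      using assms(2)[of "inv (id_plus Y) y"] id_plus_inv(1)[OF D assms(1)] by simp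
    then show "y \<in> id_plus Y ` \<Omega>" using id_plus_inv(1)[OF D assms(1), of y] by (metis imageI)
  qed
qed

text \<open>While the perturbation is switched on, a point off the boundary cannot reach the boundary,
  whose points stay fixed, because each stage is injective.\<close>

lemma id_plus_image_fixed_frontier:
  assumes "small_field D Y" "open \<Omega>" "\<And>x. x \<in> frontier \<Omega> \<Longrightarrow> Y x = 0"
  shows "id_plus Y ` \<Omega> = \<Omega>"
proof (rule id_plus_image_eqI[OF assms(1)])
  fix x
  show "id_plus Y x \<in> \<Omega> \<longleftrightarrow> x \<in> \<Omega>"
  proof (cases "x \<in> frontier \<Omega>")
    case True
    then show ?thesis using assms(3) by (simp add: id_plus_def)
  next
    case False
    define S where "S = closed_segment x (id_plus Y x)"
    have "z \<notin> frontier \<Omega>" if zS: "z \<in> S" for z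
    proof
      assume z: "z \<in> frontier \<Omega>"
      obtain s where s: "0 \<le> s" "s \<le> 1" "z = (1 - s) *\<^sub>R x + s *\<^sub>R id_plus Y x"
        using zS unfolding S_def in_segment by blast
      have small: "small_field D (\<lambda>x. s *\<^sub>R Y x)" by (rule small_field_shrink[OF D assms(1)]) (use s in simp)
      have "id_plus (\<lambda>x. s *\<^sub>R Y x) x = z" using s(3) by (simp add: id_plus_def algebra_simps)
      also have "z = id_plus (\<lambda>x. s *\<^sub>R Y x) z" using assms(3)[OF z] by (simp add: id_plus_def)
      finally have "x = z" using bij_id_plus[OF D small] by (metis bij_pointE)
      with z False show False by simp
    qed
    then have "S \<inter> frontier \<Omega> = {}" by blast
    moreover have "connected S" by (simp add: S_def)
    ultimately have "S \<inter> \<Omega> = {} \<or> S - \<Omega> = {}" using connected_Int_frontier by blast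
    moreover have "x \<in> S" "id_plus Y x \<in> S" by (auto simp: S_def)
    ultimately show ?thesis by blast
  qed
qed

lemma eventually_small_scale:
  assumes "X \<in> Ck_ring 1 D"
  shows "\<forall>\<^sub>F t in at 0. small_field D (scale_field t X)"
proof -
  have "((\<lambda>t. \<bar>t\<bar> * C1_norm D X) \<longlongrightarrow> \<bar>0\<bar> * C1_norm D X) (at (0::real))"
    by (intro tendsto_intros)
  then have "\<forall>\<^sub>F t in at 0. \<bar>t\<bar> * C1_norm D X < 1 / 2"
    by (rule order_tendstoD) simp
  then show ?thesis
    unfolding scale_field_def by (rule eventually_mono) (intro small_field_scale[OF D assms], simp)
qed

text \<open>If the perturbed sets do not move, all difference quotients are zero.\<close>

lemma DHJ_eq_0_if_invariant:
  assumes "shape_differentiable J \<Omega> D" "X \<in> Ck_ring 1 D" "filterlim W (C1_ring_nhds D X) (at 0)"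
    "\<forall>\<^sub>F t in at 0. id_plus (scale_field t (W t)) ` \<Omega> = \<Omega>"
  shows "DHJ J \<Omega> D X = 0"
proof -
  have "((\<lambda>t. DJ_quotient J \<Omega> (W t) t) \<longlongrightarrow> 0) (at 0)"
    by (rule tendsto_eventually, rule eventually_mono[OF assms(4)]) (simp add: DJ_quotient_def)
  then show ?thesis
    using tendsto_unique[OF _ DHJ_tendsto_along[OF assms(1-3)]] by simp
qed

lemma DHJ_eq_0_if_zero_on_frontier:
  assumes "shape_differentiable J \<Omega> D" "open \<Omega>" "X \<in> Ck_ring 1 D" "\<And>x. x \<in> frontier \<Omega> \<Longrightarrow> X x = 0"
  shows "DHJ J \<Omega> D X = 0"
proof (rule DHJ_eq_0_if_invariant[OF assms(1,3) filterlim_C1_const[OF assms(3)]])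
  show "\<forall>\<^sub>F t in at 0. id_plus (scale_field t X) ` \<Omega> = \<Omega>"
    using eventually_small_scale[OF assms(3)]
    by (rule eventually_mono) (rule id_plus_image_fixed_frontier[OF _ assms(2)], auto simp: scale_field_def assms(4))
qed

lemma DHJ_cong_frontier:
  assumes "shape_differentiable J \<Omega> D" "open \<Omega>" "X \<in> Ck_ring 1 D" "Y \<in> Ck_ring 1 D"
    "\<And>x. x \<in> frontier \<Omega> \<Longrightarrow> X x = Y x"
  shows "DHJ J \<Omega> D X = DHJ J \<Omega> D Y"
  using DHJ_eq_0_if_zero_on_frontier[OF assms(1,2) Ck_ring_diff[OF D(1) assms(3,4)]]
    DHJ_diff[OF assms(1,3,4)] assms(5) by simp

context
  fixes J :: "(real ^ 'd) set \<Rightarrow> real" and \<Omega> :: "(real ^ 'd) set"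
  assumes td: "twice_shape_differentiable J \<Omega> D" and op: "open \<Omega>"
begin

lemma shape_differentiable_nearby:
  obtains \<delta> where "\<delta> > 0" "\<And>Y. Y \<in> Ck_ring 1 D \<Longrightarrow> C1_norm D Y < \<delta> \<Longrightarrow>
     small_field D Y \<and> shape_differentiable J (id_plus Y ` \<Omega>) D"
proof -
  obtain e where e: "e > 0" "\<And>Y. Y \<in> Ck_ring 1 D \<Longrightarrow> C1_norm D Y < e \<Longrightarrow> shape_differentiable J (id_plus Y ` \<Omega>) D"
    using td unfolding twice_shape_differentiable_def eventually_norm_nhds by auto
  show ?thesis
    by (rule that[of "min e (1/2)"]) (use e small_fieldI[OF D] in auto)
qed

lemma eventually_nearby:
  assumes "filterlim V (C1_ring_nhds D (\<lambda>x. 0)) F"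
  shows "\<forall>\<^sub>F n in F. V n \<in> Ck_ring 1 D \<and> small_field D (V n) \<and> shape_differentiable J (id_plus (V n) ` \<Omega>) D"
proof -
  obtain \<delta> where \<delta>: "\<delta> > 0" "\<And>Y. Y \<in> Ck_ring 1 D \<Longrightarrow> C1_norm D Y < \<delta> \<Longrightarrow>
     small_field D Y \<and> shape_differentiable J (id_plus Y ` \<Omega>) D"
    by (rule shape_differentiable_nearby) (rule that)
  show ?thesis
    using filterlim_norm_nhdsD[OF assms \<delta>(1)] by (rule eventually_mono) (use \<delta>(2) in auto)
qed

lemma shape_differentiable_here: "shape_differentiable J \<Omega> D"
proof -
  obtain \<delta> where \<delta>: "\<delta> > 0" "\<And>Y. Y \<in> Ck_ring 1 D \<Longrightarrow> C1_norm D Y < \<delta> \<Longrightarrow>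
     small_field D Y \<and> shape_differentiable J (id_plus Y ` \<Omega>) D"
    by (rule shape_differentiable_nearby) (rule that)
  have "shape_differentiable J (id_plus (\<lambda>x. 0) ` \<Omega>) D"
    using \<delta>(2)[OF Ck_ring_zero[OF D(1)]] \<delta>(1) by (simp add: C1_norm_zero[OF D(2)])
  then show ?thesis by (simp add: id_plus_def)
qed

lemmas sd0 = shape_differentiable_here

lemma transported_DHJ_zero: "transported_DHJ J \<Omega> D X (\<lambda>x. 0) = DHJ J \<Omega> D X"
  by (simp add: transported_DHJ_def id_plus_def inv_id[unfolded id_def] comp_def)

lemma transported_tendsto:
  assumes "X \<in> Ck_ring 1 D" "filterlim Z (C1_ring_nhds D X) F" "filterlim V (C1_ring_nhds D (\<lambda>x. 0)) F"
  shows "((\<lambda>n. transported_DHJ J \<Omega> D (Z n) (V n)) \<longlongrightarrow> DHJ J \<Omega> D X) F"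
proof -
  have "((\<lambda>(X, Y). transported_DHJ J \<Omega> D X Y) \<longlongrightarrow> transported_DHJ J \<Omega> D X (\<lambda>x. 0))
      (C1_ring_nhds D X \<times>\<^sub>F C1_ring_nhds D (\<lambda>x. 0))"
    using td assms(1) unfolding twice_shape_differentiable_def by blast
  from filterlim_compose[OF this filterlim_Pair[OF assms(2,3)]]
  show ?thesis by (simp add: transported_DHJ_zero)
qed

lemma frakD2HJ_tendsto_along:
  assumes "X \<in> Ck_ring 1 D" "Y \<in> Ck_ring 1 D" "filterlim \<tau> (at 0) F" "filterlim W (C1_ring_nhds D Y) F"
  shows "((\<lambda>n. frakD2HJ_quotient J \<Omega> D X (\<tau> n) (W n)) \<longlongrightarrow> frakD2HJ J \<Omega> D X Y) F"
proof -
  obtain L where L: "((\<lambda>(t, W). frakD2HJ_quotient J \<Omega> D X t W) \<longlongrightarrow> L) (at 0 \<times>\<^sub>F C1_ring_nhds D Y)"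
    using td assms(1,2) unfolding twice_shape_differentiable_def by blast
  have "at (0::real) \<times>\<^sub>F C1_ring_nhds D Y \<noteq> bot"
    using C1_nhds_neq_bot[OF assms(2)] by (simp add: prod_filter_eq_bot)
  from tendsto_Lim[OF this L] L
  have "((\<lambda>(t, W). frakD2HJ_quotient J \<Omega> D X t W) \<longlongrightarrow> frakD2HJ J \<Omega> D X Y) (at 0 \<times>\<^sub>F C1_ring_nhds D Y)"
    by (simp add: frakD2HJ_def)
  from filterlim_compose[OF this filterlim_Pair[OF assms(3,4)]] show ?thesis by simp
qed

lemma frakD2HJ_linear:
  assumes "X \<in> Ck_ring 1 D" "X' \<in> Ck_ring 1 D" "Y \<in> Ck_ring 1 D"
  shows "frakD2HJ J \<Omega> D (\<lambda>x. X x + X' x) Y = frakD2HJ J \<Omega> D X Y + frakD2HJ J \<Omega> D X' Y"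
    and "frakD2HJ J \<Omega> D Y (\<lambda>x. X x + X' x) = frakD2HJ J \<Omega> D Y X + frakD2HJ J \<Omega> D Y X'"
    and "frakD2HJ J \<Omega> D (\<lambda>x. c *\<^sub>R X x) Y = c * frakD2HJ J \<Omega> D X Y"
    and "frakD2HJ J \<Omega> D Y (\<lambda>x. c *\<^sub>R X x) = c * frakD2HJ J \<Omega> D Y X"
  using td assms unfolding twice_shape_differentiable_def fun_linear_on_def by simp_all

lemma frakD2HJ_diff:
  assumes "X \<in> Ck_ring 1 D" "X' \<in> Ck_ring 1 D" "Y \<in> Ck_ring 1 D"
  shows "frakD2HJ J \<Omega> D (\<lambda>x. X x - X' x) Y = frakD2HJ J \<Omega> D X Y - frakD2HJ J \<Omega> D X' Y"
    and "frakD2HJ J \<Omega> D Y (\<lambda>x. X x - X' x) = frakD2HJ J \<Omega> D Y X - frakD2HJ J \<Omega> D Y X'"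
  using frakD2HJ_linear(1,2)[OF assms(1) Ck_ring_cmul[OF D(1) assms(2), of "-1"] assms(3)]
    frakD2HJ_linear(3,4)[OF assms(2,2,3), of "-1"] by simp_all

lemma transported_DHJ_add:
  assumes "X \<in> Ck_ring 1 D" "X' \<in> Ck_ring 1 D" "small_field D V" "shape_differentiable J (id_plus V ` \<Omega>) D"
  shows "transported_DHJ J \<Omega> D (\<lambda>x. X x + c *\<^sub>R X' x) V = transported_DHJ J \<Omega> D X V + c * transported_DHJ J \<Omega> D X' V"
  using DHJ_add[OF assms(4) Ck_ring_transport[OF D assms(1,3)] Ck_ring_cmul[OF D(1) Ck_ring_transport[OF D assms(2,3)], of c]]
    DHJ_cmul[OF assms(4) Ck_ring_transport[OF D assms(2,3)], of c]
  by (simp add: transported_DHJ_def comp_def)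

text \<open>Writing \<open>X = (X \<circ> T) \<circ> T\<^sup>-\<^sup>1\<close> with \<open>T = id + t W\<close> compares the derivative along the fixed field
  with the derivative along the transported field.\<close>

lemma DHJ_fixed_field:
  assumes "X \<in> Ck_ring 1 D" "small_field D (scale_field t W)"
    "shape_differentiable J (id_plus (scale_field t W) ` \<Omega>) D" "t \<noteq> 0"
  shows "DHJ J (id_plus (scale_field t W) ` \<Omega>) D X =
    transported_DHJ J \<Omega> D X (scale_field t W) + t * transported_DHJ J \<Omega> D (diff_quotient X t W) (scale_field t W)"
proof -
  have m: "diff_quotient X t W \<in> Ck_ring 1 D"
    using diff_quotient_Ck_ring[OF D assms(1)] assms(2) by (simp add: scale_field_def)
  have "X x + t *\<^sub>R diff_quotient X t W x = X (id_plus (scale_field t W) x)" for x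
    using assms(4) by (simp add: diff_quotient_def id_plus_def scale_field_def)
  then have "(\<lambda>x. X x + t *\<^sub>R diff_quotient X t W x) \<circ> inv (id_plus (scale_field t W)) = X"
    by (auto simp: id_plus_inv[OF D assms(2)])
  then show ?thesis
    using transported_DHJ_add[OF assms(1) m assms(2,3), of t] by (simp add: transported_DHJ_def)
qed

lemma tendsto_fixed_field:
  assumes "X \<in> Ck_ring 2 D" "Y \<in> Ck_ring 1 D" "filterlim W (C1_ring_nhds D Y) (at 0)"
  shows "((\<lambda>t. (DHJ J (id_plus (scale_field t (W t)) ` \<Omega>) D X - DHJ J \<Omega> D X) / t)
     \<longlongrightarrow> frakD2HJ J \<Omega> D X Y + DHJ J \<Omega> D (field_deriv X Y)) (at 0)"
proof -
  note X1 = Ck_ring_2_1[OF assms(1)]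
  note V = filterlim_C1_scale[OF assms(3,2) tendsto_ident_at]
  have "((\<lambda>t. frakD2HJ_quotient J \<Omega> D X t (W t) + transported_DHJ J \<Omega> D (diff_quotient X t (W t)) (scale_field t (W t)))
      \<longlongrightarrow> frakD2HJ J \<Omega> D X Y + DHJ J \<Omega> D (field_deriv X Y)) (at 0)"
    by (intro tendsto_add frakD2HJ_tendsto_along[OF X1 assms(2) filterlim_ident assms(3)]
        transported_tendsto[OF field_deriv_Ck_ring[OF D assms(1,2)] diff_quotient_tendsto(1)[OF assms] V])
  moreover have "\<forall>\<^sub>F t in at (0::real). t \<noteq> 0" by (simp add: eventually_at_filter)
  with eventually_nearby[OF V]
  have "\<forall>\<^sub>F t in at 0. frakD2HJ_quotient J \<Omega> D X t (W t) + transported_DHJ J \<Omega> D (diff_quotient X t (W t)) (scale_field t (W t))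
     = (DHJ J (id_plus (scale_field t (W t)) ` \<Omega>) D X - DHJ J \<Omega> D X) / t"
  proof eventually_elim
    case (elim t)
    then have "DHJ J (id_plus (scale_field t (W t)) ` \<Omega>) D X =
      transported_DHJ J \<Omega> D X (scale_field t (W t)) + t * transported_DHJ J \<Omega> D (diff_quotient X t (W t)) (scale_field t (W t))"
      by (intro DHJ_fixed_field X1) auto
    then show ?case using elim(2) by (simp add: frakD2HJ_quotient_def field_simps)
  qed
  ultimately show ?thesis by (rule Lim_transform_eventually)
qed

lemma D2J_tendsto:
  assumes "X \<in> Ck_ring 2 D" "Y \<in> Ck_ring 1 D"
  shows "(D2J_quotient J \<Omega> X Y \<longlongrightarrow> frakD2HJ J \<Omega> D X Y + DHJ J \<Omega> D (field_deriv X Y)) (at 0)"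
proof (rule Lim_transform_eventually[OF tendsto_fixed_field[OF assms filterlim_C1_const[OF assms(2)]]])
  show "\<forall>\<^sub>F t in at 0. (DHJ J (id_plus (scale_field t Y) ` \<Omega>) D X - DHJ J \<Omega> D X) / t = D2J_quotient J \<Omega> X Y t"
    using eventually_nearby[OF filterlim_C1_scale[OF filterlim_C1_const[OF assms(2)] assms(2) tendsto_ident_at]]
    by (rule eventually_mono) (simp add: D2J_quotient_def DJ_eq_DHJ sd0 Ck_ring_2_1[OF assms(1)] del: One_nat_def)
qed

lemma frakD2J_eq:
  assumes "X \<in> Ck_ring 1 D" "Y \<in> Ck_ring 1 D"
  shows "frakD2J J \<Omega> X Y = frakD2HJ J \<Omega> D X Y"
  unfolding frakD2J_def
proof (rule tendsto_Lim, simp, rule Lim_transform_eventually[OF frakD2HJ_tendsto_along[OF assms filterlim_ident filterlim_C1_const[OF assms(2)]]])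
  show "\<forall>\<^sub>F t in at 0. frakD2HJ_quotient J \<Omega> D X t Y =
    (DJ J (id_plus (scale_field t Y) ` \<Omega>) (X \<circ> inv (id_plus (scale_field t Y))) - DJ J \<Omega> X) / t"
    using eventually_nearby[OF filterlim_C1_scale[OF filterlim_C1_const[OF assms(2)] assms(2) tendsto_ident_at]]
    by (rule eventually_mono)
      (simp add: frakD2HJ_quotient_def transported_DHJ_def DJ_eq_DHJ sd0 assms Ck_ring_transport[OF D] del: One_nat_def)
qed

text \<open>If the sets \<open>(id + t W\<^sub>t) \<Omega>\<close> do not move, the quotients along the fixed field \<open>X\<close> are zero, so the two
  contributions to their limit cancel.\<close>

lemma frakD2HJ_invariant:
  assumes "X \<in> Ck_ring 2 D" "Y \<in> Ck_ring 1 D" "filterlim W (C1_ring_nhds D Y) (at 0)"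
    "\<forall>\<^sub>F t in at 0. id_plus (scale_field t (W t)) ` \<Omega> = \<Omega>"
  shows "frakD2HJ J \<Omega> D X Y = - DHJ J \<Omega> D (field_deriv X Y)"
proof -
  have "((\<lambda>t. (DHJ J (id_plus (scale_field t (W t)) ` \<Omega>) D X - DHJ J \<Omega> D X) / t) \<longlongrightarrow> 0) (at 0)"
    by (rule tendsto_eventually, rule eventually_mono[OF assms(4)]) simp
  then show ?thesis
    using tendsto_unique[OF _ tendsto_fixed_field[OF assms(1-3)]] by fastforce
qed

text \<open>The transported field vanishes on the boundary of the transported set, so both terms of every
  quotient are zero.\<close>

lemma frakD2HJ_zero_left:
  assumes "X \<in> Ck_ring 1 D" "Y \<in> Ck_ring 1 D" "\<And>x. x \<in> frontier \<Omega> \<Longrightarrow> X x = 0"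
  shows "frakD2HJ J \<Omega> D X Y = 0"
proof -
  have "((\<lambda>t. frakD2HJ_quotient J \<Omega> D X t Y) \<longlongrightarrow> 0) (at 0)"
  proof (rule tendsto_eventually)
    show "\<forall>\<^sub>F t in at 0. frakD2HJ_quotient J \<Omega> D X t Y = 0"
      using eventually_nearby[OF filterlim_C1_scale[OF filterlim_C1_const[OF assms(2)] assms(2) tendsto_ident_at]]
    proof (rule eventually_mono)
      fix t assume V: "scale_field t Y \<in> Ck_ring 1 D \<and> small_field D (scale_field t Y) \<and>
        shape_differentiable J (id_plus (scale_field t Y) ` \<Omega>) D"
      let ?T = "id_plus (scale_field t Y)"
      have small: "small_field D (scale_field t Y)" using V by simp
      have "?T ` \<Omega> = inv ?T -` \<Omega>"
        using bij_vimage_eq_inv_image[OF bij_imp_bij_inv[OF bij_id_plus[OF D small]]]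
        by (simp add: inv_inv_eq bij_id_plus[OF D small])
      then have o: "open (?T ` \<Omega>)"
        using open_vimage[OF op continuous_id_plus(2)[OF D small]] by simp
      have "DHJ J (?T ` \<Omega>) D (X \<circ> inv ?T) = 0"
        by (rule DHJ_eq_0_if_zero_on_frontier[OF _ o Ck_ring_transport[OF D assms(1) small]])
          (use V assms(3) in \<open>auto simp: frontier_id_plus[OF D small] id_plus_inv[OF D small]\<close>)
      moreover have "DHJ J \<Omega> D X = 0"
        by (rule DHJ_eq_0_if_zero_on_frontier[OF sd0 op assms(1,3)])
      ultimately show "frakD2HJ_quotient J \<Omega> D X t Y = 0"
        by (simp add: frakD2HJ_quotient_def transported_DHJ_def)
    qed
  qed
  then show ?thesis
    using tendsto_unique[OF _ frakD2HJ_tendsto_along[OF assms(1,2) filterlim_ident filterlim_C1_const[OF assms(2)]]] by fastforce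
qed

text \<open>Since \<open>id + t Y\<close> maps \<open>\<Omega>\<close> onto itself and fixes its boundary, transport changes neither the set nor the
  boundary values of \<open>X\<close>.\<close>

lemma frakD2HJ_zero_right:
  assumes "X \<in> Ck_ring 1 D" "Y \<in> Ck_ring 1 D" "\<And>x. x \<in> frontier \<Omega> \<Longrightarrow> Y x = 0"
  shows "frakD2HJ J \<Omega> D X Y = 0"
proof -
  have "((\<lambda>t. frakD2HJ_quotient J \<Omega> D X t Y) \<longlongrightarrow> 0) (at 0)"
  proof (rule tendsto_eventually)
    show "\<forall>\<^sub>F t in at 0. frakD2HJ_quotient J \<Omega> D X t Y = 0"
      using eventually_small_scale[OF assms(2)]
    proof (rule eventually_mono)
      fix t assume small: "small_field D (scale_field t Y)"
      let ?T = "id_plus (scale_field t Y)"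
      have z: "scale_field t Y x = 0" if "x \<in> frontier \<Omega>" for x
        using assms(3)[OF that] by (simp add: scale_field_def)
      have im: "?T ` \<Omega> = \<Omega>" by (rule id_plus_image_fixed_frontier[OF small op z])
      have "(X \<circ> inv ?T) x = X x" if "x \<in> frontier \<Omega>" for x
        using id_plus_inv(2)[OF D small, of x] z[OF that] by (simp add: id_plus_def)
      then have "DHJ J \<Omega> D (X \<circ> inv ?T) = DHJ J \<Omega> D X"
        by (intro DHJ_cong_frontier[OF sd0 op Ck_ring_transport[OF D assms(1) small] assms(1)])
      then show "frakD2HJ_quotient J \<Omega> D X t Y = 0"
        by (simp add: frakD2HJ_quotient_def transported_DHJ_def im)
    qed
  qed
  then show ?thesis
    using tendsto_unique[OF _ frakD2HJ_tendsto_along[OF assms(1,2) filterlim_ident filterlim_C1_const[OF assms(2)]]] by fastforce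
qed

lemma frakD2HJ_cong_frontier:
  assumes "X \<in> Ck_ring 1 D" "Y \<in> Ck_ring 1 D" "X' \<in> Ck_ring 1 D" "Y' \<in> Ck_ring 1 D"
    "\<And>x. x \<in> frontier \<Omega> \<Longrightarrow> X x = X' x" "\<And>x. x \<in> frontier \<Omega> \<Longrightarrow> Y x = Y' x"
  shows "frakD2HJ J \<Omega> D X Y = frakD2HJ J \<Omega> D X' Y'"
proof -
  have "frakD2HJ J \<Omega> D (\<lambda>x. X x - X' x) Y = 0"
    by (rule frakD2HJ_zero_left[OF Ck_ring_diff[OF D(1) assms(1,3)] assms(2)]) (simp add: assms(5))
  moreover have "frakD2HJ J \<Omega> D X' (\<lambda>x. Y x - Y' x) = 0"
    by (rule frakD2HJ_zero_right[OF assms(3) Ck_ring_diff[OF D(1) assms(2,4)]]) (simp add: assms(6))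
  ultimately show ?thesis
    using frakD2HJ_diff(1)[OF assms(1,3,2)] frakD2HJ_diff(2)[OF assms(2,4,3)] by simp
qed

subsection \<open>Symmetry of the second derivative\<close>

text \<open>The transported derivative at \<open>(id + V) \<Omega>\<close> is a directional derivative of \<open>V \<mapsto> J ((id + V) \<Omega>)\<close>.\<close>

lemma perturbation_has_derivative:
  assumes "X \<in> Ck_ring 1 D" "small_field D V" "shape_differentiable J (id_plus V ` \<Omega>) D"
  shows "((\<lambda>s. J (id_plus (\<lambda>x. V x + s *\<^sub>R X x) ` \<Omega>)) has_real_derivative transported_DHJ J \<Omega> D X V) (at 0)"
proof -
  have "id_plus (scale_field t (X \<circ> inv (id_plus V))) (id_plus V x) = id_plus (\<lambda>x. V x + t *\<^sub>R X x) x" for t x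
  proof -
    have "id_plus (scale_field t Z) y = y + t *\<^sub>R Z y" for Z :: "real ^ 'd \<Rightarrow> real ^ 'd" and y
      by (simp add: id_plus_def scale_field_def)
    moreover have "(X \<circ> inv (id_plus V)) (id_plus V x) = X x"
      by (simp add: id_plus_inv[OF D assms(2)])
    ultimately have "id_plus (scale_field t (X \<circ> inv (id_plus V))) (id_plus V x) = id_plus V x + t *\<^sub>R X x"
      by (simp only:)
    also have "\<dots> = id_plus (\<lambda>x. V x + t *\<^sub>R X x) x" by (simp add: id_plus_def add.assoc)
    finally show ?thesis .
  qed
  then have "id_plus (scale_field t (X \<circ> inv (id_plus V))) ` id_plus V ` \<Omega> = id_plus (\<lambda>x. V x + t *\<^sub>R X x) ` \<Omega>" for t
    unfolding image_image by simp
  then have "DJ_quotient J (id_plus V ` \<Omega>) (X \<circ> inv (id_plus V)) =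
    (\<lambda>t. (J (id_plus (\<lambda>x. V x + t *\<^sub>R X x) ` \<Omega>) - J (id_plus V ` \<Omega>)) / t)"
    by (auto simp: DJ_quotient_def)
  with DJ_tendsto[OF assms(3) Ck_ring_transport[OF D assms(1,2)]]
  show ?thesis by (simp add: DERIV_def transported_DHJ_def)
qed

text \<open>By the mean value theorem the second difference equals \<open>t\<close> times a difference of first
  derivatives at points \<open>t (\<theta> X + Y)\<close> and \<open>t \<theta> X\<close>, where \<open>\<theta>\<close> depends on \<open>t\<close>. The limit along moving
  directions applies once \<open>\<theta>\<close> converges, hence the passage to a subsequence.\<close>

lemma second_difference_tendsto:
  assumes X: "X \<in> Ck_ring 1 D" and Y: "Y \<in> Ck_ring 1 D"
    and c: "c > 0" "\<And>s t. \<bar>s\<bar> \<le> c \<Longrightarrow> \<bar>t\<bar> \<le> c \<Longrightarrow> small_field D (\<lambda>x. t *\<^sub>R Y x + s *\<^sub>R X x) \<and>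
        shape_differentiable J (id_plus (\<lambda>x. t *\<^sub>R Y x + s *\<^sub>R X x) ` \<Omega>) D"
    and \<tau>: "\<And>n. 0 < \<tau> n" "\<And>n. \<tau> n \<le> c" "\<tau> \<longlonglongrightarrow> 0"
  defines "E \<equiv> \<lambda>s t. J (id_plus (\<lambda>x. t *\<^sub>R Y x + s *\<^sub>R X x) ` \<Omega>)"
  obtains r where "strict_mono (r :: nat \<Rightarrow> nat)"
    "(\<lambda>n. (E (\<tau> (r n)) (\<tau> (r n)) - E (\<tau> (r n)) 0 - E 0 (\<tau> (r n)) + E 0 0) / (\<tau> (r n))\<^sup>2) \<longlonglongrightarrow> frakD2HJ J \<Omega> D X Y"
proof -
  define A where "A = (\<lambda>s t. transported_DHJ J \<Omega> D X (\<lambda>x. t *\<^sub>R Y x + s *\<^sub>R X x))"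
  have der: "((\<lambda>s. E s t) has_real_derivative A s t) (at s)" if "\<bar>s\<bar> \<le> c" "\<bar>t\<bar> \<le> c" for s t
  proof -
    have "((\<lambda>u. J (id_plus (\<lambda>x. (t *\<^sub>R Y x + s *\<^sub>R X x) + u *\<^sub>R X x) ` \<Omega>)) has_real_derivative A s t) (at 0)"
      unfolding A_def using c(2)[OF that] by (intro perturbation_has_derivative X) auto
    moreover have "J (id_plus (\<lambda>x. (t *\<^sub>R Y x + s *\<^sub>R X x) + u *\<^sub>R X x) ` \<Omega>) = E (s + u) t" for u
      by (simp add: E_def algebra_simps)
    ultimately show ?thesis by (simp add: DERIV_def)
  qed
  have "\<exists>\<theta>. 0 \<le> \<theta> \<and> \<theta> \<le> 1 \<and> E (\<tau> n) (\<tau> n) - E (\<tau> n) 0 - E 0 (\<tau> n) + E 0 0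
      = \<tau> n * (A (\<tau> n * \<theta>) (\<tau> n) - A (\<tau> n * \<theta>) 0)" for n
  proof -
    have "\<exists>z>0. z < \<tau> n \<and> (E (\<tau> n) (\<tau> n) - E (\<tau> n) 0) - (E 0 (\<tau> n) - E 0 0) = (\<tau> n - 0) * (A z (\<tau> n) - A z 0)"
    proof (rule MVT2[OF \<tau>(1)])
      fix s assume "0 \<le> s" "s \<le> \<tau> n"
      then show "((\<lambda>s. E s (\<tau> n) - E s 0) has_real_derivative A s (\<tau> n) - A s 0) (at s)"
        using \<tau>(1,2)[of n] c(1) by (intro DERIV_diff der) auto
    qed
    then obtain z where "0 < z" "z < \<tau> n" "(E (\<tau> n) (\<tau> n) - E (\<tau> n) 0) - (E 0 (\<tau> n) - E 0 0) = \<tau> n * (A z (\<tau> n) - A z 0)"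
      by auto
    then show ?thesis using \<tau>(1)[of n] by (intro exI[of _ "z / \<tau> n"]) (auto simp: field_simps)
  qed
  then obtain \<theta> where \<theta>: "\<And>n. 0 \<le> \<theta> n" "\<And>n. \<theta> n \<le> 1" "\<And>n. E (\<tau> n) (\<tau> n) - E (\<tau> n) 0 - E 0 (\<tau> n) + E 0 0
      = \<tau> n * (A (\<tau> n * \<theta> n) (\<tau> n) - A (\<tau> n * \<theta> n) 0)" by metis
  have "\<forall>n. \<theta> n \<in> {0..1}" using \<theta>(1,2) by simp
  then obtain l r where r: "l \<in> {0..1::real}" "strict_mono (r :: nat \<Rightarrow> nat)" "(\<theta> \<circ> r) \<longlonglongrightarrow> l"
    using compact_Icc[of 0 "1::real"] unfolding compact_def by metis
  have lX: "(\<lambda>x. l *\<^sub>R X x) \<in> Ck_ring 1 D" by (rule Ck_ring_cmul[OF D(1) X])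
  have \<tau>r: "filterlim (\<lambda>n. \<tau> (r n)) (at 0) sequentially"
    unfolding filterlim_at using \<tau>(1) LIMSEQ_subseq_LIMSEQ[OF \<tau>(3) r(2)]
    by (auto simp: comp_def less_imp_neq[symmetric])
  have d0: "(\<lambda>n. \<bar>\<theta> (r n) - l\<bar> * C1_norm D X * (1 + real CARD('d))) \<longlonglongrightarrow> 0"
  proof -
    have "(\<lambda>n. \<bar>(\<theta> \<circ> r) n - l\<bar> * C1_norm D X * (1 + real CARD('d))) \<longlonglongrightarrow> \<bar>l - l\<bar> * C1_norm D X * (1 + real CARD('d))"
      by (intro tendsto_intros r(3))
    then show ?thesis by simp
  qed
  have le: "C1_norm D (\<lambda>x. (\<theta> (r n) - l) *\<^sub>R X x) \<le> \<bar>\<theta> (r n) - l\<bar> * C1_norm D X * (1 + real CARD('d))" for n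
    by (rule C1_norm_cmul_le[OF D Ck_ring_1D(1)[OF D X]])
  have W1: "filterlim (\<lambda>n x. \<theta> (r n) *\<^sub>R X x) (C1_ring_nhds D (\<lambda>x. l *\<^sub>R X x)) sequentially"
  proof (rule filterlim_norm_nhds)
    fix e :: real assume "e > 0"
    from order_tendstoD(2)[OF d0 this]
    show "\<forall>\<^sub>F n in sequentially. (\<lambda>x. \<theta> (r n) *\<^sub>R X x) \<in> Ck_ring 1 D \<and> C1_norm D (\<lambda>x. \<theta> (r n) *\<^sub>R X x - l *\<^sub>R X x) < e"
      by (rule eventually_mono) (use le Ck_ring_cmul[OF D(1) X] in \<open>auto simp: scaleR_diff_left[symmetric] intro: le_less_trans\<close>)
  qed
  have W2: "filterlim (\<lambda>n x. Y x + \<theta> (r n) *\<^sub>R X x) (C1_ring_nhds D (\<lambda>x. Y x + l *\<^sub>R X x)) sequentially"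
  proof (rule filterlim_norm_nhds)
    fix e :: real assume "e > 0"
    from order_tendstoD(2)[OF d0 this]
    show "\<forall>\<^sub>F n in sequentially. (\<lambda>x. Y x + \<theta> (r n) *\<^sub>R X x) \<in> Ck_ring 1 D \<and>
        C1_norm D (\<lambda>x. (Y x + \<theta> (r n) *\<^sub>R X x) - (Y x + l *\<^sub>R X x)) < e"
      by (rule eventually_mono) (use le Ck_ring_add[OF D(1) Y Ck_ring_cmul[OF D(1) X]] in \<open>auto simp: scaleR_diff_left[symmetric] intro: le_less_trans\<close>)
  qed
  have "(\<lambda>n. frakD2HJ_quotient J \<Omega> D X (\<tau> (r n)) (\<lambda>x. Y x + \<theta> (r n) *\<^sub>R X x)
      - frakD2HJ_quotient J \<Omega> D X (\<tau> (r n)) (\<lambda>x. \<theta> (r n) *\<^sub>R X x))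
     \<longlonglongrightarrow> frakD2HJ J \<Omega> D X (\<lambda>x. Y x + l *\<^sub>R X x) - frakD2HJ J \<Omega> D X (\<lambda>x. l *\<^sub>R X x)"
    by (intro tendsto_diff frakD2HJ_tendsto_along X Y \<tau>r W1 W2 lX Ck_ring_add D)
  also have "frakD2HJ J \<Omega> D X (\<lambda>x. Y x + l *\<^sub>R X x) - frakD2HJ J \<Omega> D X (\<lambda>x. l *\<^sub>R X x) = frakD2HJ J \<Omega> D X Y"
    using frakD2HJ_linear(2)[OF Y lX X] by simp
  also have "(\<lambda>n. frakD2HJ_quotient J \<Omega> D X (\<tau> (r n)) (\<lambda>x. Y x + \<theta> (r n) *\<^sub>R X x)
      - frakD2HJ_quotient J \<Omega> D X (\<tau> (r n)) (\<lambda>x. \<theta> (r n) *\<^sub>R X x)) =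
    (\<lambda>n. (E (\<tau> (r n)) (\<tau> (r n)) - E (\<tau> (r n)) 0 - E 0 (\<tau> (r n)) + E 0 0) / (\<tau> (r n))\<^sup>2)"
  proof
    fix n
    have A: "transported_DHJ J \<Omega> D X (scale_field (\<tau> (r n)) (\<lambda>x. Y x + \<theta> (r n) *\<^sub>R X x)) = A (\<tau> (r n) * \<theta> (r n)) (\<tau> (r n))"
      "transported_DHJ J \<Omega> D X (scale_field (\<tau> (r n)) (\<lambda>x. \<theta> (r n) *\<^sub>R X x)) = A (\<tau> (r n) * \<theta> (r n)) 0"
      by (simp_all add: A_def scale_field_def scaleR_add_right)
    show "frakD2HJ_quotient J \<Omega> D X (\<tau> (r n)) (\<lambda>x. Y x + \<theta> (r n) *\<^sub>R X x)
      - frakD2HJ_quotient J \<Omega> D X (\<tau> (r n)) (\<lambda>x. \<theta> (r n) *\<^sub>R X x) =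
      (E (\<tau> (r n)) (\<tau> (r n)) - E (\<tau> (r n)) 0 - E 0 (\<tau> (r n)) + E 0 0) / (\<tau> (r n))\<^sup>2"
      unfolding \<theta>(3) frakD2HJ_quotient_def A using \<tau>(1)[of "r n"]
      by (simp add: field_simps power2_eq_square)
  qed
  finally show ?thesis using that r(2) by blast
qed

text \<open>The second difference is symmetric in the two fields. Its quotients converge to both values along
  suitable subsequences; the second one is chosen inside the first.\<close>

lemma frakD2HJ_symmetric:
  assumes X: "X \<in> Ck_ring 1 D" and Y: "Y \<in> Ck_ring 1 D"
  shows "frakD2HJ J \<Omega> D X Y = frakD2HJ J \<Omega> D Y X"
proof -
  obtain \<delta> where \<delta>: "\<delta> > 0" "\<And>Y. Y \<in> Ck_ring 1 D \<Longrightarrow> C1_norm D Y < \<delta> \<Longrightarrow>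
     small_field D Y \<and> shape_differentiable J (id_plus Y ` \<Omega>) D"
    by (rule shape_differentiable_nearby) (rule that)
  define d where "d = 1 + real CARD('d)"
  have d: "d \<ge> 1" by (simp add: d_def)
  define K where "K = (C1_norm D X + C1_norm D Y) * d * d + 1"
  note nn = Ck_ring_1D(7)[OF D X] Ck_ring_1D(7)[OF D Y]
  have K: "K > 0" using nn d by (simp add: K_def add_nonneg_pos)
  define c where "c = \<delta> / K"
  have c: "c > 0" using \<delta>(1) K by (simp add: c_def)
  have near: "small_field D (\<lambda>x. t *\<^sub>R Y x + s *\<^sub>R X x) \<and> shape_differentiable J (id_plus (\<lambda>x. t *\<^sub>R Y x + s *\<^sub>R X x) ` \<Omega>) D"
    if "\<bar>s\<bar> \<le> c" "\<bar>t\<bar> \<le> c" for s t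
  proof (rule \<delta>(2))
    have m: "(\<lambda>x. t *\<^sub>R Y x) \<in> Ck_ring 1 D" "(\<lambda>x. s *\<^sub>R X x) \<in> Ck_ring 1 D"
      using Ck_ring_cmul[OF D(1)] X Y by auto
    then show "(\<lambda>x. t *\<^sub>R Y x + s *\<^sub>R X x) \<in> Ck_ring 1 D" by (rule Ck_ring_add[OF D(1)])
    have "C1_norm D (\<lambda>x. t *\<^sub>R Y x + s *\<^sub>R X x) \<le> (C1_norm D (\<lambda>x. t *\<^sub>R Y x) + C1_norm D (\<lambda>x. s *\<^sub>R X x)) * d"
      using C1_norm_add_le[OF D Ck_ring_1D(1)[OF D m(1)] Ck_ring_1D(1)[OF D m(2)]] by (simp add: d_def)
    also have "\<dots> \<le> (\<bar>t\<bar> * C1_norm D Y * d + \<bar>s\<bar> * C1_norm D X * d) * d"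
      using C1_norm_cmul_le[OF D Ck_ring_1D(1)[OF D Y], of t] C1_norm_cmul_le[OF D Ck_ring_1D(1)[OF D X], of s] d
      by (intro mult_right_mono add_mono) (auto simp: d_def)
    also have "\<dots> \<le> (c * C1_norm D Y * d + c * C1_norm D X * d) * d"
      using that nn d by (intro mult_right_mono add_mono) auto
    also have "\<dots> = c * (K - 1)" by (simp add: K_def algebra_simps)
    also have "\<dots> < c * K" using c by simp
    also have "\<dots> = \<delta>" using K by (simp add: c_def)
    finally show "C1_norm D (\<lambda>x. t *\<^sub>R Y x + s *\<^sub>R X x) < \<delta>" .
  qed
  define \<tau> where "\<tau> = (\<lambda>n. c * inverse (real (Suc n)))"
  have \<tau>0: "\<tau> \<longlonglongrightarrow> 0"
    using tendsto_mult_right_zero[OF LIMSEQ_inverse_real_of_nat, of c] by (simp add: \<tau>_def)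
  have \<tau>: "0 < \<tau> n" "\<tau> n \<le> c" for n
    using c by (auto simp: \<tau>_def field_simps)
  define E where "E s t = J (id_plus (\<lambda>x. t *\<^sub>R Y x + s *\<^sub>R X x) ` \<Omega>)" for s t
  obtain r where r: "strict_mono (r :: nat \<Rightarrow> nat)"
    "(\<lambda>n. (E (\<tau> (r n)) (\<tau> (r n)) - E (\<tau> (r n)) 0 - E 0 (\<tau> (r n)) + E 0 0) / (\<tau> (r n))\<^sup>2) \<longlonglongrightarrow> frakD2HJ J \<Omega> D X Y"
    by (rule second_difference_tendsto[OF X Y c near \<tau> \<tau>0, folded E_def]) (assumption | rule that)+
  define \<sigma> where "\<sigma> = \<tau> \<circ> r"
  have \<sigma>0: "\<sigma> \<longlonglongrightarrow> 0" unfolding \<sigma>_def by (rule LIMSEQ_subseq_LIMSEQ[OF \<tau>0 r(1)])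
  have \<sigma>: "0 < \<sigma> n" "\<sigma> n \<le> c" for n using \<tau> by (auto simp: \<sigma>_def)
  have near': "small_field D (\<lambda>x. t *\<^sub>R X x + s *\<^sub>R Y x) \<and> shape_differentiable J (id_plus (\<lambda>x. t *\<^sub>R X x + s *\<^sub>R Y x) ` \<Omega>) D"
    if "\<bar>s\<bar> \<le> c" "\<bar>t\<bar> \<le> c" for s t
    using near[OF that(2,1)] by (simp add: add.commute)
  have E': "J (id_plus (\<lambda>x. t *\<^sub>R X x + s *\<^sub>R Y x) ` \<Omega>) = E t s" for s t
    by (simp add: E_def add.commute)
  obtain q where q: "strict_mono (q :: nat \<Rightarrow> nat)"
    "(\<lambda>n. (E (\<sigma> (q n)) (\<sigma> (q n)) - E 0 (\<sigma> (q n)) - E (\<sigma> (q n)) 0 + E 0 0) / (\<sigma> (q n))\<^sup>2) \<longlonglongrightarrow> frakD2HJ J \<Omega> D Y X"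
    by (rule second_difference_tendsto[OF Y X c near' \<sigma> \<sigma>0, unfolded E']) (assumption | rule that)+
  have "(\<lambda>n. (E (\<sigma> (q n)) (\<sigma> (q n)) - E (\<sigma> (q n)) 0 - E 0 (\<sigma> (q n)) + E 0 0) / (\<sigma> (q n))\<^sup>2) \<longlonglongrightarrow> frakD2HJ J \<Omega> D X Y"
    using LIMSEQ_subseq_LIMSEQ[OF r(2) q(1)] by (simp add: \<sigma>_def comp_def)
  moreover have "(\<lambda>n. (E (\<sigma> (q n)) (\<sigma> (q n)) - E (\<sigma> (q n)) 0 - E 0 (\<sigma> (q n)) + E 0 0) / (\<sigma> (q n))\<^sup>2) \<longlonglongrightarrow> frakD2HJ J \<Omega> D Y X"
    using q(2) by (simp add: algebra_simps)
  ultimately show ?thesis by (rule LIMSEQ_unique)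
qed

end

end

section \<open>Partitions of unity and graph representations of the boundary\<close>

lemma bump_function:
  fixes p :: "real ^ 'd::finite"
  assumes "open V" "p \<in> V"
  obtains \<psi> :: "real ^ 'd \<Rightarrow> real" and r C where "r > 0" "Ck_on k UNIV \<psi>" "compact C" "C \<subseteq> V"
    "\<And>x. x \<in> ball p r \<Longrightarrow> \<psi> x = 1" "\<And>x. x \<notin> C \<Longrightarrow> \<psi> x = 0"
proof -
  obtain e where e: "e > 0" "cball p e \<subseteq> V" using assms open_contains_cball by blast
  define r where "r = e / 2"
  have r: "r > 0" "cball p (2 * r) \<subseteq> V" using e by (auto simp: r_def)
  define a where "a x = (4 - (x - p) \<bullet> (x - p) / r\<^sup>2) / 3" for x
  \<comment> \<open>The argument \<open>a\<close> exceeds 1 on the ball of radius \<open>r\<close> and is negative off the ball of radius \<open>2 * r\<close>.\<close>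
  define \<psi> where "\<psi> x = 1 - max 0 (1 - max 0 (a x) ^ Suc k) ^ Suc k" for x
  have "Ck_on k UNIV a"
  proof -
    have "Ck_on k UNIV (\<lambda>x. (x - p) \<bullet> (x - p))"
      by (intro Ck_on_inner Ck_on_diff Ck_on_ident Ck_on_const open_UNIV)
    then have "Ck_on k UNIV (\<lambda>x. (4 - (x - p) \<bullet> (x - p) * inverse (r\<^sup>2)) * (1 / 3))"
      by (intro Ck_on_mult Ck_on_diff Ck_on_const open_UNIV)
    moreover have "(4 - (x - p) \<bullet> (x - p) * inverse (r\<^sup>2)) * (1 / 3) = a x" for x
      unfolding a_def by (simp only: divide_inverse mult_1_left)
    ultimately show ?thesis by simp
  qed
  then have Ck: "Ck_on k UNIV \<psi>"
    unfolding \<psi>_def[abs_def]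
    by (intro Ck_on_diff Ck_on_max_power Ck_on_const open_UNIV lessI)
  have one: "\<psi> x = 1" if "x \<in> ball p r" for x
  proof -
    have "(x - p) \<bullet> (x - p) \<le> r\<^sup>2"
      using that by (simp add: power2_norm_eq_inner[symmetric] dist_norm norm_minus_commute power_mono)
    then have "(x - p) \<bullet> (x - p) / r\<^sup>2 \<le> 1" using r by simp
    then have "1 \<le> max 0 (a x)" by (simp add: a_def)
    then have "1 \<le> max 0 (a x) ^ Suc k" by (rule one_le_power)
    then have "max 0 (1 - max 0 (a x) ^ Suc k) = 0" by linarith
    then show ?thesis by (simp add: \<psi>_def del: power_Suc)
  qed
  have zero: "\<psi> x = 0" if "x \<notin> cball p (2 * r)" for x
  proof -
    have "2 * r \<le> norm (x - p)" using that by (simp add: dist_norm norm_minus_commute)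
    then have "(2 * r)\<^sup>2 \<le> (x - p) \<bullet> (x - p)"
      using r by (subst power2_norm_eq_inner[symmetric]) (intro power_mono, auto)
    then have "4 \<le> (x - p) \<bullet> (x - p) / r\<^sup>2" using r by (simp add: field_simps power_mult_distrib)
    then have "max 0 (a x) = 0" by (simp add: a_def)
    then show ?thesis by (simp add: \<psi>_def)
  qed
  show ?thesis
    by (rule that[OF r(1) Ck compact_cball r(2) one zero])
qed

text \<open>With cut-off functions \<open>\<psi>\<^sub>i\<close> equal to 1 on smaller balls, the recursion \<open>l\<^sub>j = \<psi>\<^sub>j \<Prod>\<^sub>i (1 - \<psi>\<^sub>i)\<close> over the earlier
  indices gives \<open>\<Sum>\<^sub>i l\<^sub>i = 1 - \<Prod>\<^sub>i (1 - \<psi>\<^sub>i)\<close>, which is 1 on the union of these balls.\<close>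

lemma partition_of_unity:
  fixes K :: "(real ^ 'd::finite) set"
  assumes "compact K" "\<And>p. p \<in> K \<Longrightarrow> open (N p)" "\<And>p. p \<in> K \<Longrightarrow> p \<in> N p"
  obtains I C and l :: "real ^ 'd \<Rightarrow> real ^ 'd \<Rightarrow> real" where "finite I" "I \<subseteq> K"
    "\<And>i. i \<in> I \<Longrightarrow> Ck_on k UNIV (l i)" "\<And>i. i \<in> I \<Longrightarrow> compact (C i)" "\<And>i. i \<in> I \<Longrightarrow> C i \<subseteq> N i"
    "\<And>i x. i \<in> I \<Longrightarrow> x \<notin> C i \<Longrightarrow> l i x = 0" "\<And>x. x \<in> K \<Longrightarrow> (\<Sum>i\<in>I. l i x) = 1"
proof -
  define Q where "Q p \<psi> r C \<longleftrightarrow> r > 0 \<and> Ck_on k UNIV \<psi> \<and> compact C \<and> C \<subseteq> N p \<and>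
      (\<forall>x\<in>ball p r. \<psi> x = 1) \<and> (\<forall>x. x \<notin> C \<longrightarrow> \<psi> x = 0)"
    for p and \<psi> :: "real ^ 'd \<Rightarrow> real" and r C
  have "\<forall>p\<in>K. \<exists>\<psi> r C. Q p \<psi> r C"
  proof
    fix p assume pK: "p \<in> K"
    show "\<exists>\<psi> r C. Q p \<psi> r C"
      unfolding Q_def by (rule bump_function[OF assms(2)[OF pK] assms(3)[OF pK], where k=k]) blast
  qed
  then obtain \<psi> r C where Q: "\<And>p. p \<in> K \<Longrightarrow> Q p (\<psi> p) (r p) (C p)"
    by metis
  then have \<psi>: "\<And>p. p \<in> K \<Longrightarrow> r p > 0" "\<And>p. p \<in> K \<Longrightarrow> Ck_on k UNIV (\<psi> p)"
    "\<And>p. p \<in> K \<Longrightarrow> compact (C p)" "\<And>p. p \<in> K \<Longrightarrow> C p \<subseteq> N p"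
    "\<And>p x. p \<in> K \<Longrightarrow> x \<in> ball p (r p) \<Longrightarrow> \<psi> p x = 1" "\<And>p x. p \<in> K \<Longrightarrow> x \<notin> C p \<Longrightarrow> \<psi> p x = 0"
    by (auto simp: Q_def)
  have cov: "K \<subseteq> (\<Union>p\<in>K. ball p (r p))" using \<psi>(1) by force
  obtain I where I: "I \<subseteq> K" "finite I" "K \<subseteq> (\<Union>p\<in>I. ball p (r p))"
    by (rule compactE_image[OF assms(1) _ cov]) auto
  have "\<exists>l. (\<forall>i\<in>A. Ck_on k UNIV (l i) \<and> (\<forall>x. x \<notin> C i \<longrightarrow> l i x = 0)) \<and>
     (\<forall>x. (\<Sum>i\<in>A. l i x) = 1 - (\<Prod>i\<in>A. 1 - \<psi> i x))" if "finite A" "A \<subseteq> K" for A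
    using that
  proof (induction A rule: finite_induct)
    case empty
    show ?case by simp
  next
    case (insert j A)
    then obtain l where l0: "(\<forall>i\<in>A. Ck_on k UNIV (l i) \<and> (\<forall>x. x \<notin> C i \<longrightarrow> l i x = 0)) \<and>
       (\<forall>x. (\<Sum>i\<in>A. l i x) = 1 - (\<Prod>i\<in>A. 1 - \<psi> i x))" by auto
    then have l: "\<And>i. i \<in> A \<Longrightarrow> Ck_on k UNIV (l i)" "\<And>i x. i \<in> A \<Longrightarrow> x \<notin> C i \<Longrightarrow> l i x = 0"
      "\<And>x. (\<Sum>i\<in>A. l i x) = 1 - (\<Prod>i\<in>A. 1 - \<psi> i x)" by auto
    define l' where "l' = l(j := \<lambda>x. \<psi> j x * (\<Prod>i\<in>A. 1 - \<psi> i x))"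
    have "Ck_on k UNIV (\<lambda>x. \<psi> j x * (\<Prod>i\<in>A. 1 - \<psi> i x))"
      using insert.prems \<psi>(2) by (intro Ck_on_mult Ck_on_prod Ck_on_diff Ck_on_const open_UNIV) auto
    moreover have "(\<Sum>i\<in>insert j A. l' i x) = 1 - (\<Prod>i\<in>insert j A. 1 - \<psi> i x)" for x
    proof -
      have "(\<Sum>i\<in>A. l' i x) = (\<Sum>i\<in>A. l i x)"
        using insert.hyps by (intro sum.cong) (auto simp: l'_def)
      then show ?thesis using insert.hyps l(3)[of x] by (simp add: l'_def algebra_simps)
    qed
    ultimately show ?case
      using l(1,2) insert.prems \<psi>(6) by (intro exI[of _ l']) (auto simp: l'_def)
  qed
  from this[OF I(2,1)] obtain l where l: "\<And>i. i \<in> I \<Longrightarrow> Ck_on k UNIV (l i)" "\<And>i x. i \<in> I \<Longrightarrow> x \<notin> C i \<Longrightarrow> l i x = 0"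
      "\<And>x. (\<Sum>i\<in>I. l i x) = 1 - (\<Prod>i\<in>I. 1 - \<psi> i x)" by blast
  have "(\<Prod>i\<in>I. 1 - \<psi> i x) = 0" if xK: "x \<in> K" for x
  proof -
    obtain p where "p \<in> I" "x \<in> ball p (r p)" using I(3) xK by blast
    then show ?thesis using \<psi>(5)[of p x] I(1,2) by (intro prod_zero) (auto intro!: bexI[of _ p])
  qed
  then have "(\<Sum>i\<in>I. l i x) = 1" if "x \<in> K" for x using l(3) that by simp
  moreover have "C i \<subseteq> N i" "compact (C i)" if "i \<in> I" for i using \<psi>(3,4) I(1) that by auto
  ultimately show ?thesis by (intro that[of I l C] I l) assumption+
qed

lemma Ck_on_cutoff:
  assumes "open V" "Ck_on k V f" "Ck_on k UNIV l" "compact C" "C \<subseteq> V" "\<And>x. x \<notin> C \<Longrightarrow> l x = 0"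
  shows "Ck_on k UNIV (\<lambda>x. l x *\<^sub>R f x)"
proof -
  have o: "open (- C)" using assms(4) compact_imp_closed by blast
  have "Ck_on k V (\<lambda>x. l x *\<^sub>R f x)"
    using Ck_on_mono[OF assms(3), of k V] by (intro Ck_on_scaleR assms) auto
  moreover have "Ck_on k (- C) (\<lambda>x. l x *\<^sub>R f x)"
    using Ck_on_cong[OF o, of "\<lambda>x. l x *\<^sub>R f x" "\<lambda>x. 0"] Ck_on_const[OF o] assms(6) by simp
  ultimately have "Ck_on k (V \<union> - C) (\<lambda>x. l x *\<^sub>R f x)" by (rule Ck_on_Un[OF assms(1) o])
  moreover have "V \<union> - C = UNIV" using assms(5) by blast
  ultimately show ?thesis by simp
qed

lemma global_extension:
  fixes K :: "(real ^ 'd::finite) set" and f :: "real ^ 'd \<Rightarrow> 'b::real_normed_vector"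
  assumes "compact K" "K \<subseteq> D" "open D"
    "\<And>p. p \<in> K \<Longrightarrow> \<exists>U F. open U \<and> p \<in> U \<and> Ck_on k U F \<and> (\<forall>x\<in>K \<inter> U. F x = f x)"
  obtains F C where "Ck_on k UNIV F" "\<And>x. x \<in> K \<Longrightarrow> F x = f x" "compact C" "C \<subseteq> D" "\<And>x. x \<notin> C \<Longrightarrow> F x = 0"
proof -
  from assms(4) obtain U F where U: "\<And>p. p \<in> K \<Longrightarrow> open (U p)" "\<And>p. p \<in> K \<Longrightarrow> p \<in> U p"
    "\<And>p. p \<in> K \<Longrightarrow> Ck_on k (U p) (F p)" "\<And>p x. p \<in> K \<Longrightarrow> x \<in> K \<Longrightarrow> x \<in> U p \<Longrightarrow> F p x = f x"
    by (metis IntI)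
  have N: "open (U p \<inter> D)" "p \<in> U p \<inter> D" if "p \<in> K" for p
    using U(1,2)[OF that] assms(2,3) that by auto
  obtain I C l where l: "finite I" "I \<subseteq> K"
    "\<And>i. i \<in> I \<Longrightarrow> Ck_on k UNIV (l i)" "\<And>i. i \<in> I \<Longrightarrow> compact (C i)" "\<And>i. i \<in> I \<Longrightarrow> C i \<subseteq> U i \<inter> D"
    "\<And>i x. i \<in> I \<Longrightarrow> x \<notin> C i \<Longrightarrow> l i x = 0" "\<And>x. x \<in> K \<Longrightarrow> (\<Sum>i\<in>I. l i x) = (1::real)"
    by (rule partition_of_unity[OF assms(1), of "\<lambda>p. U p \<inter> D" k, OF N]) auto
  define G where "G x = (\<Sum>i\<in>I. l i x *\<^sub>R F i x)" for x
  have "Ck_on k UNIV G"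
    unfolding G_def[abs_def]
  proof (rule Ck_on_sum[OF open_UNIV])
    fix i assume i: "i \<in> I"
    then have iK: "i \<in> K" using l(2) by blast
    show "Ck_on k UNIV (\<lambda>x. l i x *\<^sub>R F i x)"
      by (rule Ck_on_cutoff[OF U(1,3)[OF iK] l(3)[OF i] l(4)[OF i] _ l(6)[OF i]]) (use l(5)[OF i] in auto)
  qed
  moreover have "G x = f x" if xK: "x \<in> K" for x
  proof -
    have "l i x *\<^sub>R F i x = l i x *\<^sub>R f x" if "i \<in> I" for i
      using l(2) l(5,6)[of i] that xK U(4)[of i x] by (cases "x \<in> C i") auto
    then have "G x = (\<Sum>i\<in>I. l i x *\<^sub>R f x)" unfolding G_def by (intro sum.cong) auto
    also have "\<dots> = f x" using l(7)[OF xK] by (simp add: scaleR_sum_left[symmetric])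
    finally show ?thesis .
  qed
  moreover have "compact (\<Union>i\<in>I. C i)" using l(1,4) by auto
  moreover have "(\<Union>i\<in>I. C i) \<subseteq> D" using l(5) by auto
  moreover have "G x = 0" if "x \<notin> (\<Union>i\<in>I. C i)" for x
    unfolding G_def using l(6) that by (intro sum.neutral) auto
  ultimately show ?thesis using that by blast
qed

lemma gradient_inner:
  assumes "f differentiable at x"
  shows "gradient f x \<bullet> v = frechet_derivative f (at x) v"
  using frechet_derivative_pd[OF assms, of v]
  by (simp add: gradient_def inner_vec_def pd_def mult.commute)

lemma gradient_eq:
  assumes "(f has_derivative f') (at x)"
  shows "gradient f x \<bullet> v = f' v"
  using gradient_inner[of f x v] assms has_derivative_eq_frechet differentiable_def by metis

text \<open>Near a boundary point the map \<open>x \<mapsto> x + (\<phi> x - x \<bullet> e) e\<close> straightens the boundary, where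
  \<open>e\<close> is the direction of the gradient at that point. It is injective because \<open>\<phi>\<close> increases along
  \<open>e\<close>, and the \<open>e\<close>-component of its inverse on the hyperplane is the graph function.\<close>

lemma local_graph:
  fixes \<phi> :: "real ^ 'd::finite \<Rightarrow> real"
  assumes \<phi>: "Ck_defining k \<Omega> U \<phi>" and k: "k \<ge> 1" and p: "p \<in> U" "p \<in> frontier \<Omega>"
  obtains V e u where "open V" "p \<in> V" "V \<subseteq> U" "norm e = 1" "Ck_on k V u"
    "\<And>x. x \<in> V \<Longrightarrow> x \<in> \<Omega> \<longleftrightarrow> x \<bullet> e < u x" "\<And>x. x \<in> V \<Longrightarrow> x \<in> frontier \<Omega> \<longleftrightarrow> x \<bullet> e = u x"
    "\<And>x c. x \<in> V \<Longrightarrow> x + c *\<^sub>R e \<in> V \<Longrightarrow> u (x + c *\<^sub>R e) = u x"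
proof -
  have U: "open U" "Ck_on k U \<phi>" "\<And>y. y \<in> U \<Longrightarrow> gradient \<phi> y \<noteq> 0"
    "\<Omega> \<inter> U = {y\<in>U. \<phi> y < 0}" "frontier \<Omega> \<inter> U = {y\<in>U. \<phi> y = 0}"
    using \<phi> by (auto simp: Ck_defining_def)
  have \<phi>d: "\<phi> differentiable at y" if "y \<in> U" for y
    by (rule Ck_on_differentiable[OF U(2) k U(1) that])
  define e where "e = gradient \<phi> p /\<^sub>R norm (gradient \<phi> p)"
  have e1: "norm e = 1" using U(3)[OF p(1)] by (simp add: e_def)
  then have ee: "e \<bullet> e = 1" by (simp add: norm_eq_1)
  define de where "de y = (\<Sum>i\<in>UNIV. e $ i * pd i \<phi> y)" for y
  have de: "frechet_derivative \<phi> (at y) e = de y" if "y \<in> U" for y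
    by (simp add: frechet_derivative_pd[OF \<phi>d[OF that]] de_def)
  have pdC: "Ck_on (k - 1) U (pd i \<phi>)" for i
    using U(2) k Ck_on_pd[of "k - 1" U \<phi> i] by simp
  have dep: "de p > 0"
  proof -
    have "de p = gradient \<phi> p \<bullet> e" using gradient_inner[OF \<phi>d[OF p(1)]] de[OF p(1)] by simp
    also have "\<dots> = norm (gradient \<phi> p)"
      using U(3)[OF p(1)] by (simp add: e_def dot_square_norm power2_eq_square)
    finally show ?thesis using U(3)[OF p(1)] by simp
  qed
  have "Ck_on (k - 1) U de"
    unfolding de_def[abs_def] by (intro Ck_on_sum Ck_on_mult Ck_on_const pdC U)
  then have "continuous_on U de" by (rule Ck_on_continuous)
  then have "open {y \<in> U. de y \<in> {0<..}}"
    using continuous_open_preimage[OF _ U(1) open_greaterThan] by (simp add: vimage_def Int_def)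
  then obtain \<epsilon> where \<epsilon>: "\<epsilon> > 0" "ball p \<epsilon> \<subseteq> {y \<in> U. de y \<in> {0<..}}"
    using p(1) dep open_contains_ball by (metis (no_types, lifting) greaterThan_iff mem_Collect_eq)
  define B where "B = ball p \<epsilon>"
  have B: "open B" "convex B" "p \<in> B" "B \<subseteq> U" "\<And>y. y \<in> B \<Longrightarrow> de y > 0"
    using \<epsilon> by (auto simp: B_def)
  define P where "P x = x - (x \<bullet> e) *\<^sub>R e" for x
  have P: "P x \<bullet> e = 0" "P e = 0" "P (P x) = P x" "P (x + c *\<^sub>R e) = P x" "x = P x + (x \<bullet> e) *\<^sub>R e" for x c
    by (simp_all add: P_def inner_diff_left inner_add_left ee algebra_simps)
  have blP: "bounded_linear P"
    unfolding P_def
    by (intro bounded_linear_sub bounded_linear_ident bounded_linear_scaleR_const bounded_linear_inner_left)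
  define G where "G x = P x + \<phi> x *\<^sub>R e" for x
  have PG: "P (G x) = P x" for x by (simp add: G_def P)
  have Ge: "G x \<bullet> e = \<phi> x" for x by (simp add: G_def P inner_add_left ee)
  have mono: "\<phi> x < \<phi> (x + c *\<^sub>R e)" if "x \<in> B" "x + c *\<^sub>R e \<in> B" "c > 0" for x c
  proof -
    have seg: "x + s *\<^sub>R e \<in> B" if "0 \<le> s" "s \<le> c" for s
    proof -
      have "x + s *\<^sub>R e = (1 - s / c) *\<^sub>R x + (s / c) *\<^sub>R (x + c *\<^sub>R e)"
        using \<open>c > 0\<close> by (simp add: algebra_simps)
      also have "\<dots> \<in> B"
        using that \<open>c > 0\<close> \<open>x \<in> B\<close> \<open>x + c *\<^sub>R e \<in> B\<close> by (intro convexD[OF B(2)]) auto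
      finally show ?thesis .
    qed
    have "(\<lambda>s. \<phi> (x + s *\<^sub>R e)) 0 < (\<lambda>s. \<phi> (x + s *\<^sub>R e)) c"
    proof (rule DERIV_pos_imp_increasing[OF that(3)])
      fix s assume s: "0 \<le> s" "s \<le> c"
      have m: "x + s *\<^sub>R e \<in> B" by (rule seg[OF s])
      then have mU: "x + s *\<^sub>R e \<in> U" using B by blast
      have d: "(\<phi> has_derivative frechet_derivative \<phi> (at (x + s *\<^sub>R e))) (at (x + s *\<^sub>R e))"
        using \<phi>d[OF mU] frechet_derivative_works by blast
      have a: "((\<lambda>s. x + s *\<^sub>R e) has_derivative (\<lambda>h. h *\<^sub>R e)) (at s)"
        by (auto intro!: derivative_eq_intros)
      have "((\<lambda>s. \<phi> (x + s *\<^sub>R e)) has_derivative (\<lambda>h. frechet_derivative \<phi> (at (x + s *\<^sub>R e)) (h *\<^sub>R e))) (at s)"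
        by (rule has_derivative_compose[OF a d])
      moreover have "frechet_derivative \<phi> (at (x + s *\<^sub>R e)) (h *\<^sub>R e) = de (x + s *\<^sub>R e) * h" for h
        using has_derivative_linear[OF d] de[OF mU] by (simp add: linear_scale)
      ultimately have "((\<lambda>s. \<phi> (x + s *\<^sub>R e)) has_real_derivative de (x + s *\<^sub>R e)) (at s)"
        by (simp add: has_field_derivative_def)
      then show "\<exists>y. ((\<lambda>s. \<phi> (x + s *\<^sub>R e)) has_real_derivative y) (at s) \<and> 0 < y"
        using B(5)[OF m] by blast
    qed
    then show ?thesis by simp
  qed
  have same_line: "x = y + ((x - y) \<bullet> e) *\<^sub>R e" if "P x = P y" for x y
    using that by (simp add: P_def inner_diff_left algebra_simps)
  have mono_iff: "\<phi> x < \<phi> y \<longleftrightarrow> x \<bullet> e < y \<bullet> e" "\<phi> x = \<phi> y \<longleftrightarrow> x \<bullet> e = y \<bullet> e" if "x \<in> B" "y \<in> B" "P x = P y" for x y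
  proof -
    have lt: "\<phi> x < \<phi> y" if "x \<bullet> e < y \<bullet> e" "x \<in> B" "y \<in> B" "P x = P y" for x y
      using mono[of x "(y - x) \<bullet> e"] same_line[of y x] that by (simp add: inner_diff_left)
    have xy: "x = y" if "x \<bullet> e = y \<bullet> e"
      using same_line[OF \<open>P x = P y\<close>] that by (simp add: inner_diff_left)
    consider "x \<bullet> e < y \<bullet> e" | "y \<bullet> e < x \<bullet> e" | "x \<bullet> e = y \<bullet> e" by linarith
    then have "(\<phi> x < \<phi> y \<longleftrightarrow> x \<bullet> e < y \<bullet> e) \<and> (\<phi> x = \<phi> y \<longleftrightarrow> x \<bullet> e = y \<bullet> e)"
    proof cases
      case 1
      then show ?thesis using lt[of x y] \<open>x \<in> B\<close> \<open>y \<in> B\<close> \<open>P x = P y\<close> by auto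
    next
      case 2
      then show ?thesis using lt[of y x] \<open>x \<in> B\<close> \<open>y \<in> B\<close> \<open>P x = P y\<close> by auto
    qed (use xy in auto)
    then show "\<phi> x < \<phi> y \<longleftrightarrow> x \<bullet> e < y \<bullet> e" "\<phi> x = \<phi> y \<longleftrightarrow> x \<bullet> e = y \<bullet> e"
      by auto
  qed
  have injG: "inj_on G B"
  proof (rule inj_onI)
    fix x y assume xy: "x \<in> B" "y \<in> B" "G x = G y"
    have Pxy: "P x = P y" using xy(3) PG by metis
    have "\<phi> x = \<phi> y" using xy(3) Ge by metis
    then have "x \<bullet> e = y \<bullet> e" using mono_iff(2)[OF xy(1,2) Pxy] by simp
    then show "x = y" using same_line[OF Pxy] by (simp add: inner_diff_left)
  qed
  have "continuous_on B \<phi>" using Ck_on_continuous[OF U(2)] B(4) continuous_on_subset by blast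
  then have contG: "continuous_on B G"
    unfolding G_def[abs_def]
    using linear_continuous_on[OF blP] by (intro continuous_intros) auto
  have openGB: "open (G ` B)" by (rule invariance_of_domain[OF contG B(1) injG])
  obtain H where H: "homeomorphism B (G ` B) G H"
    by (rule invariance_of_domain_homeomorphism[OF B(1) contG _ injG]) auto
  have HG: "H (G x) = x" if "x \<in> B" for x using H that by (simp add: homeomorphism_def)
  have GH: "G (H y) = y" "H y \<in> B" if "y \<in> G ` B" for y using H that by (auto simp: homeomorphism_def)
  have contH: "continuous_on (G ` B) H" using H by (simp add: homeomorphism_def)
  \<comment> \<open>The derivative of the inverse is explicit: \<open>v \<mapsto> P v + \<partial>\<phi> v e\<close> is inverted by solving for the \<open>e\<close>-component.\<close>
  have derH: "(H has_derivative (\<lambda>w. P w + ((w \<bullet> e - frechet_derivative \<phi> (at (H y)) (P w)) / de (H y)) *\<^sub>R e)) (at y)"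
    if y: "y \<in> G ` B" for y
  proof (rule has_derivative_inverse_basic[where f=G and g=H and T="G ` B"])
    have m: "H y \<in> U" "de (H y) > 0" using GH(2)[OF y] B by auto
    have d: "(\<phi> has_derivative frechet_derivative \<phi> (at (H y))) (at (H y))"
      using \<phi>d[OF m(1)] frechet_derivative_works by blast
    note lin = has_derivative_linear[OF d] and bl = has_derivative_bounded_linear[OF d]
    show "(G has_derivative (\<lambda>v. P v + frechet_derivative \<phi> (at (H y)) v *\<^sub>R e)) (at (H y))"
      unfolding G_def[abs_def]
      by (intro has_derivative_add has_derivative_scaleR_left d bounded_linear_imp_has_derivative blP)
    show "bounded_linear (\<lambda>w. P w + ((w \<bullet> e - frechet_derivative \<phi> (at (H y)) (P w)) / de (H y)) *\<^sub>R e)"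
      by (intro bounded_linear_add blP bounded_linear_scaleR_const bounded_linear_divide[THEN bounded_linear_compose]
        bounded_linear_sub bounded_linear_inner_left bounded_linear_ident bounded_linear_compose[OF bl blP])
    show "(\<lambda>w. P w + ((w \<bullet> e - frechet_derivative \<phi> (at (H y)) (P w)) / de (H y)) *\<^sub>R e) \<circ>
      (\<lambda>v. P v + frechet_derivative \<phi> (at (H y)) v *\<^sub>R e) = id"
    proof
      fix v
      have "frechet_derivative \<phi> (at (H y)) v = frechet_derivative \<phi> (at (H y)) (P v + (v \<bullet> e) *\<^sub>R e)"
        using P(5)[of v] by simp
      also have "\<dots> = frechet_derivative \<phi> (at (H y)) (P v) + (v \<bullet> e) * de (H y)"
        using lin de[OF m(1)] by (simp add: linear_add linear_scale)
      finally have "(frechet_derivative \<phi> (at (H y)) v - frechet_derivative \<phi> (at (H y)) (P v)) / de (H y) = v \<bullet> e"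
        using m(2) by simp
      then show "((\<lambda>w. P w + ((w \<bullet> e - frechet_derivative \<phi> (at (H y)) (P w)) / de (H y)) *\<^sub>R e) \<circ>
        (\<lambda>v. P v + frechet_derivative \<phi> (at (H y)) v *\<^sub>R e)) v = id v"
        using P(5)[of v, symmetric] by (simp add: P inner_add_left ee)
    qed
    show "continuous (at y) H" using contH openGB y continuous_on_eq_continuous_at by blast
  qed (use openGB y GH in auto)
  \<comment> \<open>The graph representation holds where the line through \<open>x\<close> in direction \<open>e\<close> meets the boundary inside \<open>B\<close>.\<close>
  define V where "V = {x \<in> B. P x \<in> G ` B}"
  have V: "open V"
  proof -
    have "V = B \<inter> P -` (G ` B)" by (auto simp: V_def)
    then show ?thesis
      using B(1) open_vimage[OF openGB linear_continuous_on[OF blP]] by auto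
  qed
  have "\<phi> p = 0" using p U(5) by blast
  then have "G p = P p" by (simp add: G_def)
  then have pV: "p \<in> V" using B(3) by (auto simp: V_def intro: rev_image_eqI)
  define u where "u x = H (P x) \<bullet> e" for x
  define R where "R x = P x + u x *\<^sub>R e" for x
  have R: "H (P x) = R x" "R x \<in> B" "\<phi> (R x) = 0" "P (R x) = P x" "R x \<bullet> e = u x" if "x \<in> V" for x
  proof -
    have m: "P x \<in> G ` B" using that by (simp add: V_def)
    have "P (H (P x)) = P (G (H (P x)))" by (simp add: PG)
    also have "\<dots> = P x" by (simp add: GH[OF m] P)
    finally show 1: "H (P x) = R x" using P(5)[of "H (P x)"] by (simp add: R_def u_def)
    show "R x \<in> B" using GH(2)[OF m] 1 by simp
    have "\<phi> (H (P x)) = G (H (P x)) \<bullet> e" by (simp add: Ge)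
    also have "\<dots> = 0" by (simp add: GH[OF m] P)
    finally show "\<phi> (R x) = 0" using 1 by simp
    show "P (R x) = P x" "R x \<bullet> e = u x" by (simp_all add: R_def P inner_add_left ee)
  qed
  have char: "x \<in> \<Omega> \<longleftrightarrow> x \<bullet> e < u x" "x \<in> frontier \<Omega> \<longleftrightarrow> x \<bullet> e = u x" if x: "x \<in> V" for x
  proof -
    have xB: "x \<in> B" "x \<in> U" using x B(4) by (auto simp: V_def)
    have "x \<in> \<Omega> \<longleftrightarrow> \<phi> x < \<phi> (R x)" "x \<in> frontier \<Omega> \<longleftrightarrow> \<phi> x = \<phi> (R x)"
      using U(4,5) xB(2) R(3)[OF x] by auto
    then show "x \<in> \<Omega> \<longleftrightarrow> x \<bullet> e < u x" "x \<in> frontier \<Omega> \<longleftrightarrow> x \<bullet> e = u x"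
      using mono_iff[OF xB(1) R(2)[OF x]] R(4,5)[OF x] by auto
  qed
  have RU: "R x \<in> U" "de (R x) > 0" if "x \<in> V" for x using R(2)[OF that] B by auto
  have deru: "(u has_derivative (\<lambda>v. - frechet_derivative \<phi> (at (R x)) (P v) / de (R x))) (at x)" if x: "x \<in> V" for x
  proof -
    have m: "P x \<in> G ` B" using x by (simp add: V_def)
    have "((\<lambda>x. H (P x)) has_derivative
      (\<lambda>v. P (P v) + ((P v \<bullet> e - frechet_derivative \<phi> (at (H (P x))) (P (P v))) / de (H (P x))) *\<^sub>R e)) (at x)"
      by (rule has_derivative_compose[OF bounded_linear_imp_has_derivative[OF blP] derH[OF m]])
    then have "(u has_derivative (\<lambda>v. (P (P v) + ((P v \<bullet> e - frechet_derivative \<phi> (at (H (P x))) (P (P v))) / de (H (P x))) *\<^sub>R e) \<bullet> e)) (at x)"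
      unfolding u_def[abs_def] by (rule has_derivative_inner_left)
    then show ?thesis by (simp add: P inner_add_left inner_diff_left ee R[OF x])
  qed
  \<comment> \<open>The derivative of \<open>u\<close> is a \<open>C\<^sup>k\<^sup>-\<^sup>1\<close> function of \<open>x\<close> and \<open>u x\<close>, so each order of regularity gives the next.\<close>
  have Cu: "Ck_on j V u" if "j \<le> k" for j
    using that
  proof (induction j)
    case 0
    have "continuous_on V u"
      using has_derivative_continuous[OF deru] by (auto intro: continuous_at_imp_continuous_on)
    then show ?case by (simp add: Ck_on_0)
  next
    case (Suc j)
    then have uj: "Ck_on j V u" by simp
    have Rj: "Ck_on j V R"
      unfolding R_def[abs_def]
      by (intro Ck_on_add Ck_on_scaleR Ck_on_const Ck_on_bounded_linear blP uj V)
    have pj: "Ck_on j V (\<lambda>x. pd i \<phi> (R x))" for i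
      using Suc.prems RU by (intro Ck_on_compose[OF V U(1) Ck_on_mono[OF pdC] Rj]) auto
    have dj: "Ck_on j V (\<lambda>x. de (R x) powr (- 1))"
      unfolding de_def
      by (rule Ck_on_powr[OF V]) (use RU in \<open>auto simp: de_def intro!: Ck_on_sum Ck_on_mult Ck_on_const pj V\<close>)
    show ?case
    proof (rule Ck_on_SucI[OF V deru])
      fix i
      have a: "Ck_on j V (\<lambda>x. - (\<Sum>l\<in>UNIV. P (axis i 1) $ l * pd l \<phi> (R x)) * de (R x) powr (- 1))"
        by (intro Ck_on_mult Ck_on_minus Ck_on_sum Ck_on_const pj dj V)
      have b: "- (\<Sum>l\<in>UNIV. P (axis i 1) $ l * pd l \<phi> (R x)) * de (R x) powr (- 1)
         = - frechet_derivative \<phi> (at (R x)) (P (axis i 1)) / de (R x)" if "x \<in> V" for x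
        using RU[OF that] \<phi>d by (simp add: frechet_derivative_pd powr_minus divide_inverse)
      show "Ck_on j V (\<lambda>x. - frechet_derivative \<phi> (at (R x)) (P (axis i 1)) / de (R x))"
        by (rule iffD1[OF Ck_on_cong[OF V b] a])
    qed
  qed
  show ?thesis
  proof (rule that[OF V pV _ e1 Cu[OF order_refl]])
    show "V \<subseteq> U" using B(4) by (auto simp: V_def)
    show "u (x + c *\<^sub>R e) = u x" for x c by (simp add: u_def P)
  qed (use char in auto)
qed

section \<open>Normal vectors and tangential derivatives\<close>

lemma Ck_defining_mono:
  "Ck_defining k \<Omega> U \<phi> \<Longrightarrow> j \<le> k \<Longrightarrow> Ck_defining j \<Omega> U \<phi>"
  unfolding Ck_defining_def using Ck_on_mono by blast

lemma Ck_boundary_mono: "Ck_boundary k \<Omega> \<Longrightarrow> j \<le> k \<Longrightarrow> Ck_boundary j \<Omega>"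
  unfolding Ck_boundary_def using Ck_defining_mono by meson

lemma directional_derivative:
  fixes f :: "real ^ 'd::finite \<Rightarrow> real"
  assumes "f differentiable at x"
  shows "((\<lambda>s. f (x + s *\<^sub>R v)) has_real_derivative gradient f x \<bullet> v) (at 0)"
proof -
  have d: "(f has_derivative frechet_derivative f (at x)) (at (x + 0 *\<^sub>R v))"
    using assms unfolding frechet_derivative_works by simp
  have a: "((\<lambda>s. x + s *\<^sub>R v) has_derivative (\<lambda>h. h *\<^sub>R v)) (at (0::real))"
    by (auto intro!: derivative_eq_intros)
  have "((\<lambda>s. f (x + s *\<^sub>R v)) has_derivative (\<lambda>h. frechet_derivative f (at x) (h *\<^sub>R v))) (at 0)"
    by (rule has_derivative_compose[OF a d])
  moreover have "frechet_derivative f (at x) (h *\<^sub>R v) = (gradient f x \<bullet> v) * h" for h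
    using has_derivative_linear[OF d] by (simp add: linear_scale gradient_inner[OF assms])
  ultimately show ?thesis by (simp add: has_field_derivative_def)
qed

text \<open>A direction in which \<open>\<phi>\<close> decreases points into \<open>\<Omega>\<close>, where every defining function is
  negative, so the open half spaces determined by the two gradients coincide.\<close>

lemma unit_normal_unique:
  assumes "Ck_defining 1 \<Omega> U \<phi>" "Ck_defining 1 \<Omega> V \<psi>" "x \<in> U" "x \<in> V" "x \<in> frontier \<Omega>"
  shows "gradient \<phi> x /\<^sub>R norm (gradient \<phi> x) = gradient \<psi> x /\<^sub>R norm (gradient \<psi> x)"
proof -
  have U: "open U" "Ck_on 1 U \<phi>" "gradient \<phi> x \<noteq> 0" "\<Omega> \<inter> U = {y\<in>U. \<phi> y < 0}" "frontier \<Omega> \<inter> U = {y\<in>U. \<phi> y = 0}"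
    using assms(1,3) by (auto simp: Ck_defining_def)
  have V: "open V" "Ck_on 1 V \<psi>" "gradient \<psi> x \<noteq> 0" "\<Omega> \<inter> V = {y\<in>V. \<psi> y < 0}" "frontier \<Omega> \<inter> V = {y\<in>V. \<psi> y = 0}"
    using assms(2,4) by (auto simp: Ck_defining_def)
  have dU: "\<phi> differentiable at x" by (rule Ck_on_differentiable[OF U(2) _ U(1) assms(3)]) simp
  have dV: "\<psi> differentiable at x" by (rule Ck_on_differentiable[OF V(2) _ V(1) assms(4)]) simp
  have z: "\<phi> x = 0" "\<psi> x = 0" using U(5) V(5) assms(3-5) by auto
  have key: "gradient \<psi> x \<bullet> v \<le> 0" if v: "gradient \<phi> x \<bullet> v < 0" for v
  proof (rule ccontr)
    assume "\<not> gradient \<psi> x \<bullet> v \<le> 0"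
    then have "gradient \<psi> x \<bullet> v > 0" by simp
    from DERIV_pos_inc_right[OF directional_derivative[OF dV] this]
    obtain d1 where d1: "d1 > 0" "\<And>h. 0 < h \<Longrightarrow> h < d1 \<Longrightarrow> \<psi> x < \<psi> (x + h *\<^sub>R v)" by auto
    from DERIV_neg_dec_right[OF directional_derivative[OF dU] v]
    obtain d2 where d2: "d2 > 0" "\<And>h. 0 < h \<Longrightarrow> h < d2 \<Longrightarrow> \<phi> (x + h *\<^sub>R v) < \<phi> x" by auto
    have "((\<lambda>h. x + h *\<^sub>R v) \<longlongrightarrow> x + 0 *\<^sub>R v) (at_right (0::real))"
      by (intro tendsto_intros)
    moreover have "open (U \<inter> V)" "x + 0 *\<^sub>R v \<in> U \<inter> V" using U(1) V(1) assms(3,4) by auto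
    ultimately have "\<forall>\<^sub>F h in at_right (0::real). x + h *\<^sub>R v \<in> U \<inter> V"
      using topological_tendstoD by blast
    moreover have "\<forall>\<^sub>F h in at_right (0::real). h \<in> {0<..<min d1 d2}"
      by (rule eventually_at_right_real) (use d1 d2 in auto)
    ultimately have "\<forall>\<^sub>F h in at_right (0::real). False"
    proof eventually_elim
      case (elim h)
      have "\<phi> (x + h *\<^sub>R v) < 0" using d2(2)[of h] elim z by auto
      then have "x + h *\<^sub>R v \<in> \<Omega>" using U(4) elim by blast
      then have "\<psi> (x + h *\<^sub>R v) < 0" using V(4) elim by blast
      then show False using d1(2)[of h] elim z by auto
    qed
    then show False by simp
  qed
  define a where "a = gradient \<phi> x /\<^sub>R norm (gradient \<phi> x)"
  define b where "b = gradient \<psi> x /\<^sub>R norm (gradient \<psi> x)"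
  have ab: "norm a = 1" "norm b = 1" "gradient \<phi> x = norm (gradient \<phi> x) *\<^sub>R a" "gradient \<psi> x = norm (gradient \<psi> x) *\<^sub>R b"
    using U(3) V(3) by (auto simp: a_def b_def)
  have k2: "b \<bullet> v \<le> 0" if "a \<bullet> v < 0" for v
  proof -
    have "gradient \<phi> x \<bullet> v < 0"
      using that U(3) by (subst ab(3)) (simp add: mult_pos_neg)
    from key[OF this] show ?thesis
      by (subst (asm) ab(4)) (use V(3) in \<open>simp add: mult_le_0_iff\<close>)
  qed
  have "a = b"
  proof (rule ccontr)
    assume "a \<noteq> b"
    then have "0 < (a - b) \<bullet> (a - b)" by simp
    moreover have "a \<bullet> a = 1" "b \<bullet> b = 1" using ab(1,2) by (simp_all add: norm_eq_1)
    ultimately have lt: "a \<bullet> b < 1" by (simp add: inner_diff_left inner_diff_right inner_commute)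
    then have "a \<bullet> (b - a) < 0" using \<open>a \<bullet> a = 1\<close> by (simp add: inner_diff_right)
    from k2[OF this] show False using lt \<open>b \<bullet> b = 1\<close> by (simp add: inner_diff_right inner_commute)
  qed
  then show ?thesis by (simp add: a_def b_def)
qed

lemma outward_normal_eq:
  assumes "Ck_defining k \<Omega> U \<phi>" "k \<ge> 1" "x \<in> U" "x \<in> frontier \<Omega>"
  shows "outward_normal \<Omega> x = gradient \<phi> x /\<^sub>R norm (gradient \<phi> x)"
  unfolding outward_normal_def
proof (rule the_equality)
  have d: "Ck_defining 1 \<Omega> U \<phi>" by (rule Ck_defining_mono[OF assms(1,2)])
  show "\<exists>V \<psi>. x \<in> V \<and> Ck_defining 1 \<Omega> V \<psi> \<and> gradient \<phi> x /\<^sub>R norm (gradient \<phi> x) = gradient \<psi> x /\<^sub>R norm (gradient \<psi> x)"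
    using d assms(3) by blast
  show "n = gradient \<phi> x /\<^sub>R norm (gradient \<phi> x)"
    if "\<exists>V \<psi>. x \<in> V \<and> Ck_defining 1 \<Omega> V \<psi> \<and> n = gradient \<psi> x /\<^sub>R norm (gradient \<psi> x)" for n
    using that unit_normal_unique[OF _ d _ assms(3,4)] by blast
qed

text \<open>The graph function is cut off so that the field \<open>x \<mapsto> u x *\<^sub>R e\<close> is globally defined; only its
  values on the ball describe the boundary.\<close>

definition boundary_chart ::
    "nat \<Rightarrow> (real ^ 'd::finite) set \<Rightarrow> (real ^ 'd) set \<Rightarrow> real ^ 'd \<Rightarrow> real \<Rightarrow> real ^ 'd \<Rightarrow> (real ^ 'd \<Rightarrow> real) \<Rightarrow> bool" where
  "boundary_chart k D \<Omega> p r e u \<longleftrightarrow> norm e = 1 \<and> r > 0 \<and> ball p r \<subseteq> D \<and> Ck_on k UNIV u \<and>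
     (\<exists>C. compact C \<and> C \<subseteq> D \<and> (\<forall>x. x \<notin> C \<longrightarrow> u x = 0)) \<and>
     (\<forall>x\<in>ball p r. (x \<in> \<Omega> \<longleftrightarrow> x \<bullet> e < u x) \<and> (x \<in> frontier \<Omega> \<longleftrightarrow> x \<bullet> e = u x)) \<and>
     (\<forall>x\<in>ball p r. \<forall>c. x + c *\<^sub>R e \<in> ball p r \<longrightarrow> u (x + c *\<^sub>R e) = u x)"

lemma boundary_chart_exists:
  assumes "Ck_boundary k \<Omega>" "k \<ge> 1" "open D" "p \<in> frontier \<Omega>" "p \<in> D"
  obtains r e u where "boundary_chart k D \<Omega> p r e u"
proof -
  obtain U \<phi> where U: "p \<in> U" "Ck_defining k \<Omega> U \<phi>"
    using assms(1,4) unfolding Ck_boundary_def by blast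
  obtain V e u where V: "open V" "p \<in> V" "V \<subseteq> U" "norm e = 1" "Ck_on k V u"
    "\<And>x. x \<in> V \<Longrightarrow> x \<in> \<Omega> \<longleftrightarrow> x \<bullet> e < u x" "\<And>x. x \<in> V \<Longrightarrow> x \<in> frontier \<Omega> \<longleftrightarrow> x \<bullet> e = u x"
    "\<And>x c. x \<in> V \<Longrightarrow> x + c *\<^sub>R e \<in> V \<Longrightarrow> u (x + c *\<^sub>R e) = u x"
    by (rule local_graph[OF U(2) assms(2) U(1) assms(4)]) (rule that)
  have o: "open (V \<inter> D)" "p \<in> V \<inter> D" using V assms by auto
  obtain \<psi> r C where b: "r > 0" "Ck_on k UNIV \<psi>" "compact C" "C \<subseteq> V \<inter> D"
    "\<And>x. x \<in> ball p r \<Longrightarrow> \<psi> x = (1::real)" "\<And>x. x \<notin> C \<Longrightarrow> \<psi> x = 0"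
    by (rule bump_function[OF o, of k]) (rule that)
  have sub: "ball p r \<subseteq> V \<inter> D" using b(4-6) by fastforce
  define w where "w x = \<psi> x *\<^sub>R u x" for x
  have "Ck_on k UNIV w"
    unfolding w_def[abs_def] by (rule Ck_on_cutoff[OF V(1,5) b(2,3) _ b(6)]) (use b(4) in auto)
  moreover have "w x = u x" if "x \<in> ball p r" for x using b(5)[OF that] by (simp add: w_def)
  moreover have "\<exists>C. compact C \<and> C \<subseteq> D \<and> (\<forall>x. x \<notin> C \<longrightarrow> w x = 0)"
    using b(3,4,6) by (intro exI[of _ C]) (auto simp: w_def)
  ultimately have "boundary_chart k D \<Omega> p r e w"
    unfolding boundary_chart_def using V(4,6,7,8) b(1) sub by (auto simp: subset_iff)
  then show ?thesis by (rule that)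
qed

context
  fixes k D \<Omega> and p :: "real ^ 'd::finite" and r e u
  assumes ch: "boundary_chart k D \<Omega> p r e u" and k: "k \<ge> 1"
begin

lemma chart:
  shows "e \<bullet> e = 1" "r > 0" "ball p r \<subseteq> D" "Ck_on k UNIV u"
    "x \<in> ball p r \<Longrightarrow> x \<in> \<Omega> \<longleftrightarrow> x \<bullet> e < u x" "x \<in> ball p r \<Longrightarrow> x \<in> frontier \<Omega> \<longleftrightarrow> x \<bullet> e = u x"
    "x \<in> ball p r \<Longrightarrow> x + c *\<^sub>R e \<in> ball p r \<Longrightarrow> u (x + c *\<^sub>R e) = u x"
  using ch by (auto simp: boundary_chart_def norm_eq_1)

lemma chart_has_derivative: "(u has_derivative frechet_derivative u (at x)) (at x)"
  using Ck_on_differentiable[OF chart(4) k open_UNIV, of x] frechet_derivative_works by auto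

lemma chart_linear: "linear (frechet_derivative u (at x))"
  by (rule has_derivative_linear[OF chart_has_derivative])

text \<open>In the ball the graph function is constant along \<open>e\<close>, hence so is its derivative.\<close>

lemma chart_derivative_shift:
  assumes "x \<in> ball p r" "x + c *\<^sub>R e \<in> ball p r"
  shows "frechet_derivative u (at (x + c *\<^sub>R e)) = frechet_derivative u (at x)"
proof -
  define W where "W = ball p r \<inter> (\<lambda>y. y + c *\<^sub>R e) -` ball p r"
  have W: "open W" "x \<in> W"
    unfolding W_def using assms by (auto intro!: open_Int open_vimage continuous_intros)
  have a: "((\<lambda>y. y + c *\<^sub>R e) has_derivative (\<lambda>v. v)) (at x)"
    by (auto intro!: derivative_eq_intros)
  have "((\<lambda>y. u (y + c *\<^sub>R e)) has_derivative frechet_derivative u (at (x + c *\<^sub>R e))) (at x)"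
    by (rule has_derivative_compose[OF a chart_has_derivative])
  then have "(u has_derivative frechet_derivative u (at (x + c *\<^sub>R e))) (at x)"
    by (rule has_derivative_transform_within_open[OF _ W]) (auto simp: W_def chart(7))
  then show ?thesis by (rule has_derivative_eq_frechet[symmetric])
qed

lemma chart_derivative_e:
  assumes "x \<in> ball p r"
  shows "frechet_derivative u (at x) e = 0"
proof -
  have a: "((\<lambda>s. x + s *\<^sub>R e) has_derivative (\<lambda>h. h *\<^sub>R e)) (at (0::real))"
    by (auto intro!: derivative_eq_intros)
  have "((\<lambda>s. u (x + s *\<^sub>R e)) has_derivative (\<lambda>h. frechet_derivative u (at x) (h *\<^sub>R e))) (at (0::real))"
    by (rule has_derivative_compose[OF a]) (simp add: chart_has_derivative)
  moreover have "((\<lambda>s. u (x + s *\<^sub>R e)) has_derivative (\<lambda>h. 0)) (at (0::real))"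
  proof (rule has_derivative_transform_within_open[OF has_derivative_const])
    show "open ((\<lambda>s. x + s *\<^sub>R e) -` ball p r)" by (auto intro!: open_vimage continuous_intros)
  qed (use assms chart(7)[OF assms] in auto)
  ultimately have "(\<lambda>h. frechet_derivative u (at x) (h *\<^sub>R e)) = (\<lambda>h. 0)"
    by (rule has_derivative_unique)
  from fun_cong[OF this, of 1] show ?thesis by simp
qed

lemma chart_defining: "Ck_defining k \<Omega> (ball p r) (\<lambda>x. x \<bullet> e - u x)"
  and chart_gradient: "x \<in> ball p r \<Longrightarrow> gradient (\<lambda>x. x \<bullet> e - u x) x \<bullet> v = v \<bullet> e - frechet_derivative u (at x) v"
proof -
  have d: "((\<lambda>x. x \<bullet> e - u x) has_derivative (\<lambda>v. v \<bullet> e - frechet_derivative u (at x) v)) (at x)" for x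
    by (intro has_derivative_diff has_derivative_inner_left has_derivative_ident chart_has_derivative)
  show g: "x \<in> ball p r \<Longrightarrow> gradient (\<lambda>x. x \<bullet> e - u x) x \<bullet> v = v \<bullet> e - frechet_derivative u (at x) v" for x v
    by (rule gradient_eq[OF d])
  have "gradient (\<lambda>x. x \<bullet> e - u x) x \<noteq> 0" if "x \<in> ball p r" for x
    using g[OF that, of e] chart_derivative_e[OF that] chart(1) by auto
  moreover have "Ck_on k (ball p r) (\<lambda>x. x \<bullet> e - u x)"
    by (intro Ck_on_diff Ck_on_bounded_linear bounded_linear_inner_left Ck_on_mono[OF chart(4)]) auto
  ultimately show "Ck_defining k \<Omega> (ball p r) (\<lambda>x. x \<bullet> e - u x)"
    unfolding Ck_defining_def using chart(5,6) by auto
qed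

text \<open>The function \<open>x \<bullet> e - u x\<close> is a defining function in the ball, so its gradient is normal to the
  boundary.\<close>

lemma chart_tangent_iff:
  assumes "x \<in> ball p r" "x \<in> frontier \<Omega>"
  shows "v \<bullet> outward_normal \<Omega> x = 0 \<longleftrightarrow> v \<bullet> e = frechet_derivative u (at x) v"
proof -
  let ?g = "gradient (\<lambda>x. x \<bullet> e - u x) x"
  have n: "outward_normal \<Omega> x = ?g /\<^sub>R norm ?g"
    by (rule outward_normal_eq[OF chart_defining k assms])
  have "?g \<noteq> 0" using chart_defining assms(1) by (simp add: Ck_defining_def)
  then show ?thesis
    unfolding n using chart_gradient[OF assms(1), of v] by (simp add: inner_commute)
qed

lemma chart_norm_outward_normal:
  assumes "x \<in> ball p r" "x \<in> frontier \<Omega>"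
  shows "norm (outward_normal \<Omega> x) = 1"
  using outward_normal_eq[OF chart_defining k assms] chart_defining assms(1) by (simp add: Ck_defining_def)

text \<open>The local retraction onto the boundary slides points along \<open>e\<close> until they meet the graph.\<close>

definition chart_retraction :: "real ^ 'd \<Rightarrow> real ^ 'd" where
  "chart_retraction x = x - (x \<bullet> e - u x) *\<^sub>R e"

lemma chart_retraction_Ck: "Ck_on k UNIV chart_retraction"
  unfolding chart_retraction_def[abs_def]
  by (intro Ck_on_diff Ck_on_scaleR Ck_on_const Ck_on_ident Ck_on_bounded_linear bounded_linear_inner_left chart(4) open_UNIV)

lemma chart_retraction_has_derivative:
  "(chart_retraction has_derivative (\<lambda>v. v - (v \<bullet> e - frechet_derivative u (at x) v) *\<^sub>R e)) (at x)"
  unfolding chart_retraction_def[abs_def]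
  by (intro has_derivative_diff has_derivative_scaleR_left has_derivative_inner_left has_derivative_ident chart_has_derivative)

lemma chart_retraction_id: "x \<in> ball p r \<Longrightarrow> x \<in> frontier \<Omega> \<Longrightarrow> chart_retraction x = x"
  by (simp add: chart_retraction_def chart(6))

lemma chart_retraction_frontier:
  assumes "x \<in> ball p r" "chart_retraction x \<in> ball p r"
  shows "chart_retraction x \<in> frontier \<Omega>"
proof -
  have e: "chart_retraction x = x + (u x - x \<bullet> e) *\<^sub>R e"
    by (simp add: chart_retraction_def scaleR_diff_left)
  have "u (chart_retraction x) = u x"
    using assms unfolding e by (rule chart(7))
  moreover have "chart_retraction x \<bullet> e = u x" unfolding e by (simp add: inner_add_left chart(1))
  ultimately show ?thesis using chart(6)[OF assms(2)] by simp
qed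

text \<open>The retraction takes values in the boundary, so the image of its derivative is tangential.\<close>

lemma chart_retraction_tangent:
  assumes "x \<in> ball p r" "chart_retraction x \<in> ball p r"
  shows "frechet_derivative chart_retraction (at x) v \<bullet> outward_normal \<Omega> (chart_retraction x) = 0"
proof -
  let ?w = "v - (v \<bullet> e - frechet_derivative u (at x) v) *\<^sub>R e"
  have e: "chart_retraction x = x + (u x - x \<bullet> e) *\<^sub>R e"
    by (simp add: chart_retraction_def scaleR_diff_left)
  have "frechet_derivative u (at (chart_retraction x)) = frechet_derivative u (at x)"
    using assms unfolding e by (rule chart_derivative_shift)
  moreover have "?w \<bullet> e = frechet_derivative u (at x) v"
    by (simp add: inner_diff_left chart(1))
  moreover have "frechet_derivative u (at x) ?w = frechet_derivative u (at x) v"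
    using chart_derivative_e[OF assms(1)] by (simp add: linear_diff[OF chart_linear] linear_scale[OF chart_linear])
  ultimately have "?w \<bullet> outward_normal \<Omega> (chart_retraction x) = 0"
    by (simp add: chart_tangent_iff[OF assms(2) chart_retraction_frontier[OF assms]])
  then show ?thesis by (simp add: has_derivative_eq_frechet[OF chart_retraction_has_derivative])
qed

lemma chart_retraction_ball:
  assumes "p \<in> frontier \<Omega>"
  obtains r' where "r' > 0" "r' \<le> r" "\<And>x. x \<in> ball p r' \<Longrightarrow> chart_retraction x \<in> ball p r"
proof -
  have "continuous_on UNIV chart_retraction" by (rule Ck_on_continuous[OF chart_retraction_Ck])
  then have "open (chart_retraction -` ball p r)" by (intro open_vimage open_ball)
  moreover have "p \<in> chart_retraction -` ball p r"
    using chart_retraction_id[of p] assms chart(2) by simp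
  ultimately obtain d where "d > 0" "ball p d \<subseteq> chart_retraction -` ball p r"
    using open_contains_ball by blast
  then show ?thesis
    using chart(2) by (intro that[of "min d r"]) (auto simp: subset_iff)
qed

end

lemma compact_derivative_bound:
  fixes F :: "real ^ 'd::finite \<Rightarrow> 'b::real_normed_vector"
  assumes "Ck_on 1 U F" "open U" "compact K" "K \<subseteq> U"
  obtains B where "B \<ge> 0" "\<And>x v. x \<in> K \<Longrightarrow> norm (frechet_derivative F (at x) v) \<le> B * norm v"
    "\<And>x. x \<in> K \<Longrightarrow> norm (F x) \<le> B"
proof -
  have "bounded (G ` K)" if "continuous_on U G" for G :: "real ^ 'd \<Rightarrow> 'b"
    by (intro compact_imp_bounded compact_continuous_image continuous_on_subset[OF that] assms)
  moreover have "continuous_on U (pd i F)" for i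
    using Ck_on_pd[of 0 U F i] assms(1) by (simp add: Ck_on_0)
  ultimately have "\<exists>B>0. \<forall>x\<in>K. norm (pd i F x) \<le> B" for i
    unfolding bounded_pos by simp
  then obtain b where b: "\<And>i. b i > 0" "\<And>i x. x \<in> K \<Longrightarrow> norm (pd i F x) \<le> b i" by metis
  have "bounded (F ` K)"
    by (intro compact_imp_bounded compact_continuous_image continuous_on_subset[OF Ck_on_continuous[OF assms(1)]] assms)
  then obtain c where c: "c > 0" "\<And>x. x \<in> K \<Longrightarrow> norm (F x) \<le> c" unfolding bounded_pos by auto
  show ?thesis
  proof (rule that[of "c + (\<Sum>i\<in>UNIV. b i)"])
    show "0 \<le> c + (\<Sum>i\<in>UNIV. b i)" using b(1) c(1) by (intro add_nonneg_nonneg sum_nonneg) (auto intro: less_imp_le)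
    show "norm (F x) \<le> c + (\<Sum>i\<in>UNIV. b i)" if "x \<in> K" for x
      using c(2)[OF that] sum_nonneg[of UNIV b] b(1) by (smt (verit) less_imp_le)
    show "norm (frechet_derivative F (at x) v) \<le> (c + (\<Sum>i\<in>UNIV. b i)) * norm v" if x: "x \<in> K" for x v
    proof -
      have "F differentiable at x" by (rule Ck_on_differentiable[OF assms(1) order_refl assms(2)]) (use x assms(4) in auto)
      then have "norm (frechet_derivative F (at x) v) = norm (\<Sum>i\<in>UNIV. v $ i *\<^sub>R pd i F x)"
        by (simp add: frechet_derivative_pd)
      also have "\<dots> \<le> (\<Sum>i\<in>UNIV. norm v * b i)"
      proof (rule sum_norm_le)
        show "norm (v $ i *\<^sub>R pd i F x) \<le> norm v * b i" for i
          unfolding norm_scaleR using component_le_norm_cart[of v i] b(2)[OF x, of i] by (intro mult_mono) auto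
      qed
      also have "\<dots> = (\<Sum>i\<in>UNIV. b i) * norm v" by (simp add: sum_distrib_left mult.commute)
      also have "\<dots> \<le> (c + (\<Sum>i\<in>UNIV. b i)) * norm v" using c(1) by (intro mult_right_mono) auto
      finally show ?thesis .
    qed
  qed
qed

context
  fixes D \<Omega> :: "(real ^ 'd::finite) set"
  assumes D: "open D" and Om: "Ck_boundary 1 \<Omega>" "frontier \<Omega> \<subseteq> D" "compact (frontier \<Omega>)" "frontier \<Omega> \<noteq> {}"
begin

lemma norm_outward_normal:
  assumes "x \<in> frontier \<Omega>"
  shows "norm (outward_normal \<Omega> x) = 1"
proof -
  have "x \<in> D" using assms Om(2) by blast
  then obtain r e u where c: "boundary_chart 1 D \<Omega> x r e u"
    by (rule boundary_chart_exists[OF Om(1) _ D assms, of thesis for thesis, OF order_refl]) (rule that)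
  show ?thesis using chart_norm_outward_normal[OF c _ _ assms] chart(2)[OF c] by simp
qed

lemma outward_normal_inner: "x \<in> frontier \<Omega> \<Longrightarrow> outward_normal \<Omega> x \<bullet> outward_normal \<Omega> x = 1"
  using norm_outward_normal by (simp add: norm_eq_1)

text \<open>A map that vanishes on the boundary also vanishes after composition with a local retraction
  onto the boundary, whose derivative is the identity on tangent vectors.\<close>

lemma tangential_derivative_zero:
  assumes "x \<in> frontier \<Omega>" "(F has_derivative F') (at x)" "open W" "x \<in> W"
    "\<And>y. y \<in> frontier \<Omega> \<Longrightarrow> y \<in> W \<Longrightarrow> F y = 0" "v \<bullet> outward_normal \<Omega> x = 0"
  shows "F' v = 0"
proof -
  have xD: "x \<in> D" using assms(1) Om(2) by blast
  obtain r e u where c: "boundary_chart 1 D \<Omega> x r e u"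
    by (rule boundary_chart_exists[OF Om(1) order_refl D assms(1) xD]) (rule that)
  let ?R = "chart_retraction e u"
  have xr: "x \<in> ball x r" using chart(2)[OF c] by simp
  have Rx: "?R x = x" by (rule chart_retraction_id[OF c order_refl xr assms(1)])
  obtain r' where r': "r' > 0" "r' \<le> r" "\<And>y. y \<in> ball x r' \<Longrightarrow> ?R y \<in> ball x r"
    by (rule chart_retraction_ball[OF c order_refl assms(1)]) (rule that)
  define N where "N = ball x r' \<inter> ?R -` W"
  have N: "open N" "x \<in> N"
    using r'(1) assms(3,4) Rx Ck_on_continuous[OF chart_retraction_Ck[OF c order_refl]]
    by (auto simp: N_def intro!: open_Int open_vimage)
  have "((\<lambda>y. F (?R y)) has_derivative (\<lambda>v. F' (v - (v \<bullet> e - frechet_derivative u (at x) v) *\<^sub>R e))) (at x)"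
    by (rule has_derivative_compose[OF chart_retraction_has_derivative[OF c order_refl]]) (simp add: Rx assms(2))
  moreover have "((\<lambda>y. F (?R y)) has_derivative (\<lambda>v. 0)) (at x)"
  proof (rule has_derivative_transform_within_open[OF has_derivative_const N])
    fix y assume y: "y \<in> N"
    then have "y \<in> ball x r" "?R y \<in> ball x r" "?R y \<in> W" using r' by (auto simp: N_def)
    then show "0 = F (?R y)" using assms(5)[OF chart_retraction_frontier[OF c order_refl]] by simp
  qed
  ultimately have "(\<lambda>v. F' (v - (v \<bullet> e - frechet_derivative u (at x) v) *\<^sub>R e)) = (\<lambda>v. 0)"
    by (rule has_derivative_unique)
  from fun_cong[OF this, of v] show ?thesis
    using chart_tangent_iff[OF c order_refl xr assms(1), of v] assms(6) by simp
qed

text \<open>The regularity in the definition of \<open>C\<^sup>1\<close> maps on the boundary, without the convention about values off the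
  boundary. Unlike that convention it is inherited by differences.\<close>

definition local_C1 :: "(real ^ 'd \<Rightarrow> 'b::real_normed_vector) \<Rightarrow> bool" where
  "local_C1 f \<longleftrightarrow> (\<forall>p\<in>frontier \<Omega>. \<exists>U F. open U \<and> p \<in> U \<and> Ck_on 1 U F \<and> (\<forall>x\<in>frontier \<Omega> \<inter> U. F x = f x))"

lemma C1_maps_iff: "f \<in> C1_maps (frontier \<Omega>) \<longleftrightarrow> f \<in> extensional (frontier \<Omega>) \<and> local_C1 f"
  by (simp add: C1_maps_def local_C1_def)

lemma local_C1_I: "open U \<Longrightarrow> frontier \<Omega> \<subseteq> U \<Longrightarrow> Ck_on 1 U F \<Longrightarrow> (\<And>x. x \<in> frontier \<Omega> \<Longrightarrow> F x = f x) \<Longrightarrow> local_C1 f"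
  unfolding local_C1_def by blast

lemma local_C1_extension:
  assumes "local_C1 f"
  obtains F C where "Ck_on 1 UNIV F" "\<And>x. x \<in> frontier \<Omega> \<Longrightarrow> F x = f x" "compact C" "C \<subseteq> D" "\<And>x. x \<notin> C \<Longrightarrow> F x = 0"
  by (rule global_extension[OF Om(3,2) D, of 1 f]) (use assms in \<open>auto simp: local_C1_def\<close>)

lemma C1_extension_props:
  assumes "local_C1 f"
  obtains U where "open U" "frontier \<Omega> \<subseteq> U" "Ck_on 1 U (C1_extension (frontier \<Omega>) f)"
    "\<And>x. x \<in> frontier \<Omega> \<Longrightarrow> C1_extension (frontier \<Omega>) f x = f x"
proof -
  obtain F C where F: "Ck_on 1 UNIV F" "\<And>x. x \<in> frontier \<Omega> \<Longrightarrow> F x = f x" "compact C" "C \<subseteq> D" "\<And>x. x \<notin> C \<Longrightarrow> F x = 0"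
    by (rule local_C1_extension[OF assms]) (rule that)
  have "\<exists>F. (\<exists>U. open U \<and> frontier \<Omega> \<subseteq> U \<and> Ck_on 1 U F) \<and> (\<forall>x\<in>frontier \<Omega>. F x = f x)"
    using F(1,2) by (intro exI[of _ F] conjI exI[of _ UNIV]) auto
  from someI_ex[OF this] show ?thesis
    using that unfolding C1_extension_def by blast
qed

lemma C1_extension_derivative:
  assumes "local_C1 f" "x \<in> frontier \<Omega>" "(G has_derivative G') (at x)" "open W" "x \<in> W"
    "\<And>y. y \<in> frontier \<Omega> \<Longrightarrow> y \<in> W \<Longrightarrow> G y = f y" "v \<bullet> outward_normal \<Omega> x = 0"
  shows "frechet_derivative (C1_extension (frontier \<Omega>) f) (at x) v = G' v"
    and "C1_extension (frontier \<Omega>) f differentiable at x"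
proof -
  let ?F = "C1_extension (frontier \<Omega>) f"
  obtain U where U: "open U" "frontier \<Omega> \<subseteq> U" "Ck_on 1 U ?F" "\<And>x. x \<in> frontier \<Omega> \<Longrightarrow> ?F x = f x"
    by (rule C1_extension_props[OF assms(1)]) (rule that)
  show d: "?F differentiable at x"
    by (rule Ck_on_differentiable[OF U(3) order_refl U(1)]) (use U(2) assms(2) in auto)
  have "((\<lambda>y. ?F y - G y) has_derivative (\<lambda>v. frechet_derivative ?F (at x) v - G' v)) (at x)"
    using d frechet_derivative_works by (intro has_derivative_diff assms(3)) blast
  from tangential_derivative_zero[OF assms(2) this assms(4,5) _ assms(7)]
  show "frechet_derivative ?F (at x) v = G' v" using U(4) assms(6) by simp
qed

lemma tangent_projection: "x \<in> frontier \<Omega> \<Longrightarrow>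
    (v - (v \<bullet> outward_normal \<Omega> x) *\<^sub>R outward_normal \<Omega> x) \<bullet> outward_normal \<Omega> x = 0"
  by (simp add: inner_diff_left outward_normal_inner)

lemma norm_tangent_projection: "x \<in> frontier \<Omega> \<Longrightarrow>
    norm (v - (v \<bullet> outward_normal \<Omega> x) *\<^sub>R outward_normal \<Omega> x) \<le> 2 * norm v"
  using norm_triangle_ineq4[of v "(v \<bullet> outward_normal \<Omega> x) *\<^sub>R outward_normal \<Omega> x"]
    Cauchy_Schwarz_ineq2[of v "outward_normal \<Omega> x"] norm_outward_normal[of x] by simp

text \<open>Tangential derivatives can be computed from any local extension, because two extensions differ by a
  map that vanishes on the boundary.\<close>

lemma tangential_jacobian_mult:
  assumes "local_C1 g" "x \<in> frontier \<Omega>" "(G has_derivative G') (at x)" "open W" "x \<in> W"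
    "\<And>y. y \<in> frontier \<Omega> \<Longrightarrow> y \<in> W \<Longrightarrow> G y = g y"
  shows "tangential_jacobian \<Omega> g x *v v = G' (v - (v \<bullet> outward_normal \<Omega> x) *\<^sub>R outward_normal \<Omega> x)"
proof -
  let ?F = "C1_extension (frontier \<Omega>) g" and ?n = "outward_normal \<Omega> x"
  note t = tangent_projection[OF assms(2), of v]
  note c = C1_extension_derivative[OF assms t]
  have lin: "linear (frechet_derivative ?F (at x))" using c(2) linear_frechet_derivative by blast
  have "tangential_jacobian \<Omega> g x *v v = jacobian ?F (at x) *v v - (v \<bullet> ?n) *\<^sub>R (jacobian ?F (at x) *v ?n)"
    using assms(2) by (simp add: tangential_jacobian_def tangential_matrix_def matrix_vector_mult_diff_rdistrib outer_product_mult)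
  also have "\<dots> = frechet_derivative ?F (at x) (v - (v \<bullet> ?n) *\<^sub>R ?n)"
    by (simp add: jacobian_mult[OF c(2)] linear_diff[OF lin] linear_scale[OF lin])
  finally show ?thesis using c(1) by simp
qed

lemma tangential_gradient_inner:
  assumes "local_C1 g" "x \<in> frontier \<Omega>" "(G has_derivative G') (at x)" "open W" "x \<in> W"
    "\<And>y. y \<in> frontier \<Omega> \<Longrightarrow> y \<in> W \<Longrightarrow> G y = g y"
  shows "tangential_gradient \<Omega> g x \<bullet> v = G' (v - (v \<bullet> outward_normal \<Omega> x) *\<^sub>R outward_normal \<Omega> x)"
proof -
  let ?F = "C1_extension (frontier \<Omega>) g" and ?n = "outward_normal \<Omega> x"
  note t = tangent_projection[OF assms(2), of v]
  note c = C1_extension_derivative[OF assms t]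
  have "tangential_gradient \<Omega> g x \<bullet> v = gradient ?F x \<bullet> (v - (v \<bullet> ?n) *\<^sub>R ?n)"
    using assms(2) by (simp add: tangential_gradient_def tangential_def inner_diff_left inner_diff_right inner_commute)
  then show ?thesis using c(1) by (simp add: gradient_inner[OF c(2)])
qed

lemma C1_extension_bounds:
  assumes "local_C1 f"
  obtains B where "B \<ge> 0" "\<And>x v. x \<in> frontier \<Omega> \<Longrightarrow> norm (frechet_derivative (C1_extension (frontier \<Omega>) f) (at x) v) \<le> B * norm v"
    "\<And>x. x \<in> frontier \<Omega> \<Longrightarrow> norm (f x) \<le> B"
    "\<And>x. x \<in> frontier \<Omega> \<Longrightarrow> (C1_extension (frontier \<Omega>) f has_derivative frechet_derivative (C1_extension (frontier \<Omega>) f) (at x)) (at x)"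
proof -
  let ?F = "C1_extension (frontier \<Omega>) f"
  obtain U where U: "open U" "frontier \<Omega> \<subseteq> U" "Ck_on 1 U ?F" "\<And>x. x \<in> frontier \<Omega> \<Longrightarrow> ?F x = f x"
    by (rule C1_extension_props[OF assms(1)]) (rule that)
  obtain B where "B \<ge> 0" "\<And>x v. x \<in> frontier \<Omega> \<Longrightarrow> norm (frechet_derivative ?F (at x) v) \<le> B * norm v"
    "\<And>x. x \<in> frontier \<Omega> \<Longrightarrow> norm (?F x) \<le> B"
    by (rule compact_derivative_bound[OF U(3,1) Om(3) U(2)]) (rule that)
  moreover have "(?F has_derivative frechet_derivative ?F (at x)) (at x)" if "x \<in> frontier \<Omega>" for x
  proof -
    have "?F differentiable at x" by (rule Ck_on_differentiable[OF U(3) order_refl U(1)]) (use U(2) that in auto)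
    then show ?thesis using frechet_derivative_works by blast
  qed
  ultimately show ?thesis using that U(4) by metis
qed

text \<open>The suprema in the norm are over bounded sets: some extension has a continuous derivative near the
  compact boundary.\<close>

lemma boundary_C1_vnorm_ge:
  assumes "local_C1 g" "x \<in> frontier \<Omega>"
  shows "norm (g x) \<le> boundary_C1_vnorm \<Omega> g" "norm (tangential_jacobian \<Omega> g x) \<le> boundary_C1_vnorm \<Omega> g"
proof -
  let ?F = "C1_extension (frontier \<Omega>) g"
  obtain B where B: "B \<ge> 0" "\<And>x v. x \<in> frontier \<Omega> \<Longrightarrow> norm (frechet_derivative ?F (at x) v) \<le> B * norm v"
    "\<And>x. x \<in> frontier \<Omega> \<Longrightarrow> norm (g x) \<le> B"
    "\<And>x. x \<in> frontier \<Omega> \<Longrightarrow> (?F has_derivative frechet_derivative ?F (at x)) (at x)"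
    by (rule C1_extension_bounds[OF assms(1)]) (rule that)
  obtain U where U: "open U" "frontier \<Omega> \<subseteq> U" "Ck_on 1 U ?F" "\<And>x. x \<in> frontier \<Omega> \<Longrightarrow> ?F x = g x"
    by (rule C1_extension_props[OF assms(1)]) (rule that)
  have "norm (tangential_jacobian \<Omega> g y) \<le> real CARD('d) * (B * 2)" if y: "y \<in> frontier \<Omega>" for y
  proof -
    have "norm (tangential_jacobian \<Omega> g y *v axis j 1) \<le> B * 2" for j
    proof -
      have "tangential_jacobian \<Omega> g y *v axis j 1 = frechet_derivative ?F (at y) (axis j 1 - (axis j 1 \<bullet> outward_normal \<Omega> y) *\<^sub>R outward_normal \<Omega> y)"
        by (rule tangential_jacobian_mult[OF assms(1) y B(4)[OF y] U(1)]) (use U y in auto)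
      also have "norm \<dots> \<le> B * (2 * norm (axis j 1 :: real ^ 'd))"
        using B(1) norm_tangent_projection[OF y, of "axis j 1"] by (intro order_trans[OF B(2)[OF y]] mult_left_mono) auto
      finally show ?thesis by simp
    qed
    then have "(\<Sum>j\<in>UNIV. norm (tangential_jacobian \<Omega> g y *v axis j 1)) \<le> (\<Sum>j\<in>(UNIV::'d set). B * 2)"
      by (intro sum_mono)
    then show ?thesis using norm_matrix_le_sum_columns[of "tangential_jacobian \<Omega> g y"] by simp
  qed
  then have b2: "bdd_above ((\<lambda>x. norm (tangential_jacobian \<Omega> g x)) ` frontier \<Omega>)" by (rule bdd_aboveI2)
  have b1: "bdd_above ((\<lambda>x. norm (g x)) ` frontier \<Omega>)" using B(3) by (rule bdd_aboveI2)
  have "norm (g x) \<le> (SUP x\<in>frontier \<Omega>. norm (g x))" "norm (tangential_jacobian \<Omega> g x) \<le> (SUP x\<in>frontier \<Omega>. norm (tangential_jacobian \<Omega> g x))"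
    using cSUP_upper[OF assms(2) b1] cSUP_upper[OF assms(2) b2] by auto
  then show "norm (g x) \<le> boundary_C1_vnorm \<Omega> g" "norm (tangential_jacobian \<Omega> g x) \<le> boundary_C1_vnorm \<Omega> g"
    unfolding boundary_C1_vnorm_def using norm_ge_zero[of "g x"] norm_ge_zero[of "tangential_jacobian \<Omega> g x"] by linarith+
qed

lemma boundary_C1_norm_ge:
  assumes "local_C1 f" "x \<in> frontier \<Omega>"
  shows "\<bar>f x\<bar> \<le> boundary_C1_norm \<Omega> f" "norm (tangential_gradient \<Omega> f x) \<le> boundary_C1_norm \<Omega> f"
proof -
  let ?F = "C1_extension (frontier \<Omega>) f"
  obtain B where B: "B \<ge> 0" "\<And>x v. x \<in> frontier \<Omega> \<Longrightarrow> norm (frechet_derivative ?F (at x) v) \<le> B * norm v"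
    "\<And>x. x \<in> frontier \<Omega> \<Longrightarrow> norm (f x) \<le> B"
    "\<And>x. x \<in> frontier \<Omega> \<Longrightarrow> (?F has_derivative frechet_derivative ?F (at x)) (at x)"
    by (rule C1_extension_bounds[OF assms(1)]) (rule that)
  obtain U where U: "open U" "frontier \<Omega> \<subseteq> U" "Ck_on 1 U ?F" "\<And>x. x \<in> frontier \<Omega> \<Longrightarrow> ?F x = f x"
    by (rule C1_extension_props[OF assms(1)]) (rule that)
  have "norm (tangential_gradient \<Omega> f y) \<le> B * 2" if y: "y \<in> frontier \<Omega>" for y
  proof -
    let ?t = "tangential_gradient \<Omega> f y"
    have "?t \<bullet> ?t = frechet_derivative ?F (at y) (?t - (?t \<bullet> outward_normal \<Omega> y) *\<^sub>R outward_normal \<Omega> y)"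
      by (rule tangential_gradient_inner[OF assms(1) y B(4)[OF y] U(1)]) (use U y in auto)
    also have "\<dots> \<le> B * (2 * norm ?t)"
      using B(1) norm_tangent_projection[OF y] by (intro order_trans[OF order_trans[OF abs_ge_self B(2)[OF y, unfolded real_norm_def]]] mult_left_mono) auto
    finally have "norm ?t * norm ?t \<le> (B * 2) * norm ?t"
      by (simp add: dot_square_norm power2_eq_square algebra_simps)
    then show ?thesis using B(1) by (cases "norm ?t = 0") (auto simp: mult_le_cancel_right)
  qed
  then have b2: "bdd_above ((\<lambda>x. norm (tangential_gradient \<Omega> f x)) ` frontier \<Omega>)" by (rule bdd_aboveI2)
  have b1: "bdd_above ((\<lambda>x. \<bar>f x\<bar>) ` frontier \<Omega>)" using B(3)[unfolded real_norm_def] by (rule bdd_aboveI2)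
  have "\<bar>f x\<bar> \<le> (SUP x\<in>frontier \<Omega>. \<bar>f x\<bar>)" "norm (tangential_gradient \<Omega> f x) \<le> (SUP x\<in>frontier \<Omega>. norm (tangential_gradient \<Omega> f x))"
    using cSUP_upper[OF assms(2) b1] cSUP_upper[OF assms(2) b2] by auto
  then show "\<bar>f x\<bar> \<le> boundary_C1_norm \<Omega> f" "norm (tangential_gradient \<Omega> f x) \<le> boundary_C1_norm \<Omega> f"
    unfolding boundary_C1_norm_def using abs_ge_zero[of "f x"] norm_ge_zero[of "tangential_gradient \<Omega> f x"] by linarith+
qed

lemma boundary_C1_vnorm_le:
  assumes "\<And>x. x \<in> frontier \<Omega> \<Longrightarrow> norm (g x) \<le> a" "\<And>x. x \<in> frontier \<Omega> \<Longrightarrow> norm (tangential_jacobian \<Omega> g x) \<le> b"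
  shows "boundary_C1_vnorm \<Omega> g \<le> a + b"
  unfolding boundary_C1_vnorm_def using assms Om(4) by (intro add_mono cSUP_least) auto

end

section \<open>Extension of boundary fields with a bound\<close>

context
  fixes D \<Omega> :: "(real ^ 'd::finite) set"
  assumes D: "open D" "D \<noteq> {}"
    and Om: "Ck_boundary 1 \<Omega>" "frontier \<Omega> \<subseteq> D" "compact (frontier \<Omega>)" "frontier \<Omega> \<noteq> {}"
begin

lemmas Om' = D(1) Om

text \<open>The extension is \<open>\<Sum>\<^sub>i l\<^sub>i (g \<circ> R\<^sub>i)\<close> with retractions \<open>R\<^sub>i\<close>. In its derivative, that of \<open>g\<close> is evaluated at
  boundary points in directions \<open>\<partial>R\<^sub>i v\<close>, which are tangential, and is therefore controlled by the
  norm on the boundary. An arbitrary extension of \<open>g\<close> may have a large normal derivative.\<close>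

lemma bounded_extension:
  obtains M where "M \<ge> 0" "\<And>g :: real ^ 'd \<Rightarrow> real ^ 'd. local_C1 \<Omega> g \<Longrightarrow>
    \<exists>X\<in>Ck_ring 1 D. (\<forall>x\<in>frontier \<Omega>. X x = g x) \<and> C1_norm D X \<le> M * boundary_C1_vnorm \<Omega> g"
proof -
  define Q where "Q p r r' e u \<longleftrightarrow> boundary_chart 1 D \<Omega> p r e u \<and> r' > 0 \<and> r' \<le> r \<and>
     (\<forall>x\<in>ball p r'. chart_retraction e u x \<in> ball p r)" for p :: "real ^ 'd" and r r' e u
  have "\<forall>p\<in>frontier \<Omega>. \<exists>r r' e u. Q p r r' e u"
  proof
    fix p assume p: "p \<in> frontier \<Omega>"
    then have pD: "p \<in> D" using Om(2) by blast
    obtain r e u where c: "boundary_chart 1 D \<Omega> p r e u"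
      by (rule boundary_chart_exists[OF Om(1) order_refl D(1) p pD]) (rule that)
    obtain r' where "r' > 0" "r' \<le> r" "\<And>x. x \<in> ball p r' \<Longrightarrow> chart_retraction e u x \<in> ball p r"
      by (rule chart_retraction_ball[OF c order_refl p]) (rule that)
    then show "\<exists>r r' e u. Q p r r' e u" using c unfolding Q_def by blast
  qed
  then obtain r r' e u where Q: "\<And>p. p \<in> frontier \<Omega> \<Longrightarrow> Q p (r p) (r' p) (e p) (u p)"
    by metis
  define R where "R p = chart_retraction (e p) (u p)" for p
  have ch: "boundary_chart 1 D \<Omega> p (r p) (e p) (u p)" "p \<in> ball p (r' p)" "ball p (r' p) \<subseteq> ball p (r p)"
    "\<And>x. x \<in> ball p (r' p) \<Longrightarrow> R p x \<in> ball p (r p)" if "p \<in> frontier \<Omega>" for p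
    using Q[OF that] by (auto simp: Q_def R_def)
  obtain I C and l :: "real ^ 'd \<Rightarrow> real ^ 'd \<Rightarrow> real" where I: "finite I" "I \<subseteq> frontier \<Omega>"
    and l: "\<And>i. i \<in> I \<Longrightarrow> Ck_on 1 UNIV (l i)" "\<And>i. i \<in> I \<Longrightarrow> compact (C i)" "\<And>i. i \<in> I \<Longrightarrow> C i \<subseteq> ball i (r' i)"
    "\<And>i x. i \<in> I \<Longrightarrow> x \<notin> C i \<Longrightarrow> l i x = 0" "\<And>x. x \<in> frontier \<Omega> \<Longrightarrow> (\<Sum>i\<in>I. l i x) = 1"
    by (rule partition_of_unity[OF Om(3), of "\<lambda>p. ball p (r' p)" 1, OF open_ball ch(2)]) auto
  have RC: "Ck_on 1 UNIV (R i)" if "i \<in> I" for i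
    unfolding R_def using chart_retraction_Ck[OF ch(1) order_refl] I(2) that by blast
  have RF: "R i x \<in> frontier \<Omega>" "frechet_derivative (R i) (at x) v \<bullet> outward_normal \<Omega> (R i x) = 0"
    if "i \<in> I" "x \<in> C i" for i x v
  proof -
    have i: "i \<in> frontier \<Omega>" using that I(2) by blast
    have x: "x \<in> ball i (r' i)" using that l(3) by blast
    have x': "x \<in> ball i (r i)" "R i x \<in> ball i (r i)" using ch(3,4)[OF i] x by blast+
    show "R i x \<in> frontier \<Omega>"
      using chart_retraction_frontier[OF ch(1)[OF i] order_refl x'(1)] x'(2) by (simp add: R_def)
    show "frechet_derivative (R i) (at x) v \<bullet> outward_normal \<Omega> (R i x) = 0"
      using chart_retraction_tangent[OF ch(1)[OF i] order_refl x'(1)] x'(2) by (simp add: R_def)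
  qed
  have "\<exists>b\<ge>0. \<forall>x\<in>C i. \<bar>l i x\<bar> \<le> b \<and> (\<forall>v. \<bar>frechet_derivative (l i) (at x) v\<bar> \<le> b * norm v)" if "i \<in> I" for i
    by (rule compact_derivative_bound[OF l(1)[OF that] open_UNIV l(2)[OF that]]) auto
  then obtain b where b: "\<And>i. i \<in> I \<Longrightarrow> b i \<ge> 0" "\<And>i x. i \<in> I \<Longrightarrow> x \<in> C i \<Longrightarrow> \<bar>l i x\<bar> \<le> b i"
    "\<And>i x v. i \<in> I \<Longrightarrow> x \<in> C i \<Longrightarrow> \<bar>frechet_derivative (l i) (at x) v\<bar> \<le> b i * norm v" by metis
  have "\<exists>b\<ge>0. \<forall>x\<in>C i. \<forall>v. norm (frechet_derivative (R i) (at x) v) \<le> b * norm v" if "i \<in> I" for i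
    by (rule compact_derivative_bound[OF RC[OF that] open_UNIV l(2)[OF that]]) auto
  then obtain c where c: "\<And>i. i \<in> I \<Longrightarrow> c i \<ge> 0"
    "\<And>i x v. i \<in> I \<Longrightarrow> x \<in> C i \<Longrightarrow> norm (frechet_derivative (R i) (at x) v) \<le> c i * norm v" by metis
  define M where "M = (\<Sum>i\<in>I. b i) + real CARD('d) * (\<Sum>i\<in>I. b i * c i + b i)"
  have "\<exists>X\<in>Ck_ring 1 D. (\<forall>x\<in>frontier \<Omega>. X x = g x) \<and> C1_norm D X \<le> M * boundary_C1_vnorm \<Omega> g"
    if g: "local_C1 \<Omega> g" for g :: "real ^ 'd \<Rightarrow> real ^ 'd"
  proof -
    define N where "N = boundary_C1_vnorm \<Omega> g"
    have N: "norm (g x) \<le> N" "norm (tangential_jacobian \<Omega> g x) \<le> N" if "x \<in> frontier \<Omega>" for x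
      using boundary_C1_vnorm_ge[OF Om' g that] by (auto simp: N_def)
    have N0: "N \<ge> 0" using N(1) Om(4) norm_ge_zero order_trans by blast
    obtain F CF where F: "Ck_on 1 UNIV F" "\<And>x. x \<in> frontier \<Omega> \<Longrightarrow> F x = g x"
      "compact CF" "CF \<subseteq> D" "\<And>x. x \<notin> CF \<Longrightarrow> F x = 0"
      by (rule local_C1_extension[OF Om' g]) (rule that)
    define T where "T i x = l i x *\<^sub>R F (R i x)" for i x
    define X where "X x = (\<Sum>i\<in>I. T i x)" for x
    have TC: "Ck_on 1 UNIV (T i)" if "i \<in> I" for i
      unfolding T_def[abs_def]
      by (intro Ck_on_scaleR Ck_on_compose[OF open_UNIV open_UNIV F(1)] RC l(1) that) auto
    have "Ck_on 1 UNIV X" unfolding X_def[abs_def] by (intro Ck_on_sum TC) auto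
    moreover have "compact (\<Union>i\<in>I. C i)" using I(1) l(2) by auto
    moreover have "(\<Union>i\<in>I. C i) \<subseteq> D"
      using l(3) ch(3) chart(3)[OF ch(1) order_refl] I(2) by blast
    moreover have "X x = 0" if "x \<notin> (\<Union>i\<in>I. C i)" for x
      unfolding X_def T_def using l(4) that by (intro sum.neutral) auto
    ultimately have "X \<in> Ck_ring 1 D" by (rule Ck_ring_compact_support[OF D(1)])
    moreover have "X x = g x" if x: "x \<in> frontier \<Omega>" for x
    proof -
      have "T i x = l i x *\<^sub>R g x" if i: "i \<in> I" for i
      proof (cases "x \<in> C i")
        case True
        have "i \<in> frontier \<Omega>" using i I(2) by blast
        then have "R i x = x"
          unfolding R_def using True l(3)[OF i] ch(3)[of i] by (intro chart_retraction_id[OF ch(1) order_refl _ x]) auto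
        then show ?thesis using F(2)[OF x] by (simp add: T_def)
      next
        case False
        then show ?thesis using l(4)[OF i] by (simp add: T_def)
      qed
      then have "X x = (\<Sum>i\<in>I. l i x *\<^sub>R g x)" unfolding X_def by (intro sum.cong) auto
      then show ?thesis using l(5)[OF x] by (simp add: scaleR_sum_left[symmetric])
    qed
    moreover have "C1_norm D X \<le> (\<Sum>i\<in>I. b i) * N + real CARD('d) * ((\<Sum>i\<in>I. b i * c i + b i) * N)"
    proof (rule C1_norm_le[OF D(2)])
      fix x assume "x \<in> D"
      have Tdiff: "T i differentiable at x" if "i \<in> I" for i
        by (rule Ck_on_differentiable[OF TC[OF that] order_refl open_UNIV]) simp
      then have "\<forall>i\<in>I. (T i has_derivative frechet_derivative (T i) (at x)) (at x)"
        using frechet_derivative_works by blast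
      then have Xd: "(X has_derivative (\<lambda>v. \<Sum>i\<in>I. frechet_derivative (T i) (at x) v)) (at x)"
        unfolding X_def[abs_def] by (intro has_derivative_sum) auto
      then show "X differentiable at x" by (auto simp: differentiable_def)
      have "norm (T i x) \<le> b i * N" if i: "i \<in> I" for i
      proof (cases "x \<in> C i")
        case True
        have "norm (T i x) = \<bar>l i x\<bar> * norm (g (R i x))" using F(2)[OF RF(1)[OF i True]] by (simp add: T_def)
        also have "\<dots> \<le> b i * N" using b(1,2)[OF i] True N(1)[OF RF(1)[OF i True]] by (intro mult_mono) auto
        finally show ?thesis .
      next
        case False
        then show ?thesis using l(4)[OF i] b(1)[OF i] N0 by (simp add: T_def)
      qed
      then show "norm (X x) \<le> (\<Sum>i\<in>I. b i) * N"
        unfolding X_def sum_distrib_right by (rule sum_norm_le)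
      fix j
      have "norm (frechet_derivative (T i) (at x) (axis j 1)) \<le> (b i * c i + b i) * N" if i: "i \<in> I" for i
      proof (cases "x \<in> C i")
        case False
        have "open (- C i)" using l(2)[OF i] compact_imp_closed by blast
        then have "frechet_derivative (T i) (at x) = frechet_derivative (\<lambda>x. 0) (at x)"
          using False l(4)[OF i] by (intro frechet_derivative_cong_open[of "- C i"]) (auto simp: T_def)
        then show ?thesis
          using b(1)[OF i] c(1)[OF i] N0 by (simp add: has_derivative_eq_frechet[OF has_derivative_const])
      next
        case True
        let ?v = "axis j 1 :: real ^ 'd"
        let ?w = "frechet_derivative (R i) (at x) ?v"
        have ld: "(l i has_derivative frechet_derivative (l i) (at x)) (at x)"
          using Ck_on_differentiable[OF l(1)[OF i] order_refl open_UNIV, of x] frechet_derivative_works by auto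
        have Rd: "(R i has_derivative frechet_derivative (R i) (at x)) (at x)"
          using Ck_on_differentiable[OF RC[OF i] order_refl open_UNIV, of x] frechet_derivative_works by auto
        have Fd: "(F has_derivative frechet_derivative F (at (R i x))) (at (R i x))"
          using Ck_on_differentiable[OF F(1) order_refl open_UNIV, of "R i x"] frechet_derivative_works by auto
        have "(T i has_derivative (\<lambda>v. l i x *\<^sub>R frechet_derivative F (at (R i x)) (frechet_derivative (R i) (at x) v)
            + frechet_derivative (l i) (at x) v *\<^sub>R F (R i x))) (at x)"
          unfolding T_def[abs_def] by (intro has_derivative_scaleR ld has_derivative_compose[OF Rd Fd])
        then have e: "frechet_derivative (T i) (at x) ?v = l i x *\<^sub>R frechet_derivative F (at (R i x)) ?w
            + frechet_derivative (l i) (at x) ?v *\<^sub>R F (R i x)"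
          by (simp add: has_derivative_eq_frechet)
        have "tangential_jacobian \<Omega> g (R i x) *v ?w = frechet_derivative F (at (R i x))
            (?w - (?w \<bullet> outward_normal \<Omega> (R i x)) *\<^sub>R outward_normal \<Omega> (R i x))"
          by (rule tangential_jacobian_mult[OF Om' g RF(1)[OF i True] Fd open_UNIV]) (use F(2) in auto)
        then have "norm (frechet_derivative F (at (R i x)) ?w) \<le> norm (tangential_jacobian \<Omega> g (R i x)) * norm ?w"
          using norm_matrix_vector_le[of "tangential_jacobian \<Omega> g (R i x)" ?w] RF(2)[OF i True] by simp
        also have "\<dots> \<le> N * c i"
          using N(2)[OF RF(1)[OF i True]] c(2)[OF i True, of ?v] N0 by (intro mult_mono) auto
        finally have 1: "norm (l i x *\<^sub>R frechet_derivative F (at (R i x)) ?w) \<le> b i * (N * c i)"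
          unfolding norm_scaleR using b(1,2)[OF i] True by (intro mult_mono) auto
        have 2: "norm (frechet_derivative (l i) (at x) ?v *\<^sub>R F (R i x)) \<le> b i * N"
          unfolding norm_scaleR F(2)[OF RF(1)[OF i True]]
          using b(1)[OF i] b(3)[OF i True, of ?v] N(1)[OF RF(1)[OF i True]] by (intro mult_mono) auto
        show ?thesis unfolding e using norm_triangle_mono[OF 1 2] by (simp add: algebra_simps)
      qed
      then show "norm (pd j X x) \<le> (\<Sum>i\<in>I. b i * c i + b i) * N"
        unfolding pd_eq[OF Xd] sum_distrib_right by (rule sum_norm_le)
    qed
    then have "C1_norm D X \<le> M * boundary_C1_vnorm \<Omega> g"
      by (simp add: M_def N_def algebra_simps)
    ultimately show ?thesis by blast
  qed
  moreover have "M \<ge> 0"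
    unfolding M_def using b(1) c(1) by (intro add_nonneg_nonneg mult_nonneg_nonneg sum_nonneg) auto
  ultimately show ?thesis using that by blast
qed

lemma boundary_image_eq: "boundary_image D \<Omega> = C1_maps (frontier \<Omega>)"
proof
  show "boundary_image D \<Omega> \<subseteq> C1_maps (frontier \<Omega>)"
  proof
    fix f assume "f \<in> boundary_image D \<Omega>"
    then obtain X where X: "X \<in> Ck_ring 1 D" "f = restrict X (frontier \<Omega>)" by (auto simp: boundary_image_def)
    have "local_C1 \<Omega> f"
      by (rule local_C1_I[OF Om' D(1) Om(2) Ck_ringD(4)[OF X(1)]]) (simp add: X(2))
    then show "f \<in> C1_maps (frontier \<Omega>)" using X(2) by (simp add: C1_maps_iff[OF Om'])
  qed
  show "C1_maps (frontier \<Omega>) \<subseteq> boundary_image D \<Omega>"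
  proof
    fix f :: "real ^ 'd \<Rightarrow> real ^ 'd" assume "f \<in> C1_maps (frontier \<Omega>)"
    then have f: "f \<in> extensional (frontier \<Omega>)" "local_C1 \<Omega> f" by (auto simp: C1_maps_iff[OF Om'])
    obtain M where "\<And>g :: real ^ 'd \<Rightarrow> real ^ 'd. local_C1 \<Omega> g \<Longrightarrow>
      \<exists>X\<in>Ck_ring 1 D. (\<forall>x\<in>frontier \<Omega>. X x = g x) \<and> C1_norm D X \<le> M * boundary_C1_vnorm \<Omega> g"
      by (rule bounded_extension) (rule that)
    from this[OF f(2)] obtain X where X: "X \<in> Ck_ring 1 D" "\<forall>x\<in>frontier \<Omega>. X x = f x" by blast
    have "restrict X (frontier \<Omega>) = f"
      by (rule extensionalityI[OF restrict_extensional f(1)]) (use X(2) in auto)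
    then show "f \<in> boundary_image D \<Omega>" using X(1) by (auto simp: boundary_image_def)
  qed
qed

end

section \<open>Tangential fields\<close>

text \<open>In the chart \<open>x \<bullet> e = u x\<close> the projection of \<open>T\<close> along \<open>e\<close>, corrected by the increment of
  \<open>u\<close>, moves points without changing \<open>x \<bullet> e - u x\<close>, hence leaves \<open>\<Omega>\<close> invariant. The correction divided
  by \<open>t\<close> is a difference quotient and converges in \<open>C\<^sup>1\<close>, since \<open>u\<close> is twice differentiable. On the
  boundary the limit field is \<open>T\<close>.\<close>

lemma invariant_family_in_chart:
  fixes D \<Omega> :: "(real ^ 'd::finite) set"
  assumes D: "open D" "D \<noteq> {}" and c: "boundary_chart 2 D \<Omega> p r e u"
    and T: "T \<in> Ck_ring 1 D" "compact C" "C \<subseteq> ball p r" "\<And>x. x \<notin> C \<Longrightarrow> T x = 0"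
      "\<And>x. x \<in> frontier \<Omega> \<Longrightarrow> T x \<bullet> outward_normal \<Omega> x = 0"
  obtains T' W where "T' \<in> Ck_ring 1 D" "\<And>x. x \<in> frontier \<Omega> \<Longrightarrow> T' x = T x"
    "filterlim W (C1_ring_nhds D T') (at 0)" "\<forall>\<^sub>F t in at 0. id_plus (scale_field t (W t)) ` \<Omega> = \<Omega>"
proof -
  note ch = chart[OF c one_le_numeral]
  define X where "X x = u x *\<^sub>R e" for x
  have X: "X \<in> Ck_ring 2 D"
  proof -
    obtain K where K: "compact K" "K \<subseteq> D" "\<And>x. x \<notin> K \<Longrightarrow> u x = 0"
      using c unfolding boundary_chart_def by blast
    show ?thesis
    proof (rule Ck_ring_compact_support[OF D(1) _ K(1,2)])
      show "Ck_on 2 UNIV X"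
        unfolding X_def[abs_def] by (intro Ck_on_scaleR ch(4) Ck_on_const open_UNIV)
    qed (simp add: X_def K(3))
  qed
  define P where "P v = v - (v \<bullet> e) *\<^sub>R e" for v
  have blP: "bounded_linear P"
    unfolding P_def
    by (intro bounded_linear_sub bounded_linear_ident bounded_linear_scaleR_const bounded_linear_inner_left)
  define Y where "Y x = P (T x)" for x
  note T1 = Ck_ring_1D[OF D T(1)]
  have Y: "Y \<in> Ck_ring 1 D"
  proof -
    have "Y \<in> Ck_bar 1 D"
    proof (rule Ck_bar_1I[OF D(1)])
      show "(Y has_derivative (\<lambda>v. P (frechet_derivative T (at x) v))) (at x)" if "x \<in> D" for x
        unfolding Y_def[abs_def] by (rule bounded_linear.has_derivative[OF blP T1(2)[OF that]])
      show "bounded_ucont D Y" unfolding Y_def[abs_def] by (rule bounded_ucont_linear[OF blP T1(4)])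
      show "bounded_ucont D (\<lambda>x. P (frechet_derivative T (at x) (axis i 1)))" for i
        using bounded_ucont_linear[OF blP T1(5)] by (simp add: pd_def)
    qed
    moreover have "continuous_on (closure D) Y"
      unfolding Y_def[abs_def] by (rule bounded_linear.continuous_on[OF blP Ck_ringD(2)[OF T(1)]])
    ultimately show ?thesis using T1(3) by (simp add: Ck_ring_def Y_def P_def)
  qed
  have Ye: "Y x \<bullet> e = 0" for x by (simp add: Y_def P_def inner_diff_left ch(1))
  have Y0: "Y x = 0" if "x \<notin> C" for x by (simp add: Y_def P_def T(4)[OF that])
  define T' where "T' x = Y x + field_deriv X Y x" for x
  define W where "W t x = Y x + diff_quotient X t Y x" for t x
  have T': "T' \<in> Ck_ring 1 D"
    unfolding T'_def[abs_def] by (intro Ck_ring_add D Y field_deriv_Ck_ring X)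
  have T'T: "T' x = T x" if x: "x \<in> frontier \<Omega>" for x
  proof (cases "x \<in> C")
    case False
    then show ?thesis using Y0 T(4) by (simp add: T'_def field_deriv_def)
  next
    case True
    then have xb: "x \<in> ball p r" using T(3) by blast
    have "(X has_derivative (\<lambda>v. frechet_derivative u (at x) v *\<^sub>R e)) (at x)"
      unfolding X_def[abs_def] by (intro has_derivative_scaleR_left chart_has_derivative[OF c]) simp
    then have "field_deriv X Y x = frechet_derivative u (at x) (Y x) *\<^sub>R e"
      using field_deriv_eq[of X x Y] by (auto simp: differentiable_def has_derivative_eq_frechet)
    moreover have "frechet_derivative u (at x) (Y x) = frechet_derivative u (at x) (T x)"
      using chart_derivative_e[OF c one_le_numeral xb]
      by (simp add: Y_def P_def linear_diff[OF chart_linear[OF c one_le_numeral]] linear_scale[OF chart_linear[OF c one_le_numeral]])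
    moreover have "\<dots> = T x \<bullet> e"
      using chart_tangent_iff[OF c one_le_numeral xb x] T(5)[OF x] by simp
    ultimately show ?thesis by (simp add: T'_def Y_def P_def)
  qed
  note dq = diff_quotient_tendsto[OF D X Y filterlim_C1_const[OF D Y]]
  have W: "filterlim W (C1_ring_nhds D T') (at 0)"
  proof (rule filterlim_norm_nhds)
    fix \<epsilon> :: real assume "\<epsilon> > 0"
    from filterlim_norm_nhdsD[OF dq(1) this]
    show "\<forall>\<^sub>F t in at 0. W t \<in> Ck_ring 1 D \<and> C1_norm D (\<lambda>x. W t x - T' x) < \<epsilon>"
      by (rule eventually_mono) (auto simp: W_def[abs_def] T'_def intro!: Ck_ring_add D Y simp del: One_nat_def)
  qed
  have "\<exists>\<eta>>0. \<forall>x\<in>C. \<forall>y. norm (y - x) < \<eta> \<longrightarrow> y \<in> ball p r"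
  proof -
    obtain \<eta> where \<eta>: "\<eta> > 0" "(\<Union>x\<in>C. ball x \<eta>) \<subseteq> ball p r"
      using compact_subset_open_imp_ball_epsilon_subset[OF T(2) open_ball T(3)] by blast
    have "y \<in> ball p r" if "x \<in> C" "norm (y - x) < \<eta>" for x y
    proof -
      have "y \<in> ball x \<eta>" using that(2) by (simp add: dist_norm norm_minus_commute)
      then show ?thesis using \<eta>(2) that(1) by blast
    qed
    then show ?thesis using \<eta>(1) by blast
  qed
  then obtain \<eta> where \<eta>: "\<eta> > 0" "\<And>x y. x \<in> C \<Longrightarrow> norm (y - x) < \<eta> \<Longrightarrow> y \<in> ball p r" by blast
  have "\<forall>\<^sub>F t in at (0::real). t \<noteq> 0" by (simp add: eventually_at_filter)
  moreover note filterlim_norm_nhdsD[OF filterlim_C1_scale[OF D filterlim_C1_const[OF D Y] Y tendsto_ident_at] \<eta>(1)]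
  moreover have "min \<eta> (1/2) > 0" using \<eta>(1) by simp
  note filterlim_norm_nhdsD[OF filterlim_C1_scale[OF D W T' tendsto_ident_at] this]
  ultimately have "\<forall>\<^sub>F t in at 0. id_plus (scale_field t (W t)) ` \<Omega> = \<Omega>"
  proof eventually_elim
    case (elim t)
    let ?V = "scale_field t (W t)"
    have V: "?V \<in> Ck_ring 1 D" "C1_norm D ?V < \<eta>" "C1_norm D ?V \<le> 1/2" using elim(3) by auto
    have tY: "scale_field t Y \<in> Ck_ring 1 D" "C1_norm D (scale_field t Y) < \<eta>" using elim(2) by auto
    have Vx: "?V x = t *\<^sub>R Y x + (u (x + t *\<^sub>R Y x) - u x) *\<^sub>R e" for x
      using elim(1) by (simp add: scale_field_def W_def diff_quotient_def X_def scaleR_add_right scaleR_diff_left)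
    show ?case
    proof (rule id_plus_image_eqI[OF D small_fieldI[OF D V(1,3)]])
      fix x
      show "id_plus ?V x \<in> \<Omega> \<longleftrightarrow> x \<in> \<Omega>"
      proof (cases "x \<in> C")
        case False
        then show ?thesis by (simp add: id_plus_def Vx Y0)
      next
        case True
        let ?y = "x + t *\<^sub>R Y x"
        have xb: "x \<in> ball p r" using True T(3) by blast
        have yb: "?y \<in> ball p r"
          using Ck_ring_1D(8)[OF D tY(1), of x] tY(2) by (intro \<eta>(2)[OF True]) (simp add: scale_field_def)
        have zb: "id_plus ?V x \<in> ball p r"
          using Ck_ring_1D(8)[OF D V(1), of x] V(2) by (intro \<eta>(2)[OF True]) (simp add: id_plus_def)
        have z: "id_plus ?V x = ?y + (u ?y - u x) *\<^sub>R e" by (simp add: id_plus_def Vx)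
        have "u (id_plus ?V x) = u ?y"
          using zb unfolding z by (rule ch(7)[OF yb])
        moreover have "id_plus ?V x \<bullet> e = x \<bullet> e + u ?y - u x"
          unfolding z by (simp add: inner_add_left ch(1) Ye)
        ultimately show ?thesis using ch(5)[OF xb] ch(5)[OF zb] by auto
      qed
    qed
  qed
  then show ?thesis using that T' T'T W by blast
qed

context
  fixes D \<Omega> :: "(real ^ 'd::finite) set" and J :: "(real ^ 'd) set \<Rightarrow> real"
  assumes D: "open D" "D \<noteq> {}"
    and Om: "Ck_boundary 2 \<Omega>" "frontier \<Omega> \<subseteq> D" "compact (frontier \<Omega>)" "frontier \<Omega> \<noteq> {}"
    and td: "twice_shape_differentiable J \<Omega> D" and op: "open \<Omega>"
begin

lemmas sd = shape_differentiable_here[OF D td op]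

text \<open>The two identities are bundled because one localisation argument proves both.\<close>

definition tangential_identities :: "(real ^ 'd \<Rightarrow> real ^ 'd) \<Rightarrow> bool" where
  "tangential_identities T \<longleftrightarrow> T \<in> Ck_ring 1 D \<and> DHJ J \<Omega> D T = 0 \<and>
     (\<forall>X\<in>Ck_ring 2 D. frakD2HJ J \<Omega> D X T = - DHJ J \<Omega> D (field_deriv X T))"

lemma tangential_identities_add:
  assumes "tangential_identities T" "tangential_identities T'"
  shows "tangential_identities (\<lambda>x. T x + T' x)"
  unfolding tangential_identities_def
proof (intro conjI ballI)
  have T: "T \<in> Ck_ring 1 D" "T' \<in> Ck_ring 1 D"
    using assms by (auto simp: tangential_identities_def)
  then show "(\<lambda>x. T x + T' x) \<in> Ck_ring 1 D" by (rule Ck_ring_add[OF D(1)])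
  show "DHJ J \<Omega> D (\<lambda>x. T x + T' x) = 0"
    using assms DHJ_add[OF D sd T] by (simp add: tangential_identities_def)
  fix X :: "real ^ 'd \<Rightarrow> real ^ 'd" assume X: "X \<in> Ck_ring 2 D"
  have "frakD2HJ J \<Omega> D X (\<lambda>x. T x + T' x) = frakD2HJ J \<Omega> D X T + frakD2HJ J \<Omega> D X T'"
    by (rule frakD2HJ_linear(2)[OF D td op T Ck_ring_2_1[OF X]])
  also have "\<dots> = - DHJ J \<Omega> D (field_deriv X T) - DHJ J \<Omega> D (field_deriv X T')"
    using assms X by (simp add: tangential_identities_def)
  also have "\<dots> = - DHJ J \<Omega> D (field_deriv X (\<lambda>x. T x + T' x))"
    unfolding field_deriv_add
    using DHJ_add[OF D sd field_deriv_Ck_ring[OF D X T(1)] field_deriv_Ck_ring[OF D X T(2)]] by simp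
  finally show "frakD2HJ J \<Omega> D X (\<lambda>x. T x + T' x) = - DHJ J \<Omega> D (field_deriv X (\<lambda>x. T x + T' x))" .
qed

lemma tangential_identities_cong:
  assumes "tangential_identities T'" "T \<in> Ck_ring 1 D" "\<And>x. x \<in> frontier \<Omega> \<Longrightarrow> T' x = T x"
  shows "tangential_identities T"
proof -
  have T': "T' \<in> Ck_ring 1 D" "DHJ J \<Omega> D T' = 0"
    "\<And>X. X \<in> Ck_ring 2 D \<Longrightarrow> frakD2HJ J \<Omega> D X T' = - DHJ J \<Omega> D (field_deriv X T')"
    using assms(1) by (auto simp: tangential_identities_def)
  have "DHJ J \<Omega> D T = 0"
    using DHJ_cong_frontier[OF D sd op T'(1) assms(2,3)] T'(2) by simp
  moreover have "frakD2HJ J \<Omega> D X T = - DHJ J \<Omega> D (field_deriv X T)" if X: "X \<in> Ck_ring 2 D" for X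
  proof -
    have "DHJ J \<Omega> D (field_deriv X T) = DHJ J \<Omega> D (field_deriv X T')"
      by (rule DHJ_cong_frontier[OF D sd op field_deriv_Ck_ring[OF D X assms(2)] field_deriv_Ck_ring[OF D X T'(1)]])
        (simp add: field_deriv_def assms(3))
    moreover have "frakD2HJ J \<Omega> D X T = frakD2HJ J \<Omega> D X T'"
      by (rule frakD2HJ_cong_frontier[OF D td op Ck_ring_2_1[OF X] assms(2) Ck_ring_2_1[OF X] T'(1)]) (simp_all add: assms(3))
    ultimately show ?thesis using T'(3)[OF X] by simp
  qed
  ultimately show ?thesis using assms(2) by (simp add: tangential_identities_def)
qed

text \<open>Both identities are additive and only depend on the boundary values, so a partition of unity
  reduces them to fields supported in one chart.\<close>

lemma tangential_fields:
  assumes T: "T \<in> Ck_ring 1 D" "\<And>x. x \<in> frontier \<Omega> \<Longrightarrow> T x \<bullet> outward_normal \<Omega> x = 0"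
  shows "DHJ J \<Omega> D T = 0" and "X \<in> Ck_ring 2 D \<Longrightarrow> frakD2HJ J \<Omega> D X T = - DHJ J \<Omega> D (field_deriv X T)"
proof -
  have "\<forall>p\<in>frontier \<Omega>. \<exists>r e u. boundary_chart 2 D \<Omega> p r e u"
  proof
    fix p assume p: "p \<in> frontier \<Omega>"
    then have "p \<in> D" using Om(2) by blast
    then show "\<exists>r e u. boundary_chart 2 D \<Omega> p r e u"
      by (rule boundary_chart_exists[OF Om(1) one_le_numeral D(1) p]) blast
  qed
  then obtain r e u where c: "\<And>p. p \<in> frontier \<Omega> \<Longrightarrow> boundary_chart 2 D \<Omega> p (r p) (e p) (u p)" by metis
  have pb: "p \<in> ball p (r p)" if "p \<in> frontier \<Omega>" for p
    using chart(2)[OF c[OF that] one_le_numeral] by simp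
  obtain I C and l :: "real ^ 'd \<Rightarrow> real ^ 'd \<Rightarrow> real" where I: "finite I" "I \<subseteq> frontier \<Omega>"
    and l: "\<And>i. i \<in> I \<Longrightarrow> Ck_on 1 UNIV (l i)" "\<And>i. i \<in> I \<Longrightarrow> compact (C i)" "\<And>i. i \<in> I \<Longrightarrow> C i \<subseteq> ball i (r i)"
    "\<And>i x. i \<in> I \<Longrightarrow> x \<notin> C i \<Longrightarrow> l i x = 0" "\<And>x. x \<in> frontier \<Omega> \<Longrightarrow> (\<Sum>i\<in>I. l i x) = 1"
    by (rule partition_of_unity[OF Om(3), of "\<lambda>p. ball p (r p)" 1, OF open_ball pb]) auto
  have local: "tangential_identities (\<lambda>x. l i x *\<^sub>R T x)" if i: "i \<in> I" for i
  proof -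
    have ci: "boundary_chart 2 D \<Omega> i (r i) (e i) (u i)" using c I(2) i by blast
    have CD: "C i \<subseteq> D" using l(3)[OF i] chart(3)[OF ci one_le_numeral] by blast
    have "Ck_on 1 UNIV (\<lambda>x. l i x *\<^sub>R T x)"
      by (rule Ck_on_cutoff[OF D(1) Ck_ringD(4)[OF T(1)] l(1,2)[OF i] CD l(4)[OF i]])
    then have m: "(\<lambda>x. l i x *\<^sub>R T x) \<in> Ck_ring 1 D"
      by (rule Ck_ring_compact_support[OF D(1) _ l(2)[OF i] CD]) (simp add: l(4)[OF i])
    obtain T' W where T': "T' \<in> Ck_ring 1 D" "\<And>x. x \<in> frontier \<Omega> \<Longrightarrow> T' x = l i x *\<^sub>R T x"
      "filterlim W (C1_ring_nhds D T') (at 0)" "\<forall>\<^sub>F t in at 0. id_plus (scale_field t (W t)) ` \<Omega> = \<Omega>"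
      by (rule invariant_family_in_chart[OF D ci m l(2,3)[OF i]]) (auto simp: l(4)[OF i] T(2))
    have "tangential_identities T'"
      unfolding tangential_identities_def
      using T'(1) DHJ_eq_0_if_invariant[OF D sd T'(1,3,4)] frakD2HJ_invariant[OF D td op _ T'(1,3,4)] by blast
    then show ?thesis by (rule tangential_identities_cong[OF _ m T'(2)])
  qed
  have zero: "tangential_identities (\<lambda>x. 0)"
  proof -
    have z: "(\<lambda>x. 0) \<in> Ck_ring 1 D" by (rule Ck_ring_zero[OF D(1)])
    have "DHJ J \<Omega> D (\<lambda>x. 0) = 0" using DHJ_cmul[OF D sd z, of 0] by simp
    moreover have "frakD2HJ J \<Omega> D X (\<lambda>x. 0) = 0" if "X \<in> Ck_ring 2 D" for X
      by (rule frakD2HJ_zero_right[OF D td op Ck_ring_2_1[OF that] z]) simp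
    moreover have "field_deriv X (\<lambda>x. 0) = (\<lambda>x. 0)" for X :: "real ^ 'd \<Rightarrow> real ^ 'd"
      by (simp add: field_deriv_def)
    ultimately show ?thesis using z by (simp add: tangential_identities_def)
  qed
  have "tangential_identities (\<lambda>x. \<Sum>i\<in>A. l i x *\<^sub>R T x)" if "finite A" "A \<subseteq> I" for A
    using that
    by (induction A rule: finite_induct) (auto intro: zero tangential_identities_add local)
  from this[OF I(1) order_refl] have "tangential_identities T"
  proof (rule tangential_identities_cong[OF _ T(1)])
    show "(\<Sum>i\<in>I. l i x *\<^sub>R T x) = T x" if "x \<in> frontier \<Omega>" for x
      using l(5)[OF that] by (simp add: scaleR_sum_left[symmetric])
  qed
  then show "DHJ J \<Omega> D T = 0" "X \<in> Ck_ring 2 D \<Longrightarrow> frakD2HJ J \<Omega> D X T = - DHJ J \<Omega> D (field_deriv X T)"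
    by (auto simp: tangential_identities_def)
qed

end

section \<open>Normal components\<close>

text \<open>Normalising the gradient of a defining function costs one order of differentiability.\<close>

lemma local_unit_normal:
  fixes \<Omega> :: "(real ^ 'd::finite) set"
  assumes "Ck_boundary (Suc k) \<Omega>" "p \<in> frontier \<Omega>"
  obtains U n where "open U" "p \<in> U" "Ck_on k U n" "\<And>y. y \<in> U \<Longrightarrow> n y \<bullet> n y = 1"
    "\<And>y. y \<in> U \<Longrightarrow> y \<in> frontier \<Omega> \<Longrightarrow> n y = outward_normal \<Omega> y"
proof -
  obtain U \<phi> where U: "p \<in> U" "Ck_defining (Suc k) \<Omega> U \<phi>"
    using assms unfolding Ck_boundary_def by blast
  then have \<phi>: "open U" "Ck_on (Suc k) U \<phi>" "\<And>y. y \<in> U \<Longrightarrow> gradient \<phi> y \<noteq> 0"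
    by (auto simp: Ck_defining_def)
  define g where "g y = (\<Sum>i\<in>UNIV. pd i \<phi> y *\<^sub>R (axis i 1 :: real ^ 'd))" for y
  have g: "gradient \<phi> y = g y" for y
    by (simp add: g_def gradient_def pd_def vec_eq_iff axis_def if_distrib cong: if_cong)
  have gC: "Ck_on k U g"
    unfolding g_def[abs_def] by (intro Ck_on_sum Ck_on_scaleR Ck_on_const Ck_on_pd \<phi>)
  have pos: "0 < g y \<bullet> g y" if "y \<in> U" for y using \<phi>(3)[OF that] g by simp
  define n where "n y = (g y \<bullet> g y) powr (- 1 / 2) *\<^sub>R g y" for y
  have n: "n y = gradient \<phi> y /\<^sub>R norm (gradient \<phi> y)" if "y \<in> U" for y
  proof -
    have "(g y \<bullet> g y) powr (- (1 / 2)) = inverse (norm (g y))"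
      using pos[OF that] by (simp only: powr_minus powr_half_sqrt) (simp add: norm_eq_sqrt_inner powr_half_sqrt)
    then show ?thesis by (simp add: n_def g)
  qed
  show ?thesis
  proof (rule that[OF \<phi>(1) U(1)])
    show "Ck_on k U n"
      unfolding n_def[abs_def] by (intro Ck_on_scaleR Ck_on_powr Ck_on_inner gC \<phi>(1) pos)
    show "n y \<bullet> n y = 1" if "y \<in> U" for y
      using \<phi>(3)[OF that] unfolding n[OF that] by (simp add: power2_norm_eq_inner[symmetric] power2_eq_square)
    show "n y = outward_normal \<Omega> y" if "y \<in> U" "y \<in> frontier \<Omega>" for y
      unfolding n[OF that(1)] by (rule outward_normal_eq[OF U(2) _ that, symmetric]) simp
  qed
qed

lemma normal_component_extension:
  fixes D \<Omega> :: "(real ^ 'd::finite) set"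
  assumes "open D" "Ck_boundary (Suc k) \<Omega>" "frontier \<Omega> \<subseteq> D" "compact (frontier \<Omega>)" "P \<in> Ck_ring k D"
  obtains N where "N \<in> Ck_ring k D"
    "\<And>x. x \<in> frontier \<Omega> \<Longrightarrow> N x = (P x \<bullet> outward_normal \<Omega> x) *\<^sub>R outward_normal \<Omega> x"
proof -
  have "\<exists>U F. open U \<and> p \<in> U \<and> Ck_on k U F \<and> (\<forall>x\<in>frontier \<Omega> \<inter> U. F x = (P x \<bullet> outward_normal \<Omega> x) *\<^sub>R outward_normal \<Omega> x)"
    if p: "p \<in> frontier \<Omega>" for p
  proof -
    obtain U n where U: "open U" "p \<in> U" "Ck_on k U n" "\<And>y. y \<in> U \<Longrightarrow> n y \<bullet> n y = 1"
      "\<And>y. y \<in> U \<Longrightarrow> y \<in> frontier \<Omega> \<Longrightarrow> n y = outward_normal \<Omega> y"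
      by (rule local_unit_normal[OF assms(2) p]) (rule that)
    have o: "open (U \<inter> D)" "p \<in> U \<inter> D" using U(1,2) assms(1,3) p by auto
    have c: "Ck_on k (U \<inter> D) n" "Ck_on k (U \<inter> D) P"
      using Ck_on_mono[OF U(3) order_refl, of "U \<inter> D"] Ck_on_mono[OF Ck_ringD(4)[OF assms(5)] order_refl, of "U \<inter> D"] by auto
    have "Ck_on k (U \<inter> D) (\<lambda>x. (P x \<bullet> n x) *\<^sub>R n x)"
      by (intro Ck_on_scaleR Ck_on_inner c o)
    then show ?thesis
      using o U(5) by (intro exI[of _ "U \<inter> D"] exI[of _ "\<lambda>x. (P x \<bullet> n x) *\<^sub>R n x"]) auto
  qed
  then obtain F C where F: "Ck_on k UNIV F" "\<And>x. x \<in> frontier \<Omega> \<Longrightarrow> F x = (P x \<bullet> outward_normal \<Omega> x) *\<^sub>R outward_normal \<Omega> x"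
    "compact C" "C \<subseteq> D" "\<And>x. x \<notin> C \<Longrightarrow> F x = 0"
    by (rule global_extension[OF assms(4,3,1), of k "\<lambda>x. (P x \<bullet> outward_normal \<Omega> x) *\<^sub>R outward_normal \<Omega> x"]) auto
  show ?thesis by (rule that[OF Ck_ring_compact_support[OF assms(1) F(1,3-5)] F(2)])
qed

context
  fixes D \<Omega> :: "(real ^ 'd::finite) set"
  assumes D: "open D" and Om: "Ck_boundary 2 \<Omega>" "frontier \<Omega> \<subseteq> D" "compact (frontier \<Omega>)" "frontier \<Omega> \<noteq> {}"
begin

lemma Om1: "Ck_boundary 1 \<Omega>" by (rule Ck_boundary_mono[OF Om(1)]) simp

lemmas Om1' = D Om1 Om(2-4)

lemma Om_Suc: "Ck_boundary (Suc 1) \<Omega>" using Om(1) by (simp add: numeral_2_eq_2)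

lemma local_C1_outward_normal: "local_C1 \<Omega> (outward_normal \<Omega>)"
  unfolding local_C1_def[OF Om1']
proof
  fix p assume "p \<in> frontier \<Omega>"
  then show "\<exists>U F. open U \<and> p \<in> U \<and> Ck_on 1 U F \<and> (\<forall>x\<in>frontier \<Omega> \<inter> U. F x = outward_normal \<Omega> x)"
    by (rule local_unit_normal[OF Om_Suc]) blast
qed

lemma local_C1_times_normal:
  assumes "local_C1 \<Omega> v" "\<And>x. x \<in> frontier \<Omega> \<Longrightarrow> h x = v x *\<^sub>R outward_normal \<Omega> x"
  shows "local_C1 \<Omega> h"
proof -
  obtain F C where F: "Ck_on 1 UNIV F" "\<And>x. x \<in> frontier \<Omega> \<Longrightarrow> F x = v x" "compact C" "C \<subseteq> D" "\<And>x. x \<notin> C \<Longrightarrow> F x = 0"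
    by (rule local_C1_extension[OF Om1' assms(1)]) (rule that)
  obtain n C' where n: "Ck_on 1 UNIV n" "\<And>x. x \<in> frontier \<Omega> \<Longrightarrow> n x = outward_normal \<Omega> x" "compact C'" "C' \<subseteq> D" "\<And>x. x \<notin> C' \<Longrightarrow> n x = 0"
    by (rule local_C1_extension[OF Om1' local_C1_outward_normal]) (rule that)
  show ?thesis
  proof (rule local_C1_I[OF Om1' open_UNIV])
    show "Ck_on 1 UNIV (\<lambda>x. F x *\<^sub>R n x)" by (intro Ck_on_scaleR F(1) n(1) open_UNIV)
  qed (simp_all add: F(2) n(2) assms(2))
qed

text \<open>The tangential derivative of \<open>v \<nu>\<close> is \<open>\<nu> \<otimes> \<nabla> v + v \<partial> \<nu>\<close>, with tangential derivatives on
  the right, and \<open>\<partial> \<nu>\<close> is bounded on the compact boundary.\<close>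

lemma times_normal_bound:
  obtains K where "K \<ge> 0" "\<And>v h. local_C1 \<Omega> v \<Longrightarrow> \<forall>x\<in>frontier \<Omega>. h x = v x *\<^sub>R outward_normal \<Omega> x \<Longrightarrow>
     boundary_C1_vnorm \<Omega> h \<le> K * boundary_C1_norm \<Omega> v"
proof -
  let ?n = "C1_extension (frontier \<Omega>) (outward_normal \<Omega>)"
  obtain B where B: "B \<ge> 0" "\<And>x v. x \<in> frontier \<Omega> \<Longrightarrow> norm (frechet_derivative ?n (at x) v) \<le> B * norm v"
    "\<And>x. x \<in> frontier \<Omega> \<Longrightarrow> norm (outward_normal \<Omega> x) \<le> B"
    "\<And>x. x \<in> frontier \<Omega> \<Longrightarrow> (?n has_derivative frechet_derivative ?n (at x)) (at x)"
    by (rule C1_extension_bounds[OF Om1' local_C1_outward_normal]) (rule that)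
  obtain U where U: "open U" "frontier \<Omega> \<subseteq> U" "Ck_on 1 U ?n" "\<And>x. x \<in> frontier \<Omega> \<Longrightarrow> ?n x = outward_normal \<Omega> x"
    by (rule C1_extension_props[OF Om1' local_C1_outward_normal]) (rule that)
  have "boundary_C1_vnorm \<Omega> h \<le> (1 + real CARD('d) * (2 * B + 1)) * boundary_C1_norm \<Omega> v"
    if v: "local_C1 \<Omega> v" and h': "\<forall>x\<in>frontier \<Omega>. h x = v x *\<^sub>R outward_normal \<Omega> x" for v h
  proof -
    have h: "h x = v x *\<^sub>R outward_normal \<Omega> x" if "x \<in> frontier \<Omega>" for x using h' that by blast
    define N where "N = boundary_C1_norm \<Omega> v"
    have N: "\<bar>v x\<bar> \<le> N" "norm (tangential_gradient \<Omega> v x) \<le> N" if "x \<in> frontier \<Omega>" for x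
      using boundary_C1_norm_ge[OF Om1' v that] by (auto simp: N_def)
    have N0: "N \<ge> 0" using N(1) Om(4) abs_ge_zero order_trans by blast
    note hC = local_C1_times_normal[OF v h]
    obtain F C where F: "Ck_on 1 UNIV F" "\<And>x. x \<in> frontier \<Omega> \<Longrightarrow> F x = v x" "compact C" "C \<subseteq> D" "\<And>x. x \<notin> C \<Longrightarrow> F x = 0"
      by (rule local_C1_extension[OF Om1' v]) (rule that)
    have "boundary_C1_vnorm \<Omega> h \<le> N + real CARD('d) * (N * (2 * B + 1))"
    proof (rule boundary_C1_vnorm_le[OF Om1'])
      fix x assume x: "x \<in> frontier \<Omega>"
      show "norm (h x) \<le> N"
        using h[OF x] N(1)[OF x] norm_outward_normal[OF Om1' x] by simp
      have Fd: "(F has_derivative frechet_derivative F (at x)) (at x)"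
        using Ck_on_differentiable[OF F(1) order_refl open_UNIV, of x] frechet_derivative_works by auto
      have Gd: "((\<lambda>y. F y *\<^sub>R ?n y) has_derivative
          (\<lambda>w. F x *\<^sub>R frechet_derivative ?n (at x) w + frechet_derivative F (at x) w *\<^sub>R ?n x)) (at x)"
        by (rule has_derivative_scaleR[OF Fd B(4)[OF x]])
      have "norm (tangential_jacobian \<Omega> h x *v axis j 1) \<le> N * (2 * B + 1)" for j
      proof -
        let ?v = "axis j 1 :: real ^ 'd"
        let ?w = "?v - (?v \<bullet> outward_normal \<Omega> x) *\<^sub>R outward_normal \<Omega> x"
        have e: "tangential_jacobian \<Omega> h x *v ?v = F x *\<^sub>R frechet_derivative ?n (at x) ?w + frechet_derivative F (at x) ?w *\<^sub>R ?n x"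
          by (rule tangential_jacobian_mult[OF Om1' hC x Gd U(1)]) (use U x F h in auto)
        have "tangential_gradient \<Omega> v x \<bullet> ?v = frechet_derivative F (at x) ?w"
          by (rule tangential_gradient_inner[OF Om1' v x Fd open_UNIV]) (use F in auto)
        then have "\<bar>frechet_derivative F (at x) ?w\<bar> \<le> norm (tangential_gradient \<Omega> v x) * norm ?v"
          using Cauchy_Schwarz_ineq2 by metis
        then have "\<bar>frechet_derivative F (at x) ?w\<bar> \<le> N" using N(2)[OF x] by simp
        then have 2: "norm (frechet_derivative F (at x) ?w *\<^sub>R ?n x) \<le> N"
          using U(4)[OF x] norm_outward_normal[OF Om1' x] by simp
        have "norm (frechet_derivative ?n (at x) ?w) \<le> B * norm ?w" by (rule B(2)[OF x])
        also have "\<dots> \<le> B * 2"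
          using norm_tangent_projection[OF Om1' x, of ?v] B(1) by (intro mult_left_mono) auto
        finally have 1: "norm (F x *\<^sub>R frechet_derivative ?n (at x) ?w) \<le> N * (B * 2)"
          unfolding norm_scaleR F(2)[OF x] using N(1)[OF x] N0 by (intro mult_mono) auto
        show ?thesis unfolding e using norm_triangle_mono[OF 1 2] by (simp add: algebra_simps)
      qed
      then have "(\<Sum>j\<in>UNIV. norm (tangential_jacobian \<Omega> h x *v axis j 1)) \<le> (\<Sum>j\<in>(UNIV::'d set). N * (2 * B + 1))"
        by (rule sum_mono)
      then show "norm (tangential_jacobian \<Omega> h x) \<le> real CARD('d) * (N * (2 * B + 1))"
        using norm_matrix_le_sum_columns[of "tangential_jacobian \<Omega> h x"] by simp
    qed
    then show ?thesis by (simp add: N_def algebra_simps)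
  qed
  moreover have "0 \<le> 1 + real CARD('d) * (2 * B + 1)" using B(1) by simp
  ultimately show ?thesis using that by blast
qed

text \<open>The derivative of a unit normal field is orthogonal to it, so differentiating
  \<open>(X \<bullet> \<nu>) \<nu>\<close> in a tangential direction changes the normal component only through \<open>X \<bullet> \<nu>\<close>.\<close>

lemma normal_derivative_of_normal_field:
  assumes x: "x \<in> frontier \<Omega>" and N: "N \<in> Ck_ring 1 D" "\<And>y. y \<in> frontier \<Omega> \<Longrightarrow> N y = v y *\<^sub>R outward_normal \<Omega> y"
    and v: "local_C1 \<Omega> v" and w: "w \<bullet> outward_normal \<Omega> x = 0"
  shows "frechet_derivative N (at x) w \<bullet> outward_normal \<Omega> x = tangential_gradient \<Omega> v x \<bullet> w"
proof -
  have DD: "D \<noteq> {}" using Om(2) x by blast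
  obtain U n where U: "open U" "x \<in> U" "Ck_on 1 U n" "\<And>y. y \<in> U \<Longrightarrow> n y \<bullet> n y = 1"
    "\<And>y. y \<in> U \<Longrightarrow> y \<in> frontier \<Omega> \<Longrightarrow> n y = outward_normal \<Omega> y"
    by (rule local_unit_normal[OF Om_Suc x]) (rule that)
  have xD: "x \<in> D" using x Om(2) by blast
  have nd: "(n has_derivative frechet_derivative n (at x)) (at x)"
    using Ck_on_differentiable[OF U(3) order_refl U(1,2)] frechet_derivative_works by blast
  have Nd: "(N has_derivative frechet_derivative N (at x)) (at x)" by (rule Ck_ring_1D(2)[OF D DD N(1) xD])
  have "((\<lambda>y. n y \<bullet> n y) has_derivative (\<lambda>w. n x \<bullet> frechet_derivative n (at x) w + frechet_derivative n (at x) w \<bullet> n x)) (at x)"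
    by (rule has_derivative_inner[OF nd nd])
  moreover have "((\<lambda>y. n y \<bullet> n y) has_derivative (\<lambda>w. 0)) (at x)"
    by (rule has_derivative_transform_within_open[OF has_derivative_const U(1,2)]) (simp add: U(4))
  ultimately have "(\<lambda>w. n x \<bullet> frechet_derivative n (at x) w + frechet_derivative n (at x) w \<bullet> n x) = (\<lambda>w. 0)"
    by (rule has_derivative_unique)
  from fun_cong[OF this, of w] have z: "n x \<bullet> frechet_derivative n (at x) w = 0" by (simp add: inner_commute)
  have "((\<lambda>y. N y \<bullet> n y) has_derivative (\<lambda>w. N x \<bullet> frechet_derivative n (at x) w + frechet_derivative N (at x) w \<bullet> n x)) (at x)"
    by (rule has_derivative_inner[OF Nd nd])
  from tangential_gradient_inner[OF Om1' v x this U(1,2), of w]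
  have "tangential_gradient \<Omega> v x \<bullet> w = N x \<bullet> frechet_derivative n (at x) w + frechet_derivative N (at x) w \<bullet> n x"
    using U(5) N(2) w outward_normal_inner[OF Om1'] by simp
  also have "N x = v x *\<^sub>R n x" using N(2)[OF x] U(5)[OF U(2) x] by simp
  finally show ?thesis using z U(5)[OF U(2) x] by simp
qed

end

section \<open>Structure of the second shape derivative\<close>

context
  fixes D \<Omega> :: "(real ^ 'd::finite) set" and J :: "(real ^ 'd) set \<Rightarrow> real"
  assumes D: "open D" "D \<noteq> {}"
    and td: "twice_shape_differentiable J \<Omega> D" and op: "open \<Omega>"
begin

text \<open>Any field with the given boundary values serves, since the derivatives only depend on these. The choice
  is arbitrary off the set of attained boundary values.\<close>

definition field_with_trace :: "(real ^ 'd \<Rightarrow> real ^ 'd) \<Rightarrow> real ^ 'd \<Rightarrow> real ^ 'd" where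
  "field_with_trace f = (SOME X. X \<in> Ck_ring 1 D \<and> restrict X (frontier \<Omega>) = f)"

definition boundary_gradient :: "(real ^ 'd \<Rightarrow> real ^ 'd) \<Rightarrow> real" where
  "boundary_gradient f = DHJ J \<Omega> D (field_with_trace f)"

definition boundary_hessian :: "(real ^ 'd \<Rightarrow> real ^ 'd) \<Rightarrow> (real ^ 'd \<Rightarrow> real ^ 'd) \<Rightarrow> real" where
  "boundary_hessian f h = frakD2HJ J \<Omega> D (field_with_trace f) (field_with_trace h)"

lemma field_with_trace:
  assumes "X \<in> Ck_ring 1 D" "restrict X (frontier \<Omega>) = f"
  shows "field_with_trace f \<in> Ck_ring 1 D" "x \<in> frontier \<Omega> \<Longrightarrow> field_with_trace f x = X x"
proof -
  have "field_with_trace f \<in> Ck_ring 1 D \<and> restrict (field_with_trace f) (frontier \<Omega>) = f"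
    unfolding field_with_trace_def by (rule someI[of _ X]) (use assms in auto)
  then show "field_with_trace f \<in> Ck_ring 1 D" "x \<in> frontier \<Omega> \<Longrightarrow> field_with_trace f x = X x"
    using assms(2) restrict_apply' by metis+
qed

lemma boundary_gradient_eq:
  assumes "X \<in> Ck_ring 1 D" "restrict X (frontier \<Omega>) = f"
  shows "boundary_gradient f = DHJ J \<Omega> D X"
  unfolding boundary_gradient_def
  by (rule DHJ_cong_frontier[OF D shape_differentiable_here[OF D td op] op field_with_trace(1)[OF assms] assms(1) field_with_trace(2)[OF assms]])

lemma boundary_hessian_eq:
  assumes "X \<in> Ck_ring 1 D" "restrict X (frontier \<Omega>) = f" "Y \<in> Ck_ring 1 D" "restrict Y (frontier \<Omega>) = h"
  shows "boundary_hessian f h = frakD2HJ J \<Omega> D X Y"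
  unfolding boundary_hessian_def
  by (rule frakD2HJ_cong_frontier[OF D td op field_with_trace(1)[OF assms(1,2)] field_with_trace(1)[OF assms(3,4)] assms(1,3)
        field_with_trace(2)[OF assms(1,2)] field_with_trace(2)[OF assms(3,4)]])

text \<open>Continuity on the boundary follows from continuity on fields once small boundary data
  extend to small fields. The map \<open>\<tau>\<close> sends data to boundary fields; it is the identity or
  multiplication by the normal.\<close>

lemma continuous_on_boundary_data:
  fixes \<tau> :: "('a \<Rightarrow> 'b::ab_group_add) \<Rightarrow> real ^ 'd \<Rightarrow> real ^ 'd"
  assumes ext: "\<And>f. f \<in> A \<Longrightarrow> \<exists>X\<in>Ck_ring 1 D. restrict X (frontier \<Omega>) = \<tau> f"
    and ex: "\<And>f. f \<in> A \<Longrightarrow> \<tau> f \<in> extensional (frontier \<Omega>)"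
    and M: "M \<ge> 0" "\<And>f g. f \<in> A \<Longrightarrow> g \<in> A \<Longrightarrow> \<exists>E\<in>Ck_ring 1 D. (\<forall>x\<in>frontier \<Omega>. E x = \<tau> g x - \<tau> f x) \<and>
      C1_norm D E \<le> M * N (\<lambda>x. g x - f x)"
  shows "norm_continuous A N (\<lambda>f. boundary_gradient (\<tau> f))" "norm_continuous2 A N (\<lambda>f h. boundary_hessian (\<tau> f) (\<tau> h))"
proof -
  have near: "\<exists>Z\<in>Ck_ring 1 D. restrict Z (frontier \<Omega>) = \<tau> g \<and> C1_norm D (\<lambda>x. Z x - X x) < \<delta>"
    if f: "f \<in> A" and X: "X \<in> Ck_ring 1 D" "restrict X (frontier \<Omega>) = \<tau> f" and g: "g \<in> A"
      and small: "N (\<lambda>x. g x - f x) < \<delta> / (M + 1)" and \<delta>: "\<delta> > 0" for f g X \<delta>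
  proof -
    obtain E where E: "E \<in> Ck_ring 1 D" "\<forall>x\<in>frontier \<Omega>. E x = \<tau> g x - \<tau> f x" "C1_norm D E \<le> M * N (\<lambda>x. g x - f x)"
      using M(2)[OF f g] by blast
    define Z where "Z x = X x + E x" for x
    have Z: "Z \<in> Ck_ring 1 D" unfolding Z_def[abs_def] by (rule Ck_ring_add[OF D(1) X(1) E(1)])
    have "X x = \<tau> f x" if "x \<in> frontier \<Omega>" for x using X(2) that restrict_apply' by metis
    then have "restrict Z (frontier \<Omega>) = \<tau> g"
      by (intro extensionalityI[OF restrict_extensional ex[OF g]]) (use E(2) in \<open>auto simp: Z_def\<close>)
    moreover have "C1_norm D (\<lambda>x. Z x - X x) < \<delta>"
    proof -
      have "M * N (\<lambda>x. g x - f x) \<le> M * (\<delta> / (M + 1))" using small M(1) by (intro mult_left_mono) auto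
      also have "\<dots> < \<delta>" using M(1) \<delta> by (simp add: field_simps)
      finally show ?thesis using E(3) by (simp add: Z_def)
    qed
    ultimately show ?thesis using Z by blast
  qed
  show "norm_continuous A N (\<lambda>f. boundary_gradient (\<tau> f))"
    unfolding norm_continuous_def
  proof
    fix f assume f: "f \<in> A"
    obtain X where X: "X \<in> Ck_ring 1 D" "restrict X (frontier \<Omega>) = \<tau> f" using ext[OF f] by blast
    show "((\<lambda>f. boundary_gradient (\<tau> f)) \<longlongrightarrow> boundary_gradient (\<tau> f)) (norm_nhds A N f)"
    proof (rule tendstoI)
      fix \<epsilon> :: real assume \<epsilon>: "\<epsilon> > 0"
      have "(DHJ J \<Omega> D \<longlongrightarrow> DHJ J \<Omega> D X) (C1_ring_nhds D X)"
        using shape_differentiable_here[OF D td op] X(1) by (simp add: shape_differentiable_def norm_continuous_def)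
      from tendstoD[OF this \<epsilon>] obtain \<delta> where \<delta>: "\<delta> > 0"
        "\<And>Z. Z \<in> Ck_ring 1 D \<Longrightarrow> C1_norm D (\<lambda>x. Z x - X x) < \<delta> \<Longrightarrow> dist (DHJ J \<Omega> D Z) (DHJ J \<Omega> D X) < \<epsilon>"
        unfolding eventually_norm_nhds by blast
      have "dist (boundary_gradient (\<tau> g)) (boundary_gradient (\<tau> f)) < \<epsilon>" if g: "g \<in> A" "N (\<lambda>x. g x - f x) < \<delta> / (M + 1)" for g
      proof -
        obtain Z where Z: "Z \<in> Ck_ring 1 D" "restrict Z (frontier \<Omega>) = \<tau> g" "C1_norm D (\<lambda>x. Z x - X x) < \<delta>"
          using near[OF f X g \<delta>(1)] by blast
        show ?thesis unfolding boundary_gradient_eq[OF X] boundary_gradient_eq[OF Z(1,2)] by (rule \<delta>(2)[OF Z(1,3)])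
      qed
      moreover have "\<delta> / (M + 1) > 0" using \<delta>(1) M(1) by simp
      ultimately show "\<forall>\<^sub>F g in norm_nhds A N f. dist (boundary_gradient (\<tau> g)) (boundary_gradient (\<tau> f)) < \<epsilon>"
        unfolding eventually_norm_nhds by blast
    qed
  qed
  show "norm_continuous2 A N (\<lambda>f h. boundary_hessian (\<tau> f) (\<tau> h))"
    unfolding norm_continuous2_def
  proof (intro ballI)
    fix f h assume f: "f \<in> A" and h: "h \<in> A"
    obtain X where X: "X \<in> Ck_ring 1 D" "restrict X (frontier \<Omega>) = \<tau> f" using ext[OF f] by blast
    obtain Y where Y: "Y \<in> Ck_ring 1 D" "restrict Y (frontier \<Omega>) = \<tau> h" using ext[OF h] by blast
    show "((\<lambda>(f, h). boundary_hessian (\<tau> f) (\<tau> h)) \<longlongrightarrow> boundary_hessian (\<tau> f) (\<tau> h)) (norm_nhds A N f \<times>\<^sub>F norm_nhds A N h)"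
    proof (rule tendstoI)
      fix \<epsilon> :: real assume \<epsilon>: "\<epsilon> > 0"
      have "((\<lambda>(X, Y). frakD2HJ J \<Omega> D X Y) \<longlongrightarrow> frakD2HJ J \<Omega> D X Y) (C1_ring_nhds D X \<times>\<^sub>F C1_ring_nhds D Y)"
        using td X(1) Y(1) unfolding twice_shape_differentiable_def norm_continuous2_def by blast
      from tendstoD[OF this \<epsilon>] obtain P Q where PQ: "eventually P (C1_ring_nhds D X)" "eventually Q (C1_ring_nhds D Y)"
        "\<And>Z V. P Z \<Longrightarrow> Q V \<Longrightarrow> dist (frakD2HJ J \<Omega> D Z V) (frakD2HJ J \<Omega> D X Y) < \<epsilon>"
        unfolding eventually_prod_filter by auto
      obtain \<delta>1 where \<delta>1: "\<delta>1 > 0" "\<And>Z. Z \<in> Ck_ring 1 D \<Longrightarrow> C1_norm D (\<lambda>x. Z x - X x) < \<delta>1 \<Longrightarrow> P Z"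
        using PQ(1) unfolding eventually_norm_nhds by blast
      obtain \<delta>2 where \<delta>2: "\<delta>2 > 0" "\<And>Z. Z \<in> Ck_ring 1 D \<Longrightarrow> C1_norm D (\<lambda>x. Z x - Y x) < \<delta>2 \<Longrightarrow> Q Z"
        using PQ(2) unfolding eventually_norm_nhds by blast
      have d: "\<delta>1 / (M + 1) > 0" "\<delta>2 / (M + 1) > 0" using \<delta>1(1) \<delta>2(1) M(1) by auto
      have key: "dist (boundary_hessian (\<tau> g) (\<tau> k)) (boundary_hessian (\<tau> f) (\<tau> h)) < \<epsilon>"
        if g: "g \<in> A" "N (\<lambda>x. g x - f x) < \<delta>1 / (M + 1)" and k: "k \<in> A" "N (\<lambda>x. k x - h x) < \<delta>2 / (M + 1)" for g k
      proof -
        obtain Z where Z: "Z \<in> Ck_ring 1 D" "restrict Z (frontier \<Omega>) = \<tau> g" "C1_norm D (\<lambda>x. Z x - X x) < \<delta>1"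
          using near[OF f X g \<delta>1(1)] by blast
        obtain V where V: "V \<in> Ck_ring 1 D" "restrict V (frontier \<Omega>) = \<tau> k" "C1_norm D (\<lambda>x. V x - Y x) < \<delta>2"
          using near[OF h Y k \<delta>2(1)] by blast
        show ?thesis
          unfolding boundary_hessian_eq[OF X Y] boundary_hessian_eq[OF Z(1,2) V(1,2)] by (rule PQ(3)[OF \<delta>1(2)[OF Z(1,3)] \<delta>2(2)[OF V(1,3)]])
      qed
      show "\<forall>\<^sub>F x in norm_nhds A N f \<times>\<^sub>F norm_nhds A N h. dist (case x of (f, h) \<Rightarrow> boundary_hessian (\<tau> f) (\<tau> h)) (boundary_hessian (\<tau> f) (\<tau> h)) < \<epsilon>"
        unfolding eventually_prod_filter
      proof (intro exI conjI allI impI)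
        show "\<forall>\<^sub>F g in norm_nhds A N f. g \<in> A \<and> N (\<lambda>x. g x - f x) < \<delta>1 / (M + 1)"
          unfolding eventually_norm_nhds using d(1) by blast
        show "\<forall>\<^sub>F k in norm_nhds A N h. k \<in> A \<and> N (\<lambda>x. k x - h x) < \<delta>2 / (M + 1)"
          unfolding eventually_norm_nhds using d(2) by blast
      qed (use key in auto)
    qed
  qed
qed

lemma boundary_dependence:
  assumes "X \<in> Ck_ring 2 D" "Y \<in> Ck_ring 2 D"
  shows "frakD2J J \<Omega> X Y = boundary_hessian (restrict X (frontier \<Omega>)) (restrict Y (frontier \<Omega>))"
    "DJ J \<Omega> (field_deriv X Y) = boundary_gradient (restrict (field_deriv X Y) (frontier \<Omega>))"
    "(D2J_quotient J \<Omega> X Y \<longlongrightarrow> D2J J \<Omega> X Y) (at 0)"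
    "D2J J \<Omega> X Y = boundary_hessian (restrict X (frontier \<Omega>)) (restrict Y (frontier \<Omega>)) + boundary_gradient (restrict (field_deriv X Y) (frontier \<Omega>))"
proof -
  note X1 = Ck_ring_2_1[OF assms(1)] and Y1 = Ck_ring_2_1[OF assms(2)]
  note fd = field_deriv_Ck_ring[OF D assms(1) Y1]
  have l: "boundary_hessian (restrict X (frontier \<Omega>)) (restrict Y (frontier \<Omega>)) = frakD2HJ J \<Omega> D X Y"
    by (rule boundary_hessian_eq[OF X1 refl Y1 refl])
  have g: "boundary_gradient (restrict (field_deriv X Y) (frontier \<Omega>)) = DHJ J \<Omega> D (field_deriv X Y)"
    by (rule boundary_gradient_eq[OF fd refl])
  note lim = D2J_tendsto[OF D td op assms(1) Y1]
  have d2: "D2J J \<Omega> X Y = frakD2HJ J \<Omega> D X Y + DHJ J \<Omega> D (field_deriv X Y)"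
    unfolding D2J_def by (rule tendsto_Lim[OF _ lim]) simp
  show "frakD2J J \<Omega> X Y = boundary_hessian (restrict X (frontier \<Omega>)) (restrict Y (frontier \<Omega>))"
    unfolding l by (rule frakD2J_eq[OF D td op X1 Y1])
  show "DJ J \<Omega> (field_deriv X Y) = boundary_gradient (restrict (field_deriv X Y) (frontier \<Omega>))"
    unfolding g by (rule DJ_eq_DHJ[OF D shape_differentiable_here[OF D td op] fd])
  show "(D2J_quotient J \<Omega> X Y \<longlongrightarrow> D2J J \<Omega> X Y) (at 0)" unfolding d2 by (rule lim)
  show "D2J J \<Omega> X Y = boundary_hessian (restrict X (frontier \<Omega>)) (restrict Y (frontier \<Omega>)) + boundary_gradient (restrict (field_deriv X Y) (frontier \<Omega>))"
    unfolding l g by (rule d2)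
qed

context
  assumes Om: "Ck_boundary 2 \<Omega>" "frontier \<Omega> \<subseteq> D" "compact (frontier \<Omega>)" "frontier \<Omega> \<noteq> {}"
begin

lemmas Om2 = D(1) Om
lemmas OmC1 = D(1) Om1[OF Om2] Om(2-4)

lemma boundary_continuity:
  "boundary_image D \<Omega> = C1_maps (frontier \<Omega>)"
  "norm_continuous (C1_maps (frontier \<Omega>)) (boundary_C1_vnorm \<Omega>) boundary_gradient"
  "norm_continuous2 (C1_maps (frontier \<Omega>)) (boundary_C1_vnorm \<Omega>) boundary_hessian"
  "norm_continuous (C1_maps (frontier \<Omega>)) (boundary_C1_norm \<Omega>) (\<lambda>v. boundary_gradient (times_normal \<Omega> v))"
  "norm_continuous2 (C1_maps (frontier \<Omega>)) (boundary_C1_norm \<Omega>) (\<lambda>v w. boundary_hessian (times_normal \<Omega> v) (times_normal \<Omega> w))"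
proof -
  show im: "boundary_image D \<Omega> = C1_maps (frontier \<Omega>)"
    by (rule boundary_image_eq[OF D OmC1(2-5)])
  obtain M where M: "M \<ge> 0" "\<And>g :: real ^ 'd \<Rightarrow> real ^ 'd. local_C1 \<Omega> g \<Longrightarrow>
    \<exists>X\<in>Ck_ring 1 D. (\<forall>x\<in>frontier \<Omega>. X x = g x) \<and> C1_norm D X \<le> M * boundary_C1_vnorm \<Omega> g"
    by (rule bounded_extension[OF D OmC1(2-5)]) (rule that)
  obtain K where K: "K \<ge> 0" "\<And>v h. local_C1 \<Omega> v \<Longrightarrow> \<forall>x\<in>frontier \<Omega>. h x = v x *\<^sub>R outward_normal \<Omega> x \<Longrightarrow>
     boundary_C1_vnorm \<Omega> h \<le> K * boundary_C1_norm \<Omega> v"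
    by (rule times_normal_bound[OF Om2]) (rule that)
  have trace: "\<exists>X\<in>Ck_ring 1 D. restrict X (frontier \<Omega>) = f" if "f \<in> C1_maps (frontier \<Omega>)" for f :: "real ^ 'd \<Rightarrow> real ^ 'd"
    using that unfolding im[symmetric] boundary_image_def by blast
  have diffC1: "local_C1 \<Omega> (\<lambda>x. g x - f x)" if fC: "local_C1 \<Omega> f" and gC: "local_C1 \<Omega> g" for f g :: "real ^ 'd \<Rightarrow> 'b::real_normed_vector"
  proof -
    obtain F C where F: "Ck_on 1 UNIV F" "\<And>x. x \<in> frontier \<Omega> \<Longrightarrow> F x = f x" "compact C" "C \<subseteq> D" "\<And>x. x \<notin> C \<Longrightarrow> F x = 0"
      by (rule local_C1_extension[OF OmC1 fC]) (rule that)
    obtain G C' where G: "Ck_on 1 UNIV G" "\<And>x. x \<in> frontier \<Omega> \<Longrightarrow> G x = g x" "compact C'" "C' \<subseteq> D" "\<And>x. x \<notin> C' \<Longrightarrow> G x = 0"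
      by (rule local_C1_extension[OF OmC1 gC]) (rule that)
    show ?thesis
    proof (rule local_C1_I[OF OmC1 open_UNIV])
      show "Ck_on 1 UNIV (\<lambda>x. G x - F x)" by (intro Ck_on_diff F(1) G(1) open_UNIV)
    qed (simp_all add: F(2) G(2))
  qed
  have C1: "f \<in> extensional (frontier \<Omega>)" "local_C1 \<Omega> f" if "f \<in> C1_maps (frontier \<Omega>)" for f :: "real ^ 'd \<Rightarrow> 'b::real_normed_vector"
    using that C1_maps_iff[OF OmC1] by auto
  have E1: "\<exists>E\<in>Ck_ring 1 D. (\<forall>x\<in>frontier \<Omega>. E x = g x - f x) \<and> C1_norm D E \<le> M * boundary_C1_vnorm \<Omega> (\<lambda>x. g x - f x)"
    if "f \<in> C1_maps (frontier \<Omega>)" "g \<in> C1_maps (frontier \<Omega>)" for f g :: "real ^ 'd \<Rightarrow> real ^ 'd"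
    using M(2)[OF diffC1[OF C1(2)[OF that(1)] C1(2)[OF that(2)]]] .
  show "norm_continuous (C1_maps (frontier \<Omega>)) (boundary_C1_vnorm \<Omega>) boundary_gradient"
    "norm_continuous2 (C1_maps (frontier \<Omega>)) (boundary_C1_vnorm \<Omega>) boundary_hessian"
    by (rule continuous_on_boundary_data[where \<tau>="\<lambda>f. f", OF trace C1(1) M(1) E1]; assumption)+
  have tn: "times_normal \<Omega> v \<in> C1_maps (frontier \<Omega>)" if "v \<in> C1_maps (frontier \<Omega>)" for v
  proof -
    have "local_C1 \<Omega> (times_normal \<Omega> v)"
      by (rule local_C1_times_normal[OF Om2 C1(2)[OF that]]) (simp add: times_normal_def)
    then show ?thesis by (simp add: C1_maps_iff[OF OmC1] times_normal_def)
  qed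
  have E2: "\<exists>E\<in>Ck_ring 1 D. (\<forall>x\<in>frontier \<Omega>. E x = times_normal \<Omega> g x - times_normal \<Omega> f x) \<and>
      C1_norm D E \<le> M * K * boundary_C1_norm \<Omega> (\<lambda>x. g x - f x)"
    if f: "f \<in> C1_maps (frontier \<Omega>)" and g: "g \<in> C1_maps (frontier \<Omega>)" for f g :: "real ^ 'd \<Rightarrow> real"
  proof -
    let ?h = "\<lambda>x. times_normal \<Omega> g x - times_normal \<Omega> f x"
    obtain E where E: "E \<in> Ck_ring 1 D" "\<forall>x\<in>frontier \<Omega>. E x = ?h x" "C1_norm D E \<le> M * boundary_C1_vnorm \<Omega> ?h"
      using E1[OF tn[OF f] tn[OF g]] by blast
    have "boundary_C1_vnorm \<Omega> ?h \<le> K * boundary_C1_norm \<Omega> (\<lambda>x. g x - f x)"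
      by (rule K(2)[OF diffC1[OF C1(2)[OF f] C1(2)[OF g]]]) (simp add: times_normal_def scaleR_diff_left)
    from mult_left_mono[OF this M(1)] E show ?thesis by (intro bexI[of _ E]) (auto simp: mult.assoc)
  qed
  have MK: "M * K \<ge> 0" using M(1) K(1) by simp
  show "norm_continuous (C1_maps (frontier \<Omega>)) (boundary_C1_norm \<Omega>) (\<lambda>v. boundary_gradient (times_normal \<Omega> v))"
    "norm_continuous2 (C1_maps (frontier \<Omega>)) (boundary_C1_norm \<Omega>) (\<lambda>v w. boundary_hessian (times_normal \<Omega> v) (times_normal \<Omega> w))"
    by (rule continuous_on_boundary_data[where \<tau>="times_normal \<Omega>", OF trace[OF tn] C1(1)[OF tn] MK E2]; assumption)+
qed

lemmas sdh = shape_differentiable_here[OF D td op]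

text \<open>A field differs from its normal component by a tangential field, on which the first derivative
  vanishes.\<close>

lemma DHJ_normal_part:
  assumes P: "P \<in> Ck_ring 1 D"
  shows "DHJ J \<Omega> D P = boundary_gradient (times_normal \<Omega> (normal_part \<Omega> P))"
proof -
  obtain N where N: "N \<in> Ck_ring 1 D"
    "\<And>x. x \<in> frontier \<Omega> \<Longrightarrow> N x = (P x \<bullet> outward_normal \<Omega> x) *\<^sub>R outward_normal \<Omega> x"
    by (rule normal_component_extension[OF D(1) Om_Suc[OF Om2] Om(2,3) P]) (rule that)
  have "DHJ J \<Omega> D (\<lambda>x. P x - N x) = 0"
    by (rule tangential_fields(1)[OF D Om td op Ck_ring_diff[OF D(1) P N(1)]])
      (simp add: N(2) tangent_projection[OF OmC1])
  then have "DHJ J \<Omega> D P = DHJ J \<Omega> D N" using DHJ_diff[OF D sdh P N(1)] by simp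
  also have "\<dots> = boundary_gradient (times_normal \<Omega> (normal_part \<Omega> P))"
    by (rule boundary_gradient_eq[OF N(1), symmetric]) (auto simp: times_normal_def normal_part_def N(2) intro!: restrict_ext)
  finally show ?thesis .
qed

text \<open>The mixed term with a tangential first entry is turned into one with a tangential second entry by
  symmetry. Three derivatives of the boundary make the unit normal, and with it the normal
  component of a \<open>C\<^sup>2\<close> field, of class \<open>C\<^sup>2\<close>.\<close>

lemma second_derivative_formula:
  assumes Om3: "Ck_boundary 3 \<Omega>" and X: "X \<in> Ck_ring 2 D" and Y: "Y \<in> Ck_ring 2 D"
  defines "g \<equiv> \<lambda>v. boundary_gradient (times_normal \<Omega> v)"
  shows "frakD2J J \<Omega> X Y = boundary_hessian (times_normal \<Omega> (normal_part \<Omega> X)) (times_normal \<Omega> (normal_part \<Omega> Y))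
    - g (\<lambda>x\<in>frontier \<Omega>. (tangential_jacobian \<Omega> (tangential \<Omega> X) x *v tangential \<Omega> Y x) \<bullet> outward_normal \<Omega> x)
    - g (\<lambda>x\<in>frontier \<Omega>. tangential_gradient \<Omega> (normal_part \<Omega> Y) x \<bullet> tangential \<Omega> X x)
    - g (\<lambda>x\<in>frontier \<Omega>. tangential_gradient \<Omega> (normal_part \<Omega> X) x \<bullet> tangential \<Omega> Y x)"
proof -
  have OmS: "Ck_boundary (Suc 2) \<Omega>" using Om3 by simp
  have split: "\<exists>N. N \<in> Ck_ring 2 D \<and> (\<lambda>x. Z x - N x) \<in> Ck_ring 2 D \<and>
      (\<forall>x\<in>frontier \<Omega>. N x = normal_part \<Omega> Z x *\<^sub>R outward_normal \<Omega> x \<and> Z x - N x = tangential \<Omega> Z x) \<and> local_C1 \<Omega> (normal_part \<Omega> Z)"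
    if Z: "Z \<in> Ck_ring 2 D" for Z
  proof -
    obtain N where N: "N \<in> Ck_ring 2 D"
      "\<And>x. x \<in> frontier \<Omega> \<Longrightarrow> N x = (Z x \<bullet> outward_normal \<Omega> x) *\<^sub>R outward_normal \<Omega> x"
      by (rule normal_component_extension[OF D(1) OmS Om(2,3) Z]) (rule that)
    obtain n C' where n: "Ck_on 1 UNIV n" "\<And>x. x \<in> frontier \<Omega> \<Longrightarrow> n x = outward_normal \<Omega> x" "compact C'" "C' \<subseteq> D" "\<And>x. x \<notin> C' \<Longrightarrow> n x = 0"
      by (rule local_C1_extension[OF OmC1 local_C1_outward_normal[OF Om2]]) (rule that)
    have "Ck_on 1 D (\<lambda>x. Z x \<bullet> n x)"
      by (intro Ck_on_inner D(1) Ck_ringD(4)[OF Ck_ring_2_1[OF Z]] Ck_on_mono[OF n(1)]) auto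
    then have "local_C1 \<Omega> (normal_part \<Omega> Z)"
      by (rule local_C1_I[OF OmC1 D(1) Om(2)]) (simp add: normal_part_def n(2))
    then show ?thesis
      using N Ck_ring_diff[OF D(1) Z N(1)] by (intro exI[of _ N]) (auto simp: normal_part_def tangential_def)
  qed
  obtain Xn where Xn: "Xn \<in> Ck_ring 2 D" "(\<lambda>x. X x - Xn x) \<in> Ck_ring 2 D"
    "\<And>x. x \<in> frontier \<Omega> \<Longrightarrow> Xn x = normal_part \<Omega> X x *\<^sub>R outward_normal \<Omega> x"
    "\<And>x. x \<in> frontier \<Omega> \<Longrightarrow> X x - Xn x = tangential \<Omega> X x" "local_C1 \<Omega> (normal_part \<Omega> X)"
    using split[OF X] by blast
  obtain Yn where Yn: "Yn \<in> Ck_ring 2 D" "(\<lambda>x. Y x - Yn x) \<in> Ck_ring 2 D"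
    "\<And>x. x \<in> frontier \<Omega> \<Longrightarrow> Yn x = normal_part \<Omega> Y x *\<^sub>R outward_normal \<Omega> x"
    "\<And>x. x \<in> frontier \<Omega> \<Longrightarrow> Y x - Yn x = tangential \<Omega> Y x" "local_C1 \<Omega> (normal_part \<Omega> Y)"
    using split[OF Y] by blast
  define Xt where "Xt = (\<lambda>x. X x - Xn x)"
  define Yt where "Yt = (\<lambda>x. Y x - Yn x)"
  have t: "Xt \<in> Ck_ring 2 D" "Yt \<in> Ck_ring 2 D" using Xn(2) Yn(2) by (auto simp: Xt_def Yt_def)
  note m = Ck_ring_2_1[OF X] Ck_ring_2_1[OF Y] Ck_ring_2_1[OF Xn(1)] Ck_ring_2_1[OF Yn(1)] Ck_ring_2_1[OF t(1)] Ck_ring_2_1[OF t(2)]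
  have tan: "tangential \<Omega> Z x \<bullet> outward_normal \<Omega> x = 0" if "x \<in> frontier \<Omega>" for Z x
    using tangent_projection[OF OmC1 that] that by (simp add: tangential_def)
  have Xt0: "Xt x = tangential \<Omega> X x" "Xt x \<bullet> outward_normal \<Omega> x = 0" if "x \<in> frontier \<Omega>" for x
    using Xn(4)[OF that] tan[OF that] by (auto simp: Xt_def)
  have Yt0: "Yt x = tangential \<Omega> Y x" "Yt x \<bullet> outward_normal \<Omega> x = 0" if "x \<in> frontier \<Omega>" for x
    using Yn(4)[OF that] tan[OF that] by (auto simp: Yt_def)
  let ?F = "frakD2HJ J \<Omega> D"
  have diff: "W differentiable at x" if "W \<in> Ck_ring 1 D" "x \<in> frontier \<Omega>" for W x
    using Ck_ring_1D(6)[OF D that(1)] that(2) Om(2) by blast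
  have fd: "- DHJ J \<Omega> D (field_deriv W V) = - g (\<lambda>x\<in>frontier \<Omega>. a x)"
    if W: "W \<in> Ck_ring 2 D" and V: "V \<in> Ck_ring 1 D"
      and a: "\<And>x. x \<in> frontier \<Omega> \<Longrightarrow> frechet_derivative W (at x) (V x) \<bullet> outward_normal \<Omega> x = a x" for W V a
  proof -
    have "normal_part \<Omega> (field_deriv W V) = (\<lambda>x\<in>frontier \<Omega>. a x)"
      unfolding normal_part_def
      by (rule restrict_ext) (simp add: field_deriv_eq[OF diff[OF Ck_ring_2_1[OF W]]] a)
    then show ?thesis using DHJ_normal_part[OF field_deriv_Ck_ring[OF D W V]] by (simp add: g_def)
  qed
  have 1: "?F Xn Yn = boundary_hessian (times_normal \<Omega> (normal_part \<Omega> X)) (times_normal \<Omega> (normal_part \<Omega> Y))"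
    by (rule boundary_hessian_eq[OF m(3) _ m(4), symmetric]) (auto simp: times_normal_def Xn(3) Yn(3) intro!: restrict_ext)
  have eXnYt: "?F Xn Yt = - DHJ J \<Omega> D (field_deriv Xn Yt)"
    by (rule tangential_fields(2)[OF D Om td op m(6) _ Xn(1)]) (rule Yt0(2))
  have 2: "?F Xn Yt = - g (\<lambda>x\<in>frontier \<Omega>. tangential_gradient \<Omega> (normal_part \<Omega> X) x \<bullet> tangential \<Omega> Y x)"
    unfolding eXnYt
  proof (rule fd[OF Xn(1) m(6)])
    fix x assume x: "x \<in> frontier \<Omega>"
    show "frechet_derivative Xn (at x) (Yt x) \<bullet> outward_normal \<Omega> x = tangential_gradient \<Omega> (normal_part \<Omega> X) x \<bullet> tangential \<Omega> Y x"
      using normal_derivative_of_normal_field[OF Om2 x m(3) Xn(3) Xn(5) Yt0(2)[OF x]] Yt0(1)[OF x] by simp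
  qed
  have eYnXt: "?F Yn Xt = - DHJ J \<Omega> D (field_deriv Yn Xt)"
    by (rule tangential_fields(2)[OF D Om td op m(5) _ Yn(1)]) (rule Xt0(2))
  have 3: "?F Yn Xt = - g (\<lambda>x\<in>frontier \<Omega>. tangential_gradient \<Omega> (normal_part \<Omega> Y) x \<bullet> tangential \<Omega> X x)"
    unfolding eYnXt
  proof (rule fd[OF Yn(1) m(5)])
    fix x assume x: "x \<in> frontier \<Omega>"
    show "frechet_derivative Yn (at x) (Xt x) \<bullet> outward_normal \<Omega> x = tangential_gradient \<Omega> (normal_part \<Omega> Y) x \<bullet> tangential \<Omega> X x"
      using normal_derivative_of_normal_field[OF Om2 x m(4) Yn(3) Yn(5) Xt0(2)[OF x]] Xt0(1)[OF x] by simp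
  qed
  have eXtYt: "?F Xt Yt = - DHJ J \<Omega> D (field_deriv Xt Yt)"
    by (rule tangential_fields(2)[OF D Om td op m(6) _ t(1)]) (rule Yt0(2))
  have 4: "?F Xt Yt = - g (\<lambda>x\<in>frontier \<Omega>. (tangential_jacobian \<Omega> (tangential \<Omega> X) x *v tangential \<Omega> Y x) \<bullet> outward_normal \<Omega> x)"
    unfolding eXtYt
  proof (rule fd[OF t(1) m(6)])
    fix x assume x: "x \<in> frontier \<Omega>"
    have xD: "x \<in> D" using x Om(2) by blast
    have C: "local_C1 \<Omega> (tangential \<Omega> X)"
      by (rule local_C1_I[OF OmC1 D(1) Om(2) Ck_ringD(4)[OF m(5)] Xt0(1)])
    have "tangential_jacobian \<Omega> (tangential \<Omega> X) x *v Yt x =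
      frechet_derivative Xt (at x) (Yt x - (Yt x \<bullet> outward_normal \<Omega> x) *\<^sub>R outward_normal \<Omega> x)"
      by (rule tangential_jacobian_mult[OF OmC1 C x Ck_ring_1D(2)[OF D m(5) xD] D(1) xD Xt0(1)])
    then show "frechet_derivative Xt (at x) (Yt x) \<bullet> outward_normal \<Omega> x =
      (tangential_jacobian \<Omega> (tangential \<Omega> X) x *v tangential \<Omega> Y x) \<bullet> outward_normal \<Omega> x"
      using Yt0[OF x] by simp
  qed
  have "frakD2J J \<Omega> X Y = ?F X Y" by (rule frakD2J_eq[OF D td op m(1,2)])
  also have "\<dots> = ?F (\<lambda>x. Xn x + Xt x) (\<lambda>x. Yn x + Yt x)" by (simp add: Xt_def Yt_def)
  also have "\<dots> = ?F Xn Yn + ?F Xn Yt + (?F Xt Yn + ?F Xt Yt)"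
    unfolding frakD2HJ_linear(1)[OF D td op m(3,5) Ck_ring_add[OF D(1) m(4,6)]]
      frakD2HJ_linear(2)[OF D td op m(4,6,3)] frakD2HJ_linear(2)[OF D td op m(4,6,5)] ..
  also have "?F Xt Yn = ?F Yn Xt" by (rule frakD2HJ_symmetric[OF D td op m(5,4)])
  finally show ?thesis unfolding 1 2 3 4 by simp
qed

end

end

text \<open>The displacement of an admissible transformation is bounded.\<close>

lemma bounded_diffeo_image:
  assumes "F \<in> diffeos" "bounded \<omega>"
  shows "bounded (F ` \<omega>)"
proof -
  obtain f where f: "f \<in> Ck_bar 1 UNIV" "F = (\<lambda>x. x + f x)" using assms(1) by (auto simp: diffeos_def)
  have "bounded (range f)"
    using Ck_bar_1D(2)[OF f(1) open_UNIV] by (simp add: bounded_ucont_def)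
  then have "bounded (f ` \<omega>)" by (rule bounded_subset) auto
  from bounded_plus[OF assms(2) this] show ?thesis
    by (rule bounded_subset) (auto simp: f(2))
qed

theorem theorem2p10:
  fixes D \<omega> \<Omega> :: "(real ^ 'd::finite) set"
    and J :: "(real ^ 'd) set \<Rightarrow> real"
  assumes "open D"
    and "bounded_C1_domain \<omega>" and "\<omega> \<subseteq> D"
    and "\<Omega> \<in> admissible D \<omega>" and "open \<Omega>"
    and "twice_shape_differentiable J \<Omega> D"
  shows "\<exists>(gt :: (real ^ 'd \<Rightarrow> real ^ 'd) \<Rightarrow> real)
          (lt :: (real ^ 'd \<Rightarrow> real ^ 'd) \<Rightarrow> (real ^ 'd \<Rightarrow> real ^ 'd) \<Rightarrow> real).
    (\<forall>X\<in>Ck_ring 2 D. \<forall>Y\<in>Ck_ring 2 D.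
       frakD2J J \<Omega> X Y = lt (restrict X (frontier \<Omega>)) (restrict Y (frontier \<Omega>)) \<and>
       DJ J \<Omega> (field_deriv X Y) = gt (restrict (field_deriv X Y) (frontier \<Omega>)) \<and>
       (D2J_quotient J \<Omega> X Y \<longlongrightarrow> D2J J \<Omega> X Y) (at 0) \<and>
       D2J J \<Omega> X Y = lt (restrict X (frontier \<Omega>)) (restrict Y (frontier \<Omega>))
                     + gt (restrict (field_deriv X Y) (frontier \<Omega>)))
    \<and>
    (closure \<Omega> \<subseteq> D \<and> Ck_boundary 2 \<Omega> \<longrightarrow>
       boundary_image D \<Omega> = C1_maps (frontier \<Omega>) \<and>
       norm_continuous (C1_maps (frontier \<Omega>)) (boundary_C1_vnorm \<Omega>) gt \<and>
       norm_continuous2 (C1_maps (frontier \<Omega>)) (boundary_C1_vnorm \<Omega>) lt)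
    \<and>
    (closure \<Omega> \<subseteq> D \<and> Ck_boundary 3 \<Omega> \<longrightarrow>
       (let g = (\<lambda>v. gt (times_normal \<Omega> v));
            l = (\<lambda>v w. lt (times_normal \<Omega> v) (times_normal \<Omega> w))
        in norm_continuous (C1_maps (frontier \<Omega>)) (boundary_C1_norm \<Omega>) g \<and>
           norm_continuous2 (C1_maps (frontier \<Omega>)) (boundary_C1_norm \<Omega>) l \<and>
           (\<forall>X\<in>Ck_ring 2 D. \<forall>Y\<in>Ck_ring 2 D.
              frakD2J J \<Omega> X Y =
                l (normal_part \<Omega> X) (normal_part \<Omega> Y)
                - g (\<lambda>x\<in>frontier \<Omega>. (tangential_jacobian \<Omega> (tangential \<Omega> X) x *v tangential \<Omega> Y x)
                                      \<bullet> outward_normal \<Omega> x)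
                - g (\<lambda>x\<in>frontier \<Omega>. tangential_gradient \<Omega> (normal_part \<Omega> Y) x \<bullet> tangential \<Omega> X x)
                - g (\<lambda>x\<in>frontier \<Omega>. tangential_gradient \<Omega> (normal_part \<Omega> X) x \<bullet> tangential \<Omega> Y x))))"
proof -
  obtain F where F: "F \<in> diffeos" "\<Omega> = F ` \<omega>" "\<Omega> \<subseteq> D"
    using assms(4) by (auto simp: admissible_def)
  have \<omega>: "\<omega> \<noteq> {}" "bounded \<omega>" using assms(2) by (auto simp: bounded_C1_domain_def)
  have bd: "bounded \<Omega>" "\<Omega> \<noteq> {}" using bounded_diffeo_image[OF F(1) \<omega>(2)] \<omega>(1) F(2) by auto
  have D: "open D" "D \<noteq> {}" using assms(1) bd(2) F(3) by auto
  note td = assms(6) and op = assms(5)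
  have Om: "compact (frontier \<Omega>)" "frontier \<Omega> \<noteq> {}"
    using bd by (auto simp: compact_frontier_bounded frontier_eq_empty)
  have fr: "frontier \<Omega> \<subseteq> D" if "closure \<Omega> \<subseteq> D" using that by (auto simp: frontier_def)
  note cont = boundary_continuity[OF D td op _ fr Om]
  note formula = second_derivative_formula[OF D td op _ fr Om]
  show ?thesis
    unfolding Let_def
    using boundary_dependence[OF D td op] cont formula Ck_boundary_mono[of 3 \<Omega> 2]
    by (intro exI[of _ "boundary_gradient D \<Omega> J"] exI[of _ "boundary_hessian D \<Omega> J"] conjI ballI impI) auto
qed

end
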